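(* Up to isomorphism there are exactly $134$ directed strongly regular graphs with parameters $(22,9,6,3,4)$ that admit an automorphism of order three. Of these, exactly $14$ have full automorphism group of order $6$, isomorphic to the symmetric group $S_3$, and the remaining $120$ have full automorphism group of order $3$.
   Context: A directed strongly regular graph with parameters $(v,k,t,\lambda,\mu)$ is a loopless directed graph $\Gamma=(V,E)$ on $v$ vertices in which every vertex has in-degree and out-degree $k$, every vertex $x$ has exactly $t$ out-neighbors that are also in-neighbors of $x$, and for any vertices $x,y$ the number of directed paths of length two from $x$ to $y$ is $\lambda$ if $(x,y)\in E$ and $\mu$ if $(x,y)\notin E$. An automorphism is a permutation $\sigma$ of $V$ with $(x,y)\in E\iff(\sigma(x),\sigma(y))\in E$; the full automorphism group is the group of all automorphisms. Two directed graphs are isomorphic if there is a bijection between their vertex sets mapping edges exactly onto edges.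
   Formalization: The two-path condition is imposed only for distinct vertices x, y (the standard definition); read literally at x = y it would require μ = 4 closed two-paths at each vertex, contradicting t = 6, so no such graph would exist. *)

theory Defs
  imports
    "Graph_Theory.Pair_Digraph"
    "Graph_Theory.Digraph_Isomorphism"
    "HOL-Algebra.Bij"
    "HOL-Algebra.Multiplicative_Group"
    "HOL-Algebra.Sym_Groups"
begin

text \<open>
  The two-path condition is imposed on pairs of distinct vertices only: the paths of length two
  from a vertex to itself correspond to its reciprocated out-neighbours, and their number is
  prescribed by the parameter \<open>t\<close>.
\<close>

definition directed_srg ::
    "'a pair_pre_digraph \<Rightarrow> nat \<Rightarrow> nat \<Rightarrow> nat \<Rightarrow> nat \<Rightarrow> nat \<Rightarrow> bool" where
  "directed_srg G v k t l m \<longleftrightarrow>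
     pair_digraph G \<and>
     card (pverts G) = v \<and>
     (\<forall>x\<in>pverts G. in_degree (with_proj G) x = k \<and> out_degree (with_proj G) x = k) \<and>
     (\<forall>x\<in>pverts G. card {y. (x, y) \<in> parcs G \<and> (y, x) \<in> parcs G} = t) \<and>
     (\<forall>x\<in>pverts G. \<forall>y\<in>pverts G. x \<noteq> y \<longrightarrow>
        card {z. (x, z) \<in> parcs G \<and> (z, y) \<in> parcs G} = (if (x, y) \<in> parcs G then l else m))"

text \<open>
  As in \<^const>\<open>AutoGroup\<close>, permutations of the vertex set are represented by functions
  that are extensional on it, so that each permutation is counted once.
\<close>

definition digraph_auto :: "'a pair_pre_digraph \<Rightarrow> ('a \<Rightarrow> 'a) set" where
  "digraph_auto G = {\<sigma> \<in> Bij (pverts G).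
     \<forall>x\<in>pverts G. \<forall>y\<in>pverts G. (x, y) \<in> parcs G \<longleftrightarrow> (\<sigma> x, \<sigma> y) \<in> parcs G}"

definition digraph_AutoGroup :: "'a pair_pre_digraph \<Rightarrow> ('a \<Rightarrow> 'a) monoid" where
  "digraph_AutoGroup G = BijGroup (pverts G) \<lparr>carrier := digraph_auto G\<rparr>"

lemma subgroup_digraph_auto: "subgroup (digraph_auto G) (BijGroup (pverts G))"
proof (rule subgroup.intro)
  show "digraph_auto G \<subseteq> carrier (BijGroup (pverts G))"
    by (auto simp: digraph_auto_def BijGroup_def)
next
  fix f g assume "f \<in> digraph_auto G" "g \<in> digraph_auto G"
  then show "f \<otimes>\<^bsub>BijGroup (pverts G)\<^esub> g \<in> digraph_auto G"
    using Bij_imp_funcset[of g "pverts G"]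
    by (auto simp: digraph_auto_def BijGroup_def compose_Bij compose_eq Pi_iff)
next
  show "\<one>\<^bsub>BijGroup (pverts G)\<^esub> \<in> digraph_auto G"
    by (auto simp: digraph_auto_def BijGroup_def id_Bij)
next
  fix f assume f: "f \<in> digraph_auto G"
  then have B: "f \<in> Bij (pverts G)" and im: "f ` pverts G = pverts G"
    by (auto simp: digraph_auto_def Bij_def bij_betw_def)
  have "(x, y) \<in> parcs G \<longleftrightarrow> (inv_into (pverts G) f x, inv_into (pverts G) f y) \<in> parcs G"
    if "x \<in> pverts G" "y \<in> pverts G" for x y
  proof -
    have *: "inv_into (pverts G) f u \<in> pverts G \<and> f (inv_into (pverts G) f u) = u"
      if "u \<in> pverts G" for u
      using that im by (simp add: inv_into_into f_inv_into_f)
    show ?thesis using f *[OF that(1)] *[OF that(2)] unfolding digraph_auto_def by force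
  qed
  then show "inv\<^bsub>BijGroup (pverts G)\<^esub> f \<in> digraph_auto G"
    using B by (simp add: inv_BijGroup digraph_auto_def restrict_inv_into_Bij)
qed

lemma group_digraph_AutoGroup: "group (digraph_AutoGroup G)"
  by (simp add: digraph_AutoGroup_def subgroup.subgroup_is_group subgroup_digraph_auto
        group_BijGroup)

lemma digraph_iso_pair_iff:
  fixes G :: "'a pair_pre_digraph" and H :: "'b pair_pre_digraph"
  assumes "pair_wf_digraph G" "pair_wf_digraph H"
  shows "digraph_iso (with_proj G) (with_proj H) \<longleftrightarrow>
    (\<exists>f. bij_betw f (pverts G) (pverts H) \<and>
       (\<forall>x\<in>pverts G. \<forall>y\<in>pverts G. (x, y) \<in> parcs G \<longleftrightarrow> (f x, f y) \<in> parcs H))"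
    (is "?L \<longleftrightarrow> (\<exists>f. ?P f)")
proof
  interpret G: pair_wf_digraph G by fact
  interpret H: pair_wf_digraph H by fact
  {
    assume ?L
    then obtain h where h: "pre_digraph.digraph_isomorphism (with_proj G) h"
      and HG: "with_proj H = app_iso h (with_proj G)"
      unfolding digraph_iso_def by blast
    define f where "f = iso_verts h"
    from HG have V: "pverts H = f ` pverts G" and A: "parcs H = iso_arcs h ` parcs G"
      and T: "iso_tail h = fst" and D: "iso_head h = snd"
      by (auto simp: with_proj_def app_iso_def f_def)
    from h have inj: "inj_on f (pverts G)"
      and ends: "\<forall>a\<in>parcs G. f (fst a) = fst (iso_arcs h a) \<and> f (snd a) = snd (iso_arcs h a)"
      by (auto simp: pre_digraph.digraph_isomorphism_def f_def T D)
    have A': "parcs H = map_prod f f ` parcs G"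
      unfolding A using ends by (intro image_cong refl) (auto simp: prod_eq_iff)
    have "(x, y) \<in> parcs G \<longleftrightarrow> (f x, f y) \<in> parcs H" if "x \<in> pverts G" "y \<in> pverts G" for x y
    proof
      assume "(x, y) \<in> parcs G"
      then show "(f x, f y) \<in> parcs H" unfolding A' by force
    next
      assume "(f x, f y) \<in> parcs H"
      then obtain x' y' where "(x', y') \<in> parcs G" "f x' = f x" "f y' = f y"
        unfolding A' by auto
      then show "(x, y) \<in> parcs G"
        using inj that G.in_arcsD1 G.in_arcsD2 by (metis inj_onD)
    qed
    then have "?P f" using inj V by (simp add: bij_betw_def)
    then show "\<exists>f. ?P f" by blast
  }
  assume "\<exists>f. ?P f"
  then obtain f where P: "?P f" by blast
  define h where "h = \<lparr>iso_verts = f, iso_arcs = map_prod f f, iso_head = snd, iso_tail = fst\<rparr>"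
  have inj: "inj_on f (pverts G)" and im: "f ` pverts G = pverts H"
    using P by (auto simp: bij_betw_def)
  have "inj_on (map_prod f f) (pverts G \<times> pverts G)"
    using inj by (intro map_prod_inj_on)
  then have "inj_on (map_prod f f) (parcs G)"
    by (rule inj_on_subset) (auto dest: G.in_arcsD1 G.in_arcsD2)
  then have 1: "pre_digraph.digraph_isomorphism (with_proj G) h"
    using inj G.wf_digraph_axioms by (auto simp: pre_digraph.digraph_isomorphism_def h_def)
  have "parcs H = map_prod f f ` parcs G"
  proof (intro equalityI subsetI)
    fix e assume e: "e \<in> parcs H"
    obtain u w where uw: "e = (u, w)" by (cases e)
    with e have "u \<in> f ` pverts G" "w \<in> f ` pverts G"
      using H.in_arcsD1[of u w] H.in_arcsD2[of u w] im by simp_all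
    then obtain x y where "x \<in> pverts G" "y \<in> pverts G" "e = (f x, f y)" using uw by auto
    with P e show "e \<in> map_prod f f ` parcs G" by force
  next
    fix e assume "e \<in> map_prod f f ` parcs G"
    then obtain x y where "(x, y) \<in> parcs G" "e = (f x, f y)" by auto
    then show "e \<in> parcs H" using P G.in_arcsD1[of x y] G.in_arcsD2[of x y] by simp
  qed
  then have "with_proj H = app_iso h (with_proj G)"
    using im by (auto simp: with_proj_def app_iso_def h_def)
  with 1 show ?L unfolding digraph_iso_def by blast
qed

text \<open>
  Isomorphism classes of finite digraphs are counted on vertex sets of natural numbers:
  since \<^const>\<open>directed_srg\<close> only admits finite graphs, these
  represent all isomorphism types.
\<close>

definition dsrgs_auto3 ::
    "nat \<Rightarrow> nat \<Rightarrow> nat \<Rightarrow> nat \<Rightarrow> nat \<Rightarrow> nat pair_pre_digraph set" where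
  "dsrgs_auto3 v k t l m = {G. directed_srg G v k t l m \<and>
     (\<exists>\<sigma> \<in> carrier (digraph_AutoGroup G). group.ord (digraph_AutoGroup G) \<sigma> = 3)}"

definition iso_classes :: "'a pair_pre_digraph set \<Rightarrow> 'a pair_pre_digraph set set" where
  "iso_classes \<G> =
     \<G> // {(G, H). G \<in> \<G> \<and> H \<in> \<G> \<and> digraph_iso (with_proj G) (with_proj H)}"

lemma equiv_digraph_iso:
  assumes "\<And>G. G \<in> \<G> \<Longrightarrow> pair_wf_digraph G"
  shows "equiv \<G> {(G, H). G \<in> \<G> \<and> H \<in> \<G> \<and> digraph_iso (with_proj G) (with_proj H)}"
proof (rule equivI)
  show "refl_on \<G> {(G, H). G \<in> \<G> \<and> H \<in> \<G> \<and> digraph_iso (with_proj G) (with_proj H)}"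
  proof (rule refl_onI)
    fix G assume "G \<in> \<G>"
    then have "digraph_iso (with_proj G) (with_proj G)"
      using assms digraph_iso_pair_iff[of G G] bij_betw_id[of "pverts G"]
      by (metis id_apply)
    with \<open>G \<in> \<G>\<close> show "(G, G) \<in> {(G, H). G \<in> \<G> \<and> H \<in> \<G> \<and> digraph_iso (with_proj G) (with_proj H)}"
      by simp
  qed
  show "sym {(G, H). G \<in> \<G> \<and> H \<in> \<G> \<and> digraph_iso (with_proj G) (with_proj H)}"
  proof (rule symI, clarify)
    fix G H assume GH: "G \<in> \<G>" "H \<in> \<G>" "digraph_iso (with_proj G) (with_proj H)"
    interpret pair_wf_digraph G using assms GH(1) .
    show "digraph_iso (with_proj H) (with_proj G)"
      using digraph_iso_swap[OF wf_digraph_axioms GH(3)] .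
  qed
  show "trans {(G, H). G \<in> \<G> \<and> H \<in> \<G> \<and> digraph_iso (with_proj G) (with_proj H)}"
    by (rule transI) (blast intro: digraph_iso_trans)
  show "{(G, H). G \<in> \<G> \<and> H \<in> \<G> \<and> digraph_iso (with_proj G) (with_proj H)} \<subseteq> \<G> \<times> \<G>"
    by auto
qed

end

theory Submission
  imports Defs
begin

text \<open>
  Let \<open>s\<close> be an automorphism of order three.  Counting two-paths between fixed vertices and orbits
  modulo 3 and over the integers excludes every number of fixed vertices except one.  The other 21
  vertices then form seven orbits, two of them joined to the fixed vertex in both directions, one
  only from it, one only to it and three not at all.  The graph is a seven by seven matrix of
  subsets of the integers modulo 3.  The sizes of the blocks satisfy a quadratic matrix equation,
  which has 197 solutions up to the symmetries used below, and for each of these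
  a search over the blocks is done up to rotations of the orbits.  The 151 graphs found in this way
  fall into 134 classes.

  In each class representative an isomorphism invariant shows that the fixed vertex of \<open>s\<close> is
  fixed by all automorphisms, which therefore act on its unique three-element orbit of
  out-neighbours that send no arc back.  An exhaustive search shows that this action is faithful, so
  that the group has order 3 or is the symmetric group on three letters, the latter exactly if
  some automorphism acts as a transposition.
\<close>

section \<open>Matrices of orbit sizes\<close>

text \<open>The search is trusted only to overlook nothing. Every test in it is a condition that the
  normalised matrix is proved to satisfy, so working modulo 13 or bounding reciprocated arcs by
  block sizes can at worst leave extra candidates; the survivors are checked against the definition
  afterwards. Branching orders are thus plain data, constrained only by the forest condition for
  rotations and by a size check of the listed results. For the number of fixed vertices, the
  equations between fixed vertices are read modulo 3, and comparing the two-paths inside one orbit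
  shows that at least two further orbits are joined to it by non-constant blocks in both directions.
  This leaves 1, 4, 7, 10 and 13. For 4 and 7 the degrees clash; 10 forces the Petersen graph on the
  fixed vertices together with an equitable partition of it; 13 forces an almost unique pattern of
  neighbourhoods, in which three vertices end up with too many arcs between them. Non-isomorphism is
  never searched for: the representatives have distinct values of one integer invariant.\<close>

datatype idx = I0 | I1 | I2 | I3 | I4 | I5 | I6
datatype 'a row = Row 'a 'a 'a 'a 'a 'a 'a

fun el :: "idx \<Rightarrow> 'a row \<Rightarrow> 'a" where
  "el I0 (Row a b c d e f g) = a"
| "el I1 (Row a b c d e f g) = b"
| "el I2 (Row a b c d e f g) = c"
| "el I3 (Row a b c d e f g) = d"
| "el I4 (Row a b c d e f g) = e"
| "el I5 (Row a b c d e f g) = f"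
| "el I6 (Row a b c d e f g) = g"

fun put :: "idx \<Rightarrow> 'a \<Rightarrow> 'a row \<Rightarrow> 'a row" where
  "put I0 x (Row a b c d e f g) = Row x b c d e f g"
| "put I1 x (Row a b c d e f g) = Row a x c d e f g"
| "put I2 x (Row a b c d e f g) = Row a b x d e f g"
| "put I3 x (Row a b c d e f g) = Row a b c x e f g"
| "put I4 x (Row a b c d e f g) = Row a b c d x f g"
| "put I5 x (Row a b c d e f g) = Row a b c d e x g"
| "put I6 x (Row a b c d e f g) = Row a b c d e f x"

fun col :: "idx \<Rightarrow> 'a row row \<Rightarrow> 'a row" where
  "col j (Row a b c d e f g) = Row (el j a) (el j b) (el j c) (el j d) (el j e) (el j f) (el j g)"

text \<open>Programs run on small datatypes with first-order recursive functions, which rewriting evaluates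
  quickly.  Equations are only tested modulo 13, which is sound because they serve as necessary
  conditions.  Since 3 has order three modulo 13, the map \<open>z \<mapsto> 3\<^sup>z\<close> extends to the group ring of the
  integers modulo 3, and a full block becomes \<open>1 + 3 + 9 = 0\<close>.\<close>

datatype res = E0 | E1 | E2 | E3 | E4 | E5 | E6 | E7 | E8 | E9 | E10 | E11 | E12

primrec ad1 :: "res \<Rightarrow> res" where
  "ad1 E0 = E1" | "ad1 E1 = E2" | "ad1 E2 = E3" | "ad1 E3 = E4" | "ad1 E4 = E5" | "ad1 E5 = E6" | "ad1 E6 = E7" | "ad1 E7 = E8" | "ad1 E8 = E9" | "ad1 E9 = E10" | "ad1 E10 = E11" | "ad1 E11 = E12" | "ad1 E12 = E0"

primrec ad2 :: "res \<Rightarrow> res" where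
  "ad2 E0 = E2" | "ad2 E1 = E3" | "ad2 E2 = E4" | "ad2 E3 = E5" | "ad2 E4 = E6" | "ad2 E5 = E7" | "ad2 E6 = E8" | "ad2 E7 = E9" | "ad2 E8 = E10" | "ad2 E9 = E11" | "ad2 E10 = E12" | "ad2 E11 = E0" | "ad2 E12 = E1"

primrec ad3 :: "res \<Rightarrow> res" where
  "ad3 E0 = E3" | "ad3 E1 = E4" | "ad3 E2 = E5" | "ad3 E3 = E6" | "ad3 E4 = E7" | "ad3 E5 = E8" | "ad3 E6 = E9" | "ad3 E7 = E10" | "ad3 E8 = E11" | "ad3 E9 = E12" | "ad3 E10 = E0" | "ad3 E11 = E1" | "ad3 E12 = E2"

primrec ad4 :: "res \<Rightarrow> res" where
  "ad4 E0 = E4" | "ad4 E1 = E5" | "ad4 E2 = E6" | "ad4 E3 = E7" | "ad4 E4 = E8" | "ad4 E5 = E9" | "ad4 E6 = E10" | "ad4 E7 = E11" | "ad4 E8 = E12" | "ad4 E9 = E0" | "ad4 E10 = E1" | "ad4 E11 = E2" | "ad4 E12 = E3"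

primrec ad6 :: "res \<Rightarrow> res" where
  "ad6 E0 = E6" | "ad6 E1 = E7" | "ad6 E2 = E8" | "ad6 E3 = E9" | "ad6 E4 = E10" | "ad6 E5 = E11" | "ad6 E6 = E12" | "ad6 E7 = E0" | "ad6 E8 = E1" | "ad6 E9 = E2" | "ad6 E10 = E3" | "ad6 E11 = E4" | "ad6 E12 = E5"

primrec ad9 :: "res \<Rightarrow> res" where
  "ad9 E0 = E9" | "ad9 E1 = E10" | "ad9 E2 = E11" | "ad9 E3 = E12" | "ad9 E4 = E0" | "ad9 E5 = E1" | "ad9 E6 = E2" | "ad9 E7 = E3" | "ad9 E8 = E4" | "ad9 E9 = E5" | "ad9 E10 = E6" | "ad9 E11 = E7" | "ad9 E12 = E8"

primrec ad10 :: "res \<Rightarrow> res" where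
  "ad10 E0 = E10" | "ad10 E1 = E11" | "ad10 E2 = E12" | "ad10 E3 = E0" | "ad10 E4 = E1" | "ad10 E5 = E2" | "ad10 E6 = E3" | "ad10 E7 = E4" | "ad10 E8 = E5" | "ad10 E9 = E6" | "ad10 E10 = E7" | "ad10 E11 = E8" | "ad10 E12 = E9"

primrec ad11 :: "res \<Rightarrow> res" where
  "ad11 E0 = E11" | "ad11 E1 = E12" | "ad11 E2 = E0" | "ad11 E3 = E1" | "ad11 E4 = E2" | "ad11 E5 = E3" | "ad11 E6 = E4" | "ad11 E7 = E5" | "ad11 E8 = E6" | "ad11 E9 = E7" | "ad11 E10 = E8" | "ad11 E11 = E9" | "ad11 E12 = E10"

primrec ad12 :: "res \<Rightarrow> res" where
  "ad12 E0 = E12" | "ad12 E1 = E0" | "ad12 E2 = E1" | "ad12 E3 = E2" | "ad12 E4 = E3" | "ad12 E5 = E4" | "ad12 E6 = E5" | "ad12 E7 = E6" | "ad12 E8 = E7" | "ad12 E9 = E8" | "ad12 E10 = E9" | "ad12 E11 = E10" | "ad12 E12 = E11"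

text \<open>The number of arcs from a vertex into an orbit; \<open>ZX\<close> is a junk value for results out of range.\<close>

datatype sz = Z0 | Z1 | Z2 | Z3 | ZX

fun mac :: "res \<Rightarrow> sz \<Rightarrow> sz \<Rightarrow> res" where
  "mac a Z0 Z0 = a"
| "mac a Z0 Z1 = a"
| "mac a Z0 Z2 = a"
| "mac a Z0 Z3 = a"
| "mac a Z1 Z0 = a"
| "mac a Z1 Z1 = ad1 a"
| "mac a Z1 Z2 = ad2 a"
| "mac a Z1 Z3 = ad3 a"
| "mac a Z2 Z0 = a"
| "mac a Z2 Z1 = ad2 a"
| "mac a Z2 Z2 = ad4 a"
| "mac a Z2 Z3 = ad6 a"
| "mac a Z3 Z0 = a"
| "mac a Z3 Z1 = ad3 a"
| "mac a Z3 Z2 = ad6 a"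
| "mac a Z3 Z3 = ad9 a"
| "mac a ZX y = a"
| "mac a Z0 ZX = a"
| "mac a Z1 ZX = a"
| "mac a Z2 ZX = a"
| "mac a Z3 ZX = a"

fun is0 :: "res \<Rightarrow> bool" where
  "is0 E0 = True" | "is0 E1 = False" | "is0 E2 = False" | "is0 E3 = False" | "is0 E4 = False" | "is0 E5 = False" | "is0 E6 = False" | "is0 E7 = False" | "is0 E8 = False" | "is0 E9 = False" | "is0 E10 = False" | "is0 E11 = False" | "is0 E12 = False"

fun tosz :: "res \<Rightarrow> sz" where
  "tosz E0 = Z0" | "tosz E1 = Z1" | "tosz E2 = Z2" | "tosz E3 = Z3" | "tosz _ = ZX"

fun sb :: "res \<Rightarrow> sz \<Rightarrow> res" where
  "sb a Z0 = a" | "sb a Z1 = ad12 a" | "sb a Z2 = ad11 a" | "sb a Z3 = ad10 a" | "sb a ZX = a"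

datatype quad = Q sz sz sz sz

datatype ordr = LT | EQ | GT

fun cmp :: "sz \<Rightarrow> sz \<Rightarrow> ordr" where
  "cmp Z0 Z0 = EQ" | "cmp Z0 Z1 = LT" | "cmp Z0 Z2 = LT" | "cmp Z0 Z3 = LT" | "cmp Z0 ZX = LT"
| "cmp Z1 Z0 = GT" | "cmp Z1 Z1 = EQ" | "cmp Z1 Z2 = LT" | "cmp Z1 Z3 = LT" | "cmp Z1 ZX = LT"
| "cmp Z2 Z0 = GT" | "cmp Z2 Z1 = GT" | "cmp Z2 Z2 = EQ" | "cmp Z2 Z3 = LT" | "cmp Z2 ZX = LT"
| "cmp Z3 Z0 = GT" | "cmp Z3 Z1 = GT" | "cmp Z3 Z2 = GT" | "cmp Z3 Z3 = EQ" | "cmp Z3 ZX = LT"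
| "cmp ZX Z0 = GT" | "cmp ZX Z1 = GT" | "cmp ZX Z2 = GT" | "cmp ZX Z3 = GT" | "cmp ZX ZX = EQ"

fun lexle :: "sz list \<Rightarrow> sz list \<Rightarrow> bool" and lexc :: "ordr \<Rightarrow> sz list \<Rightarrow> sz list \<Rightarrow> bool" where
  "lexle [] ys = True"
| "lexle (x # xs) [] = False"
| "lexle (x # xs) (y # ys) = lexc (cmp x y) xs ys"
| "lexc LT xs ys = True"
| "lexc EQ xs ys = lexle xs ys"
| "lexc GT xs ys = False"

fun le3 :: "sz \<Rightarrow> bool" where
  "le3 Z0 = True" | "le3 Z1 = True" | "le3 Z2 = True" | "le3 Z3 = True" | "le3 ZX = False"

fun le2 :: "sz \<Rightarrow> bool" where
  "le2 Z0 = True" | "le2 Z1 = True" | "le2 Z2 = True" | "le2 Z3 = False" | "le2 ZX = False"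

text \<open>A lower bound for the number of reciprocated arcs of a vertex, counted in unary.\<close>

fun mn :: "sz \<Rightarrow> sz \<Rightarrow> nat \<Rightarrow> nat" where
  "mn Z1 Z1 n = Suc n" | "mn Z1 Z2 n = Suc n" | "mn Z1 Z3 n = Suc n"
| "mn Z2 Z1 n = Suc n" | "mn Z2 Z2 n = Suc (Suc n)" | "mn Z2 Z3 n = Suc (Suc n)"
| "mn Z3 Z1 n = Suc n" | "mn Z3 Z2 n = Suc (Suc n)" | "mn Z3 Z3 n = Suc (Suc (Suc n))"
| "mn Z0 y n = n" | "mn ZX y n = n"
| "mn Z1 Z0 n = n" | "mn Z2 Z0 n = n" | "mn Z3 Z0 n = n"
| "mn Z1 ZX n = n" | "mn Z2 ZX n = n" | "mn Z3 ZX n = n"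

fun dg :: "sz \<Rightarrow> nat \<Rightarrow> nat" where
  "dg Z0 n = n" | "dg Z1 n = n" | "dg Z2 n = Suc (Suc n)" | "dg Z3 n = n" | "dg ZX n = n"

fun ge6 :: "nat \<Rightarrow> bool" where
  "ge6 (Suc (Suc (Suc (Suc (Suc (Suc n)))))) = True"
| "ge6 0 = False" | "ge6 (Suc 0) = False" | "ge6 (Suc (Suc 0)) = False"
| "ge6 (Suc (Suc (Suc 0))) = False" | "ge6 (Suc (Suc (Suc (Suc 0)))) = False"
| "ge6 (Suc (Suc (Suc (Suc (Suc 0))))) = False"

fun flip :: "sz \<Rightarrow> bool \<Rightarrow> bool" where
  "flip Z0 b = b" | "flip Z1 True = False" | "flip Z1 False = True" | "flip Z2 b = b"
| "flip Z3 True = False" | "flip Z3 False = True" | "flip ZX b = b"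

section \<open>Enumeration of the size matrices\<close>

fun chk :: "res \<Rightarrow> quad \<Rightarrow> quad \<Rightarrow> bool" where
  "chk p (Q a b c d) (Q x y z v) = is0 (mac (mac (mac (mac p a x) b y) c z) d v)"

fun hi4 :: "nat \<Rightarrow> quad \<Rightarrow> quad \<Rightarrow> bool" where
  "hi4 n (Q a b c d) (Q x y z v) = ge6 (mn a x (mn b y (mn c z (mn d v n))))"

text \<open>Nested conditionals instead of conjunctions make the rewriting stop at the first failed
  test; the same form recurs in the programs below.\<close>

fun copts :: "res \<Rightarrow> quad \<Rightarrow> res \<Rightarrow> quad \<Rightarrow> nat \<Rightarrow> quad \<Rightarrow> quad list \<Rightarrow> quad list" where
  "copts p qa q qb n qs [] = []"
| "copts p qa q qb n qs (t # ts) =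
    (if chk p qa t then if chk q qb t then if hi4 n qs t then t # copts p qa q qb n qs ts
       else copts p qa q qb n qs ts else copts p qa q qb n qs ts else copts p qa q qb n qs ts)"

text \<open>By the row and column sums, four entries of each line sum to 5.\<close>

definition quads5 :: "quad list" where
  "quads5 = [Q Z0 Z0 Z2 Z3, Q Z0 Z0 Z3 Z2, Q Z0 Z1 Z1 Z3, Q Z0 Z1 Z2 Z2, Q Z0 Z1 Z3 Z1, Q Z0 Z2 Z0 Z3, Q Z0 Z2 Z1 Z2, Q Z0 Z2 Z2 Z1, Q Z0 Z2 Z3 Z0, Q Z0 Z3 Z0 Z2, Q Z0 Z3 Z1 Z1, Q Z0 Z3 Z2 Z0, Q Z1 Z0 Z1 Z3, Q Z1 Z0 Z2 Z2, Q Z1 Z0 Z3 Z1, Q Z1 Z1 Z0 Z3, Q Z1 Z1 Z1 Z2, Q Z1 Z1 Z2 Z1, Q Z1 Z1 Z3 Z0, Q Z1 Z2 Z0 Z2, Q Z1 Z2 Z1 Z1, Q Z1 Z2 Z2 Z0, Q Z1 Z3 Z0 Z1, Q Z1 Z3 Z1 Z0, Q Z2 Z0 Z0 Z3, Q Z2 Z0 Z1 Z2, Q Z2 Z0 Z2 Z1, Q Z2 Z0 Z3 Z0, Q Z2 Z1 Z0 Z2, Q Z2 Z1 Z1 Z1, Q Z2 Z1 Z2 Z0, Q Z2 Z2 Z0 Z1, Q Z2 Z2 Z1 Z0, Q Z2 Z3 Z0 Z0, Q Z3 Z0 Z0 Z2, Q Z3 Z0 Z1 Z1, Q Z3 Z0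 Z2 Z0, Q Z3 Z1 Z0 Z1, Q Z3 Z1 Z1 Z0, Q Z3 Z2 Z0 Z0]"

text \<open>A row quadruple lists the columns \<open>I2\<close>, \<open>I4\<close>,
  \<open>I5\<close>, \<open>I6\<close>, so its second member is the diagonal entry of row
  \<open>I4\<close>. A diagonal block lacks 0 and has at most two elements. \<open>qle3\<close> does
  the same for row \<open>I5\<close>.\<close>

fun qle2 :: "quad list \<Rightarrow> quad list" where
  "qle2 [] = []"
| "qle2 (Q a b c d # qs) = (if le2 b then Q a b c d # qle2 qs else qle2 qs)"

fun qle3 :: "quad list \<Rightarrow> quad list" where
  "qle3 [] = []"
| "qle3 (Q a b c d # qs) = (if le2 c then Q a b c d # qle3 qs else qle3 qs)"

text \<open>The entries of a column in the rows \<open>I0\<close>, \<open>I1\<close>,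
  \<open>I2\<close> count two-paths from the fixed vertex, 3 if it sends arcs to that orbit and 4
  otherwise. Hence row \<open>I2\<close> is determined.\<close>

fun row2 :: "sz row \<Rightarrow> sz row \<Rightarrow> sz row" where
  "row2 (Row a0 a1 a2 a3 a4 a5 a6) (Row b0 b1 b2 b3 b4 b5 b6) =
    Row (tosz (sb (sb E3 a0) b0)) (tosz (sb (sb E3 a1) b1)) (tosz (sb (sb E3 a2) b2))
      (tosz (sb (sb E4 a3) b3)) (tosz (sb (sb E4 a4) b4)) (tosz (sb (sb E4 a5) b5)) (tosz (sb (sb E4 a6) b6))"

fun okc :: "sz row \<Rightarrow> bool" where
  "okc (Row a b c d e f g) = (if le3 a then if le3 b then if le2 c then if le3 d then if le3 e then
     if le3 f then le3 g else False else False else False else False else False else False)"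

text \<open>Dual to \<open>row2\<close>: the columns \<open>I0\<close>, \<open>I1\<close>,
  \<open>I3\<close> count two-paths to the fixed vertex, 3 from orbit \<open>I3\<close> and 4 from
  \<open>I4\<close>, \<open>I5\<close>, \<open>I6\<close>.\<close>

fun col3 :: "quad \<Rightarrow> quad \<Rightarrow> quad" where
  "col3 (Q x3 x4 x5 x6) (Q y3 y4 y5 y6) = Q (tosz (sb (sb E3 x3) y3)) (tosz (sb (sb E4 x4) y4))
     (tosz (sb (sb E4 x5) y5)) (tosz (sb (sb E4 x6) y6))"

fun okz :: "quad \<Rightarrow> bool" where
  "okz (Q a b c d) = (if le2 a then if le3 b then if le3 c then le3 d else False else False else False)"

fun okv :: "quad \<Rightarrow> bool" where
  "okv (Q a b c d) = (if le3 a then if le3 b then if le3 c then le2 d else False else False else False)"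

fun row6 :: "quad \<Rightarrow> quad \<Rightarrow> quad \<Rightarrow> quad" where
  "row6 (Q a b c d) (Q a' b' c' d') (Q a'' b'' c'' d'') = Q (tosz (sb (sb (sb E5 a) a') a''))
     (tosz (sb (sb (sb E5 b) b') b'')) (tosz (sb (sb (sb E5 c) c') c'')) (tosz (sb (sb (sb E5 d) d') d''))"

text \<open>The first test breaks the exchange of \<open>I0\<close> and \<open>I1\<close>, the
  others the permutations of \<open>I4\<close>, \<open>I5\<close>, \<open>I6\<close>; orbits
  exchanged here have the same relation to the fixed vertex.\<close>

fun symB :: "sz row \<Rightarrow> sz row \<Rightarrow> bool" where
  "symB (Row a0 a1 a2 a3 a4 a5 a6) (Row b0 b1 b2 b3 b4 b5 b6) =
    (if lexle [a0, a1] [b1, b0] then if lexle [a4, b4] [a5, b5] then lexle [a5, b5] [a6, b6]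
     else False else False)"

datatype part = Part "sz row" "sz row" "sz row" quad quad quad

fun assemble :: "part \<Rightarrow> quad \<Rightarrow> quad \<Rightarrow> quad \<Rightarrow> quad \<Rightarrow> sz row row" where
  "assemble (Part a b c (Q x3 x4 x5 x6) (Q y3 y4 y5 y6) (Q z3 z4 z5 z6))
     (Q t2 t4 t5 t6) (Q u2 u4 u5 u6) (Q w2 w4 w5 w6) (Q v2 v4 v5 v6) =
   Row a b c (Row x3 y3 t2 z3 t4 t5 t6) (Row x4 y4 u2 z4 u4 u5 u6)
     (Row x5 y5 w2 z5 w4 w5 w6) (Row x6 y6 v2 z6 v4 v5 v6)"

fun dot :: "res \<Rightarrow> sz row \<Rightarrow> sz row \<Rightarrow> sz \<Rightarrow> bool" where
  "dot p (Row a0 a1 a2 a3 a4 a5 a6) (Row b0 b1 b2 b3 b4 b5 b6) s =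
    is0 (mac (mac (mac (mac (mac (mac (mac (mac p Z1 s) a0 b0) a1 b1) a2 b2) a3 b3) a4 b4) a5 b5) a6 b6)"

text \<open>The right-hand side of the equation for the entry \<open>(i, j)\<close>, negated.\<close>

fun rhs :: "idx \<Rightarrow> idx \<Rightarrow> res" where
  "rhs I0 I0 = E2" | "rhs I0 I1 = E4" | "rhs I0 I2 = E4" | "rhs I0 I3 = E1" | "rhs I0 I4 = E1" | "rhs I0 I5 = E1" | "rhs I0 I6 = E1"
| "rhs I1 I0 = E4" | "rhs I1 I1 = E2" | "rhs I1 I2 = E4" | "rhs I1 I3 = E1" | "rhs I1 I4 = E1" | "rhs I1 I5 = E1" | "rhs I1 I6 = E1"
| "rhs I2 I0 = E1" | "rhs I2 I1 = E1" | "rhs I2 I2 = E12" | "rhs I2 I3 = E1" | "rhs I2 I4 = E1" | "rhs I2 I5 = E1" | "rhs I2 I6 = E1"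
| "rhs I3 I0 = E4" | "rhs I3 I1 = E4" | "rhs I3 I2 = E4" | "rhs I3 I3 = E12" | "rhs I3 I4 = E1" | "rhs I3 I5 = E1" | "rhs I3 I6 = E1"
| "rhs I4 I0 = E1" | "rhs I4 I1 = E1" | "rhs I4 I2 = E1" | "rhs I4 I3 = E1" | "rhs I4 I4 = E12" | "rhs I4 I5 = E1" | "rhs I4 I6 = E1"
| "rhs I5 I0 = E1" | "rhs I5 I1 = E1" | "rhs I5 I2 = E1" | "rhs I5 I3 = E1" | "rhs I5 I4 = E1" | "rhs I5 I5 = E12" | "rhs I5 I6 = E1"
| "rhs I6 I0 = E1" | "rhs I6 I1 = E1" | "rhs I6 I2 = E1" | "rhs I6 I3 = E1" | "rhs I6 I4 = E1" | "rhs I6 I5 = E1" | "rhs I6 I6 = E12"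

fun eqij :: "idx \<Rightarrow> idx \<Rightarrow> sz row row \<Rightarrow> bool" where
  "eqij i j M = dot (rhs i j) (el i M) (col j M) (el j (el i M))"

fun eqsj :: "idx \<Rightarrow> idx list \<Rightarrow> sz row row \<Rightarrow> bool" where
  "eqsj i [] M = True"
| "eqsj i (j # js) M = (if eqij i j M then eqsj i js M else False)"

fun eqsi :: "idx list \<Rightarrow> sz row row \<Rightarrow> bool" where
  "eqsi [] M = True"
| "eqsi (i # is) M = (if eqsj i [I2, I4, I5, I6, I0, I1, I3] M then eqsi is M else False)"

fun hid :: "idx \<Rightarrow> nat" where
  "hid I0 = Suc 0" | "hid I1 = Suc 0" | "hid I2 = 0" | "hid I3 = 0" | "hid I4 = 0" | "hid I5 = 0" | "hid I6 = 0"

fun hirow :: "nat \<Rightarrow> sz row \<Rightarrow> sz row \<Rightarrow> bool" where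
  "hirow n (Row a0 a1 a2 a3 a4 a5 a6) (Row b0 b1 b2 b3 b4 b5 b6) =
    ge6 (mn a0 b0 (mn a1 b1 (mn a2 b2 (mn a3 b3 (mn a4 b4 (mn a5 b5 (mn a6 b6 n)))))))"

text \<open>The diagonal entry is blanked in the row because it counts differently: a diagonal block
  with two elements is {1, 2} and yields two reciprocated arcs, a smaller one yields none.\<close>

fun hiall :: "idx list \<Rightarrow> sz row row \<Rightarrow> bool" where
  "hiall [] M = True"
| "hiall (i # is) M = (if hirow (dg (el i (el i M)) (hid i)) (put i Z0 (el i M)) (col i M)
     then hiall is M else False)"

text \<open>Only entries involving \<open>j\<close> itself and the orbits \<open>I0\<close> to
  \<open>I3\<close> occur, so permuting \<open>I4\<close>, \<open>I5\<close>, \<open>I6\<close>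
  permutes the three keys. The two leading entries are those that \<open>symB\<close> compares
  early.\<close>

fun key :: "idx \<Rightarrow> sz row row \<Rightarrow> sz list" where
  "key j M = [el j (el I0 M), el j (el I1 M), el j (el j M), el I0 (el j M), el I1 (el j M),
     el j (el I3 M), el j (el I2 M), el I2 (el j M), el I3 (el j M)]"

fun trev :: "sz row row \<Rightarrow> bool" where
  "trev M = flip (el I0 (el I0 M)) (flip (el I1 (el I1 M)) (flip (el I2 (el I2 M)) (flip (el I3 (el I3 M))
     (flip (el I4 (el I4 M)) (flip (el I5 (el I5 M)) (flip (el I6 (el I6 M)) True))))))"

text \<open>The rows \<open>I0\<close>, \<open>I1\<close>, \<open>I3\<close> have already passed the
  reciprocity test in \<open>copts0\<close>, \<open>copts1\<close> and
  \<open>ropts3\<close>.\<close>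

fun final :: "sz row row \<Rightarrow> bool" where
  "final M = (if trev M then if eqsi [I0, I1, I4, I5, I6, I2, I3] M then
     if hiall [I2, I4, I5, I6] M then if lexle (key I4 M) (key I5 M) then lexle (key I5 M) (key I6 M)
     else False else False else False else False)"

text \<open>\<open>lpR6\<close> and \<open>lpR7\<close> receive the computed row and matrix as
  arguments, which takes the place of a let: the value is normalised once and then
  inspected.\<close>

fun lpR5 :: "part \<Rightarrow> quad \<Rightarrow> quad \<Rightarrow> quad list \<Rightarrow> sz row row list"
  and lpR6 :: "part \<Rightarrow> quad \<Rightarrow> quad \<Rightarrow> quad \<Rightarrow> quad \<Rightarrow> quad list \<Rightarrow> sz row row list"
  and lpR7 :: "part \<Rightarrow> quad \<Rightarrow> quad \<Rightarrow> sz row row \<Rightarrow> quad list \<Rightarrow> sz row row list" where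
  "lpR5 P t u [] = []"
| "lpR5 P t u (w # ws) = lpR6 P t u w (row6 t u w) ws"
| "lpR6 P t u w v ws = (if okv v then lpR7 P t u (assemble P t u w v) ws else lpR5 P t u ws)"
| "lpR7 P t u M ws = (if final M then M # lpR5 P t u ws else lpR5 P t u ws)"

fun lpR4 :: "part \<Rightarrow> quad \<Rightarrow> quad list \<Rightarrow> quad list \<Rightarrow> sz row row list" where
  "lpR4 P t [] ws = []"
| "lpR4 P t (u # us) ws = lpR5 P t u ws @ lpR4 P t us ws"

fun lpR3 :: "part \<Rightarrow> quad list \<Rightarrow> quad list \<Rightarrow> quad list \<Rightarrow> sz row row list" where
  "lpR3 P [] us ws = []"
| "lpR3 P (t # ts) us ws = lpR4 P t us ws @ lpR3 P ts us ws"

fun ropts3 :: "part \<Rightarrow> quad list" where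
  "ropts3 (Part (Row a0 a1 a2 a3 a4 a5 a6) (Row b0 b1 b2 b3 b4 b5 b6) (Row c0 c1 c2 c3 c4 c5 c6)
     (Q x3 x4 x5 x6) (Q y3 y4 y5 y6) (Q z3 z4 z5 z6)) =
   copts (mac (mac (mac (mac E4 Z1 x3) x3 a0) y3 b0) z3 x3) (Q c0 x4 x5 x6)
     (mac (mac (mac (mac E4 Z1 y3) x3 a1) y3 b1) z3 y3) (Q c1 y4 y5 y6)
     (mn x3 a3 (mn y3 b3 (dg z3 0))) (Q c3 z4 z5 z6) quads5"

text \<open>Starting the count at six lets the reciprocity test of \<open>copts\<close> always
  succeed. It is left to \<open>hiall\<close>, since column \<open>I4\<close> is still incomplete at
  this point.\<close>

fun ropts4 :: "part \<Rightarrow> quad list" where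
  "ropts4 (Part (Row a0 a1 a2 a3 a4 a5 a6) (Row b0 b1 b2 b3 b4 b5 b6) (Row c0 c1 c2 c3 c4 c5 c6)
     (Q x3 x4 x5 x6) (Q y3 y4 y5 y6) (Q z3 z4 z5 z6)) =
   copts (mac (mac (mac (mac E1 Z1 x4) x4 a0) y4 b0) z4 x3) (Q c0 x4 x5 x6)
     (mac (mac (mac (mac E1 Z1 y4) x4 a1) y4 b1) z4 y3) (Q c1 y4 y5 y6)
     (Suc (Suc (Suc (Suc (Suc (Suc 0)))))) (Q c3 z4 z5 z6) (qle2 quads5)"

fun ropts5 :: "part \<Rightarrow> quad list" where
  "ropts5 (Part (Row a0 a1 a2 a3 a4 a5 a6) (Row b0 b1 b2 b3 b4 b5 b6) (Row c0 c1 c2 c3 c4 c5 c6)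
     (Q x3 x4 x5 x6) (Q y3 y4 y5 y6) (Q z3 z4 z5 z6)) =
   copts (mac (mac (mac (mac E1 Z1 x5) x5 a0) y5 b0) z5 x3) (Q c0 x4 x5 x6)
     (mac (mac (mac (mac E1 Z1 y5) x5 a1) y5 b1) z5 y3) (Q c1 y4 y5 y6)
     (Suc (Suc (Suc (Suc (Suc (Suc 0)))))) (Q c3 z4 z5 z6) (qle3 quads5)"

text \<open>Like \<open>ent3\<close> and \<open>ent1\<close>, this inspects one candidate list
  before the next is computed, so that no work is spent on a branch that is already empty.\<close>

fun ent4 :: "part \<Rightarrow> quad list \<Rightarrow> quad list \<Rightarrow> sz row row list" where
  "ent4 P ts [] = []"
| "ent4 P ts (u # us) = lpR3 P ts (u # us) (ropts5 P)"

fun ent3 :: "part \<Rightarrow> quad list \<Rightarrow> sz row row list" where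
  "ent3 P [] = []"
| "ent3 P (t # ts) = ent4 P (t # ts) (ropts4 P)"

fun ent2 :: "sz row \<Rightarrow> sz row \<Rightarrow> sz row \<Rightarrow> quad \<Rightarrow> quad \<Rightarrow> quad \<Rightarrow> sz row row list" where
  "ent2 a b c x y z = (if okz z then ent3 (Part a b c x y z) (ropts3 (Part a b c x y z)) else [])"

fun lpC1 :: "sz row \<Rightarrow> sz row \<Rightarrow> sz row \<Rightarrow> quad \<Rightarrow> quad list \<Rightarrow> sz row row list" where
  "lpC1 a b c x [] = []"
| "lpC1 a b c x (y # ys) = ent2 a b c x y (col3 x y) @ lpC1 a b c x ys"

fun lpC0 :: "sz row \<Rightarrow> sz row \<Rightarrow> sz row \<Rightarrow> quad list \<Rightarrow> quad list \<Rightarrow> sz row row list" where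
  "lpC0 a b c [] ys = []"
| "lpC0 a b c (x # xs) ys = lpC1 a b c x ys @ lpC0 a b c xs ys"

fun copts0 :: "sz row \<Rightarrow> sz row \<Rightarrow> sz row \<Rightarrow> quad list" where
  "copts0 (Row a0 a1 a2 a3 a4 a5 a6) (Row b0 b1 b2 b3 b4 b5 b6) (Row c0 c1 c2 c3 c4 c5 c6) =
   copts (mac (mac (mac (mac E2 Z1 a0) a0 a0) a1 b0) a2 c0) (Q a3 a4 a5 a6)
     (mac (mac (mac (mac E4 Z1 b0) b0 a0) b1 b0) b2 c0) (Q b3 b4 b5 b6)
     (mn a1 b0 (mn a2 c0 (dg a0 (Suc 0)))) (Q a3 a4 a5 a6) quads5"

fun copts1 :: "sz row \<Rightarrow> sz row \<Rightarrow> sz row \<Rightarrow> quad list" where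
  "copts1 (Row a0 a1 a2 a3 a4 a5 a6) (Row b0 b1 b2 b3 b4 b5 b6) (Row c0 c1 c2 c3 c4 c5 c6) =
   copts (mac (mac (mac (mac E4 Z1 a1) a0 a1) a1 b1) a2 c1) (Q a3 a4 a5 a6)
     (mac (mac (mac (mac E2 Z1 b1) b0 a1) b1 b1) b2 c1) (Q b3 b4 b5 b6)
     (mn b0 a1 (mn b2 c1 (dg b1 (Suc 0)))) (Q b3 b4 b5 b6) quads5"

fun ent1 :: "sz row \<Rightarrow> sz row \<Rightarrow> sz row \<Rightarrow> quad list \<Rightarrow> sz row row list" where
  "ent1 a b c [] = []"
| "ent1 a b c (x # xs) = lpC0 a b c (x # xs) (copts1 a b c)"

fun ent0 :: "sz row \<Rightarrow> sz row \<Rightarrow> sz row \<Rightarrow> sz row row list" where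
  "ent0 a b c = (if okc c then ent1 a b c (copts0 a b c) else [])"

fun lpB :: "sz row \<Rightarrow> sz row list \<Rightarrow> sz row row list" where
  "lpB a [] = []"
| "lpB a (b # bs) = (if symB a b then ent0 a b (row2 a b) @ lpB a bs else lpB a bs)"

fun lpA :: "sz row list \<Rightarrow> sz row list \<Rightarrow> sz row row list" where
  "lpA [] bs = []"
| "lpA (a # as) bs = lpB a bs @ lpA as bs"

fun mkrow :: "sz \<Rightarrow> sz \<Rightarrow> sz \<Rightarrow> quad list \<Rightarrow> sz row list" where
  "mkrow a b d [] = []"
| "mkrow a b d (Q c e f g # qs) = Row a b c d e f g # mkrow a b d qs"

text \<open>Not a sorting function but symmetry breaking in row \<open>I0\<close>: by the order of
  the keys, its entries in the columns \<open>I4\<close>, \<open>I5\<close>, \<open>I6\<close> may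
  be taken as increasing.\<close>

fun qsort :: "quad list \<Rightarrow> quad list" where
  "qsort [] = []"
| "qsort (Q a b c d # qs) = (if lexle [b] [c] then if lexle [c] [d] then Q a b c d # qsort qs
     else qsort qs else qsort qs)"

definition rowsB :: "sz row list" where
  "rowsB = mkrow Z0 Z0 Z3 quads5 @ mkrow Z0 Z1 Z2 quads5 @ mkrow Z0 Z2 Z1 quads5
    @ mkrow Z1 Z0 Z2 quads5 @ mkrow Z1 Z1 Z1 quads5 @ mkrow Z1 Z2 Z0 quads5
    @ mkrow Z2 Z0 Z1 quads5 @ mkrow Z2 Z1 Z0 quads5 @ mkrow Z3 Z0 Z0 quads5"

text \<open>Four portions, so that the enumeration can be evaluated in four lemmas. The nine triples
  of leading sizes are those with sum 3 and diagonal entry at most 2.\<close>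

definition rowsA0 :: "sz row list" where
  "rowsA0 = mkrow Z0 Z0 Z3 (qsort quads5) @ mkrow Z0 Z1 Z2 (qsort quads5)"
definition rowsA1 :: "sz row list" where
  "rowsA1 = mkrow Z0 Z2 Z1 (qsort quads5) @ mkrow Z0 Z3 Z0 (qsort quads5)"
definition rowsA2 :: "sz row list" where
  "rowsA2 = mkrow Z1 Z0 Z2 (qsort quads5) @ mkrow Z1 Z1 Z1 (qsort quads5)"
definition rowsA3 :: "sz row list" where
  "rowsA3 = mkrow Z1 Z2 Z0 (qsort quads5) @ mkrow Z2 Z0 Z1 (qsort quads5) @ mkrow Z2 Z1 Z0 (qsort quads5)"

section \<open>Matrices of blocks\<close>

text \<open>A block with one arc \<open>z\<close> has the value \<open>3\<^sup>z\<close> modulo 13, and a block that misses only \<open>z\<close> has the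
  value \<open>-3\<^sup>z\<close>.  The cell is \<open>P\<close> or \<open>M\<close> followed by \<open>z\<close>, or \<open>UP\<close> or \<open>UM\<close> when \<open>z\<close> is still unknown.\<close>

datatype cell = CZ | UP | UM | P0 | P1 | P2 | M0 | M1 | M2

fun mulc :: "cell \<Rightarrow> cell \<Rightarrow> cell" where
  "mulc CZ y = CZ"
| "mulc UP CZ = CZ" | "mulc UP UP = UP" | "mulc UP UM = UM" | "mulc UP P0 = UP" | "mulc UP P1 = UP" | "mulc UP P2 = UP" | "mulc UP M0 = UM" | "mulc UP M1 = UM" | "mulc UP M2 = UM"
| "mulc UM CZ = CZ" | "mulc UM UP = UM" | "mulc UM UM = UP" | "mulc UM P0 = UM" | "mulc UM P1 = UM" | "mulc UM P2 = UM" | "mulc UM M0 = UP" | "mulc UM M1 = UP" | "mulc UM M2 = UP"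
| "mulc P0 CZ = CZ" | "mulc P0 UP = UP" | "mulc P0 UM = UM" | "mulc P0 P0 = P0" | "mulc P0 P1 = P1" | "mulc P0 P2 = P2" | "mulc P0 M0 = M0" | "mulc P0 M1 = M1" | "mulc P0 M2 = M2"
| "mulc P1 CZ = CZ" | "mulc P1 UP = UP" | "mulc P1 UM = UM" | "mulc P1 P0 = P1" | "mulc P1 P1 = P2" | "mulc P1 P2 = P0" | "mulc P1 M0 = M1" | "mulc P1 M1 = M2" | "mulc P1 M2 = M0"
| "mulc P2 CZ = CZ" | "mulc P2 UP = UP" | "mulc P2 UM = UM" | "mulc P2 P0 = P2" | "mulc P2 P1 = P0" | "mulc P2 P2 = P1" | "mulc P2 M0 = M2" | "mulc P2 M1 = M0" | "mulc P2 M2 = M1"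
| "mulc M0 CZ = CZ" | "mulc M0 UP = UM" | "mulc M0 UM = UP" | "mulc M0 P0 = M0" | "mulc M0 P1 = M1" | "mulc M0 P2 = M2" | "mulc M0 M0 = P0" | "mulc M0 M1 = P1" | "mulc M0 M2 = P2"
| "mulc M1 CZ = CZ" | "mulc M1 UP = UM" | "mulc M1 UM = UP" | "mulc M1 P0 = M1" | "mulc M1 P1 = M2" | "mulc M1 P2 = M0" | "mulc M1 M0 = P1" | "mulc M1 M1 = P2" | "mulc M1 M2 = P0"
| "mulc M2 CZ = CZ" | "mulc M2 UP = UM" | "mulc M2 UM = UP" | "mulc M2 P0 = M2" | "mulc M2 P1 = M0" | "mulc M2 P2 = M1" | "mulc M2 M0 = P2" | "mulc M2 M1 = P0" | "mulc M2 M2 = P1"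

text \<open>A partial sum: a residue, plus or minus an unknown power of 3, or (\<open>DD\<close>) a sum with several
  unknown terms, which is never refuted.\<close>

datatype st = K res | HP res | HM res | DD

fun addc :: "st \<Rightarrow> cell \<Rightarrow> st" where
  "addc (K a) CZ = K a" | "addc (K a) UP = HP a" | "addc (K a) UM = HM a" | "addc (K a) P0 = K (ad1 a)" | "addc (K a) P1 = K (ad3 a)" | "addc (K a) P2 = K (ad9 a)" | "addc (K a) M0 = K (ad12 a)" | "addc (K a) M1 = K (ad10 a)" | "addc (K a) M2 = K (ad4 a)"
| "addc (HP a) CZ = HP a" | "addc (HP a) UP = DD" | "addc (HP a) UM = DD" | "addc (HP a) P0 = HP (ad1 a)" | "addc (HP a) P1 = HP (ad3 a)" | "addc (HP a) P2 = HP (ad9 a)" | "addc (HP a) M0 = HP (ad12 a)" | "addc (HP a) M1 = HP (ad10 a)" | "addc (HP a) M2 = HP (ad4 a)"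
| "addc (HM a) CZ = HM a" | "addc (HM a) UP = DD" | "addc (HM a) UM = DD" | "addc (HM a) P0 = HM (ad1 a)" | "addc (HM a) P1 = HM (ad3 a)" | "addc (HM a) P2 = HM (ad9 a)" | "addc (HM a) M0 = HM (ad12 a)" | "addc (HM a) M1 = HM (ad10 a)" | "addc (HM a) M2 = HM (ad4 a)"
| "addc DD c = DD"

text \<open>An unknown power of 3 is 1, 3 or 9 modulo 13. Added to a residue it can give 0 only for
  12, 10 and 4, subtracted only for 1, 3 and 9.\<close>

fun fin :: "st \<Rightarrow> bool" where
  "fin (K a) = is0 a"
| "fin (HP E0) = False" | "fin (HP E1) = False" | "fin (HP E2) = False" | "fin (HP E3) = False" | "fin (HP E4) = True" | "fin (HP E5) = False" | "fin (HP E6) = False" | "fin (HP E7) = False" | "fin (HP E8) = False" | "fin (HP E9) = False" | "fin (HP E10) = True" | "fin (HP E11) = False" | "fin (HP E12) = True"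
| "fin (HM E0) = False" | "fin (HM E1) = True" | "fin (HM E2) = False" | "fin (HM E3) = True" | "fin (HM E4) = False" | "fin (HM E5) = False" | "fin (HM E6) = False" | "fin (HM E7) = False" | "fin (HM E8) = False" | "fin (HM E9) = True" | "fin (HM E10) = False" | "fin (HM E11) = False" | "fin (HM E12) = False"
| "fin DD = True"

fun ev :: "res \<Rightarrow> cell row \<Rightarrow> cell row \<Rightarrow> cell \<Rightarrow> bool" where
  "ev p (Row a0 a1 a2 a3 a4 a5 a6) (Row b0 b1 b2 b3 b4 b5 b6) s =
    fin (addc (addc (addc (addc (addc (addc (addc (addc (K p) s) (mulc a0 b0)) (mulc a1 b1))
      (mulc a2 b2)) (mulc a3 b3)) (mulc a4 b4)) (mulc a5 b5)) (mulc a6 b6))"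

datatype tok = Sp | Pr idx idx

text \<open>The full block has the value 1 + 3 + 9 = 13, so the path equations of the block matrix
  reduce to \<open>W^2 + W = 2 I\<close> modulo 13; the start value \<open>E11\<close> is
  -2.\<close>

fun evs :: "tok list \<Rightarrow> cell row row \<Rightarrow> bool" where
  "evs [] m = True"
| "evs (Pr i j # ks) m =
    (if ev (if i = j then E11 else E0) (el i m) (col j m) (el j (el i m)) then evs ks m else False)"
| "evs (Sp # ks) m = evs ks m"

fun setc :: "idx \<Rightarrow> idx \<Rightarrow> cell \<Rightarrow> cell row row \<Rightarrow> cell row row" where
  "setc i j x m = put i (put j x (el i m)) m"

fun exs :: "idx \<Rightarrow> idx \<Rightarrow> tok list \<Rightarrow> cell row row \<Rightarrow> cell list \<Rightarrow> cell row row list"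
  and exs1 :: "idx \<Rightarrow> idx \<Rightarrow> tok list \<Rightarrow> cell row row \<Rightarrow> cell list \<Rightarrow> cell row row \<Rightarrow> cell row row list" where
  "exs i j ks m [] = []"
| "exs i j ks m (x # xs) = exs1 i j ks m xs (setc i j x m)"
| "exs1 i j ks m xs m' = (if evs ks m' then m' # exs i j ks m xs else exs i j ks m xs)"

fun opt :: "bool \<Rightarrow> cell \<Rightarrow> cell list" where
  "opt True UP = [P1, P2]" | "opt False UP = [P0, P1, P2]" | "opt b UM = [M0, M1, M2]"
| "opt b CZ = [CZ]" | "opt b P0 = [P0]" | "opt b P1 = [P1]" | "opt b P2 = [P2]"
| "opt b M0 = [M0]" | "opt b M1 = [M1]" | "opt b M2 = [M2]"

text \<open>Negating the integers modulo 3 exchanges 1 and 2, so that the first cell of the search need not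
  be tried with 2.\<close>

fun opt1 :: "bool \<Rightarrow> cell \<Rightarrow> cell list" where
  "opt1 True UP = [P1]" | "opt1 False UP = [P0, P1]" | "opt1 b UM = [M0, M1]"
| "opt1 b CZ = [CZ]" | "opt1 b P0 = [P0]" | "opt1 b P1 = [P1]" | "opt1 b P2 = [P2]"
| "opt1 b M0 = [M0]" | "opt1 b M1 = [M1]" | "opt1 b M2 = [M2]"

fun ext :: "idx \<Rightarrow> idx \<Rightarrow> tok list \<Rightarrow> cell row row list \<Rightarrow> cell row row list" where
  "ext i j ks [] = []"
| "ext i j ks (m # ms) = exs i j ks m (opt (i = j) (el j (el i m))) @ ext i j ks ms"

fun ext1 :: "idx \<Rightarrow> idx \<Rightarrow> tok list \<Rightarrow> cell row row \<Rightarrow> cell row row list" where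
  "ext1 i j ks m = exs i j ks m (opt1 (i = j) (el j (el i m)))"

text \<open>The head of a step is the cell to branch on, the other tokens are the equations tested
  after each choice.\<close>

fun runp :: "tok list list \<Rightarrow> cell row row list \<Rightarrow> cell row row list" where
  "runp [] ms = ms"
| "runp (p # ps) [] = []"
| "runp ((Pr i j # ks) # ps) (m # ms) = runp ps (ext i j ks (m # ms))"
| "runp ([] # ps) (m # ms) = runp ps (m # ms)"
| "runp ((Sp # ks) # ps) (m # ms) = runp ps (m # ms)"

fun run1 :: "tok list list \<Rightarrow> cell row row \<Rightarrow> cell row row list" where
  "run1 [] m = [m]"
| "run1 ((Pr i j # ks) # ps) m = runp ps (ext1 i j ks m)"
| "run1 ([] # ps) m = [m]"
| "run1 ((Sp # ks) # ps) m = [m]"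

fun anchor :: "tok list \<Rightarrow> cell row row \<Rightarrow> cell row row" and anchor1 :: "idx \<Rightarrow> idx \<Rightarrow> cell \<Rightarrow> cell row row \<Rightarrow> cell row row" where
  "anchor [] m = m"
| "anchor (Sp # ks) m = anchor ks m"
| "anchor (Pr i j # ks) m = anchor1 i j (el j (el i m)) (anchor ks m)"
| "anchor1 i j UP m = setc i j P0 m"
| "anchor1 i j UM m = setc i j M0 m"
| "anchor1 i j CZ m = m" | "anchor1 i j P0 m = m" | "anchor1 i j P1 m = m" | "anchor1 i j P2 m = m"
| "anchor1 i j M0 m = m" | "anchor1 i j M1 m = m" | "anchor1 i j M2 m = m"

fun cl :: "sz \<Rightarrow> cell" where
  "cl Z0 = CZ" | "cl Z1 = UP" | "cl Z2 = UM" | "cl Z3 = CZ" | "cl ZX = CZ"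

text \<open>A diagonal block omits 0, so with two elements it is {1, 2}, whose value is -1.\<close>

fun cld :: "sz \<Rightarrow> cell" where
  "cld Z0 = CZ" | "cld Z1 = UP" | "cld Z2 = M0" | "cld Z3 = CZ" | "cld ZX = CZ"

fun clrow :: "sz row \<Rightarrow> cell row" where
  "clrow (Row a b c d e f g) = Row (cl a) (cl b) (cl c) (cl d) (cl e) (cl f) (cl g)"

fun init :: "sz row row \<Rightarrow> cell row row" where
  "init (Row a b c d e f g) = Row (put I0 (cld (el I0 a)) (clrow a)) (put I1 (cld (el I1 b)) (clrow b))
    (put I2 (cld (el I2 c)) (clrow c)) (put I3 (cld (el I3 d)) (clrow d)) (put I4 (cld (el I4 e)) (clrow e))
    (put I5 (cld (el I5 f)) (clrow f)) (put I6 (cld (el I6 g)) (clrow g))"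

text \<open>The index of a block is the bit mask of its elements.\<close>

datatype blk = B0 | B1 | B2 | B3 | B4 | B5 | B6 | B7

text \<open>A cell that is still undetermined becomes the junk value \<open>B0\<close>; in the
  listed results this is detected by the size check in \<open>wellf\<close>.\<close>

fun comb :: "sz \<Rightarrow> cell \<Rightarrow> blk" where
  "comb Z0 c = B0" | "comb Z3 c = B7" | "comb ZX c = B0"
| "comb Z1 P0 = B1" | "comb Z1 P1 = B2" | "comb Z1 P2 = B4" | "comb Z1 CZ = B0" | "comb Z1 UP = B0"
| "comb Z1 UM = B0" | "comb Z1 M0 = B0" | "comb Z1 M1 = B0" | "comb Z1 M2 = B0"
| "comb Z2 M0 = B6" | "comb Z2 M1 = B5" | "comb Z2 M2 = B3" | "comb Z2 CZ = B0" | "comb Z2 UP = B0"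
| "comb Z2 UM = B0" | "comb Z2 P0 = B0" | "comb Z2 P1 = B0" | "comb Z2 P2 = B0"

fun combrow :: "sz row \<Rightarrow> cell row \<Rightarrow> blk row" where
  "combrow (Row a b c d e f g) (Row a' b' c' d' e' f' g') =
    Row (comb a a') (comb b b') (comb c c') (comb d d') (comb e e') (comb f f') (comb g g')"

fun combmat :: "sz row row \<Rightarrow> cell row row \<Rightarrow> blk row row" where
  "combmat (Row a b c d e f g) (Row a' b' c' d' e' f' g') =
    Row (combrow a a') (combrow b b') (combrow c c') (combrow d d') (combrow e e') (combrow f f') (combrow g g')"

fun combs :: "sz row row \<Rightarrow> cell row row list \<Rightarrow> blk row row list" where
  "combs R [] = []"
| "combs R (m # ms) = combmat R m # combs R ms"

text \<open>Cells of a seven by seven matrix are written as characters: the three low bits of the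
  character code give the row and the next three the column, the value 4 being left out.  A space
  starts a new step of the search plan.\<close>

fun ix :: "bool \<Rightarrow> bool \<Rightarrow> bool \<Rightarrow> idx" where
  "ix False False False = I0" | "ix True False False = I1" | "ix False True False = I2"
| "ix True True False = I3" | "ix False False True = I0" | "ix True False True = I4"
| "ix False True True = I5" | "ix True True True = I6"

fun tk :: "idx \<Rightarrow> bool \<Rightarrow> bool \<Rightarrow> bool \<Rightarrow> tok" where
  "tk i False False True = Sp" | "tk i True False True = Pr i I4" | "tk i a True c = Pr i (ix a True c)"
| "tk i a False False = Pr i (ix a False False)"

fun ctok :: "char \<Rightarrow> tok" where
  "ctok (Char a b c d e f g h) = tk (ix a b c) d e f"

fun toks :: "string \<Rightarrow> tok list" where
  "toks [] = []" | "toks (c # cs) = ctok c # toks cs"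

fun stp :: "tok \<Rightarrow> tok list list \<Rightarrow> tok list list" where
  "stp Sp ls = [] # ls"
| "stp (Pr i j) [] = [[Pr i j]]"
| "stp (Pr i j) (l # ls) = (Pr i j # l) # ls"

fun steps :: "string \<Rightarrow> tok list list" where
  "steps [] = []" | "steps (c # cs) = stp (ctok c) (steps cs)"

fun csz :: "char \<Rightarrow> sz" where
  "csz (Char False False c d e f g h) = Z0" | "csz (Char True False c d e f g h) = Z1"
| "csz (Char False True c d e f g h) = Z2" | "csz (Char True True c d e f g h) = Z3"

fun cblk :: "char \<Rightarrow> blk" where
  "cblk (Char False False False d e f g h) = B0" | "cblk (Char True False False d e f g h) = B1"
| "cblk (Char False True False d e f g h) = B2" | "cblk (Char True True False d e f g h) = B3"
| "cblk (Char False False True d e f g h) = B4" | "cblk (Char True False True d e f g h) = B5"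
| "cblk (Char False True True d e f g h) = B6" | "cblk (Char True True True d e f g h) = B7"

fun szrows :: "string \<Rightarrow> sz row list" where
  "szrows (a # b # c # d # e # f # g # cs) =
    Row (csz a) (csz b) (csz c) (csz d) (csz e) (csz f) (csz g) # szrows cs"
| "szrows cs = []"

fun blkrows :: "string \<Rightarrow> blk row list" where
  "blkrows (a # b # c # d # e # f # g # cs) =
    Row (cblk a) (cblk b) (cblk c) (cblk d) (cblk e) (cblk f) (cblk g) # blkrows cs"
| "blkrows cs = []"

fun mkmat :: "'a row list \<Rightarrow> 'a row row" where
  "mkmat [a, b, c, d, e, f, g] = Row a b c d e f g"
| "mkmat as = Row (hd as) (hd as) (hd as) (hd as) (hd as) (hd as) (hd as)"

definition "szmat s = mkmat (szrows s)"
definition "blkmat s = mkmat (blkrows s)"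

text \<open>A size matrix, the anchored cells, the search plan and the resulting block matrices.\<close>

datatype task = Task string string string "string list"

fun blkmats :: "string list \<Rightarrow> blk row row list" where
  "blkmats [] = []" | "blkmats (s # ss) = blkmat s # blkmats ss"

fun leaves :: "sz row row \<Rightarrow> tok list \<Rightarrow> tok list list \<Rightarrow> blk row row list" where
  "leaves R as ps = combs R (run1 ps (anchor as (init R)))"

fun solve :: "task \<Rightarrow> bool" where
  "solve (Task R as ps ls) = (leaves (szmat R) (toks as) (steps ps) = blkmats ls)"

fun solves :: "task list \<Rightarrow> bool" where
  "solves [] = True" | "solves (t # ts) = (if solve t then solves ts else False)"

section \<open>Search plans and results for all size matrices, in eight batches\<close>

definition tasks0 :: "task list" where
  "tasks0 = [
    Task ''0003113021113031202012110112133002010032031112220'' ''Y;zGEn'' ''_? O_ JZ um jB S; QR h@ wr WR Fn KI pv s ow CG kko iA'' [''0007117061117071606016110116177006010076071116660'', ''0007117061127071606015110126177006010076071116560'', ''0007117061147071606013110146177006010076071116360''],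
    Task ''0003113121003121213002110112122102111122021112220'' ''yJZsph'' '']X OI up E@u QIQYR _Y nh F@ ;z ^Xv ~x^ wvq? }xu]}~ WQ_ Gw U]P N~H KJ;O MHM}N SRK[U oO_w?imnWo AiqA kK[;mnojSks CksCEFG BABjrCEG VPSUFNV^W'' [''0007117161007161617006110116166106111166061116660'', ''0007117161007161617006110116155206212256051116660''],
    Task ''0003113121012121212102110112133002010032031112220'' ''Z_yEpq'' ''A SR[ ;[z;? h@hm K; upu W_SW nhmFnv JJzK F@EFnv OKO?I QIQYRSW i ji oi BA rqBjr kj GAo srCkw CBCksG wqsGow'' [''0007117161016161616106110116177006010076071116660'', ''0007117161016161616205110216177006010076071116650'', ''0007117161016161616403110416177006010076071116630'', ''0007117161016151616106110226177006010076072116660'', ''0007117161016131616106110446177006010076074116660'', ''0007117161026151616205110226177006010076071116660'', ''0007117161046131616403110446177006010076071116660'', ''0007117261016161616105110116177006010076071116550'', ''0007117261016151616105110226177006010076072116550'', ''0007117261016131616105110446177006010076074116550'', ''0007117261016151615106110216177006010076072116650'', ''0007117261026151616105110126177006010076071116560'', ''0007117261026151615106110116177006010076071116660'', ''0007117261026151615205110216177006010076071116650'', ''0007117261026151615403110416177006010076071116630''],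
    Task ''0003113201112113202102100122102300313102201122210'' ''pVUKyW'' ''q nVh YIY[ hPh OIO_? E@Emu BE rruRv F@FvBn jBRjmn ;yK; _Y[O_? QQ iQ sS wqsWw Gw kSo AqAiC oiWokG CACksG'' [''0007117301145117606106100166106700717106602166540'', ''0007117502145117606103100266106700717106602166310'', ''0007117602145117606103100156106700717106601166310'', ''0007117302145117606106100156106700717106601166640'', ''0007117304145117606103100466106700717106602166510''],
    Task ''0003113201112113202102110112102300313102201112220'' ''phUKyW'' ''k YIY[ nh E@Emu VPV _YO_ BE rruRv OIO_? jRjmBn F@BFnv ;yK[;? Q SS sS wW qQqsw oW Aqi GwCGo CCsGAk iAQiko'' [''0007117601116117606106110116106700717106601116660'', ''0007117601126117606105120116106700717106601116560'', ''0007117601115117606106120116106700717106602116560'', ''0007117601146117606103140116106700717106601116360'', ''0007117601113117606106140116106700717106604116360'', ''0007117501116117606106110226106700717106602116660'', ''0007117601116117606105110226106700717106602116550'', ''0007117501126117606105120226106700717106602116560'', ''0007117501146117606103140226106700717106602116360'', ''0007117602116117606105110216106700717106601116650'', ''0007117502126117606105120216106700717106601116660'', ''0007117502115117606106120216106700717106602116660'', ''0007117602115117606105120216106700717106602116550'', ''0007117602113117606105140216106700717106604116350''],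
    Task ''0003113201112113202102120102102300313102201102230'' ''UVpGOY'' ''C qw KIK[s _O_ hPh E@Emu BE rruRv nhV Ss ;K[y;? jRjmBn F@BFnv yIYy;? oGW AGqC kCSko ikoAi QAQiqSW'' [''0007117502126117606105130206106700717106601106670'', ''0007117601126117606105130106106700717106601106570''],
    Task ''0003113201113013202012110112112200312112201112220'' ''pzVUM]'' '';} hP E@ Y] W? iI nh _? KM ^~ su k[ Fv Qy ji NH SQ Aq OK o Ck GCo BA wo'' [''0007117601117017606016110116116600716116601116660'', ''0007117601117027606015110116116600716116601116550'', ''0007117601117047606013110116116600716116601116330''],
    Task ''0003113202112013102112110130122101211122111112202'' ''p^nVN~'' ''v F@ hh MH up rv UP jJ RR E o G Y Q S _ B A K i W k O q ] C z }'' [],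
    Task ''0003113212002112113102110112112211112111121112220'' ''}M]Uhp'' ''n mh E@ ^X ~x NH VP F@ up Z] _] ;} rZz kjm s[; omk y} qYiy Go Jz w_ Iy v~ Ai Ck K; W_ RZ BF QA SV O?'' [''0007117345006443227103440445116644116112262223550'', ''0007117323006245447105220223116644116112264445330''],
    Task ''0003113212011112112202021111111202212212011201221'' ''p^~nVN'' ''? hh }x y~ MH I ON i qyI Z Q s r U A _ G E F R j u C [ w ] o k B J ; S'' [],
    Task ''0003113212011112112202021111112202112112021201221'' ''NV~ph]'' ''I nh MH }x ON ? y~ q iyI o J k ^ [ S G B j r Z R w s Q A U C F u ; _ E'' [],
    Task ''0003113212012012112112110112113200212012211112220'' ''^qhp~W'' ''R ]X }x ;} _] SSVW o A C Q j n E w N i O z I r F k M s Z G B J K'' [],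
    Task ''0003122112120122101211101212021211222301012012130'' ''_WGpNM'' ''R Fv x@ ~ AF BG rr JB zB QR yz~ CG YAZ^ I ; o K s h U u [ j n } i ] k m'' [],
    Task ''0003122202111113102112110121122102111122111112202'' ''N]hxpr'' ''OH MH n oh _X Y_ ^X up] }]M vp F E@ jZ R BrBj s qv Uu iY km Qq Aqi yiI W ; ~ z S C G K V'' [],
    Task ''0013013202111113003201002221111202213203002121012'' ''OMkVps'' ''E iIimo }M Yi PP ;K; rpRrv BRr@BF yIy}? __o?Y[ ]Y[]m} F@BFVv CC GC WS US wsGWw AGE QWAQU qAQwqu uqsEUu'' [''0017017506114117007601006661211603617607003161026'', ''0017017505114117007602006661212603617607003161016'', ''0017017305114117007604006661214605617607003161016'', ''0017017605111117007604006661211605617607003131016'', ''0017017506111117007604006661211606617607003131026''],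
    Task ''0013013202111113003201012211111202213203002111022'' ''OMkpBC'' ''u P@PR }M rpr F@BFVv ;K; iIimo Yi yIy}? __o?Y[ VPRFVv ]Y[]m} s Ss ws WS GCGWw QW USU qwQqu AQqGAE EACEUu'' [''0017017606111117007601016611111606617607006111066'', ''0017017506112117007601016611112606617607006121066'', ''0017017306114117007601016611114606617607006141066'', ''0017017506111117007601016621211606617607006121066'', ''0017017306111117007601016641411606617607006141066'', ''0017017605112117007601016611112605617607006121056'', ''0017017605111117007601026611211605617607006111066'', ''0017017606112117007601026611111605617607005111066'', ''0017017505112117007601026611212605617607006121066'', ''0017017305114117007601026611214605617607006141066'', ''0017017605111117007601016621211605617607006121056'', ''0017017606112117007601016621111605617607005121056'', ''0017017506112117007601026621211605617607005121066'', ''0017017306112117007601026641411605617607005141066''],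
    Task ''0013013202111113003201022201111202213203002101032'' ''kMOqVp'' ''Q Gw PPW }M iIimo Yi FV@Fv rpvBRr __o ;K;[? B@BRrF ][]mY} SW yIYy}? uqs AqQG UQSUu EUuAE CACSsEG'' [''0017017505111117007602036601212606617607006101076'', ''0017017605111117007601036601211605617607006101076''],
    Task ''0013013212011112013202021111121102211223001201122'' ''PJyiN^'' ''VN pHP w ; o M C U B G E F Q I k A S Z _ } [ r s q O ] u'' [],
    Task ''0013013212020112012302110103121111211221201112220'' ''p^yNnj'' ''M }~z} m} Jz F@v PHhP ZXZ O? KJ; S[ B@r IJyKN QIR o? ]Z^ iIiyYj kjK[k;n urvsMm URMmS] _Y] VPNV^n CSs wquO_ow WO_oQUW GWw EUuBCEFG AAQqBCEFG'' [''0017017526030116016706110107251141611661601125660'', ''0017017626030116016706110107151141611661601115650''],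
    Task ''0013112202111113002211012121032103011122023110202'' '']CO;zr'' ''U} km BE NJ jm pr SU sK ^[ qI F@ xH Pp Ww Vv y? hX AG ~N i YY o_ nn QW'' [''0017116606111117006611016161076107011166067110606'', ''0017116605211117006611016161076107011165067110506'', ''0017116603411117006611016161076107011163067110306''],
    Task ''0013112202111113002212011112122110212111211112220'' ''kOMjhp'' ''m }M ;K [ _ ][] Y] zJZ i yIY oO_ Bj Em Um GB CE AE WGo SCk QiU q n ~ r V F s N w P x ^'' [],
    Task ''0013112202111113002212011112213110103011221112220'' ''O~zG_}'' ''x WR PP B@ wv p rpr hx MHM ] s S o ; ^ k [ Y j m Q C q i n A E y'' [],
    Task ''0013112211011212112202011112111202212312001201221'' ''^xNiPJ'' ''I M nN Q qI R jJ U BR hP rJj AQi FVn EAF p@ OH G@ ohW CF ?O wOG kn up }M ]m yq [^ ZB ;z SR _W sw'' [''0017446322014616223503044416411306326713002604554'', ''0017116524012616426606042416412603516713004602334'', ''0017226624012616425503042416211603646713004602664'', ''0017446324012616423305042416114603326713004602554''],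
    Task ''0013112211011212112202011112112202112212011201221'' ''xw_y}U'' ''? [ ^_ o ]_ hx pX ~x nh^ G ;? ko s[; C;k ups]w F~ E@CG M} O? AGE r j Z V R B Q S N J q I i P'' [],
    Task ''0013112211011212112202011112113202012112021201221'' ''MS]hx~'' ''? px [ ^ u] _X ; s; k[ C; wps G? o_w F~ E@C j V N R I r Q q n Z J O A y P B i'' [],
    Task ''0013112212001212013202011112122112011122021211121'' ''kZJxWr'' ''N IJ q QI ^YZ nj ] m um [Z] MM VN^ yQ _Y OI ~N^ B U C h ? s P w S E ; F o p A G'' [],
    Task ''0023111021101331003200112013131002230213001112220'' ''JK^uoG'' ''SK VV x@ rR ho qr Y[ EG }? QI _] pX s[ w Pp Uu WWw OM'' [''0067111061101771007600116017171006670617001116660'', ''0057111061101771007600116017172006670617001216650'', ''0037111061101771007600116017174006670617001416630''],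
    Task ''0023111110112222102111002122213101112112021211220'' ''rCEAPz'' ''R B VR WR x pP ~x FV wp GW ; sSCs; _ ^X[ NF OG y~ qQ II n ] J u } i k j h M o Y'' [],
    Task ''0023111111111222002211012112121102231302000202221'' ''SNAYiy'' ''I nn qv MN EF OI }~ oG ?? s U C u w p j x P Q z r h ; k ] _ J B'' [],
    Task ''0023111111111222002211012112212102122202010202221'' '']hjMn~'' ''_^ k[ xX ;[ } Y] N^ ? o_ wo? O_ IN io y? qI pHh E V Q A C P J S s F z u U r B'' [],
    Task ''0102113111112121212103010103123102002022121112220'' ''SB~rJM'' ''I ZR[ w? yzy} u} kKsk qy ECE AEB QRU vu~ h@ H@HPxM nv ppxuqr XPh ihqAm ][Um O?I GAF jBjrkJ NHIJMFNv~ YXQiZ] _Y ^XYZ]^Vn oinGO_ow WQVGOW_ow'' [''0106117121113161616107010107167106005066464146660'', ''0106117121413161616107010107167106005036464116360''],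
    Task ''0102113201112112212102110103112201212112201112220'' ''SyMJNp'' ''q }} jz hx HxHp K; k;K XH up O? CKks B rrsJ ZJ n~hj Fv VvN ^Nn o? ihyjkn QPRSV UPRSV A@IiqBCF YIiXQZ[^ GA wquw _YOo WQOWowUG_ E@ABCuFGEM]m ]XYZ[EMU]m^_'' [''0106117601116116616106110107116601616116601116660'', ''0106117602216116616106110107115501616116601115650'', ''0106117604416116616106110107113301616116601113630'', ''0106117501115116616106110107216602616116602126660'', ''0106117502215116616106110107215502616116602125650'', ''0106117504415116616106110107213302616116602123630''],
    Task ''0102113202111112112202100113022210221211201112220'' ''HNJKy}'' ''R jz k; Q URS ] n O p Y h G m i V q B _ o Z X s F C M A w r ^ W'' [],
    Task ''0102113202111112112202100113122110211221201112220'' ''}njikh'' ''m yy K; Hx ph Ck sk N~ qs ^ Fnv X Z B J Y R w r U A E W M o O ] V G Q _'' [],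
    Task ''0102113202111112112202100113222010201231201112220'' ''}kiUhn'' ''m yy N~ K; qv sk Ck ps Hxh O E Z J Q V X Y j M w B G A r _ W o R'' [],
    Task ''0102113202112012112112100122123100211122201112211'' ''h;i}WV'' ''? k; Xx ]} o Mm Hh Em KM z? Ck QU sS pP _] Y[ nk qQs AE rq F@ NH JI ji RV Zz GE wu BZF ^N Ow'' [''0406127603216045443113400436157400641153601416622''],
    Task ''0102113212011111122202021111111202213202011102221'' ''~]hBHy'' ''M IH ? } n~ q iy O AI oi w? GOo FNn EAFG p@ QA JI ji RJ UM CE uE Vn X@ [X sp _G ko ;x ZY SK rv'' [''0103117345044111253605034222421603617603012105652'', ''0103127346041112233505054242421606547305011105352'', ''0103147343042114263305064212421605327506014105552''],
    Task ''0102113212011111122202021111112202113102021102221'' ''XO~VjE'' ''R n UV J MN IJ }M~ HM FN hHn BJF r QR AB iIj C@ o w u ? _ Z s S ; [ k q G p ] y'' [],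
    Task ''0102113212011111122202021111121102212212011102221'' ''OQHMNs'' ''I p hH V UP u RU qp iQ J AI rq jR BJr EM F@AB yI wq }Mu oiW ? ^ [ ~ n C ] S G Z _ ; k X'' []]"

definition tasks1 :: "task list" where
  "tasks1 = [
    Task ''0102122101220222201202100122022210221211111112220'' ''pBQMk}'' ''W m UU y} iQ ] jm om Yi _]Y A GAE CAE OGW XY_ ^ V H n s r ~ ; v N F J w h x K'' [],
    Task ''0102122111111221212103010121032101220222010202221'' ''uswFHJ'' ''I A@ OG BJ yI rB QI qA UE ]u }u SC VF ks ~N _W oW iQ ?} no pv ^v ;? Z] X^ hn jR x~ Y_'' [''0106263121141651615107040164073101360366020606564''],
    Task ''0102122201111212212102001131122101211222011211211'' ''kUMhuw'' '';s WS C ps O HK xH qp VP QPU ok ?W }U ruw JR GwO jRr yQ ~x? BJz _ [ F E ] X Z N ^ Y A n i'' [],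
    Task ''0102122201111212212102011130122101211122021211211'' ''SrJBU}'' ''[ kS C EC x; H MK jk NJ uM ps qru OM wu ~ yz ?} G? A o n X F Z _ W Q V Y h ] ^ i'' [],
    Task ''0102122201111212212102110121122101210132111211211'' ''K_S]hF'' ''? x XX H YX MH OH ~ nN^ v }~ EM] GF onO_ ; w? y?x} px u}v C@ A@EG sp; k;[ qys JK UM WO BG iAY jo ZJ Vn rR QI'' [''0205156501114625626103110154466102310175424641542''],
    Task ''0102122201120212211202100122122110211221111112220'' '';pxWQi'' ''v y UQ m M }U A Yy wp sqs rq Eu} ]u} Cs GAE BAEr Xp h H@Px _wX ~x O? oGW NH JO ^X nh KK VR FC jB ZJ ko'' [''0106266601160313644606100266463140321662224413550''],
    Task ''0102122202111112112110102131123101111122023110211'' ''KQAuMO'' ''EE Y[ kC ][ FE H p@ h@ qps ^ XX] iY BA ZY rq J RBZ VRU w x j y N } o ; z ? n W ~'' [],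
    Task ''0102122202111112112111002221123101111122022210121'' ''XW}O;^'' ''C s[ VS N HK uU MM kK EM ][] p wsu Y] hXH qup ? ok GCO_w xp ~; y}? R n z Q A Z J r j i B F'' [],
    Task ''0102122202111112112111012121123101111122022200221'' ''X]SwVQ'' ''HP pP OW R N ^V YQ hX MH uU E]M xH }M G o_ ?O y? A Z ; r ~ n s q z C j J k i F B'' [],
    Task ''0102122202111112112112011130123101111122021201212'' ''_J]XSr'' ''[ RS V QR k C[ M HK uU ps qQ hp jk NHV BJr Z o w x n Y O } ^ A E ~ F y i G z'' [],
    Task ''0102122202111112112112100122123101120123100212112'' ''JszVup'' ''R W rR vV ^v QR Fv K ;S HN x~ C BF OK ZJ X^H _O YXZ[ } k j h q o ] y E w A i M'' [],
    Task ''0102122202111112112112100131123101111122111112202'' '';}xWQq'' ''R KS V yQ k C; pP usU HP hp ik ok Xhx MK Eu AC GC@ B _ Y N z v ] ^ ~ n F O J r j Z'' [],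
    Task ''0102122202111112112112110121123101110132111201212'' ''wpV]SQ'' ''v RV Z rR JR H XP q YQ s KS hX MH uUp E]u xp OH _W A yIYq G z C B n } ~ k j o F i ;'' [],
    Task ''0102122211011211222102011121132001211122021112220'' ''BNO}UZ'' ''I W u VU JM ~}N HJ FN EME x}H GEO y Q qIQ AIAy iQy j o X C w S h _ ; n p ^ k r s ['' [],
    Task ''0102122301021102221111111022222011111122021112220'' ''XUJS;s'' ''[ C _ ^[ F GC ~F^ wG_ Z[ W_ V^S K x H z M p } O r j Q u E q o N h i y m n'' [],
    Task ''0112013010222131202102110013122112011122021112220'' ''rFsn~y'' ''qy CC p@ Hx VR Pp SS U u N O M W ^ ] G o m E J K i X I w j Y _'' [],
    Task ''0112013110122121212102110013122112011122021112220'' ''psur~y'' ''qy Hx K; Cs Pp Jz Ss VS Z BRr o m j U ^ F I E w G W X i _ O Y n A ] M N'' [],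
    Task ''0112013110123021212012110013122112011122021112220'' ''Pz~sYi'' ''I px Xp Cs AAYq m U _ E S n K ] ^ j w V Z G N H O u M W J B F o'' [],
    Task ''0112013200131112211202100113121122011320021112220'' ''PUYk~o'' ''s; CS yiy K; N~ MK} w? qyq u}s O?I psx HxK XHhp AIqQ GA ^nXY[FNv _Y^Oow EUC rpzu ZX ][]uMm_ JHzM FACFN^v@EVG jhjmJRZr B@BJRZrE WQVGOW_ow'' [''0116017600171116611606100117161166011760061116660'', ''0216027600171115611506200127151165011760061116660''],
    Task ''0112013202111112013202100131123100211023201122102'' ''QNHiy;'' ''PP FV pv qv rp AqQ B M _ E C k K X ] J ^ W Y o } G Z O'' [],
    Task ''0112013210022111222102110013122112011122021112220'' ''~purqK'' ''I w? yy s; M} iq nk mm A X O N _ o E j P C V B F ] J ^ Z S G H U W'' [],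
    Task ''0112013211021111122202120012121112111222011102221'' ''X;sKZj'' ''? y ~; p Hx P ^X qp rp S C[s N~ Jz IHK R BZr QPS n O A _ } G F V o ] u w E i U M m'' [],
    Task ''0112013212011111023202021111111202213203001102122'' ''VZk;XH'' ''PX FV^ y G ] O U I E A C [ p Q i o S } s u w _ J M q B r'' [],
    Task ''0112022010221231202102110022122111111122021112220'' ''r}~FCY'' ''jz EB VR ^ nF GF ; sC x;~ X@ _[ ]Z^ mjE on w_? y K p J S P q N U W O I i u M H'' [],
    Task ''0112022011220231102200201113122111121212012012130'' ''yGFsru'' ''~F p@ x? Hx Pp R WW VP QP JR NV~ Xp KHS; k i I Y n j m E o _ ^ ] M [ U }'' [],
    Task ''0112022100221222202101200212122111120220121112220'' ''P~Vjik'' ''B rR UR v F WV p wv xP GF oW ^n ;~ mk }z ]m Mm urU EU} Jj HJh qpu OMNOw X Y s C K A y _'' [],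
    Task ''0112022101220222102201101113122111121211111112220'' ''AEWxp^'' ''~x yy Hx Q P RPQ VP J r BRz FB G@ jB UR iQA }yz o C Y s n ] N K O v _ X u k [ m M w'' []]"

definition tasks2 :: "task list" where
  "tasks2 = [
    Task ''0112022110121221212102110022122111111122021112220'' ''KiUox~'' ''m H p yx X ;x s; nhk C; I qi wps Oo NHKn Y AIqy MI uq }ym G? _?Ow EA ]} ^Y] ru Z] Pp Ss JM jr WSU F~ VN B@'' [''0116056140264531646106110056166224442133062146650''],
    Task ''0112022201120212112202110022122111111221111102311'' ''OHKinj'' ''Q mi u Um S sk p Ph R VP CS XP vn rps Jj BRr ZRr ? F ] ^ A N x } _ G ; y Y E w M ~'' [],
    Task ''0112022202111112013110102131122111111122023120111'' ''BKAiq~'' ''JB Y[ r FB pr P@ EA kC QA uqs VR UQS mkE MEU ][ nim ; X ? H o y x O z N ^ } Z w W'' [],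
    Task ''0112022202111112013111012121122111111122022210121'' ''CxBpNn'' ''? O HH J PH rJ zJ i ohj m wo qpr ~n yxiz } G? W?Ow MO uwm AI QIqy EG FAB UME YA VRU ^F X@ sv ZB ;~ ks; SK ]_'' [''0215066503244415027111016464133244111166056640132''],
    Task ''0112022202111112013112011130122111111122021211112'' ''}uMkSC'' ''m [k U PS H JK B EC NM pH rsJ qru OM zJ x; A F G@BE ^ ] y X W w Y Z _ ~ o Q n i V'' [],
    Task ''0112022202120112012212001113122111112210211112310'' ''^UMk_X'' ''m [k ] s[ jm C[ im P VS Hh Nn Y Qi pP ZX JjH rp BJRZ u A G W z x ~ } E w F y O'' [],
    Task ''0112022210021211222102110022122111111122021112220'' ''AZ;wNi'' ''I M H qI O yI m o nio uq }m pq ~n xyhx Xx _? ]Y} ^YX E}] sp B r F U W S K j J P G V C'' [],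
    Task ''0112022211020211122202110022122111111222011102221'' ''^KyPjM'' ''R Q I O i JI mij oi UQ }m ?yo AQ xy HIh XH G BA C@ EA ]EM _GO_ ZXJ F u n N s ; p w ~ V S r'' [],
    Task ''0112022211020211122202120021122111111122021102221'' ''SnHQV~'' ''R s KS C PS XP pP rps ^ ZX[ BZr JR F A@BC NV IHJK UV jR iQhjk } O x u _ E w y m o M ] ? ; G'' [],
    Task ''0112022212011111023112021111122111111122021201131'' ''Hi;uVs'' ''[ o m k nk } ]m Mm _ ?_o Oo y? IiO qiw GO X_ pwp Eu NM AI Z U Q r J S F P C B ~ z x ^'' [],
    Task ''0112022212011111023112021111122111112112021102131'' ''iFuokS'' ''I ? O m _o yi ; }? MO ]m [k_ nm qi skw ^ Nn pv Gw ~n x?~ X_X^ E]u} CC; z; V~ PxS B A Z U J Q H r'' [],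
    Task ''0112022301020202122202110022122111101231112101311'' ''CZ_~yi'' ''? X@ GG_ j ] R p Q J n K x O w V u M } ; P E N S s v H m r U'' []]"

definition tasks3 :: "task list" where
  "tasks3 = [
    Task ''0112112010222131201112001113122102112212011112220'' ''PCHxFE'' ''[ s kC h nk V USV pPs G@ usU WP z rR jBR N O Y i y ^ J o M w X ~ I _ q } ]'' [],
    Task ''0112112101212122102111101122223001102122112012211'' ''HrPEo;'' ''R J B Q VR NJ u MMU jJ ABE qQ iI h njm }m zj WRU K ^ X [ ? p G s k y ~ x v w C Y _'' [],
    Task ''0112112102212022002121002122222001202222102111211'' ''C^VzUi'' '';~ n }~ ?} x; E} k; GC BEF jzB vVn X s[ hxk Px@ Nn AF QVAQ Y u O o p w H r _ J M q W'' [],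
    Task ''0112112110112221212102001113122102112212011112220'' ''xPNHC]'' ''[ X k[ s MK E FC ~ }; y}~ n~ hkx px ^[ i ohn Z Y u J V G W j B r q w _ U I O A'' [],
    Task ''0112112200113112212012001113123101112112111112220'' ''PAC}xF'' ''yy iy WQ zR BR O MI HI EMU j JJz GB YA ZB ]E X [YZ k[; w V ^ ~ v N _ s o u n h p'' [],
    Task ''0112112200113112212012100122123101112112111013211'' ''Yy}WVP'' ''? AQ BR zR x pP GW o? wW EG uU vwu iAqy jr hpo s F K ] n Z X C k ; ^ ~ H J M N'' [],
    Task ''0112112202101212013202001212111222013300021112121'' ''hXBHF~'' ''x~ PR WV Em pv GF QP A@Q [ u ] ? y M Y o k U Z _ C w O ; s J r q'' [],
    Task ''0112112202111112012210102311111202213302003011022'' ''WK;nwF'' ''MN _[O_? Z_ HN EF ]M^ QS JO Y[ UMV uv y; joJ BJGE PVRU hnHPm imhIQYjk AIQE@AiBC xP~ qAi sCksw p@hvq }U~y]u} zyRz}?xZr rqBjruwp XHXpxYZ]^'' [''0116116606111116016610106711111606617706007011066'', ''0225115606111116016610106711122506517706007011066''],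
    Task ''0112112202111112012211002122222001202222102111211'' ''CVUZ;y'' ''v nV N QV ^ Y^ E AF BF iA GA kCn }E~ MEN z~ ?y} xy;} jn P WQSU rR _ O? JNJ HK XZ pX w_ u] sv qv hm o?'' [''0143245603121125013641006436656002505655203142344''],
    Task ''0112112202111112012211012211111202213302002101122'' ''OPXxFn'' ''G hn UV }~ MN HNHO oO pv ]^ QPW SPU _W_ uv EUFM JHM y? ;?x} ZX] YX]_ CKS[ kKS[; B@RCE jRhJZkm A@EIQYG zxJZz;}yB rBj wGo sCkspruw qpruwAiq ihAIQYiqyjmo'' [''0116116606111116016611016611111606617706006101166'', ''0116116606111126015512016511111606617706006101156'', ''0116116606111146013314016311111606617706006101136'', ''0116116506122116016611016621111606617706005101266'', ''0116116506122126015512016521111606617706005101256'', ''0116116506122146013314016321111606617706005101236''],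
    Task ''0112112202111112012211111202022211122201112002131'' ''pPHG}_'' ''? o ;? CG S UW K MO k [K QS JK mo ]MU X_ Y[] Z[] v N r u x n h q F j V B i A z y ~'' [],
    Task ''0112112202111112012212001113032110221211201112220'' ''JBU}ks'' ''WU OM mU z} y o? HJ xz C; GO NK Px pH VS FN A@ ]m wO ru ^v n~ X@ ZB [^ QW jm iy YAZ qQ hn _w'' [''0115145505212116026323002117076140654514602125650''],
    Task ''0112112202111112012212001113123110112111211112220'' ''VN~sCE'' ''[ PS k FC Q WV }; MUK x; y} AQ qQ zy~ HP OM GW wW? J n Y _ h o i m X p ^ B ] r Z j'' [],
    Task ''0112112202111112012212001122133000211122201112211'' ''}O_wGW'' ''? EE PU HM VW pu NO JO FN q rvw y Q B X Z h k Y [ ; C z s x ^ i A o n j'' [],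
    Task ''0112112202111112012212100023113220013100221013310'' ''KyQihF'' ''Em Mm PU CkS j s ~ J X Y x H G V z A q W B Z ] p r w'' [],
    Task ''0112112202112012012122001122133000211122201112211'' ''HpXE}W'' ''[ _] C ;[ PUS Q h ? j V F z s Z N q n Y x i G o B r w J ^ O A k'' [],
    Task ''0112112211011211122202011112111202213302001102221'' '']UHFn}'' ''[ x~ X^ EF _] ; ?} o G_? M s h Z I k p C r O A q J w i u P R Q y j S B'' [],
    Task ''0112112211011211122202011112112202113202011102221'' ''~;QHOo'' ''? G I MO E }M n~ FFN x~ w y? AG iIy qyA hHino px uqvw _? Xx swp r ] U k P B S C Z J j [ R V'' [],
    Task ''0112112211011211122202011112113202013102021102221'' ''V~MOxX'' ''F ?~ I H EM nN GFO w y? i AI qyA oOG hno uEm Q [ J C j r B S s R P ] k _ p ; Z'' [],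
    Task ''0112112211011211122202011112121102212312001102221'' ''NyAiJS'' ''I ? x }y F n~ hn Hx MN q OI oi G? wOo pH uqvw PH QI jih BAz C E R [ _ X ] ; U Z k s ^ r'' [],
    Task ''0112112211011211122202011112122102112212011102221'' ''wGyo;Z'' ''? ~ x O }? H I NO MO i qy AyI F nN~ hio pHx uqw EM} k B s J r Q j X ^ R ] _ V S P [ U C'' [],
    Task ''0112112212002111023112001113123111012111121112220'' ''xPEHC^'' ''[ X s[ VS uU ]] m] k[ FCE w I y G h B z _ r O N n J ~ M o v p Q q A Z W'' [],
    Task ''0112112301011202122201012112122102112212012101221'' ''uhMJS;'' ''R jJ N rJ qr Q iIq nij V UQR ZR kj srS G P C X } H ? O ] o p ~ _ ^ y w F x E'' [],
    Task ''0112112302002102023111111202022211122201112002131'' ''qnZrFG'' ''J vr QqI y S _ k h M V ? m u N X C o } z K ~ ] P H p U x ; ['' [],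
    Task ''0122012101221122002210102212121112122202012022021'' ''K_kXVs'' ''m M NK i nk jn JjN rjJ w Wo ?Ww G_ HO pw PHW qp u y Q ; B F A z } E ] x ~ Y U'' [],
    Task ''0122012210021211122202120012122112011122021102221'' ''SjPApx'' ''R X VP s CS Z ^X[ B rRZ ]Z ur UR m] EU] ME qu iQ Iq Hp NI JrJ ~ y O w F _ o G ? K ; n'' [],
    Task ''0122111021101330013200112013121102231203001112220'' ''ZrNoEH'' ''] sr VRV^v QV }m}? KJK hm@hx YY^I[ xhx} SRS[Qs G@EGo? qIQqsv u MM OM _O XHX]_ PX U]U WU_PW wOWpuw pHPpuw'' [''0166111061101770017600116017161106671607001116660'', ''0165121061101770017600116017162106671607001126660'', ''0163141061101770017600116017164106671607001146660'', ''0166121061101770017600116017152106671607001116650'', ''0166141061101770017600116017134106671607001116630'', ''0155111061101770017600116017162206671607001226660'', ''0156111061101770017600116017152206671607001216650'', ''0166111061101770017600116017151206671607001215660'', ''0165121061101770017600116017152206671607001225660'', ''0163141061101770017600116017154206671607001245660'', ''0156111061101770017600116017161205671607001126660'', ''0156121061101770017600116017152205671607001126650'', ''0166121061101770017600116017151205671607001125660'', ''0156141061101770017600116017134205671607001126630'']]"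

definition tasks4 :: "task list" where
  "tasks4 = [
    Task ''0122111021111230012210112112131002231202011013220'' ''ZNKGXE'' ''zB W_ jB rJ h@ oGo njF U] sK VR^ ~FVn QV }Ezm~ worOW? x@?} kjC HOHM y~A YY^XI[ ;zC; qIqyv pHxuw urMmu}vwpsU SRS[s;PQk iAQiqyknh PPXhpxUW'' [''0166111061111670016610116116171006671606011017660'', ''0166111061121570015620116215171006671605021017660''],
    Task ''0122111110112221112111002122223001111122021211220'' ''rBkW}y'' ''R P VR p xP C ;; sS ~;V u EU} wsuW _ X[ ^[] M j J I z i h O o Z G N q n H F Y A'' [],
    Task ''0122111111111221012211012112121102231302000202221'' '']}UnNA'' ''MN Y^ EF QV CE SU PU kS Z X[] o O J p H B y h ; u I ? _ i x r s j z q w'' [],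
    Task ''0122111111111221012211012112131002230312000202221'' ''Eo^nUJ'' ''HM PU BE IHJ X S Q x } i y Z ; q _ ? s r j C p Y w h z O k A u'' [],
    Task ''0122111111111221012211012112212102122202010202221'' ''ZoUPAF'' ''? V nV N QV BF EF u MEU w OGOW IO qw iAQo J HIMN ~N yI }M? rv pvqu xH hH jnh kj ]m su SU zz} Yq _] CB ;[ XP'' [''0166121141241662016624046123626106265605040605662''],
    Task ''0132002110123021012120112022221012111122022121210'' ''WwoxAY'' ''I H@ ih KI XY sp ;x G@ SP mi }y rs UQ OH VS jo NK no ~n Mm ^v z; ZR u} Bz F~ EG JN _W'' [''0175006120167061016160146033364043224155066161610''],
    Task ''0132011110121221012210112013120112231302001112220'' ''SXn]Yy'' ''i N^n~ WQW ZR[ xPx mn HxX uv A@F MmN EFE] K[C; qv BC }U}~y zR; OM omhiG? G@EG?A IAIiyMNHY pHh _XY]W_ wpquOo JOBZzK rJw jBJZjzork spqrKksuw'' [''0176041120151661016610116047130146671706001116660'', ''0176041120151664013610116017130146671706001116630''],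
    Task ''0201113202111111122201111202112202122201111102221'' ''pN~}UZ'' ''v ? n y~ H hx MH u} qp F wv ON o? GwO ihno Eu A@FG ru Vv BFE R X C J _ [ Q j S Y K k ] ;'' [],
    Task ''0201113202111111122201121102111202222202101102221'' ''NHJYyo'' ''? O }? ;y _? X hx ]X} [X_ M} E] iy AY K r C u q F G Q j v n S U R B Z k w p V'' [],
    Task ''0211013202111111023201121201111202222202101102122'' ''yNiHJZ'' ''v nn ph PH rj qpr V uv FvN QPV MN ;z SR kj UV Br ]m EU KJ AqB GA [; Cs YI OK X^ ok wWo _o }u'' [''0611027606414111067502264501441303366305201105166''],
    Task ''0211013212011110033202021111121102212213001102122'' ''BiNyHX'' ''FN rBJ E q V k I p C o P G s u A } S [ O Q ] U ^ M w ; _'' [],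
    Task ''0211013212021010032212130110121112111122021102122'' ''Xpz~qM'' ''s ^X C[ Ks Hp IH NHK w m Q u E k n r o P } U i ] j V _ A B O G F'' [],
    Task ''0211112201111211122200211202112202131201111102221'' ''Gy~}_S'' ''? v n N~ E AF ME ON oG w x? u} qvw pwu iAqyn HO h@px ;? ko Xxh R Q Y P V Z K r U ] [ j B J'' [],
    Task ''0211112201111211122200221102111202231202101102221'' ''En}]ij'' ''v Nn q uv Vn rv A BF JBN RBr hj MN HJ Q U w G _ [ Y O K y X o ; p x P Z S ? k'' [],
    Task ''0211112201111211122201111202112202122201111102221'' ''Oxw;]U'' ''? ~ y _ G? } o? M E} u} N KO HOM F v~ n~N AFG CGE qw pwv J r i Z j S [ B R P h k Q V Y X'' []]"

definition tasks5 :: "task list" where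
  "tasks5 = [
    Task ''0211112201111211122201121102111202222202101102221'' ''uVqpC_'' ''v r N Fv nv E BF AF R Jr jrB hn inj Qq UV PVQR HPp Z K y G S x M o ] } k [ X Y w ; O ?'' [],
    Task ''0211112201111211122201220102012301231102201102221'' ''NYAMyJ'' ''? }} _] XY G O_G x o? ;?y CG k; K;C iy hk Hx SK Z[ pH qI QY wO RZ BC uw V^ jk U] ru PW nV'' [''0611416601141621456301630103016701571403602405362''],
    Task ''0211112201111211122202011202112202113201111102221'' ''~G}_OJ'' ''? v n~ F x~ EF HO MMN oO w y? u} pvw qwu hHpxn AG iIqy ;? ko Yyi Z Q P X ] U r C S j B R [ V'' [],
    Task ''0211112201111211122202021102111202213202101102221'' '']n}Mhj'' ''v F Vn u pv rv H JN BJF RJr ij EF AB _ [ X P Z w ? C O k U q S o Q y G ; x Y'' [],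
    Task ''0211112201111211122202120102102301213102201102221'' ''FHxEXB'' ''? }} OM KH _ GO_ o ;? y?x CK; k; hx ik Ay SC JK jk Y_ p@ QA UM RJ wG rB uE VN nF qi PR Z^'' [''0611416601141612456306130103106701517403604205362''],
    Task ''0211112301012101132111220102212103021112110103212'' ''o]jiEp'' ''^ X]X w_ qY v Ow yq? k S M V ; J F C N x R U P K Q ~ z n H h r'' [],
    Task ''0221012301022001032121230002111222021012121112121'' ''G;ozQq'' ''? CC _[ x; W? X@ PPx r M v U N F H n p J ] j E ~ K i ^ w O u'' [],
    Task ''0221012301031001031221230011210122101232012101122'' ''QzjE]n'' ''P um qiq VQUVn rqRj GB x@ wrW ojohG MU phP }mzEu CEC suSk ~yzFn~x}v? X@Xp[] KSs NVvI ;xCks;} HPpKM _XZ[]^G_?w JIRrHJN OHJKMNOWw'' [''0651046701071001071661370011640166101676016401166''],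
    Task ''0221111010212230112110221120111202211122023110211'' ''Ejonik'' ''I FF qA yi wG ? Oo ~ }y? Y U x R X z ] Z V M K s [ ^ r H N p P W u h S'' [],
    Task ''0221111010212230112110221210111202211122023110121'' ''jiEFws'' ''I qA oG nF yi ? Oo N MOI R ] ~ X r H k x z S u V h Y W ^ Z K p U P } ['' [],
    Task ''0221111010212230112111111130111202211122022220201'' ''rZUGyo'' ''R E ?G P WW z j VR ur }U x? ~z} SR kj CBCS K; [S FB hko M} nj im p@ Hx ]m IK qAQi ^V N~ YQ ON X_'' [''0564214020346670213122114270221606612135036660604'', ''0661214020615670213111414170211506611165036650604'', ''0362214020523670213144214470241306614155036630604'', ''0534114040345670213112114170421506611165056650602''],
    Task ''0221111010212230112111111220111202211122022220111'' ''G}Sr~O'' ''? R z jz E FB uE wr oG x W? U} VRW PWU njFV~ ho p@Px io y? M}m ] k K N q C X [ Z H I s Y ^'' [],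
    Task ''0221111010212230112111111310111202211122022220021'' ''jiOGFC'' ''I w ?G N HO M q yI ni ~N x? }y~ hno Wo Vn z~? P p r K [ Y ] U R X Z s u E ^ S'' [],
    Task ''0221111010212230112111210121111202210132112220201'' ''KGVZ]X'' ''F^ n^ ? E oG v ~F jZn hn W_o RZ U]VW PVW I s M x y C z q } O S H k ; u r i Y p'' [],
    Task ''0221111010212230112111220210111202201133013110022'' ''Ej~Oi]'' ''ZZ CBE p K V H X r M k s P u U Y q z R N I } y x S w W h'' [],
    Task ''0221111011211230012210211121312001210132111211211'' ''Gz}O_~'' ''? x@ v FF uE V~ rB n~ ZZ^ U]} WV jR MJMN QU wv X^ IM y} kj [Z iI ;z hn sC PV KJ YI SW o? Hhx qu pw'' [''0354421022542670045510324451723002640175411621312'', ''0334221044322670023510542251745002640276411641512''],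
    Task ''0221111011211230012210211310111202230212011211022'' ''zGEMns'' ''[ jB Vn rj SSks w q Y p y I U u ] O H _ W ~ K ^ Z X P h i x } Q'' [],
    Task ''0221111011211230012211210121313000210032210212211'' ''Fr}qw_'' ''?} CGC p@v ZBZ Mu zZr YA] y} X@^ om IYM ~^v im SR KI[ OIMOJ_ QYQqyU WQRUW_Vw? PVS ;yS[?z jJz sqrCsw kijK;o x;PXp~ hxk nijkn~ohN HHPXhpxKN'' [''0661111041611370013611610161717000610073610516612'', ''0361114041611370013611610461717000610076610516612''],
    Task ''0221111110111320122200112112212102122102021112220'' ''~FSYqu'' ''I AA i EA x~ }y} ;y ]}Y n~ sq k;i N M KIK OKMN HIN r _ j U B X R W h w G Z p o V P'' [],
    Task ''0221111110111320122200221102111202231102111112220'' ''BUZY;~'' ''R S P jR EB [ kS }; WS ]U _[ XZ xz} hPXx G@E M] rz AE nj iYy u} IY v~ om pr O_ KC VU NF HI qi w?'' [''0661241220111760263600364106111506571206411116530'', ''0664224220111760263600364206111603671205412226330'', ''0662212220111760263600364406111305371203414446630''],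
    Task ''0221111110111320122200221201111202231101121112220'' ''A~;xEj'' ''I iA q Yy }y ]} u} vq n~ N wv MN KI ONM HIM kKs X r P o p B V h _ [ U R G W S Z'' [],
    Task ''0221111110111320122201111103111202222202101112220'' ''xEAFCB'' ''R }} jz rB n~ v VF p urv S ] H w P h X Y U i q O W [ M o K Z k N I G _'' [],
    Task ''0221111110111320122201111202111202222201111112220'' ''~rqFuk'' ''v I iq p Aq EA x~ }y} n~ w Nv Mu HI ONM hHpx Vv Uu PpQ jn ]m ; Y B W G [ S Z X _ C R o K'' [],
    Task ''0221111110111320122201111301111202222200121112220'' ''~Hj]iN'' ''I v F ON x~ A M qI hi pH wv uqp }xy Eu} ohm [ _ Y S r X G ; C Z P K W R V U B'' [],
    Task ''0221111110111320122201220102011301331102201112220'' '';ZuNYC'' ''BB xz; o _ p U M V h q G K S X W r k w j A O P i H I n R'' [],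
    Task ''0221111110112220122110221012311012111122021112220'' ''AOiNKZ'' ''I s [ ;K F GC ~F y; qA H YI ^N S[ _[Y XY^ xy p@HX uq }y MIE] mM} nN oim W R V w B j h P U z r'' []]"

definition tasks6 :: "task list" where
  "tasks6 = [
    Task ''0221111110112220122111111013222012011122021112220'' ''yMYNHB'' ''I m u EM x ~} F~ AE qy i OI nN hm oin pHhx KI sq Ck; [Ks ^N X[] _ V w P r G R U W S z Z j'' [],
    Task ''0221111110112220122111111022222011111122021112220'' ''iKANOz'' ''I q M H YI yI o _ wO GO p uq sqw m ni hio xHh XHp }M EMm ; [ ~ S F W P U ^ R V Z C B j r'' [],
    Task ''0221111110112220122111200131213100210132111211211'' ''O~pEPC'' ''R VP r BR vr wv Fv WV }Uu j H ; ? _ A K q y k o G h x Z Y z ] X M n i I'' [],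
    Task ''0221111110112220122111220012211112121113010113121'' ''wFXMZj'' ''R ^ C S s[ BC rBZ VF^ PSV UR EB ]Z h p@PX mj im ;s urU] Y H I x o y ~ O W z } ? K N q A'' [],
    Task ''0221111110112220122111220120211101301132112111211'' ''~WiUBX'' ''R E ] CE Z] jBZ S kC[ PSU zR GB _Z x h@PX ? w? ojGW_ VW nFVo vV~ u I Y y H s A M r p K q N O'' [],
    Task ''0221111111111220022211012112121102231302000202221'' ''SNiQyA'' ''I nn EF UV YQ ]^ BA CA kC ZB XY[ s M o q x h u ; p ? H r O _ j } P z w'' [],
    Task ''0221111111111220022211012112212102122202010202221'' ''ZUoyAN'' ''I H O qI M iI ? wO no ~N }? FN EFG uMw pv ru Vv BFE hH P@V xHp z~x Y j s ] S k C _ X Q ;'' [],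
    Task ''0221111111111220022211111202202202122201110202221'' ''w;KXhU'' ''[ O IK _ ?O y ~? NO vN qw YI_ A HI FN CKG pH E@ iA oG ]_Y uwqE xXp B S V } P r n z k j Z Q'' [],
    Task ''0221111111111220022211121102202202122102110202221'' ''u~VBXK'' ''v j r P UR EU pru FBE nFV wv zr h ojn }um xp ?}~ C@ ]E ;}x SUP [ i q A H Q Y _ y O I N Z k'' []]"

definition tasks7 :: "task list" where
  "tasks7 = [
    Task ''0221111111111220022211121201111202231201110202221'' ''BwVZUQ'' ''v n NV E AF C jB ]E ME P SRU in Y IAQ X [Z] KCS q ~ k H r o O ? p y h ; z _ } u x'' [],
    Task ''0221111111111220022212021102111202222202100202221'' ''UB_CHN'' ''[ SC P kS EC j ZBR ] ;[ X[Z zZ ok hkj }] ?;? YX M]K O_ IM y} AE iIY r x V n Q p u F v w q'' [],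
    Task ''0221111200111311122201111202112202122201111102221'' ''xKqAhB'' ''v pq i uq ni } ~y ?x F~ w Nv on G? Owo EA}FG Hp MINO VF P@ rpv S R [ U Z J _ k ; ] C Y j X'' [],
    Task ''0221111200111311122201121102111202222202101102221'' ''Uin}G_'' ''? ; o? x? Y Ay Xx ]Y} [Y_ hx HX k; ph j r q R E O Z S w K v C B N P M V J F u'' [],
    Task ''0221111201101311023201121201111202222202101102122'' ''xAFhBX'' ''v nn }~ ;x Zz Yy QY r kj qi pqh V uv CB; Nv UV ]^ EF ME PV G@ SR JN _] ws Ks om HN OG [_'' [''0661141601202711057501134604441603366305201103166''],
    Task ''0221111210012210132111220012311022001131031112220'' ''XAnUBx'' ''yy _XY r R ; o W u s K z i I G C H M p N P S O V q j h w'' [],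
    Task ''0221111211011210032211230101111202230012210212211'' ''BnKHEo'' ''U jB PR MJ QU AE iA II k q ; ] p } O _ z C ~ W h ? ^ r u X y w x'' [],
    Task ''0221111211011210032212120102112203012112111102212'' '']zGKAp'' ''k C X[ E] ;C ME IM HMK h NH im qI _ U y Q x r ^ v B F j ~ S O w o n V P'' [],
    Task ''0221111211011210032212120201111202212210211102311'' ''Pj;^uM'' ''U BR hj Q I A iiQ Em VU qQ FA rRB p K k X z G C ~ S } ] x N ? _ H y w O'' [],
    Task ''0221111211011210032212130101120102311122201112211'' ''W;u]XA'' ''C _[ k[ E ^] FE n^ hm x} pX r Vv zR~ BZzF PRS jZn ?; GB? q I o N H O w i Q y M K'' [],
    Task ''0221111211011210032212130110121110311021221112220'' ''r~]sFq'' ''zz x Bz w pr Nv Px y~ Hxp ^v Xp _XZ^ jZ EB] I M Q C h m K n k G o i W U A O'' [],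
    Task ''0221111301002201033111121021122120111122022101131'' ''oz_Gyq'' ''? ho EmG x p n H [ M S P } ~ ^ V s U r ] Q K J C X N O F ;'' [],
    Task ''0221111301002201033111230020111220211121122101221'' ''KQEUr~'' ''v hm VR qQ sSs p Cs PSP HP Xp J G F } _ y ] ? w z x M O n N ^ o'' [],
    Task ''0221111301002201033111230200111202202121213001212'' ''kEoUnq'' ''P CCS _Go wow X@[ VWQV }? rRj h@k QQq JRIJr pPh ~?n ][E]m_ MU zjrZz~ yiqyzY KSKs;O ^YZF^n_X usU]muw}v HPKHpM xXhpx;} NHIJMNVv~O'' [''0651122701006601077111370600121606606161617001616''],
    Task ''0221111301002201033111230200111202211022212111112'' ''hC_zyq'' ''F WR GA QQ rB wqG kk ^Z X[ ~y ][ o_ n^ Jz EG P USVW MU HP NV }U x~ KN ON px um'' [''0561111701006601077111370600112605522063615411416'', ''0631144701006601077111570600141606624063615211416''],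
    Task ''0221111301011201032211230101012302121012212101212'' ''iUr^FG'' ''q QQ JR MU jR uqru zB }E wu _] CG ~z} ;[ X_ yq x pX h HPx PPx KS; k; ok O? NO nV'' [''0651442701012501076611370101016703464016616401616'', ''0531124701012501076611670201016703461015616101516''],
    Task ''0221111301011201032211230110022210220021222101221'' ''QU]CFG'' ''MU JR jR iQ mU KM kKm } s _ h O ^ r ~ H z ? x q y P n o X w p'' [],
    Task ''0221111301011201032211230110212110201031222101221'' ''QNKCEo'' ''m JR kC U PSU ][ MU HKM q x n ? h X i z s G y r _ j p } w ~ O'' [],
    Task ''1002113212011102122202021111111202212112021211220'' ''hM}Ukn'' ''@ X ph C E@ F@ ~ ;x [; s;pC ok up ws i j ^ J W G _ O Q Z y S R q I r A ] N V'' [],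
    Task ''1002122012220122101211101212111202222301011112220'' ''NKiQzG'' ''R J WR OW y IQ MI UQU ~V nNV u Y X k } B x s j F @ o [ E _ p h C w ] r ;'' [],
    Task ''1002122112120112111212100212111202221310110212310'' ''h^kUWO'' ''X @h C E@ xP Fn p@ vF sv ups wp ;sS ] BE ru }u RU z jRr Y Z _ ~ I J M A N y K Q i'' [],
    Task ''1002122113110112012211111103111202222202101112220'' ''VYUSXx'' ''n vV r uv ks [S ]U Z C[ ps Fv^ K[ N^ M IKN iIQ G @ w J z B o j W y _ A E O } h'' [],
    Task ''1002122113110112012212110112111202222202100113211'' ''AX]nUW'' ''@ hX E C@ Y IAY iAY M KI Z] ki BE J jZB v VV NN^ F^n um S[ ;S }U sS om rR ?W wW OG xx yi z? ph'' [''2006453147140216016516110126221606336306400417522''],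
    Task ''1002122212001202123102120210111202211122021211121'' ''kZr~qA'' ''R nj srk Jr Q SR VR IQ NI KJS } ] @ ? ^ w x O M y C _ u F p E h W U G X o'' [],
    Task ''1002122212010202122202120120111202211122021211211'' ''Q}jZsC'' ''R u rr ^ ]Z S k[s V URS ps X[ hP njk @hp Fv E@B J o ? A x K G y i M W O w _ I ~ N'' [],
    Task ''1002122212011102122112021111111202211122021310220'' ''oMhkuU'' ''I J NM i QI qI W wO RW VWQN }U nN ~V j A p ; Z F X [ @ r ^ x y C s S z ] G E'' [],
    Task ''1002122212011102122112021111111202212112021211220'' ''pNyiQZ'' ''I O M JI qI U }M uM V RQ WQU oO wOW rq jJ zJRr ~yz F h ] n S G X E ; s x _ A ^ [ @ k C'' [],
    Task ''1012112011211222102200201113122102121212012012220'' ''}EUnkK'' ''y; ~ s; [ ik qys Iy N~ MK YI F r W @ _ Q X J p u B ] w G ^ o x V P R j h'' [],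
    Task ''1012112011211222102201101113122102121212011112220'' ''xkEuNV'' ''@ } ~} h px C [C ss; FC G X@ nk~ ^F ][E _X]^ y~ K; M}K o B U w r O R Y q j P W i I Q J'' [],
    Task ''1012112011211222102202001113122102121212010212220'' ''CPphxy'' ''@ ~ }x k s; [s nk F~ EC X@ N ^ R j o q V Q M U u _ r I i J ] Y W B w O'' [],
    Task ''1012112011212122102111101122223001111122021112220'' ''CQOhMN'' ''I u }M W VU R wW qu yQ i JI rq zR jJr oO nijm Bj pr Emu PU xPz F ^ G ~ _ ; k Y @ [ s X K'' [],
    Task ''1012112111111212112203010112111202212312000202221'' ''N;AQO}'' ''k ?; o _? I MO nN wO sKk usM qw ^v ion ] J S E F B x Y Z j R @ h P X r U p y'' [],
    Task ''1012112112101212013203010112122112011122020212121'' '';o~BFN'' ''? w _? s; k mko nko hn E ]m SC p @@ xhx Xhx us} rBj JJ ABF OK VF y? US qr Zz QR IN ^X WV YQ PV MO'' [''2013115146401316047507020146135146011456060526162''],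
    Task ''1012112112112012012122001131212100302122111221210'' ''MkUzrp'' ''J IM Q iI qu NI vq Vv nNV OJ ~N~ ;K WVS jJ Yi on [k _ ][} w E C P A x B h ^ @ G Z X'' [],
    Task ''1012112212011102022212021111012302112112022200221'' ''UQZ^wF'' ''[ u] S s[ VU^ X^ C[ @C p@ PXS h ; y k ~ O i o q x I } z ? J G n A j r N M'' [],
    Task ''1012112212011102022212021111022202111122022200221'' ''ZQ~uUP'' ''[ ] ^] r jZ V SRU s kS[ JR MU NK nV^ IMN im qIY O F w C ; ? h p z x A X G } y @ o'' [],
    Task ''1022012010222122102111101122223001111122021112220'' ''Vqs~uE'' ''R WV } PU FV GEW @E x} pP B@ o [ z O ; K Y I C j r i J N _ k ^ M w y n X'' [],
    Task ''1111112122011110032212130110031102211122022002221'' ''UN_oup'' ''r VU jR wW zr }u ?} ~}? ] P x H h G Q A n i B q F K ^ s X y @ C k'' [],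
    Task ''1111112212012001032121230101111202212112112002221'' ''Mj]^Fx'' ''rZ I N JJ i qY QI UR VRQ nij PV AQ EAB uU vq X ; o ~ h H K G } @ ? _ C p w z k'' [],
    Task ''1121012121022010032122130101021212120121031201230'' ''z^OqFu'' ''X^ AY HI @A KN xH CCF ;xK _X[ GCG U V P Q r i B k } ] o n p M m j'' [],
    Task ''1121012121031010031221230110111202211122022101221'' ''}k^rqA'' ''s ][ nk ~; _^ on ?o wo? N V U G j O Q F H X E C x z @ P B p u M K'' [],
    Task ''1121012211021101032212130011021212111122022101221'' ''Vnq~sC'' ''PS K QS X ^[ ps @X HP A F@C NFV IQ JH ON yI GAF _ i x ? U z ; o w ] r M u } m j'' []]"

section \<open>Graphs of block matrices, their invariants and isomorphism tests\<close>

datatype z3 = D0 | D1 | D2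

type_synonym vx = "(idx \<times> z3) option"

fun dif :: "z3 \<Rightarrow> z3 \<Rightarrow> z3" where
  "dif D0 D0 = D0" | "dif D0 D1 = D2" | "dif D0 D2 = D1"
| "dif D1 D0 = D1" | "dif D1 D1 = D0" | "dif D1 D2 = D2"
| "dif D2 D0 = D2" | "dif D2 D1 = D1" | "dif D2 D2 = D0"

fun mem :: "z3 \<Rightarrow> blk \<Rightarrow> bool" where
  "mem D0 B0 = False" | "mem D0 B1 = True" | "mem D0 B2 = False" | "mem D0 B3 = True"
| "mem D0 B4 = False" | "mem D0 B5 = True" | "mem D0 B6 = False" | "mem D0 B7 = True"
| "mem D1 B0 = False" | "mem D1 B1 = False" | "mem D1 B2 = True" | "mem D1 B3 = True"
| "mem D1 B4 = False" | "mem D1 B5 = False" | "mem D1 B6 = True" | "mem D1 B7 = True"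
| "mem D2 B0 = False" | "mem D2 B1 = False" | "mem D2 B2 = False" | "mem D2 B3 = False"
| "mem D2 B4 = True" | "mem D2 B5 = True" | "mem D2 B6 = True" | "mem D2 B7 = True"

text \<open>The orbits with arcs to and from the fixed vertex, respectively.\<close>

fun ou :: "idx \<Rightarrow> bool" where
  "ou I0 = True" | "ou I1 = True" | "ou I2 = False" | "ou I3 = True" | "ou I4 = False" | "ou I5 = False" | "ou I6 = False"

fun iw :: "idx \<Rightarrow> bool" where
  "iw I0 = True" | "iw I1 = True" | "iw I2 = True" | "iw I3 = False" | "iw I4 = False" | "iw I5 = False" | "iw I6 = False"

fun adjm :: "blk row row \<Rightarrow> vx \<Rightarrow> vx \<Rightarrow> bool" where
  "adjm M None None = False"
| "adjm M None (Some (j, b)) = iw j"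
| "adjm M (Some (i, a)) None = ou i"
| "adjm M (Some (i, a)) (Some (j, b)) = mem (dif b a) (el j (el i M))"

definition vs :: "vx list" where
  "vs = [None, Some (I0, D0), Some (I0, D1), Some (I0, D2), Some (I1, D0), Some (I1, D1), Some (I1, D2), Some (I2, D0), Some (I2, D1), Some (I2, D2), Some (I3, D0), Some (I3, D1), Some (I3, D2), Some (I4, D0), Some (I4, D1), Some (I4, D2), Some (I5, D0), Some (I5, D1), Some (I5, D2), Some (I6, D0), Some (I6, D1), Some (I6, D2)]"

fun rowl :: "blk row row \<Rightarrow> vx \<Rightarrow> vx list \<Rightarrow> bool list" where
  "rowl M x [] = []" | "rowl M x (y # ys) = adjm M x y # rowl M x ys"

fun coll :: "blk row row \<Rightarrow> vx \<Rightarrow> vx list \<Rightarrow> bool list" where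
  "coll M x [] = []" | "coll M x (y # ys) = adjm M y x # coll M x ys"

fun rowls :: "blk row row \<Rightarrow> vx list \<Rightarrow> vx list \<Rightarrow> bool list list" where
  "rowls M ys [] = []" | "rowls M ys (x # xs) = rowl M x ys # rowls M ys xs"

fun colls :: "blk row row \<Rightarrow> vx list \<Rightarrow> vx list \<Rightarrow> bool list list" where
  "colls M ys [] = []" | "colls M ys (x # xs) = coll M x ys # colls M ys xs"

fun cnt :: "bool list \<Rightarrow> bool list \<Rightarrow> nat" where
  "cnt (True # as) (True # bs) = Suc (cnt as bs)" | "cnt (True # as) (False # bs) = cnt as bs"
| "cnt (False # as) (True # bs) = cnt as bs" | "cnt (False # as) (False # bs) = cnt as bs"
| "cnt [] bs = 0" | "cnt (a # as) [] = 0"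

fun sq :: "nat \<Rightarrow> int" where
  "sq 0 = 0" | "sq (Suc (0)) = 1" | "sq (Suc (Suc (0))) = 4" | "sq (Suc (Suc (Suc (0)))) = 9" | "sq (Suc (Suc (Suc (Suc (0))))) = 16" | "sq (Suc (Suc (Suc (Suc (Suc (0)))))) = 25" | "sq (Suc (Suc (Suc (Suc (Suc (Suc (0))))))) = 36" | "sq (Suc (Suc (Suc (Suc (Suc (Suc (Suc (0)))))))) = 49" | "sq (Suc (Suc (Suc (Suc (Suc (Suc (Suc (Suc (0))))))))) = 64" | "sq (Suc (Suc (Suc (Suc (Suc (Suc (Suc (Suc (Suc (0)))))))))) = 81"
| "sq (Suc (Suc (Suc (Suc (Suc (Suc (Suc (Suc (Suc (Suc (n))))))))))) = (int n + 10)\<^sup>2"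

text \<open>The weights 2, 3 and 5 = 2 + 3 tell apart arcs that are only outgoing, only incoming,
  and reciprocated.\<close>

fun hs :: "bool list \<Rightarrow> bool list list \<Rightarrow> bool list \<Rightarrow> bool list \<Rightarrow> int" where
  "hs r (q # qs) (False # as) (False # bs) = hs r qs as bs"
| "hs r (q # qs) (True # as) (False # bs) = 2 * sq (cnt r q) + hs r qs as bs"
| "hs r (q # qs) (False # as) (True # bs) = 3 * sq (cnt r q) + hs r qs as bs"
| "hs r (q # qs) (True # as) (True # bs) = 5 * sq (cnt r q) + hs r qs as bs"
| "hs r [] as bs = 0" | "hs r (q # qs) [] bs = 0" | "hs r (q # qs) (a # as) [] = 0"

fun hlist :: "bool list list \<Rightarrow> bool list list \<Rightarrow> bool list list \<Rightarrow> int list" where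
  "hlist rs (q # qs) (c # cs) = hs q rs q c # hlist rs qs cs"
| "hlist rs [] cs = []" | "hlist rs (q # qs) [] = []"

fun dotb :: "bool list \<Rightarrow> int list \<Rightarrow> int" where
  "dotb (True # as) (k # ks) = k + dotb as ks" | "dotb (False # as) (k # ks) = dotb as ks"
| "dotb [] ks = 0" | "dotb (a # as) [] = 0"

fun wsum :: "int list \<Rightarrow> int list \<Rightarrow> bool list list \<Rightarrow> int" where
  "wsum gs (k # ks) (r # rs) = k * dotb r gs + wsum gs ks rs"
| "wsum gs [] rs = 0" | "wsum gs (k # ks) [] = 0"

fun nmem :: "int \<Rightarrow> int list \<Rightarrow> bool" where
  "nmem k [] = True" | "nmem k (l # ls) = (if k = l then False else nmem k ls)"

fun punq :: "int list \<Rightarrow> bool" where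
  "punq [] = False" | "punq (k # ks) = nmem k ks"

fun is3 :: "nat \<Rightarrow> bool" where
  "is3 0 = False" | "is3 (Suc 0) = False" | "is3 (Suc (Suc 0)) = False" | "is3 (Suc (Suc (Suc 0))) = True"
| "is3 (Suc (Suc (Suc (Suc n)))) = False"

fun is4 :: "nat \<Rightarrow> bool" where
  "is4 0 = False" | "is4 (Suc n) = is3 n"

fun is6 :: "nat \<Rightarrow> bool" where
  "is6 0 = False" | "is6 (Suc 0) = False" | "is6 (Suc (Suc n)) = is4 n"

fun is9 :: "nat \<Rightarrow> bool" where
  "is9 0 = False" | "is9 (Suc 0) = False" | "is9 (Suc (Suc 0)) = False" | "is9 (Suc (Suc (Suc n))) = is6 n"

fun path :: "bool \<Rightarrow> bool \<Rightarrow> nat \<Rightarrow> bool" where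
  "path True True n = False" | "path True False n = is6 n" | "path False True n = is3 n" | "path False False n = is4 n"

fun vrow :: "vx \<Rightarrow> bool list \<Rightarrow> bool list \<Rightarrow> vx list \<Rightarrow> bool list list \<Rightarrow> bool" where
  "vrow x r (a # as) (y # ys) (c # cs) = (if path (x = y) a (cnt r c) then vrow x r as ys cs else False)"
| "vrow x r [] ys cs = True" | "vrow x r (a # as) [] cs = True" | "vrow x r (a # as) (y # ys) [] = True"

fun valids :: "vx list \<Rightarrow> vx list \<Rightarrow> bool list list \<Rightarrow> bool list list \<Rightarrow> bool list list \<Rightarrow> bool" where
  "valids ys (x # xs) (r # rs) (c # cs) ds =
    (if is9 (cnt r r) then if is9 (cnt c c) then if vrow x r r ys ds then valids ys xs rs cs ds
     else False else False else False)"
| "valids ys [] rs cs ds = True" | "valids ys (x # xs) [] cs ds = True" | "valids ys (x # xs) (r # rs) [] ds = True"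

fun cons :: "blk row row \<Rightarrow> blk row row \<Rightarrow> vx \<Rightarrow> vx \<Rightarrow> (vx \<times> vx) list \<Rightarrow> bool" where
  "cons M N x y [] = True"
| "cons M N x y ((x', y') # ps) = (if adjm M x x' = adjm N y y' then if adjm M x' x = adjm N y' y then
     if y = y' then False else cons M N x y ps else False else False)"

fun exm :: "blk row row \<Rightarrow> blk row row \<Rightarrow> vx \<Rightarrow> (vx \<times> vx) list \<Rightarrow> vx list \<Rightarrow> (vx \<times> vx) list list" where
  "exm M N x ps [] = []"
| "exm M N x ps (y # ys) = (if cons M N x y ps then ((x, y) # ps) # exm M N x ps ys else exm M N x ps ys)"

fun exl :: "blk row row \<Rightarrow> blk row row \<Rightarrow> vx \<Rightarrow> vx list \<Rightarrow> (vx \<times> vx) list list \<Rightarrow> (vx \<times> vx) list list" where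
  "exl M N x ys [] = []"
| "exl M N x ys (ps # pss) = exm M N x ps ys @ exl M N x ys pss"

text \<open>All extensions are kept level by level, so one program serves two purposes: a non-empty
  result yields an isomorphism, and a one-element result proves uniqueness.\<close>

fun bfs :: "blk row row \<Rightarrow> blk row row \<Rightarrow> vx list \<Rightarrow> vx list \<Rightarrow> (vx \<times> vx) list list \<Rightarrow> (vx \<times> vx) list list" where
  "bfs M N ys [] pss = pss"
| "bfs M N ys (x # xs) pss = bfs M N ys xs (exl M N x ys pss)"

fun diag :: "vx list \<Rightarrow> (vx \<times> vx) list \<Rightarrow> (vx \<times> vx) list" where
  "diag [] ps = ps" | "diag (x # xs) ps = diag xs ((x, x) # ps)"

text \<open>The fixed vertex and the orbit \<open>I2\<close> are left out, because the starting maps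
  prescribe their images.\<close>

definition vs1 :: "vx list" where
  "vs1 = [Some (I0, D0), Some (I0, D1), Some (I0, D2), Some (I1, D0), Some (I1, D1), Some (I1, D2), Some (I3, D0), Some (I3, D1), Some (I3, D2), Some (I4, D0), Some (I4, D1), Some (I4, D2), Some (I5, D0), Some (I5, D1), Some (I5, D2), Some (I6, D0), Some (I6, D1), Some (I6, D2)]"

definition stid :: "(vx \<times> vx) list" where
  "stid = [(Some (I2, D2), Some (I2, D2)), (Some (I2, D1), Some (I2, D1)), (Some (I2, D0), Some (I2, D0)), (None, None)]"

text \<open>Up to rotations, a permutation of three points is the identity or this transposition.
  Hence \<open>stid\<close> and \<open>stsw\<close> represent all maps that respect the fixed vertex
  and the orbit \<open>I2\<close>.\<close>

definition stsw :: "(vx \<times> vx) list" where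
  "stsw = [(Some (I2, D2), Some (I2, D1)), (Some (I2, D1), Some (I2, D2)), (Some (I2, D0), Some (I2, D0)), (None, None)]"

fun isnil :: "'a list \<Rightarrow> bool" where
  "isnil [] = True" | "isnil (x # xs) = False"

fun rigid :: "blk row row \<Rightarrow> bool" where
  "rigid M = (bfs M M vs vs1 [stid] = [diag vs1 stid])"

fun stok :: "blk row row \<Rightarrow> blk row row \<Rightarrow> (vx \<times> vx) list \<Rightarrow> bool" where
  "stok M N [] = True" | "stok M N ((x, y) # ps) = (if cons M N x y ps then stok M N ps else False)"

fun starts :: "blk row row \<Rightarrow> blk row row \<Rightarrow> (vx \<times> vx) list list \<Rightarrow> (vx \<times> vx) list list" where
  "starts M N [] = []"
| "starts M N (ps # pss) = (if stok M N ps then ps # starts M N pss else starts M N pss)"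

fun swaps :: "blk row row \<Rightarrow> bool" where
  "swaps M = (\<not> isnil (bfs M M vs vs1 (starts M M [stsw])))"

fun isom :: "blk row row \<Rightarrow> blk row row \<Rightarrow> bool" where
  "isom M N = (\<not> isnil (bfs M N vs vs1 (starts M N [stid, stsw])))"

datatype info = Inf int bool | Bad

text \<open>All checks are folded into one value, so that a single equality of lists without
  \<open>Bad\<close> certifies the parameters, the unique value of \<open>hh\<close> and rigidity of
  a whole batch.\<close>

fun info1 :: "blk row row \<Rightarrow> bool list list \<Rightarrow> bool list list \<Rightarrow> int list \<Rightarrow> info" where
  "info1 M rs cs ks = (if valids vs vs rs cs cs then if punq ks then if rigid M then Inf (wsum ks ks rs) (swaps M)
     else Bad else Bad else Bad)"

fun info0 :: "blk row row \<Rightarrow> bool list list \<Rightarrow> bool list list \<Rightarrow> info" where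
  "info0 M rs cs = info1 M rs cs (hlist rs rs cs)"

fun infos :: "blk row row list \<Rightarrow> info list" where
  "infos [] = []" | "infos (M # Ms) = info0 M (rowls M vs vs) (colls M vs vs) # infos Ms"

fun memb :: "'a \<Rightarrow> 'a list \<Rightarrow> bool" where
  "memb x [] = False" | "memb x (y # ys) = (if x = y then True else memb x ys)"

fun without :: "'a list \<Rightarrow> 'a list \<Rightarrow> 'a list" where
  "without [] ys = []" | "without (x # xs) ys = (if memb x ys then without xs ys else x # without xs ys)"

fun leafs :: "task list \<Rightarrow> blk row row list" where
  "leafs [] = []" | "leafs (Task R as ps ls # ts) = blkmats ls @ leafs ts"

text \<open>Pairs of isomorphic results of the search; the first member of each pair is discarded.\<close>

definition dups :: "(string \<times> string) list" where
  "dups = [(''0007117061147071606013110146177006010076071116360'', ''0007117061127071606015110126177006010076071116560''),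
    (''0007117161016161616403110416177006010076071116630'', ''0007117161016161616205110216177006010076071116650''),
    (''0007117161016131616106110446177006010076074116660'', ''0007117161016151616106110226177006010076072116660''),
    (''0007117161046131616403110446177006010076071116660'', ''0007117161026151616205110226177006010076071116660''),
    (''0007117601146117606103140116106700717106601116360'', ''0007117601126117606105120116106700717106601116560''),
    (''0007117601113117606106140116106700717106604116360'', ''0007117601115117606106120116106700717106602116560''),
    (''0007117601117047606013110116116600716116601116330'', ''0007117601117027606015110116116600716116601116550''),
    (''0017017306114117007601016611114606617607006141066'', ''0017017506112117007601016611112606617607006121066''),
    (''0017017306111117007601016641411606617607006141066'', ''0017017506111117007601016621211606617607006121066''),
    (''0017116603411117006611016161076107011163067110306'', ''0017116605211117006611016161076107011165067110506''),
    (''0037111061101771007600116017174006670617001416630'', ''0057111061101771007600116017172006670617001216650''),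
    (''0106117604416116616106110107113301616116601113630'', ''0106117602216116616106110107115501616116601115650''),
    (''0116116606111146013314016311111606617706006101136'', ''0116116606111126015512016511111606617706006101156''),
    (''0163141061101770017600116017164106671607001146660'', ''0165121061101770017600116017162106671607001126660''),
    (''0166141061101770017600116017134106671607001116630'', ''0166121061101770017600116017152106671607001116650''),
    (''0611416601141612456306130103106701517403604205362'', ''0611416601141621456301630103016701571403602405362''),
    (''0661141601202711057501134604441603366305201103166'', ''0611027606414111067502264501441303366305201105166'')]"

fun firsts :: "(string \<times> string) list \<Rightarrow> blk row row list" where
  "firsts [] = []" | "firsts ((s, t) # ss) = blkmat s # firsts ss"

fun dupok :: "blk row row list \<Rightarrow> (string \<times> string) list \<Rightarrow> bool" where
  "dupok rs [] = True"
| "dupok rs ((s, t) # ss) = (if memb (blkmat t) rs then if isom (blkmat s) (blkmat t) then dupok rs ss else False else False)"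

text \<open>Discarded matrices are removed from every batch, because the two members of a pair in
  \<open>dups\<close> may lie in different batches.\<close>

definition reps :: "task list \<Rightarrow> blk row row list" where
  "reps ts = without (leafs ts) (firsts dups)"

section \<open>An automorphism of order three fixes a single vertex\<close>

locale aut3 =
  fixes A :: "'v::finite \<Rightarrow> 'v \<Rightarrow> bool" and s :: "'v \<Rightarrow> 'v"
  assumes loop: "\<not> A x x"
    and outdeg: "(\<Sum>y\<in>UNIV. of_bool (A x y)) = (9::int)"
    and indeg: "(\<Sum>y\<in>UNIV. of_bool (A y x)) = (9::int)"
    and path2: "(\<Sum>z\<in>UNIV. of_bool (A x z) * of_bool (A z y)) = (if x = y then 6 else if A x y then 3 else 4 :: int)"
    and cube: "s (s (s x)) = x"
    and aut: "A (s x) (s y) = A x y"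
    and card22: "card (UNIV :: 'v set) = 22"
begin

text \<open>Reversing all arcs preserves the parameters and the automorphism; it provides the
  in-versions of the statements about out-neighbours.\<close>

lemma dual: "aut3 (\<lambda>x y. A y x) s"
proof
  fix x y show "(\<Sum>z\<in>UNIV. of_bool (A z x) * of_bool (A y z)) = (if x = y then 6 else if A y x then 3 else 4 :: int)"
    using path2[of y x] by (simp add: mult.commute eq_commute[of y x])
qed (simp_all only: loop outdeg indeg cube aut card22 not_False_eq_True)

definition Fx :: "'v set" where "Fx = {x. s x = x}"

definition orb :: "'v \<Rightarrow> 'v set" where "orb x = {x, s x, s (s x)}"

definition rep :: "'v \<Rightarrow> 'v" where "rep x = (SOME y. y \<in> orb x)"

definition Om :: "'v set" where "Om = rep ` (- Fx)"

definition a :: "'v \<Rightarrow> 'v \<Rightarrow> int" where "a x y = of_bool (A x y)"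

lemma a_cases: "a x y = 0 \<and> \<not> A x y \<or> a x y = 1 \<and> A x y"
  by (simp add: a_def)

lemma a_bd: "0 \<le> a x y" "a x y \<le> 1"
  by (simp_all add: a_def)

lemma a_loop [simp]: "a x x = 0"
  by (simp add: a_def loop)

lemma outdeg': "(\<Sum>y\<in>UNIV. a x y) = 9"
  using outdeg[of x] by (simp only: a_def)

lemma indeg': "(\<Sum>y\<in>UNIV. a y x) = 9"
  using indeg[of x] by (simp only: a_def)

lemma path2': "(\<Sum>z\<in>UNIV. a x z * a z y) = (if x = y then 6 else 4 - a x y)"
proof -
  have "(\<Sum>z\<in>UNIV. a x z * a z y) = (\<Sum>z\<in>UNIV. of_bool (A x z) * of_bool (A z y))"
    by (simp only: a_def)
  also have "\<dots> = (if x = y then 6 else 4 - a x y)" unfolding path2 by (simp add: a_def)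
  finally show ?thesis .
qed

definition R :: "'v \<Rightarrow> 'v \<Rightarrow> int" where "R x q = a x q + a x (s q) + a x (s (s q))"

lemma s_inj: "s x = s y \<longleftrightarrow> x = y"
  by (metis cube)

lemma Fx_s: "s x \<in> Fx \<longleftrightarrow> x \<in> Fx"
  by (simp add: Fx_def s_inj)

lemma orb_s: "orb (s x) = orb x"
  by (auto simp: orb_def cube)

lemma rep_in: "rep x \<in> orb x"
  unfolding rep_def by (rule someI[of _ x]) (simp add: orb_def)

lemma orb_mem: "y \<in> orb x \<Longrightarrow> orb y = orb x"
  by (auto simp: orb_def cube)

lemma orb_rep: "orb (rep x) = orb x"
  using rep_in orb_mem by blast

lemma rep_eq: "rep x = rep y \<longleftrightarrow> orb x = orb y"
proof
  assume "rep x = rep y" then show "orb x = orb y" using orb_rep[of x] orb_rep[of y] by simp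
next
  assume "orb x = orb y" then show "rep x = rep y" by (simp add: rep_def)
qed

lemma rep_rep: "rep (rep x) = rep x"
  by (simp add: rep_eq orb_rep)

lemma Om_iff: "q \<in> Om \<longleftrightarrow> q \<notin> Fx \<and> rep q = q"
proof
  assume "q \<in> Om"
  then obtain x where x: "x \<notin> Fx" "q = rep x" by (auto simp: Om_def)
  have "q \<in> orb x" using rep_in x by simp
  then have "q \<notin> Fx" using x(1) by (auto simp: orb_def Fx_s)
  then show "q \<notin> Fx \<and> rep q = q" using x by (simp add: rep_rep)
next
  assume "q \<notin> Fx \<and> rep q = q" then show "q \<in> Om" unfolding Om_def by (metis ComplI image_eqI)
qed

lemma orb_sum:
  assumes "q \<notin> Fx"
  shows "sum g (orb q) = g q + g (s q) + (g (s (s q)) :: int)"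
proof -
  have "q \<noteq> s q" "q \<noteq> s (s q)" "s q \<noteq> s (s q)"
    using assms cube[of q] unfolding Fx_def mem_Collect_eq by metis+
  then show ?thesis by (simp add: orb_def)
qed

lemma sum_split: "(\<Sum>x\<in>UNIV. g x) = sum g Fx + (\<Sum>q\<in>Om. g q + g (s q) + (g (s (s q)) :: int))"
proof -
  have 1: "(\<Sum>x\<in>UNIV. g x) = sum g Fx + sum g (- Fx)"
    by (metis Compl_eq_Diff_UNIV add.commute finite sum.subset_diff subset_UNIV)
  have "sum g (- Fx) = (\<Sum>q\<in>Om. sum g {x \<in> - Fx. rep x = q})"
    unfolding Om_def by (rule sum.image_gen) simp
  also have "\<dots> = (\<Sum>q\<in>Om. sum g (orb q))"
  proof (rule sum.cong)
    fix q assume q: "q \<in> Om"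
    have "{x \<in> - Fx. rep x = q} = orb q"
    proof (rule Set.set_eqI, rule iffI)
      fix x assume "x \<in> {x \<in> - Fx. rep x = q}"
      then show "x \<in> orb q" using orb_rep[of x] by (auto simp: orb_def)
    next
      fix x assume "x \<in> orb q"
      then have "rep x = rep q" unfolding rep_eq by (rule orb_mem)
      moreover have "x \<notin> Fx" using q \<open>x \<in> orb q\<close> by (auto simp: Om_iff orb_def Fx_s)
      ultimately show "x \<in> {x \<in> - Fx. rep x = q}" using q by (simp add: Om_iff)
    qed
    then show "sum g {x \<in> - Fx. rep x = q} = sum g (orb q)" by simp
  qed simp
  also have "\<dots> = (\<Sum>q\<in>Om. g q + g (s q) + g (s (s q)))"
    by (rule sum.cong) (simp_all add: orb_sum Om_iff)
  finally show ?thesis using 1 by simp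
qed

lemma card_FO: "int (card Fx) + 3 * int (card Om) = 22"
  using sum_split[of "\<lambda>_. 1"] card22 by simp

lemma a_F1 [simp]: "x \<in> Fx \<Longrightarrow> a x (s q) = a x q"
  using aut[of x q] by (simp add: Fx_def a_def)

lemma a_F2 [simp]: "x \<in> Fx \<Longrightarrow> a (s q) x = a q x"
  using aut[of q x] by (simp add: Fx_def a_def)

text \<open>The inverse of \<open>s\<close> is \<open>s\<close> applied twice, so a rotation of the
  source is moved to the target.\<close>

lemma a_ss: "a (s r) q = a r (s (s q))" "a (s (s r)) q = a r (s q)"
proof -
  show 1: "a (s r) q = a r (s (s q))" for r q
    using aut[of r "s (s q)"] by (simp add: cube a_def)
  show "a (s (s r)) q = a r (s q)" proof -
    have "a (s (s r)) q = a (s r) (s (s q))" by (rule 1)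
    also have "\<dots> = a r (s (s (s (s q))))" by (rule 1)
    finally show ?thesis unfolding cube .
  qed
qed

text \<open>All moved orbits have length three, so the arcs between two orbits give the same number
  per vertex at both ends.\<close>

lemma R_col: "a r q + a (s r) q + a (s (s r)) q = R r q"
  by (simp add: R_def a_ss cube)

lemma R_bd: "0 \<le> R r q" "R r q \<le> 3"
  using a_bd[of r q] a_bd[of r "s q"] a_bd[of r "s (s q)"] by (simp_all add: R_def)

lemma R_diag: "R q q \<le> 2"
  using a_bd[of q "s q"] a_bd[of q "s (s q)"] by (simp add: R_def)

lemma out_F: "x \<in> Fx \<Longrightarrow> (\<Sum>y\<in>Fx. a x y) + 3 * (\<Sum>q\<in>Om. a x q) = 9"
  using outdeg'[of x] by (simp add: sum_split sum_distrib_left)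

lemma in_F: "x \<in> Fx \<Longrightarrow> (\<Sum>y\<in>Fx. a y x) + 3 * (\<Sum>q\<in>Om. a q x) = 9"
  using indeg'[of x] by (simp add: sum_split sum_distrib_left)

lemma out_O: "(\<Sum>y\<in>Fx. a q y) + (\<Sum>r\<in>Om. R q r) = 9"
  using outdeg'[of q] by (simp add: sum_split R_def)

lemma in_O: "(\<Sum>y\<in>Fx. a y q) + (\<Sum>r\<in>Om. R r q) = 9"
  using indeg'[of q] by (simp add: sum_split R_col)

lemma pFF: "x \<in> Fx \<Longrightarrow> y \<in> Fx \<Longrightarrow> (\<Sum>z\<in>Fx. a x z * a z y) + 3 * (\<Sum>q\<in>Om. a x q * a q y)
    = (if x = y then 6 else 4 - a x y)"
  using path2'[of x y] by (simp add: sum_split sum_distrib_left ac_simps)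

lemma ne_FO: "x \<in> Fx \<Longrightarrow> q \<in> Om \<Longrightarrow> x \<noteq> q" "x \<in> Fx \<Longrightarrow> q \<in> Om \<Longrightarrow> q \<noteq> x"
  by (auto simp: Om_iff)

lemma pFO:
  assumes "x \<in> Fx" "q \<in> Om"
  shows "(\<Sum>z\<in>Fx. a x z * a z q) + (\<Sum>r\<in>Om. a x r * R r q) = 4 - a x q"
proof -
  have "(\<Sum>r\<in>Om. a x r * R r q) = (\<Sum>r\<in>Om. a x r * a r q + a x r * a (s r) q + a x r * a (s (s r)) q)"
    by (rule sum.cong) (simp_all add: R_col[symmetric] algebra_simps)
  then show ?thesis using path2'[of x q] assms by (simp add: sum_split ne_FO)
qed

lemma pOF:
  assumes "x \<in> Fx" "q \<in> Om"
  shows "(\<Sum>z\<in>Fx. a q z * a z x) + (\<Sum>r\<in>Om. R q r * a r x) = 4 - a q x"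
proof -
  have "(\<Sum>r\<in>Om. R q r * a r x) = (\<Sum>r\<in>Om. a q r * a r x + a q (s r) * a r x + a q (s (s r)) * a r x)"
    by (rule sum.cong) (simp_all add: R_def algebra_simps)
  then show ?thesis using path2'[of q x] assms by (simp add: sum_split ne_FO)
qed

lemma Om_ne: "q \<in> Om \<Longrightarrow> r \<in> Om \<Longrightarrow> q = s r \<longleftrightarrow> False" "q \<in> Om \<Longrightarrow> r \<in> Om \<Longrightarrow> q = s (s r) \<longleftrightarrow> False"
proof -
  assume q: "q \<in> Om" "r \<in> Om"
  have "rep (s r) = rep r" "rep (s (s r)) = rep r" by (simp_all add: rep_eq orb_s)
  moreover have "rep r = r" "rep q = q" "s r \<noteq> r" "s (s r) \<noteq> r"
    using q cube[of r] by (auto simp: Om_iff Fx_def)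
  ultimately show "q = s r \<longleftrightarrow> False" "q = s (s r) \<longleftrightarrow> False" by auto
qed

text \<open>The three products for each orbit \<open>t\<close> are a coefficient of the cyclic
  convolution of two 0-1 vectors indexed by the integers modulo 3.\<close>

lemma pO:
  assumes "q \<in> Om" "r \<in> Om"
  shows "(\<Sum>z\<in>Fx. a q z * a z r) + (\<Sum>t\<in>Om. a q t * a t r + a q (s t) * a t (s (s r)) + a q (s (s t)) * a t (s r))
      = (if q = r then 6 else 4 - a q r)"
    "(\<Sum>z\<in>Fx. a q z * a z r) + (\<Sum>t\<in>Om. a q t * a t (s r) + a q (s t) * a t r + a q (s (s t)) * a t (s (s r)))
      = 4 - a q (s r)"
    "(\<Sum>z\<in>Fx. a q z * a z r) + (\<Sum>t\<in>Om. a q t * a t (s (s r)) + a q (s t) * a t (s r) + a q (s (s t)) * a t r)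
      = 4 - a q (s (s r))"
  using path2'[of q r] path2'[of q "s r"] path2'[of q "s (s r)"] assms
  by (simp_all add: sum_split a_ss cube Om_ne)

text \<open>Sum of the three equations of \<open>pO\<close>: the coefficients of a convolution add
  up to the product of the sums of its factors.\<close>

lemma pOO:
  assumes "q \<in> Om" "r \<in> Om"
  shows "3 * (\<Sum>z\<in>Fx. a q z * a z r) + (\<Sum>t\<in>Om. R q t * R t r) = 12 - R q r + (if q = r then 2 else 0)"
proof -
  have "(\<Sum>t\<in>Om. R q t * R t r) = (\<Sum>t\<in>Om. a q t * a t r + a q (s t) * a t (s (s r)) + a q (s (s t)) * a t (s r))
    + (\<Sum>t\<in>Om. a q t * a t (s r) + a q (s t) * a t r + a q (s (s t)) * a t (s (s r)))
    + (\<Sum>t\<in>Om. a q t * a t (s (s r)) + a q (s t) * a t (s r) + a q (s (s t)) * a t r)"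
    unfolding sum.distrib[symmetric] by (rule sum.cong) (simp_all add: R_def algebra_simps)
  then show ?thesis using pO[OF assms] by (auto simp: R_def)
qed

end

section \<open>Two-paths inside one orbit\<close>

lemma mod3_facts:
  fixes k i j :: int
  shows "k - 1 + 3 * i = 3 \<Longrightarrow> k + 3 * j = 9 \<Longrightarrow> False"
    and "\<not> 3 \<le> k \<Longrightarrow> k + 3 * i = 9 \<Longrightarrow> 0 \<le> k \<Longrightarrow> k = 0"
    and "3 * i = 4 \<Longrightarrow> False"
    and "k + 3 * i = 4 - j \<Longrightarrow> 0 \<le> k \<Longrightarrow> k \<le> 3 - j \<Longrightarrow> j = 0 \<or> j = 1 \<Longrightarrow> k = 1 - j \<and> i = 1"
    and "3 \<le> k \<Longrightarrow> k \<noteq> 3 \<Longrightarrow> k \<le> 4 \<Longrightarrow> k + 3 * i = 9 \<Longrightarrow> False"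
    and "3 \<le> k \<Longrightarrow> k \<noteq> 6 \<Longrightarrow> k \<le> 7 \<Longrightarrow> k + 3 * i = 9 \<Longrightarrow> k = 3"
  by presburger+

text \<open>If one factor is constant, so is the convolution. Otherwise both sums are 1 or 2 and the
  coefficients are, in some order, 1, 0, 0 or 1, 1, 0 or 2, 1, 1. So differences are at most 1, and
  one coefficient exceeds both others only when the two sums agree.\<close>

lemma conv_diff:
  fixes x0 :: int
  assumes "x0 = 0 \<or> x0 = 1" "x1 = 0 \<or> x1 = 1" "x2 = 0 \<or> x2 = 1"
    "y0 = 0 \<or> y0 = 1" "y1 = 0 \<or> y1 = 1" "y2 = 0 \<or> y2 = (1::int)"
  shows "x0 * y0 + x1 * y2 + x2 * y1 - (x0 * y1 + x1 * y0 + x2 * y2)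
      \<le> of_bool (x0 + x1 + x2 \<in> {1, 2} \<and> y0 + y1 + y2 \<in> {1, 2})"
    and "x0 * y0 + x1 * y2 + x2 * y1 - (x0 * y2 + x1 * y1 + x2 * y0)
      \<le> of_bool (x0 + x1 + x2 \<in> {1, 2} \<and> y0 + y1 + y2 \<in> {1, 2})"
    and "x0 * y0 + x1 * y2 + x2 * y1 - (x0 * y1 + x1 * y0 + x2 * y2) = 1 \<Longrightarrow>
      x0 * y0 + x1 * y2 + x2 * y1 - (x0 * y2 + x1 * y1 + x2 * y0) = 1 \<Longrightarrow>
      x0 + x1 + x2 = y0 + y1 + y2"
  using assms by (elim disjE; simp)+

context aut3
begin

lemma a01: "a x y = 0 \<or> a x y = 1"
  using a_cases by blast

text \<open>The other orbits joined to \<open>i\<close> by non-constant blocks in both directions;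
  only these contribute to differences between convolution coefficients.\<close>

definition U :: "'v \<Rightarrow> 'v set" where
  "U i = {t \<in> Om. t \<noteq> i \<and> R i t \<in> {1, 2} \<and> R t i \<in> {1, 2}}"

definition Df1 :: "'v \<Rightarrow> 'v \<Rightarrow> int" where
  "Df1 i t = a i t * a t i + a i (s t) * a t (s (s i)) + a i (s (s t)) * a t (s i)
    - (a i t * a t (s i) + a i (s t) * a t i + a i (s (s t)) * a t (s (s i)))"

definition Df2 :: "'v \<Rightarrow> 'v \<Rightarrow> int" where
  "Df2 i t = a i t * a t i + a i (s t) * a t (s (s i)) + a i (s (s t)) * a t (s i)
    - (a i t * a t (s (s i)) + a i (s t) * a t (s i) + a i (s (s t)) * a t i)"

lemma D_le: "t \<in> Om \<Longrightarrow> t \<noteq> i \<Longrightarrow> Df1 i t \<le> of_bool (t \<in> U i)" "t \<in> Om \<Longrightarrow> t \<noteq> i \<Longrightarrow> Df2 i t \<le> of_bool (t \<in> U i)"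
  unfolding Df1_def Df2_def U_def R_def
  using conv_diff(1,2)[OF a01[of i t] a01[of i "s t"] a01[of i "s (s t)"] a01[of t i] a01[of t "s i"] a01[of t "s (s i)"]]
  by (simp_all add: insert_iff)

lemma D_eq: "Df1 i t = 1 \<Longrightarrow> Df2 i t = 1 \<Longrightarrow> R i t = R t i"
  unfolding Df1_def Df2_def R_def
  using conv_diff(3)[OF a01[of i t] a01[of i "s t"] a01[of i "s (s t)"] a01[of t i] a01[of t "s i"] a01[of t "s (s i)"]] by blast

text \<open>Paths through fixed vertices cancel in the difference, which leaves 6 - 4, plus 1 if the
  arc inside the orbit exists. The term of \<open>i\<close> itself is then taken away by cases on
  its diagonal block.\<close>

lemma D_sum:
  assumes "i \<in> Om"
  shows "(\<Sum>t\<in>Om - {i}. Df1 i t) = (if R i i = 1 then 3 else 2)"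
    "(\<Sum>t\<in>Om - {i}. Df2 i t) = (if R i i = 1 then 3 else 2)"
proof -
  have "(\<Sum>t\<in>Om. Df1 i t) = 2 + a i (s i)" "(\<Sum>t\<in>Om. Df2 i t) = 2 + a i (s (s i))"
    using pO[OF assms assms] unfolding Df1_def Df2_def sum_subtractf by simp_all
  moreover have "(\<Sum>t\<in>Om. Df1 i t) = Df1 i i + (\<Sum>t\<in>Om - {i}. Df1 i t)"
    "(\<Sum>t\<in>Om. Df2 i t) = Df2 i i + (\<Sum>t\<in>Om - {i}. Df2 i t)"
    using assms by (simp_all add: sum.remove)
  ultimately show "(\<Sum>t\<in>Om - {i}. Df1 i t) = (if R i i = 1 then 3 else 2)"
    "(\<Sum>t\<in>Om - {i}. Df2 i t) = (if R i i = 1 then 3 else 2)"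
    using a01[of i "s i"] a01[of i "s (s i)"] by (auto simp: Df1_def Df2_def R_def)
qed

text \<open>Compares the two-paths from \<open>i\<close> to itself with those from \<open>i\<close> to the other points of its orbit.\<close>

lemma star:
  assumes "i \<in> Om"
  shows "card (U i) \<ge> 2" "R i i = 1 \<Longrightarrow> card (U i) \<ge> 3" "card (U i) = 2 \<Longrightarrow> t \<in> U i \<Longrightarrow> R i t = R t i"
proof -
  have fin: "finite (Om - {i})" by simp
  have Us: "U i \<subseteq> Om - {i}" by (auto simp: U_def)
  have card: "(\<Sum>t\<in>Om - {i}. of_bool (t \<in> U i)) = int (card (U i))"
    using Us by (simp add: Int_absorb1)
  have le: "(\<Sum>t\<in>Om - {i}. Df1 i t) \<le> int (card (U i))" "(\<Sum>t\<in>Om - {i}. Df2 i t) \<le> int (card (U i))"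
    unfolding card[symmetric] by (rule sum_mono; simp add: D_le)+
  show "card (U i) \<ge> 2" "R i i = 1 \<Longrightarrow> card (U i) \<ge> 3"
    using le(1) D_sum(1)[OF assms] by (auto split: if_splits)
  show "R i t = R t i" if c: "card (U i) = 2" and t: "t \<in> U i"
  proof -
    have n: "R i i \<noteq> 1" using le(1) D_sum(1)[OF assms] c by auto
    have eq: "D i t = 1" if D: "\<And>t. t \<in> Om \<Longrightarrow> t \<noteq> i \<Longrightarrow> D i t \<le> of_bool (t \<in> U i)"
      and S: "(\<Sum>t\<in>Om - {i}. D i t) = 2" for D :: "'v \<Rightarrow> 'v \<Rightarrow> int"
    proof (rule ccontr)
      assume "D i t \<noteq> 1"
      have tO: "t \<in> Om" "t \<noteq> i" using t Us by auto
      then have "D i t < of_bool (t \<in> U i)" using \<open>D i t \<noteq> 1\<close> D[OF tO] t by (simp add: order_less_le)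
      then have "(\<Sum>t\<in>Om - {i}. D i t) < (\<Sum>t\<in>Om - {i}. of_bool (t \<in> U i))"
        using D t Us by (intro sum_strict_mono_ex1) auto
      then show False using S card c by simp
    qed
    have "Df1 i t = 1" "Df2 i t = 1"
      using eq[of Df1] eq[of Df2] D_le D_sum[OF assms] n by simp_all
    then show ?thesis by (rule D_eq)
  qed
qed

section \<open>Reduction to 1, 10 or 13 fixed vertices\<close>

abbreviation outF :: "'v \<Rightarrow> int" where "outF x \<equiv> (\<Sum>y\<in>Fx. a x y)"
abbreviation inF :: "'v \<Rightarrow> int" where "inF x \<equiv> (\<Sum>y\<in>Fx. a y x)"
abbreviation nI :: "'v \<Rightarrow> int" where "nI x \<equiv> (\<Sum>q\<in>Om. a x q)"
abbreviation nJ :: "'v \<Rightarrow> int" where "nJ x \<equiv> (\<Sum>q\<in>Om. a q x)"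
abbreviation pF :: "'v \<Rightarrow> 'v \<Rightarrow> int" where "pF x y \<equiv> (\<Sum>z\<in>Fx. a x z * a z y)"
abbreviation IJ :: "'v \<Rightarrow> 'v \<Rightarrow> int" where "IJ x y \<equiv> (\<Sum>q\<in>Om. a x q * a q y)"

lemma pF_le: "0 \<le> pF x y" "x \<in> Fx \<Longrightarrow> y \<in> Fx \<Longrightarrow> pF x y \<le> outF x - a x y"
proof -
  show "0 \<le> pF x y" by (intro sum_nonneg mult_nonneg_nonneg a_bd)
  assume y: "y \<in> Fx"
  have "pF x y = a x y * a y y + (\<Sum>z\<in>Fx - {y}. a x z * a z y)" using y by (simp add: sum.remove)
  also have "\<dots> \<le> (\<Sum>z\<in>Fx - {y}. a x z)" unfolding a_loop mult_zero_right add_0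
  proof (rule sum_mono)
    fix z show "a x z * a z y \<le> a x z" using a01[of z y] a_bd[of x z] by auto
  qed
  also have "\<dots> = outF x - a x y" using y by (simp add: sum.remove)
  finally show "pF x y \<le> outF x - a x y" .
qed

lemma nI_nonneg: "0 \<le> nI x" "0 \<le> nJ x" "0 \<le> IJ x y" "0 \<le> outF x" "0 \<le> inF x"
  by (intro sum_nonneg mult_nonneg_nonneg a_bd)+

text \<open>If \<open>x\<close> sends arcs to all other fixed vertices, the two-paths from
  \<open>x\<close> to \<open>y\<close> inside \<open>Fx\<close> number \<open>inF y - 1\<close>.
  This makes \<open>inF y\<close> congruent to 1 modulo 3, while the in-degree equation makes it
  divisible by 3.\<close>

lemma not_full:
  assumes x: "x \<in> Fx" and f: "card Fx \<ge> 2"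
  shows "outF x \<noteq> int (card Fx) - 1"
proof
  assume full: "outF x = int (card Fx) - 1"
  have "\<exists>y\<in>Fx. y \<noteq> x"
  proof (rule ccontr)
    assume "\<not> ?thesis" then have "Fx \<subseteq> {x}" by blast
    then have "card Fx \<le> card {x}" by (intro card_mono) simp_all
    then show False using f by simp
  qed
  then obtain y where y: "y \<in> Fx" "y \<noteq> x" by blast
  have all: "a x z = 1" if z: "z \<in> Fx" "z \<noteq> x" for z
  proof (rule ccontr)
    assume "a x z \<noteq> 1" then have 0: "a x z = 0" using a01 by blast
    have "outF x = a x x + (a x z + (\<Sum>w\<in>Fx - {x} - {z}. a x w))" using x z by (simp add: sum.remove)
    also have "\<dots> \<le> (\<Sum>w\<in>Fx - {x} - {z}. 1)" using 0 by (simp add: sum_bounded_above a_bd sum_mono del: sum_constant)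
    also have "\<dots> = int (card Fx) - 2" using x z f by (simp add: card_Diff_singleton of_nat_diff)
    finally show False using full by simp
  qed
  have "pF x y = (\<Sum>z\<in>Fx - {x}. a z y)" using x all by (simp add: sum.remove)
  also have "\<dots> = inF y - 1" using x all[OF y] by (simp add: sum.remove)
  finally have "inF y - 1 + 3 * IJ x y = 3" using pFF[OF x y(1)] all[OF y] y by simp
  then show False using in_F[OF y(1)] by (rule mod3_facts(1))
qed

text \<open>Without fixed out-neighbours every two-path to another fixed vertex runs through a moved
  orbit, so their number is a multiple of 3; but it should be 4.\<close>

lemma out_nz:
  assumes x: "x \<in> Fx" and f: "card Fx \<ge> 2"
  shows "outF x \<ge> 3"
proof (rule ccontr)
  assume "\<not> ?thesis"
  then have 0: "outF x = 0" using out_F[OF x] nI_nonneg(4)[of x] by (rule mod3_facts(2))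
  have "\<exists>y\<in>Fx. y \<noteq> x"
  proof (rule ccontr)
    assume "\<not> ?thesis" then have "Fx \<subseteq> {x}" by blast
    then have "card Fx \<le> card {x}" by (intro card_mono) simp_all
    then show False using f by simp
  qed
  then obtain y where y: "y \<in> Fx" "y \<noteq> x" by blast
  have "a x y = 0" using 0 y(1) a_bd by (simp add: sum_nonneg_eq_0_iff)
  then have "pF x y = 0" using pF_le[of x y] x y 0 by simp
  then have "3 * IJ x y = 4" using pFF[OF x y(1)] y \<open>a x y = 0\<close> by simp
  then show False by (rule mod3_facts(3))
qed

text \<open>The path equation fixes \<open>pF x y\<close> modulo 3, and three out-neighbours, of
  which \<open>y\<close> itself is no midpoint, leave no room for a larger value.\<close>

lemma out3_path:
  assumes x: "x \<in> Fx" and o: "outF x = 3" and y: "y \<in> Fx" "y \<noteq> x"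
  shows "pF x y = 1 - a x y" "IJ x y = 1"
proof -
  have "pF x y + 3 * IJ x y = 4 - a x y" using pFF[OF x y(1)] y by simp
  moreover have "0 \<le> pF x y" "pF x y \<le> 3 - a x y" using pF_le[of x y] x y o by simp_all
  ultimately have "pF x y = 1 - a x y \<and> IJ x y = 1" using a01 by (rule mod3_facts(4))
  then show "pF x y = 1 - a x y" "IJ x y = 1" by simp_all
qed

lemma pF_sum: "(\<Sum>y\<in>Fx. pF x y) = (\<Sum>z\<in>Fx. a x z * outF z)"
  by (subst sum.swap) (simp add: sum_distrib_left)

lemma IJ_sum: "(\<Sum>y\<in>Fx. IJ x y) = (\<Sum>q\<in>Om. a x q * outF q)"
  by (subst sum.swap) (simp add: sum_distrib_left)

text \<open>Two-paths from \<open>x\<close> inside \<open>Fx\<close>, counted by their midpoints on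
  the left and by their ends on the right.\<close>

lemma out3_sum:
  assumes x: "x \<in> Fx" and o: "outF x = 3"
  shows "(\<Sum>z\<in>Fx. a x z * outF z) = pF x x + int (card Fx) - 4"
proof -
  have "(\<Sum>z\<in>Fx. a x z * outF z) = pF x x + (\<Sum>y\<in>Fx - {x}. pF x y)"
    using x unfolding pF_sum[symmetric] by (rule sum.remove[OF finite])
  also have "(\<Sum>y\<in>Fx - {x}. pF x y) = (\<Sum>y\<in>Fx - {x}. 1 - a x y)"
    using out3_path[OF x o] by (intro sum.cong) auto
  also have "(\<Sum>y\<in>Fx - {x}. 1 - a x y) = (int (card Fx) - 1) - (\<Sum>y\<in>Fx - {x}. a x y)"
  proof -
    have "card Fx > 0" using x by (auto simp: card_gt_0_iff)
    then show ?thesis using x by (simp add: sum_subtractf card_Diff_singleton of_nat_diff)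
  qed
  also have "(\<Sum>y\<in>Fx - {x}. a x y) = outF x" using x by (simp add: sum.remove)
  finally show ?thesis using o by simp
qed

lemma f_cases:
  assumes "Om \<noteq> {}"
  shows "card Fx \<in> {1, 10, 13}"
proof -
  obtain i where i: "i \<in> Om" using assms by blast
  have "2 \<le> card (U i)" using star(1)[OF i] .
  also have "card (U i) \<le> card (Om - {i})" by (intro card_mono) (auto simp: U_def)
  \<comment> \<open>The orbit \<open>i\<close> together with at least two members of
    \<open>U i\<close>; with 22 vertices in all this leaves at most 13 fixed ones.\<close>
  finally have "3 \<le> card Om" using i by (simp add: card_Diff_singleton)
  then have "card Fx \<in> {1, 4, 7, 10, 13}" using card_FO by (simp add: insert_iff) presburger
  moreover have "card Fx \<noteq> 4"
  proof
    assume f: "card Fx = 4"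
    then obtain x where x: "x \<in> Fx" by (metis card.empty all_not_in_conv zero_neq_numeral)
    have "outF x \<ge> 3" "outF x \<noteq> 3" using out_nz[OF x] not_full[OF x] f by simp_all
    moreover have "outF x \<le> (\<Sum>y\<in>Fx. 1)" by (intro sum_mono a_bd)
    moreover have "outF x + 3 * nI x = 9" using out_F[OF x] .
    ultimately show False using f mod3_facts(5)[of "outF x" "nI x"] by simp
  qed
  moreover have "card Fx \<noteq> 7"
  proof
    assume f: "card Fx = 7"
    then obtain x where x: "x \<in> Fx" by (metis card.empty all_not_in_conv zero_neq_numeral)
    have o: "outF x = 3" if x: "x \<in> Fx" for x
    proof -
      have "outF x \<ge> 3" "outF x \<noteq> 6" using out_nz[OF x] not_full[OF x] f by simp_all
      moreover have "outF x \<le> (\<Sum>y\<in>Fx. 1)" by (intro sum_mono a_bd)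
      moreover have "outF x + 3 * nI x = 9" using out_F[OF x] .
      ultimately show ?thesis using f mod3_facts(6)[of "outF x" "nI x"] by simp
    qed
    have "(\<Sum>z\<in>Fx. a x z * outF z) = (\<Sum>z\<in>Fx. a x z) * 3" using o by (simp add: sum_distrib_right)
    \<comment> \<open>The two counts give \<open>9 = pF x x + 3\<close>, but \<open>pF x x\<close>
      is at most 3.\<close>
    then show False using out3_sum[OF x o[OF x]] o[OF x] pF_le(2)[OF x x] f by simp
  qed
  ultimately show ?thesis by simp
qed

end

section \<open>Thirteen fixed vertices\<close>

context aut3
begin

text \<open>Each out-neighbour orbit \<open>q\<close> of \<open>x\<close> leads on to
  \<open>outF q\<close> fixed vertices, and each of the 13 fixed vertices, \<open>x\<close>
  included, must be reached in this way at least once.\<close>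

lemma nI_IJ_13:
  assumes f: "card Fx = 13" and x: "x \<in> Fx" and n: "nI x = 2"
  shows "(\<Sum>q\<in>Om. a x q * outF q) \<ge> 13"
    "(\<Sum>q\<in>Om. a x q * outF q) = 13 \<Longrightarrow> y \<in> Fx \<Longrightarrow> IJ x y = 1"
proof -
  have o: "outF x = 3" using out_F[OF x] n by simp
  have 1: "IJ x y \<ge> 1" if y: "y \<in> Fx" for y
  proof (cases "y = x")
    case True
    have "pF x x + 3 * IJ x x = 6" "pF x x \<le> 3" using pFF[OF x x] pF_le(2)[OF x x] o by simp_all
    then show ?thesis using True by simp
  qed (use out3_path(2)[OF x o y] in simp)
  have "(\<Sum>y\<in>Fx. 1) \<le> (\<Sum>y\<in>Fx. IJ x y)" by (intro sum_mono 1)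
  then show "(\<Sum>q\<in>Om. a x q * outF q) \<ge> 13" using f by (simp add: IJ_sum)
  assume e: "(\<Sum>q\<in>Om. a x q * outF q) = 13" and y: "y \<in> Fx"
  show "IJ x y = 1"
  proof (rule ccontr)
    assume "IJ x y \<noteq> 1"
    then have "(\<Sum>y\<in>Fx. 1) < (\<Sum>y\<in>Fx. IJ x y)"
      using 1 y by (intro sum_strict_mono_ex1) (auto simp: order_less_le)
    then show False using f e by (simp add: IJ_sum)
  qed
qed

lemma nI_le2: "x \<in> Fx \<Longrightarrow> card Fx \<ge> 2 \<Longrightarrow> nI x \<le> 2"
  using out_F[of x] out_nz[of x] by simp

lemma nI_sum: "(\<Sum>x\<in>Fx. nI x) = (\<Sum>q\<in>Om. inF q)"
  by (rule sum.swap)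

text \<open>The orbits \<open>q\<close> and \<open>r\<close> together reach only 12 fixed vertices,
  so \<open>p\<close> is one of the two out-neighbour orbits of \<open>x\<close>. Together with
  \<open>q\<close> or \<open>r\<close> it reaches exactly 13, hence each fixed vertex once.\<close>

lemma f13_two:
  assumes f: "card Fx = 13" and O: "Om = {p, q, r}" and d: "p \<noteq> q" "p \<noteq> r" "q \<noteq> r"
    and o: "outF p = 7" "outF q = 6" "outF r = 6"
    and x: "x \<in> Fx" "nI x = 2"
  shows "a x p = 1" "y \<in> Fx \<Longrightarrow> a x q = 1 \<Longrightarrow> a p y + a q y = 1" "a x q = 1 \<Longrightarrow> a x r = 0"
proof -
  have s: "a x p * 7 + a x q * 6 + a x r * 6 \<ge> 13" "a x p + a x q + a x r = 2"
    using nI_IJ_13(1)[OF f x] x(2) d by (simp_all add: O o)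
  show p: "a x p = 1" using s a01[of x p] a_bd(2)[of x q] a_bd(2)[of x r] by auto
  assume q: "a x q = 1"
  show r: "a x r = 0" using s(2) p q by simp
  assume y: "y \<in> Fx"
  show "a p y + a q y = 1"
    using nI_IJ_13(2)[OF f x _ y] p q r d by (simp add: O o)
qed

end

text \<open>The only pattern of orbit sizes that the counting equations leave for 13 fixed vertices.\<close>

locale case13 = aut3 +
  fixes p q r
  assumes f: "card Fx = 13" and O: "Om = {p, q, r}" and d: "p \<noteq> q" "p \<noteq> r" "q \<noteq> r"
    and o: "outF p = 7" "outF q = 6" "outF r = 6" and i: "inF p = 7" "inF q = 6" "inF r = 6"
    and Rv: "R p p = 0" "R q q = 0" "R r r = 0" "R p q = 1" "R q p = 1" "R p r = 1" "R r p = 1"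
      "R q r = 2" "R r q = 2"
begin

lemma f2: "card Fx \<ge> 2" using f by simp

text \<open>Otherwise the numbers \<open>nI\<close> add up to at most 13, whereas the
  representatives \<open>p\<close>, \<open>q\<close>, \<open>r\<close> receive 7 + 6 + 6 = 19 arcs
  from fixed vertices.\<close>

lemma ex2: "\<exists>x\<in>Fx. nI x = 2"
proof (rule ccontr)
  assume "\<not> ?thesis"
  then have "nI x \<le> 1" if "x \<in> Fx" for x using nI_le2[OF that f2] that by force
  then have "(\<Sum>x\<in>Fx. nI x) \<le> (\<Sum>x\<in>Fx. 1)" by (intro sum_mono)
  then show False using f d unfolding nI_sum by (simp add: O i)
qed

end

lemma case13_dual: "case13 A s p q r \<Longrightarrow> case13 (\<lambda>x y. A y x) s p q r"
proof -
  assume "case13 A s p q r"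
  then interpret case13 A s p q r .
  interpret D: aut3 "\<lambda>x y. A y x" s by (rule dual)
  have a: "D.a x y = a y x" for x y by (simp add: D.a_def a_def)
  have R: "D.R x y = R y x" for x y by (simp add: D.R_def R_col[symmetric] a R_def a_ss)
  show ?thesis
    by (rule case13.intro[OF dual case13_axioms.intro]) (simp_all only: a R f O d o i Rv not_False_eq_True)
qed

lemma case13_swap: "case13 A s p q r \<Longrightarrow> case13 A s p r q"
proof -
  assume "case13 A s p q r"
  then interpret case13 A s p q r .
  have O': "Om = {p, r, q}" "r \<noteq> q" using O d by blast+
  show ?thesis
    by (rule case13.intro[OF aut3_axioms case13_axioms.intro]; rule f O' d o i Rv)
qed

locale case13q = case13 + assumes hq: "\<exists>x\<in>Fx. nI x = 2 \<and> a x q = 1"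
begin

lemma J1: "z \<in> Fx \<Longrightarrow> a p z + a q z = 1"
  using hq f13_two(2)[OF f O d o] by blast

end

text \<open>In the reversed graph some fixed vertex again has two neighbouring orbits, one of them
  \<open>p\<close>. By \<open>J1\<close> the other one is not \<open>q\<close>, so \<open>q\<close>
  and \<open>r\<close> change their roles.\<close>

lemma case13q_dual: "case13q A s p q r \<Longrightarrow> case13q (\<lambda>x y. A y x) s p r q"
proof -
  assume "case13q A s p q r"
  then interpret case13q A s p q r .
  interpret D: case13 "\<lambda>x y. A y x" s p r q by (rule case13_swap[OF case13_dual[OF case13_axioms]])
  have a: "D.a x y = a y x" for x y by (simp add: D.a_def a_def)
  obtain z where z: "z \<in> Fx" "nJ z = 2" using D.ex2 by (auto simp: a)
  have "a p z = 1" using D.f13_two(1)[OF D.f D.O D.d D.o, of z] z by (simp add: a)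
  then have "a r z = 1" using J1[OF z(1)] z(2) d by (simp add: O)
  then have "\<exists>z\<in>Fx. (\<Sum>q\<in>Om. D.a z q) = 2 \<and> D.a z r = 1" using z by (auto simp: a)
  with D.case13_axioms show ?thesis by (rule case13q.intro[OF _ case13q_axioms.intro])
qed

context case13q
begin

lemma I1: "x \<in> Fx \<Longrightarrow> a x p + a x r = 1"
proof -
  interpret D: case13q "\<lambda>x y. A y x" s p r q by (rule case13q_dual[OF case13q_axioms])
  have a: "D.a x y = a y x" for x y by (simp add: D.a_def a_def)
  assume "x \<in> Fx" then show ?thesis using D.J1 by (simp add: a)
qed

text \<open>An arc to \<open>q\<close> but not to \<open>p\<close> would by \<open>I1\<close> come
  with one to \<open>r\<close>, and then \<open>x\<close> would have two out-neighbour orbits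
  without \<open>p\<close> among them.\<close>

lemma q_le_p: "x \<in> Fx \<Longrightarrow> a x q \<le> a x p"
proof (rule ccontr)
  assume x: "x \<in> Fx" and n: "\<not> a x q \<le> a x p"
  then have v: "a x q = 1" "a x p = 0" using a01[of x q] a01[of x p] by auto
  then have "nI x = 2" using I1[OF x] d by (simp add: O)
  then show False using f13_two(1)[OF f O d o x] v by simp
qed

lemma nbrs_r:
  assumes z: "z \<in> Fx" "a z r = 1"
  shows "a z p = 0" "a z q = 0" "(\<Sum>y\<in>Fx. a z y * a y p) = 3" "(\<Sum>y\<in>Fx. a z y * a y q) = 2"
    "(\<Sum>y\<in>Fx. a z y * a y r) = 3"
proof -
  show p: "a z p = 0" using I1 z by force
  show q: "a z q = 0" using q_le_p[OF z(1)] p a_bd(1)[of z q] by simp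
  show "(\<Sum>y\<in>Fx. a z y * a y p) = 3" "(\<Sum>y\<in>Fx. a z y * a y q) = 2" "(\<Sum>y\<in>Fx. a z y * a y r) = 3"
    using pFO[OF z(1), of p] pFO[OF z(1), of q] pFO[OF z(1), of r] p q z d by (simp_all add: O Rv)
qed

text \<open>The representatives \<open>p\<close> and \<open>q\<close> receive 7 and 6 arcs from
  \<open>Fx\<close>, so by \<open>q_le_p\<close> their in-neighbourhoods differ in a single vertex
  \<open>v\<close>. The fixed in-neighbours of this \<open>v\<close> turn out to be those of
  \<open>r\<close>.\<close>

lemma special:
  obtains v where "v \<in> Fx" "\<And>y. y \<in> Fx \<Longrightarrow> a y p - a y q = of_bool (y = v)"
    "\<And>z. z \<in> Fx \<Longrightarrow> a z v = a z r" "a p v = 1" "a q v = 0" "a r v = 0" "(\<Sum>z\<in>Fx. a v z * a z r) = 3"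
proof -
  have bit: "a y p - a y q = 0 \<or> a y p - a y q = 1" if "y \<in> Fx" for y
    using q_le_p[OF that] a01[of y p] a01[of y q] by auto
  have one: "(\<Sum>y\<in>Fx. a y p - a y q) = 1" using i by (simp add: sum_subtractf)
  have "\<exists>v\<in>Fx. a v p - a v q = 1"
  proof (rule ccontr)
    assume "\<not> ?thesis" then have "(\<Sum>y\<in>Fx. a y p - a y q) = 0" using bit by (intro sum.neutral) blast
    then show False using one by simp
  qed
  then obtain v where v: "v \<in> Fx" "a v p - a v q = 1" by blast
  have uniq: "a y p - a y q = of_bool (y = v)" if y: "y \<in> Fx" for y
  proof (rule ccontr)
    assume n: "\<not> ?thesis"
    then have yv: "y \<noteq> v" "a y p - a y q = 1" using v bit[OF y] by auto
    have "(\<Sum>y\<in>Fx. a y p - a y q) = (a v p - a v q) + ((a y p - a y q) + (\<Sum>y\<in>Fx - {v} - {y}. a y p - a y q))"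
      using v y yv by (simp add: sum.remove del: sum_subtractf)
    moreover have "0 \<le> (\<Sum>y\<in>Fx - {v} - {y}. a y p - a y q)" by (intro sum_nonneg) (use q_le_p in force)
    ultimately show False using v yv one by simp
  qed
  have vp: "a v p = 1" "a v q = 0" using v(2) a01[of v p] a01[of v q] by auto
  have vr: "a v r = 0" using I1[OF v(1)] vp by simp
  have zv: "a z v = 1" if z: "z \<in> Fx" "a z r = 1" for z
  proof -
    \<comment> \<open>By \<open>nbrs_r\<close> there are 3 paths to \<open>p\<close> and 2 to
      \<open>q\<close> inside \<open>Fx\<close>; only \<open>v\<close> distinguishes the two
      targets, so the extra path runs through \<open>v\<close>.\<close>
    have "(\<Sum>y\<in>Fx. a z y * (a y p - a y q)) = 1"
      using nbrs_r[OF z] by (simp add: right_diff_distrib sum_subtractf)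
    also have "(\<Sum>y\<in>Fx. a z y * (a y p - a y q)) = (\<Sum>y\<in>Fx. if y = v then a z y else 0)"
      by (intro sum.cong) (simp_all add: uniq)
    finally show ?thesis using v(1) by simp
  qed
  have le: "a z r \<le> a z v" if z: "z \<in> Fx" for z using zv[OF z] a01[of z r] a_bd[of z v] by auto
  have "(\<Sum>z\<in>Fx. a z r) \<le> inF v" by (intro sum_mono le)
  then have "nJ v \<le> 1" using i in_F[OF v(1)] by simp
  then have nJ: "a r v = 0" using J1[OF v(1)] d a_bd(1)[of r v] by (simp add: O)
  then have inv: "inF v = 6" using in_F[OF v(1)] J1[OF v(1)] d by (simp add: O)
  have eq: "a z v = a z r" if z: "z \<in> Fx" for z
  proof (rule ccontr)
    assume "a z v \<noteq> a z r"
    then have "(\<Sum>z\<in>Fx. a z r) < inF v"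
      using le z by (intro sum_strict_mono_ex1) (auto simp: order_less_le intro!: bexI[of _ z])
    then show False using i inv by simp
  qed
  have v3: "(\<Sum>z\<in>Fx. a v z * a z r) = 3" using pFO[OF v(1), of r] vp vr d by (simp add: O Rv)
  \<comment> \<open>Without this arc all six closed two-paths at \<open>v\<close> would stay in
    \<open>Fx\<close>, but these correspond to the only three paths from \<open>v\<close> to
    \<open>r\<close>.\<close>
  have "a p v = 1"
  proof (rule ccontr)
    assume "a p v \<noteq> 1"
    then have pv: "a p v = 0" using a01[of p v] by blast
    have "IJ v v = 0" using vp vr pv nJ d by (simp add: O)
    then have "pF v v = 6" using pFF[OF v(1) v(1)] by simp
    moreover have "pF v v = (\<Sum>z\<in>Fx. a v z * a z r)" by (intro sum.cong) (simp_all add: eq)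
    ultimately show False using v3 by simp
  qed
  moreover have "a q v = 0" using J1[OF v(1)] calculation by simp
  ultimately show ?thesis using that[OF v(1) uniq eq _ _ nJ v3] by simp
qed

text \<open>Exactly three fixed vertices are joined to \<open>r\<close> in both directions, and all
  arcs between them exist. But the two-paths through \<open>r\<close> already exhaust the number
  allowed along such an arc, so no path through the third vertex is possible.\<close>

lemma case13q_False: "False"
proof -
  interpret D: case13q "\<lambda>x y. A y x" s p r q by (rule case13q_dual[OF case13q_axioms])
  have Da: "D.a x y = a y x" for x y by (simp add: D.a_def a_def)
  obtain v where v: "v \<in> Fx" "\<And>y. y \<in> Fx \<Longrightarrow> a y p - a y q = of_bool (y = v)"
    "\<And>z. z \<in> Fx \<Longrightarrow> a z v = a z r" "a p v = 1" "a q v = 0" "a r v = 0" "(\<Sum>z\<in>Fx. a v z * a z r) = 3"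
    by (rule special) blast
  obtain v' where v': "v' \<in> Fx" "\<And>y. y \<in> Fx \<Longrightarrow> a p y - a r y = of_bool (y = v')"
    "\<And>z. z \<in> Fx \<Longrightarrow> a v' z = a q z"
    by (rule D.special) (simp add: Da)
  have [simp]: "v' = v" using v'(2)[OF v(1)] v by (auto split: if_splits)
  define G where "G = {z \<in> Fx. a z r = 1 \<and> a r z = 1}"
  have vr: "a v r = 0" using I1[OF v(1)] v(2)[OF v(1)] a01[of v q] a01[of v p] a_bd(1)[of v r] by auto
  have G_iff: "of_bool (z \<in> G) = a z r * (1 - a q z)" if z: "z \<in> Fx" for z
  proof -
    have "z = v \<Longrightarrow> a z r = 0" using vr by simp
    then show ?thesis using J1[OF z] v'(2)[OF z] z a01[of z r] a01[of r z] a01[of q z]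
      by (cases "z = v") (auto simp: G_def)
  qed
  have "int (card G) = (\<Sum>z\<in>Fx. of_bool (z \<in> G))"
    by (simp add: G_def Int_absorb1 Collect_conj_eq)
  also have "\<dots> = (\<Sum>z\<in>Fx. a z r * (1 - a q z))" by (intro sum.cong) (simp_all add: G_iff)
  also have "\<dots> = inF r - (\<Sum>z\<in>Fx. a v z * a z r)"
    unfolding sum_subtractf[symmetric] by (intro sum.cong) (simp_all add: v'(3)[simplified] right_diff_distrib)
  finally have G3: "card G = 3" using v(7) i by simp
  have arc: "a c c' = 1" if c: "c \<in> G" "c' \<in> G" "c \<noteq> c'" for c c'
  proof -
    have cF: "c \<in> Fx" "a c r = 1" "a r c = 1" using c by (auto simp: G_def)
    have cJ: "a p c = 1" "a q c = 0"
      using v'(2)[OF cF(1)] J1[OF cF(1)] a01[of p c] a01[of q c] cF(3) by (auto simp: of_bool_def split: if_splits)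
    have in1: "(\<Sum>z\<in>Fx. a q z * a z c) = 1"
      using pOF[OF cF(1), of q] d cJ cF(3) by (simp add: O Rv)
    \<comment> \<open>If \<open>q\<close> sends an arc to \<open>y\<close> and \<open>y\<close>
      sends one to \<open>r\<close>, no orbit is joined to \<open>y\<close> in both directions. So
      all six reciprocated arcs of \<open>y\<close> stay in \<open>Fx\<close>, and as
      \<open>y\<close> has six fixed in-neighbours, every arc from \<open>Fx\<close> into
      \<open>y\<close> is answered.\<close>
    have rec: "a c y * (a y r * a q y) \<le> a q y * a y c" if y: "y \<in> Fx" for y
    proof (cases "a y r = 1 \<and> a q y = 1 \<and> a c y = 1")
      case True
      have y0: "a p y = 0" "a y p = 0" "a y q = 0" using J1[OF y] nbrs_r[OF y] True by auto
      have "IJ y y = a r y" using y0 True d by (simp add: O)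
      moreover have "a r y = 0" using v'(2)[OF y] y0(1) a_bd(1)[of r y] by (auto simp: of_bool_def split: if_splits)
      ultimately have "pF y y = 6" using pFF[OF y y] by simp
      moreover have "inF y = 6" using in_F[OF y] y0(1) True \<open>a r y = 0\<close> d by (simp add: O)
      ultimately have "(\<Sum>z\<in>Fx. a z y * (1 - a y z)) = 0"
        by (simp add: right_diff_distrib sum_subtractf mult.commute)
      then have "a c y * (1 - a y c) = 0"
        using cF(1) a_bd by (subst (asm) sum_nonneg_eq_0_iff) auto
      then show ?thesis using True by simp
    next
      case False
      then have "a c y * (a y r * a q y) = 0" using a01[of c y] a01[of y r] a01[of q y] by auto
      moreover have "0 \<le> a q y * a y c" by (intro mult_nonneg_nonneg a_bd)
      ultimately show ?thesis by linarith
    qed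
    have "(\<Sum>y\<in>Fx. a c y * of_bool (y \<in> G)) = (\<Sum>y\<in>Fx. a c y * a y r) - (\<Sum>y\<in>Fx. a c y * (a y r * a q y))"
      unfolding sum_subtractf[symmetric] by (intro sum.cong) (simp_all add: G_iff algebra_simps)
    moreover have "(\<Sum>y\<in>Fx. a c y * (a y r * a q y)) \<le> 1" unfolding in1[symmetric] by (rule sum_mono[OF rec])
    ultimately have ge: "(\<Sum>y\<in>Fx. a c y * of_bool (y \<in> G)) \<ge> 2" using nbrs_r(5)[OF cF(1,2)] by simp
    have "(\<Sum>y\<in>Fx. a c y * of_bool (y \<in> G)) = (\<Sum>y\<in>G. a c y)"
      by (rule sum.mono_neutral_cong_right) (auto simp: G_def)
    also have "\<dots> = a c c + (a c c' + (\<Sum>y\<in>G - {c} - {c'}. a c y))" using c by (simp add: sum.remove)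
    also have "(\<Sum>y\<in>G - {c} - {c'}. a c y) \<le> (\<Sum>y\<in>G - {c} - {c'}. 1)" by (intro sum_mono a_bd)
    also have "\<dots> = 1" using G3 c by simp
    finally show ?thesis using ge a01[of c c'] by auto
  qed
  obtain c c' c'' where c: "G = {c, c', c''}" "c \<noteq> c'" "c' \<noteq> c''" "c \<noteq> c''"
    using G3 by (auto simp: card_3_iff)
  have m: "c \<in> Fx" "c' \<in> Fx" "c'' \<in> Fx" "a c r = 1" "a r c'' = 1" using c(1) by (auto simp: G_def)
  have "IJ c c'' = 1" using nbrs_r(1,2)[OF m(1,4)] m d by (simp add: O)
  then have "pF c c'' = 0" using pFF[OF m(1,3)] c arc[of c c''] by simp
  moreover have "a c c' * a c' c'' \<le> pF c c''"
    using m(2) by (intro member_le_sum) (auto intro: mult_nonneg_nonneg a_bd)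
  ultimately show False using arc[of c c'] arc[of c' c''] c by simp
qed

end

lemma case13_False: "case13 A s p q r \<Longrightarrow> False"
proof -
  assume "case13 A s p q r"
  then interpret case13 A s p q r .
  obtain x where x: "x \<in> Fx" "nI x = 2" using ex2 by blast
  have "a x p = 1" by (rule f13_two(1)[OF f O d o x])
  then have "a x q = 1 \<or> a x r = 1" using x d a01[of x q] by (auto simp: O)
  then show False
  proof
    assume "a x q = 1"
    then have "case13q A s p q r" using x by unfold_locales blast
    then show False by (rule case13q.case13q_False)
  next
    assume r: "a x r = 1"
    have "case13q A s p r q"
      using case13_swap[OF case13_axioms] by (rule case13q.intro) (unfold_locales, use x r in blast)
    then show False by (rule case13q.case13q_False)
  qed
qed

text \<open>Reads the path equations between different orbits modulo 3; \<open>n1\<close>,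
  \<open>n2\<close>, \<open>n3\<close> stand for the numbers of paths through fixed
  vertices.\<close>

lemma R13_cases:
  fixes x y z d1 d2 d3 n1 n2 n3 :: int
  assumes "d1 = 0 \<or> d1 = 2" "d2 = 0 \<or> d2 = 2" "d3 = 0 \<or> d3 = 2" "x = 1 \<or> x = 2" "y = 1 \<or> y = 2" "z = 1 \<or> z = 2"
    "3 * n1 + (d1 * x + x * d2 + y * z) = 12 - x" "3 * n2 + (d1 * y + x * z + y * d3) = 12 - y"
    "3 * n3 + (x * y + d2 * z + z * d3) = 12 - z"
  shows "d1 = d2 \<and> d1 = d3 \<and> (d1 = 0 \<and> (x = 2 \<and> y = 2 \<and> z = 2 \<or> x = 2 \<and> y = 1 \<and> z = 1
      \<or> x = 1 \<and> y = 2 \<and> z = 1 \<or> x = 1 \<and> y = 1 \<and> z = 2) \<or> d1 = 2 \<and> (x = 1 \<and> y = 1 \<and> z = 1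
      \<or> x = 2 \<and> y = 2 \<and> z = 1 \<or> x = 2 \<and> y = 1 \<and> z = 2 \<or> x = 1 \<and> y = 2 \<and> z = 2))"
  using assms by (elim disjE; simp; presburger)

context aut3
begin

text \<open>Two out-neighbour orbits would reach at most 10 of the 13 fixed vertices.\<close>

lemma nI_le1:
  assumes f: "card Fx = 13" and o: "\<And>q. q \<in> Om \<Longrightarrow> outF q \<le> 5" and x: "x \<in> Fx"
  shows "nI x \<le> 1"
proof (rule ccontr)
  assume "\<not> ?thesis"
  then have 2: "nI x = 2" using nI_le2[OF x] f by simp
  have "13 \<le> (\<Sum>q\<in>Om. a x q * outF q)" by (rule nI_IJ_13(1)[OF f x 2])
  also have "\<dots> \<le> (\<Sum>q\<in>Om. a x q * 5)" by (intro sum_mono mult_left_mono o a_bd)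
  also have "\<dots> = nI x * 5" by (simp add: sum_distrib_right)
  finally show False using 2 by simp
qed

lemma nJ_le1:
  assumes f: "card Fx = 13" and o: "\<And>q. q \<in> Om \<Longrightarrow> inF q \<le> 5" and x: "x \<in> Fx"
  shows "nJ x \<le> 1"
proof -
  interpret D: aut3 "\<lambda>x y. A y x" s by (rule dual)
  have a: "D.a x y = a y x" for x y by (simp add: D.a_def a_def)
  show ?thesis using D.nI_le1[OF f _ x] o unfolding a by blast
qed

text \<open>The second bound sums \<open>(1 - nI x) * (1 - nJ x) \<ge> 0\<close> over the fixed
  vertices. The products \<open>nJ x * nI x\<close> count the paths from orbit to orbit through
  \<open>x\<close>.\<close>

lemma f13_small:
  assumes f: "card Fx = 13" and o: "\<And>q. q \<in> Om \<Longrightarrow> outF q \<le> 5" "\<And>q. q \<in> Om \<Longrightarrow> inF q \<le> 5"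
  shows "(\<Sum>q\<in>Om. inF q) \<le> 13" "(\<Sum>q\<in>Om. inF q) + (\<Sum>q\<in>Om. outF q) - 13 \<le> (\<Sum>p\<in>Om. \<Sum>q\<in>Om. pF p q)"
proof -
  have "(\<Sum>x\<in>Fx. nI x) \<le> (\<Sum>x\<in>Fx. 1)" by (intro sum_mono nI_le1[OF f o(1)])
  then show "(\<Sum>q\<in>Om. inF q) \<le> 13" unfolding nI_sum using f by simp
  have le: "nI x + nJ x - 1 \<le> nJ x * nI x" if x: "x \<in> Fx" for x
  proof -
    have "0 \<le> (1 - nI x) * (1 - nJ x)"
      using nI_le1[OF f o(1) x] nJ_le1[OF f o(2) x] by (intro mult_nonneg_nonneg) simp_all
    then show ?thesis by (simp add: algebra_simps)
  qed
  have "(\<Sum>p\<in>Om. \<Sum>q\<in>Om. pF p q) = (\<Sum>x\<in>Fx. nJ x * nI x)"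
  proof -
    have "(\<Sum>p\<in>Om. \<Sum>q\<in>Om. pF p q) = (\<Sum>p\<in>Om. \<Sum>x\<in>Fx. \<Sum>q\<in>Om. a p x * a x q)"
      by (intro sum.cong refl sum.swap)
    also have "\<dots> = (\<Sum>x\<in>Fx. \<Sum>p\<in>Om. \<Sum>q\<in>Om. a p x * a x q)" by (rule sum.swap)
    finally show ?thesis by (simp add: sum_product)
  qed
  moreover have "(\<Sum>x\<in>Fx. nI x + nJ x - 1) \<le> (\<Sum>x\<in>Fx. nJ x * nI x)" by (intro sum_mono le)
  moreover have "(\<Sum>x\<in>Fx. nI x + nJ x - 1) = (\<Sum>x\<in>Fx. nI x) + (\<Sum>x\<in>Fx. nJ x) - 13"
    using f by (simp add: sum.distrib sum_subtractf)
  moreover have "(\<Sum>x\<in>Fx. nJ x) = (\<Sum>q\<in>Om. outF q)" by (rule sum.swap)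
  ultimately show "(\<Sum>q\<in>Om. inF q) + (\<Sum>q\<in>Om. outF q) - 13 \<le> (\<Sum>p\<in>Om. \<Sum>q\<in>Om. pF p q)"
    unfolding nI_sum by simp
qed

text \<open>With only three orbits, \<open>star\<close> leaves no slack: \<open>U i\<close> consists
  of both other orbits, so \<open>R\<close> is symmetric with entries 1 or 2 off the diagonal and 0
  or 2 on it.\<close>

lemma card_not_13: "card Fx \<noteq> 13"
proof
  assume f: "card Fx = 13"
  then have "card Om = 3" using card_FO by simp
  then obtain p q r where O: "Om = {p, q, r}" and d: "p \<noteq> q" "q \<noteq> r" "p \<noteq> r" by (auto simp: card_3_iff)
  have Ui: "U i = Om - {i}" "R i i \<noteq> 1" if i: "i \<in> Om" for i
  proof -
    have "card (Om - {i}) = 2" using i \<open>card Om = 3\<close> by simp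
    moreover have "U i \<subseteq> Om - {i}" by (auto simp: U_def)
    ultimately show "U i = Om - {i}" using star(1)[OF i] by (intro card_subset_eq) (auto dest: card_mono[rotated])
    then show "R i i \<noteq> 1" using star(2)[OF i] \<open>card (Om - {i}) = 2\<close> by auto
  qed
  have Rd: "R i i = 0 \<or> R i i = 2" if i: "i \<in> Om" for i
    using Ui(2)[OF i] R_bd[of i i] R_diag[of i] by auto
  have Ru: "R i t = 1 \<or> R i t = 2" "R i t = R t i" if "i \<in> Om" "t \<in> Om" "t \<noteq> i" for i t
  proof -
    have t: "t \<in> U i" using Ui that by blast
    then show "R i t = 1 \<or> R i t = 2" by (simp add: U_def insert_iff)
    have "card (U i) = 2" using Ui[OF that(1)] that(1) \<open>card Om = 3\<close> by simp
    then show "R i t = R t i" using star(3)[OF that(1) _ t] by blast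
  qed
  have m: "p \<in> Om" "q \<in> Om" "r \<in> Om" using O by blast+
  have sy: "R q p = R p q" "R r p = R p r" "R r q = R q r" using Ru(2) m d by blast+
  have S: "(\<Sum>t\<in>Om. g t) = g p + g q + g r" for g :: "'v \<Rightarrow> int" using d by (simp add: O)
  have c: "R p p = R q q \<and> R p p = R r r \<and> (R p p = 0 \<and> (R p q = 2 \<and> R p r = 2 \<and> R q r = 2 \<or> R p q = 2 \<and> R p r = 1 \<and> R q r = 1
      \<or> R p q = 1 \<and> R p r = 2 \<and> R q r = 1 \<or> R p q = 1 \<and> R p r = 1 \<and> R q r = 2)
      \<or> R p p = 2 \<and> (R p q = 1 \<and> R p r = 1 \<and> R q r = 1
      \<or> R p q = 2 \<and> R p r = 2 \<and> R q r = 1 \<or> R p q = 2 \<and> R p r = 1 \<and> R q r = 2 \<or> R p q = 1 \<and> R p r = 2 \<and> R q r = 2))"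
    using pOO[OF m(1,2)] pOO[OF m(1,3)] pOO[OF m(2,3)] d
    by (intro R13_cases[OF Rd[OF m(1)] Rd[OF m(2)] Rd[OF m(3)] Ru(1)[OF m(1,2)] Ru(1)[OF m(1,3)] Ru(1)[OF m(2,3)],
          of "pF p q" "pF p r" "pF q r"]) (simp_all add: S sy)
  have os: "outF p = 9 - (R p p + R p q + R p r)" "outF q = 9 - (R p q + R q q + R q r)"
    "outF r = 9 - (R p r + R q r + R r r)" "inF p = 9 - (R p p + R p q + R p r)"
    "inF q = 9 - (R p q + R q q + R q r)" "inF r = 9 - (R p r + R q r + R r r)"
    using out_O[of p] out_O[of q] out_O[of r] in_O[of p] in_O[of q] in_O[of r] by (simp_all add: S sy)
  show False
  \<comment> \<open>Either each orbit reaches at most five fixed vertices and the counts of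
    \<open>f13_small\<close> clash, or the sizes are those of \<open>case13\<close> up to the choice
    of \<open>p\<close>.\<close>
  proof (cases "outF p \<le> 5 \<and> outF q \<le> 5 \<and> outF r \<le> 5")
    case True
    then have o: "outF t \<le> 5" "inF t \<le> 5" if "t \<in> Om" for t using that os by (auto simp: O)
    have 1: "inF p + inF q + inF r \<le> 13" using f13_small(1)[OF f o] unfolding S .
    have 2: "inF p + inF q + inF r + (outF p + outF q + outF r) - 13
      \<le> pF p p + pF p q + pF p r + (pF q p + pF q q + pF q r) + (pF r p + pF r q + pF r r)"
      using f13_small(2)[OF f o] unfolding S .
    have e: "3 * pF i j = 12 - R i j + (if i = j then 2 else 0) - (R i p * R p j + R i q * R q j + R i r * R r j)"
      if "i \<in> Om" "j \<in> Om" for i j using pOO[OF that] unfolding S by simp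
    have c1: "R q q = R p p" "R r r = R p p" using c by auto
    note c2 = conjunct2[OF conjunct2[OF c]]
    show False using 1 2 c2 os e[OF m(1,1)] e[OF m(1,2)] e[OF m(1,3)] e[OF m(2,1)] e[OF m(2,2)] e[OF m(2,3)]
      e[OF m(3,1)] e[OF m(3,2)] e[OF m(3,3)] d by (elim conjE disjE; simp add: sy c1)
  next
    case False
    then have "R p p = 0 \<and> R q q = 0 \<and> R r r = 0 \<and> (R p q = 2 \<and> R p r = 1 \<and> R q r = 1
      \<or> R p q = 1 \<and> R p r = 2 \<and> R q r = 1 \<or> R p q = 1 \<and> R p r = 1 \<and> R q r = 2)"
      using c os by auto
    then consider "case13 A s r p q" | "case13 A s q p r" | "case13 A s p q r"
    proof (elim conjE disjE)
      assume v: "R p p = 0" "R q q = 0" "R r r = 0" "R p q = 2" "R p r = 1" "R q r = 1"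
      have "Om = {r, p, q}" using O by blast
      then have "case13 A s r p q" using f v os sy d by unfold_locales simp_all
      then show ?thesis using that by blast
    next
      assume v: "R p p = 0" "R q q = 0" "R r r = 0" "R p q = 1" "R p r = 2" "R q r = 1"
      have "Om = {q, p, r}" using O by blast
      then have "case13 A s q p r" using f v os sy d by unfold_locales simp_all
      then show ?thesis using that by blast
    next
      assume v: "R p p = 0" "R q q = 0" "R r r = 0" "R p q = 1" "R p r = 1" "R q r = 2"
      then have "case13 A s p q r" using f v os sy d O by unfold_locales simp_all
      then show ?thesis using that by blast
    qed
    then show False using case13_False by cases
  qed
qed

end

section \<open>Ten fixed vertices\<close>

context aut3
begin

lemma out_F10:
  assumes f: "card Fx = 10" and x: "x \<in> Fx"
  shows "outF x = 3 \<or> outF x = 6"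
proof -
  have "k = 3 \<or> k = 6" if "3 \<le> k" "k \<noteq> 9" "k + 3 * i = 9" "0 \<le> i" for k i :: int
    using that by presburger
  from this[OF out_nz[OF x] _ out_F[OF x] nI_nonneg(1)] show ?thesis
    using not_full[OF x] f by simp
qed

text \<open>The 36 two-paths from \<open>x\<close> inside \<open>Fx\<close> exhaust the prescribed
  total, so none returns to \<open>Fx\<close> through an orbit. Hence an out-neighbour orbit
  \<open>q\<close> of \<open>x\<close> sends no arc to \<open>Fx\<close>, and the 40 two-paths from
  \<open>q\<close> to fixed vertices exceed the bound 3 times 10.\<close>

lemma out_F10_all6:
  assumes f: "card Fx = 10" and o: "\<And>x. x \<in> Fx \<Longrightarrow> outF x = 6"
  shows False
proof -
  interpret D: aut3 "\<lambda>x y. A y x" s by (rule dual)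
  have Da: "D.a x y = a y x" for x y by (simp add: D.a_def a_def)
  have le: "inF x \<le> 6" if x: "x \<in> Fx" for x using D.out_F10[OF f x] by (auto simp: Da)
  have "(\<Sum>x\<in>Fx. inF x) = (\<Sum>x\<in>Fx. outF x)" by (rule sum.swap)
  also have "\<dots> = 60" using f o by simp
  finally have s60: "(\<Sum>x\<in>Fx. inF x) = 60" .
  have i: "inF x = 6" if x: "x \<in> Fx" for x
  proof (rule ccontr)
    assume "inF x \<noteq> 6"
    then have "(\<Sum>x\<in>Fx. inF x) < (\<Sum>x\<in>Fx. 6)"
      using le x by (intro sum_strict_mono_ex1) (auto simp: order_less_le intro!: bexI[of _ x])
    then show False using f s60 by simp
  qed
  have nI: "nI x = 1" "nJ x = 1" if x: "x \<in> Fx" for x using out_F[OF x] in_F[OF x] o[OF x] i[OF x] by simp_all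
  obtain x where x: "x \<in> Fx" using f by (metis card.empty all_not_in_conv zero_neq_numeral)
  have "(\<Sum>y\<in>Fx. pF x y) = (\<Sum>z\<in>Fx. a x z * 6)" using o by (simp add: pF_sum)
  also have "\<dots> = 36" using o[OF x] by (simp add: sum_distrib_right[symmetric])
  finally have "(\<Sum>y\<in>Fx. pF x y) = 36" .
  moreover have "(\<Sum>y\<in>Fx. pF x y + 3 * IJ x y) = 36"
  proof -
    have "(\<Sum>y\<in>Fx. pF x y + 3 * IJ x y) = (\<Sum>y\<in>Fx. (if y = x then 2 else 0) + (4 - a x y))"
      by (intro sum.cong) (auto simp: pFF[OF x])
    also have "\<dots> = 2 + (40 - outF x)" using x f by (simp add: sum.distrib sum_subtractf)
    finally show ?thesis using o[OF x] by simp
  qed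
  ultimately have "(\<Sum>y\<in>Fx. IJ x y) = 0" by (simp add: sum.distrib sum_distrib_left[symmetric])
  then have z: "\<forall>q\<in>Om. a x q * outF q = 0" unfolding IJ_sum
    by (subst (asm) sum_nonneg_eq_0_iff) (auto intro: mult_nonneg_nonneg a_bd nI_nonneg)
  have "\<exists>q\<in>Om. a x q \<noteq> 0"
  proof (rule ccontr)
    assume "\<not> ?thesis" then have "nI x = 0" by (intro sum.neutral) blast
    then show False using nI(1)[OF x] by simp
  qed
  then obtain q where q: "q \<in> Om" "outF q = 0" using z by auto
  then have q0: "\<forall>z\<in>Fx. a q z = 0" by (subst (asm) sum_nonneg_eq_0_iff) (auto intro: a_bd)
  have "(\<Sum>r\<in>Om. R q r * a r x) = 4" if x: "x \<in> Fx" for x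
    using pOF[OF x q(1)] q0 x by simp
  then have "(\<Sum>x\<in>Fx. \<Sum>r\<in>Om. R q r * a r x) = (\<Sum>x\<in>Fx. 4)" by (intro sum.cong) auto
  then have "(\<Sum>r\<in>Om. R q r * outF r) = 40" using f by (subst (asm) sum.swap) (simp add: sum_distrib_left)
  moreover have "(\<Sum>r\<in>Om. R q r * outF r) \<le> (\<Sum>r\<in>Om. 3 * outF r)"
    by (intro sum_mono mult_right_mono R_bd nI_nonneg)
  moreover have "(\<Sum>r\<in>Om. outF r) = 10"
  proof -
    have "(\<Sum>r\<in>Om. outF r) = (\<Sum>x\<in>Fx. nJ x)" by (rule sum.swap)
    then show ?thesis using nI(2) f by simp
  qed
  ultimately show False by (simp add: sum_distrib_left[symmetric])
qed

text \<open>All fixed out-degrees are at least 3, so at least nine two-paths start at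
  \<open>x\<close>, which forces \<open>pF x x = 3\<close> and out-degree 3 at the out-neighbours.
  The same bound applied at these reaches all other fixed vertices.\<close>

lemma out_F10_3:
  assumes f: "card Fx = 10" and x: "x \<in> Fx" and o: "outF x = 3"
  shows "pF x x = 3" "\<And>z. z \<in> Fx \<Longrightarrow> outF z = 3"
proof -
  have ge: "3 \<le> outF z" if "z \<in> Fx" for z using out_F10[OF f that] by auto
  have S: "(\<Sum>z\<in>Fx. a x z * outF z) = pF x x + 6" using out3_sum[OF x o] f by simp
  have le: "pF x x \<le> 3" using pF_le(2)[OF x x] o by simp
  have "(\<Sum>z\<in>Fx. a x z * (outF z - 3)) = pF x x - 3"
    using S o by (simp add: right_diff_distrib sum_subtractf sum_distrib_right[symmetric])
  moreover have nn: "0 \<le> a x z * (outF z - 3)" if "z \<in> Fx" for z using ge[OF that] a_bd by simp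
  ultimately show 3: "pF x x = 3" using le sum_nonneg[of Fx "\<lambda>z. a x z * (outF z - 3)"] by simp
  then have "(\<Sum>z\<in>Fx. a x z * (outF z - 3)) = 0"
    using S o by (simp add: right_diff_distrib sum_subtractf sum_distrib_right[symmetric])
  then have nb: "outF z = 3" if "z \<in> Fx" "a x z = 1" for z
    using that nn by (subst (asm) sum_nonneg_eq_0_iff) auto
  show "outF y = 3" if y: "y \<in> Fx" for y
  proof (cases "y = x \<or> a x y = 1")
    case True then show ?thesis using nb[OF y] o by blast
  next
    case False
    then have y': "y \<noteq> x" "a x y = 0" using a01 by blast+
    then have "pF x y \<noteq> 0" using out3_path(1)[OF x o y] by simp
    then obtain z where z: "z \<in> Fx" "a x z * a z y \<noteq> 0" by (meson sum.neutral)
    then have z1: "a x z = 1" "a z y = 1" using a01[of x z] a01[of z y] by auto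
    have oz: "outF z = 3" by (rule nb[OF z(1) z1(1)])
    have "(\<Sum>w\<in>Fx. a z w * outF w) = pF z z + 6" using out3_sum[OF z(1) oz] f by simp
    moreover have "pF z z \<le> 3" using pF_le(2)[OF z(1) z(1)] oz by simp
    ultimately have "(\<Sum>w\<in>Fx. a z w * (outF w - 3)) \<le> 0"
      using oz by (simp add: right_diff_distrib sum_subtractf sum_distrib_right[symmetric])
    moreover have "a z y * (outF y - 3) \<le> (\<Sum>w\<in>Fx. a z w * (outF w - 3))"
      using y ge a_bd by (intro member_le_sum) auto
    ultimately show ?thesis using z1 ge[OF y] by simp
  qed
qed

end

text \<open>The fixed vertices carry the Petersen graph.\<close>

locale case10 = aut3 +
  assumes f: "card Fx = 10" and out3: "\<And>x. x \<in> Fx \<Longrightarrow> outF x = 3"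
    and sym: "\<And>x y. x \<in> Fx \<Longrightarrow> y \<in> Fx \<Longrightarrow> a x y = a y x"
begin

lemma in3: "x \<in> Fx \<Longrightarrow> inF x = 3"
  using out3[of x] by (simp add: sym cong: sum.cong)

lemma nIJ: "x \<in> Fx \<Longrightarrow> nI x = 2" "x \<in> Fx \<Longrightarrow> nJ x = 2"
  using out_F[of x] in_F[of x] out3[of x] in3[of x] by simp_all

lemma IJ1: "x \<in> Fx \<Longrightarrow> y \<in> Fx \<Longrightarrow> IJ x y = 1"
  using out3_path(2)[OF _ out3, of x y] out_F10_3(1)[OF f _ out3, of x] pFF[of x x]
  by (cases "x = y") auto

text \<open>The square of the adjacency matrix of a strongly regular graph with parameters (10, 3,
  0, 1).\<close>

lemma pF10: "x \<in> Fx \<Longrightarrow> y \<in> Fx \<Longrightarrow> pF x y = (if x = y then 3 else 1 - a x y)"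
  using out3_path(1)[OF _ out3, of x y] out_F10_3(1)[OF f _ out3, of x] by auto

lemma card_Om: "card Om = 4"
  using card_FO f by simp

end

lemma case10_dual: "case10 A s \<Longrightarrow> case10 (\<lambda>x y. A y x) s"
proof -
  assume "case10 A s"
  then interpret case10 A s .
  interpret D: aut3 "\<lambda>x y. A y x" s by (rule dual)
  have a: "D.a x y = a y x" for x y by (simp add: D.a_def a_def)
  show ?thesis
    by (rule case10.intro[OF dual case10_axioms.intro]) (simp_all add: a f in3 out3 sym)
qed

text \<open>The fixed vertices split into those with in-neighbour orbits \<open>p\<close>,
  \<open>t\<close> and those with \<open>q\<close>, \<open>r\<close>. By \<open>Ac\<close> this is
  an equitable partition of the Petersen graph.\<close>

locale case10J = case10 +
  fixes p q r t
  assumes O: "Om = {p, q, r, t}"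
    and d: "p \<noteq> q" "p \<noteq> r" "p \<noteq> t" "q \<noteq> r" "q \<noteq> t" "r \<noteq> t"
    and J: "\<And>z. z \<in> Fx \<Longrightarrow> a t z = a p z" "\<And>z. z \<in> Fx \<Longrightarrow> a q z = 1 - a p z" "\<And>z. z \<in> Fx \<Longrightarrow> a r z = 1 - a p z"
begin

lemma S: "(\<Sum>i\<in>Om. g i) = g p + g q + g r + g t" for g :: "'a \<Rightarrow> int"
  using d by (simp add: O)

lemma m: "p \<in> Om" "q \<in> Om" "r \<in> Om" "t \<in> Om"
  by (simp_all add: O)

lemma I: "x \<in> Fx \<Longrightarrow> a x t = 1 - a x p" "x \<in> Fx \<Longrightarrow> a x r = 1 - a x q"
proof -
  assume x: "x \<in> Fx"
  have "nI x = 2" "IJ x x = 1" using nIJ IJ1 x by blast+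
  then show "a x t = 1 - a x p" "a x r = 1 - a x q"
    using J[OF x] a01[of p x] by (auto simp: S)
qed

lemma Ac: "z \<in> Fx \<Longrightarrow> a p z = 1 \<Longrightarrow> pF p z = 3 - (R p p + R p t) \<and> pF p z = 3 - (R t p + R t t)
    \<and> R q p + R q t = 1 + pF p z \<and> R r p + R r t = 1 + pF p z"
  "z \<in> Fx \<Longrightarrow> a p z = 0 \<Longrightarrow> pF p z = 4 - (R p q + R p r) \<and> pF p z = 4 - (R t q + R t r)
    \<and> R q q + R q r = pF p z \<and> R r q + R r r = pF p z"
proof -
  assume z: "z \<in> Fx"
  have t: "pF t z = pF p z" by (intro sum.cong) (simp_all add: J)
  have q: "pF q z = inF z - pF p z" "pF r z = inF z - pF p z"
    unfolding sum_subtractf[symmetric] by (intro sum.cong; simp add: J algebra_simps)+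
  have *: "a t z = a p z" "a q z = 1 - a p z" "a r z = 1 - a p z" using J[OF z] by simp_all
  show "a p z = 1 \<Longrightarrow> pF p z = 3 - (R p p + R p t) \<and> pF p z = 3 - (R t p + R t t)
    \<and> R q p + R q t = 1 + pF p z \<and> R r p + R r t = 1 + pF p z"
    "a p z = 0 \<Longrightarrow> pF p z = 4 - (R p q + R p r) \<and> pF p z = 4 - (R t q + R t r)
    \<and> R q q + R q r = pF p z \<and> R r q + R r r = pF p z"
    using pOF[OF z m(1)] pOF[OF z m(2)] pOF[OF z m(3)] pOF[OF z m(4)] in3[OF z]
    unfolding t q S * by simp_all
qed

lemma ex: "\<exists>z\<in>Fx. a p z = 1" "\<exists>z\<in>Fx. a p z = 0"
proof -
  show "\<exists>z\<in>Fx. a p z = 1"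
  proof (rule ccontr)
    assume "\<not> ?thesis"
    then have "a q z = 1" if "z \<in> Fx" for z using J(2)[OF that] a01[of p z] that by auto
    then have "outF q = 10" using f by simp
    then show False using out_O[of q] R_bd[of q] by (simp add: S) (smt (verit) R_bd(1))
  qed
  show "\<exists>z\<in>Fx. a p z = 0"
  proof (rule ccontr)
    assume "\<not> ?thesis"
    then have "a p z = 1" if "z \<in> Fx" for z using a01[of p z] that by auto
    then have "outF p = 10" using f by simp
    then show False using out_O[of p] by (simp add: S) (smt (verit) R_bd(1))
  qed
qed

text \<open>The numbers of Petersen neighbours in the part of \<open>p\<close>: \<open>dd\<close>
  for a vertex of this part, \<open>gg\<close> for a vertex outside it (see
  \<open>Ac'\<close>).\<close>

definition "dd = 3 - (R p p + R p t)"
definition "gg = 4 - (R p q + R p r)"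

lemma Ac': "z \<in> Fx \<Longrightarrow> pF p z = gg + (dd - gg) * a p z"
  using Ac[of z] a01[of p z] by (auto simp: dd_def gg_def)

lemma rows: "R p p + R p t = 3 - dd" "R p q + R p r = 4 - gg" "R t p + R t t = 3 - dd" "R t q + R t r = 4 - gg"
  "R q p + R q t = 1 + dd" "R q q + R q r = gg" "R r p + R r t = 1 + dd" "R r q + R r r = gg"
  "0 \<le> dd" "dd \<le> 3" "0 \<le> gg" "gg \<le> 3"
proof -
  obtain z1 z0 where z: "z1 \<in> Fx" "a p z1 = 1" "z0 \<in> Fx" "a p z0 = 0" using ex by blast
  have e: "pF p z1 = dd" "pF p z0 = gg" using Ac' z by simp_all
  show "R p p + R p t = 3 - dd" "R p q + R p r = 4 - gg" "R t p + R t t = 3 - dd" "R t q + R t r = 4 - gg"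
    "R q p + R q t = 1 + dd" "R q q + R q r = gg" "R r p + R r t = 1 + dd" "R r q + R r r = gg"
    using Ac(1)[OF z(1,2)] Ac(2)[OF z(3,4)] unfolding e by simp_all
  have b: "0 \<le> pF p z" "pF p z \<le> 3" if "z \<in> Fx" for z
  proof -
    show "0 \<le> pF p z" by (rule pF_le(1))
    have "pF p z \<le> inF z"
    proof (rule sum_mono)
      fix y show "a p y * a y z \<le> a y z" using a01[of p y] a_bd[of y z] by auto
    qed
    then show "pF p z \<le> 3" using in3[OF that] by simp
  qed
  show "0 \<le> dd" "dd \<le> 3" "0 \<le> gg" "gg \<le> 3" using b[OF z(1)] b[OF z(3)] unfolding e .
qed

lemma u: "outF p = 2 + dd + gg"
  using out_O[of p] rows(1,2) by (simp add: S)

text \<open>Applies the Petersen relation \<open>A^2 + A = 2 I + J\<close> to the characteristic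
  vector of the part of \<open>p\<close>, on which \<open>A\<close> acts through \<open>dd\<close>
  and \<open>gg\<close>.\<close>

lemma square: "z \<in> Fx \<Longrightarrow> 3 * gg + (dd - gg) * pF p z = 2 * a p z + outF p - pF p z"
proof -
  assume z: "z \<in> Fx"
  have "(\<Sum>w\<in>Fx. pF p w * a w z) = (\<Sum>w\<in>Fx. gg * a w z + (dd - gg) * (a p w * a w z))"
    by (rule sum.cong[OF refl], subst Ac', assumption) (simp add: algebra_simps)
  also have "\<dots> = gg * inF z + (dd - gg) * pF p z" by (simp add: sum.distrib sum_distrib_left)
  also have "\<dots> = 3 * gg + (dd - gg) * pF p z" using in3[OF z] by simp
  finally have "(\<Sum>w\<in>Fx. pF p w * a w z) = 3 * gg + (dd - gg) * pF p z" .
  moreover have "(\<Sum>w\<in>Fx. pF p w * a w z) = (\<Sum>y\<in>Fx. a p y * pF y z)"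
    by (simp add: sum_distrib_left sum_distrib_right mult.assoc) (rule sum.swap)
  moreover have "(\<Sum>y\<in>Fx. a p y * pF y z) = (\<Sum>y\<in>Fx. (if y = z then 2 * a p z else 0) + (a p y - a p y * a y z))"
    using z by (intro sum.cong) (simp_all add: pF10 algebra_simps)
  moreover have "\<dots> = 2 * a p z + (outF p - pF p z)" using z by (simp add: sum.distrib sum_subtractf)
  ultimately show ?thesis by simp
qed

text \<open>Accordingly \<open>dd - gg\<close> is one of the Petersen eigenvalues 1 and -2.\<close>

lemma dg_cases: "dd = 2 \<and> gg = 1 \<or> dd = 0 \<and> gg = 2 \<or> dd = 1 \<and> gg = 3"
proof -
  obtain z1 z0 where z: "z1 \<in> Fx" "a p z1 = 1" "z0 \<in> Fx" "a p z0 = 0" using ex by blast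
  have e: "pF p z1 = dd" "pF p z0 = gg" using Ac' z by simp_all
  have "3 * gg + (dd - gg) * dd = 4 + gg" "3 * gg + (dd - gg) * gg = 2 + dd"
    using square[OF z(1)] square[OF z(3)] unfolding e u z by simp_all
  moreover have "dd = 0 \<or> dd = 1 \<or> dd = 2 \<or> dd = 3" "gg = 0 \<or> gg = 1 \<or> gg = 2 \<or> gg = 3" using rows(9-12) by presburger+
  ultimately show ?thesis by (elim disjE) simp_all
qed

end

context case10J
begin

lemma U_empty: "R i x = 0 \<or> R x i = 0 \<Longrightarrow> x \<notin> U i"
  by (auto simp: U_def)

text \<open>There are three other orbits. If one of them is missing from \<open>U i\<close>, the
  remaining two make up \<open>U i\<close>, and the equality case of \<open>star\<close>
  applies.\<close>

lemma U_in:
  assumes i: "i \<in> Om" and n: "x \<notin> U i" "x \<in> Om" "x \<noteq> i"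
  shows "y \<in> Om \<Longrightarrow> y \<noteq> i \<Longrightarrow> y \<noteq> x \<Longrightarrow> y \<in> U i \<and> R i y = R y i \<and> R i i \<noteq> 1"
    "y \<in> Om \<Longrightarrow> y \<noteq> i \<Longrightarrow> y \<noteq> x \<Longrightarrow> R i y = 1 \<or> R i y = 2"
proof -
  assume y: "y \<in> Om" "y \<noteq> i" "y \<noteq> x"
  have sub: "U i \<subseteq> Om - {i} - {x}" using n(1) unfolding U_def by blast
  have c: "card (Om - {i} - {x}) = 2" using i n(2,3) card_Om by simp
  have "card (U i) \<le> 2" using card_mono[OF _ sub] c by simp
  then have 2: "card (U i) = 2" "R i i \<noteq> 1" using star(1)[OF i] star(2)[OF i] by linarith+
  have "U i = Om - {i} - {x}" by (rule card_subset_eq[OF _ sub]) (simp_all add: 2 c)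
  then have yU: "y \<in> U i" using y by blast
  show "y \<in> U i \<and> R i y = R y i \<and> R i i \<noteq> 1" using yU star(3)[OF i 2(1) yU] 2(2) by blast
  show "R i y = 1 \<or> R i y = 2" using yU unfolding U_def by blast
qed

text \<open>The path equations from \<open>t\<close> to \<open>q\<close> and to \<open>r\<close>
  make \<open>R p q\<close> and \<open>R p r\<close> multiples of 3, so neither orbit lies in
  \<open>U p\<close>, which needs two members.\<close>

lemma not_21: "\<not> (dd = 2 \<and> gg = 1)"
proof
  assume dg: "dd = 2 \<and> gg = 1"
  note r = rows[unfolded conjunct1[OF dg] conjunct2[OF dg]]
  have diag: "R i i = 0 \<and> R i j = 1" if i: "i \<in> Om" "j \<in> Om" "j \<noteq> i" "R i i + R i j = 1" for i j
  proof (rule ccontr)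
    assume "\<not> ?thesis"
    then have 1: "R i i = 1" "R i j = 0" using i(4) R_bd(1)[of i i] R_bd(1)[of i j] by auto
    have "\<exists>y\<in>Om. y \<noteq> i \<and> y \<noteq> j"
    proof (rule ccontr)
      assume "\<not> ?thesis" then have "Om \<subseteq> {i, j}" by blast
      then have "card Om \<le> card {i, j}" by (intro card_mono) simp_all
      also have "\<dots> \<le> 2" by (simp add: card_insert_if)
      finally show False using card_Om by simp
    qed
    then show False using U_in(1)[OF i(1) U_empty i(2,3)] 1 by blast
  qed
  have v: "R p p = 0" "R p t = 1" "R t t = 0" "R t p = 1" "R q q = 0" "R q r = 1" "R r r = 0" "R r q = 1"
    using diag[OF m(1,4)] diag[OF m(4,1)] diag[OF m(2,3)] diag[OF m(3,2)] r d by auto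
  have mod3: "R p q mod 3 = 0" "R p r mod 3 = 0"
  proof -
    have "R p q + R t r + R t q = 12 - 3 * pF t q" "R p r + R t q + R t r = 12 - 3 * pF t r"
      using pOO[OF m(4,2)] pOO[OF m(4,3)] d unfolding S v by simp_all
    moreover have "R t q + R t r = 3" using r(4) by simp
    ultimately have "R p q = 3 * (3 - pF t q)" "R p r = 3 * (3 - pF t r)" by simp_all
    then show "R p q mod 3 = 0" "R p r mod 3 = 0" by simp_all
  qed
  have "R p q \<notin> {1, 2}" using mod3(1) by auto
  then have "q \<notin> U p" by (auto simp: U_def)
  then have "r \<in> U p" using U_in(1)[OF m(1) _ m(2), of r] m d by blast
  then show False using mod3(2) by (auto simp: U_def)
qed

text \<open>All block sizes are determined. Counting the Petersen arcs between the fixed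
  in-neighbours of \<open>p\<close> and those of \<open>q\<close> from both ends gives
  \<open>5 + X = 10 - 2 * X\<close> for the number \<open>X\<close> of common ones, which has no
  integer solution.\<close>

lemma not_02_aux:
  assumes dg: "dd = 0" "gg = 2" and v: "R q p = 1" "R r t = 1"
  shows False
proof -
  note rr = rows[unfolded dg]
  have z: "R q t = 0" "R r p = 0" using rr v by simp_all
  have pq: "R p q = R q p" "R q r = 1 \<or> R q r = 2" "R q q \<noteq> 1"
    using U_in[OF m(2) U_empty m(4)] z m d by metis+
  have tr: "R t r = R r t" "R r q = 1 \<or> R r q = 2" "R r r \<noteq> 1"
    using U_in[OF m(3) U_empty m(1)] z m d by metis+
  have pt: "R p t = 1 \<or> R p t = 2" "R p p \<noteq> 1"
    using U_in[OF m(1) U_empty m(3)] z m d by metis+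
  have tp: "R t p = 1 \<or> R t p = 2" "R t t \<noteq> 1"
    using U_in[OF m(4) U_empty m(2)] z m d by metis+
  have R: "R p q = 1" "R p r = 1" "R q q = 0" "R q r = 2" "R t r = 1" "R t q = 1" "R r r = 0" "R r q = 2"
    "R p p = 2" "R p t = 1" "R t t = 2" "R t p = 1"
    using pq tr pt tp rr v R_diag[of p] R_diag[of t] by auto
  have sp: "inF p = 5" "inF q = 5" using in_O[of p] in_O[of q] by (simp_all add: S R v z)
  have e: "(\<Sum>y\<in>Fx. a x y * a y p) = 3 - 2 * a x p - a x q" "(\<Sum>y\<in>Fx. a x y * a y q) = 1 + a x q"
    if x: "x \<in> Fx" for x
    using pFO[OF x m(1)] pFO[OF x m(2)] unfolding S R v z I[OF x] by simp_all
  have "(\<Sum>x\<in>Fx. a x p * (\<Sum>y\<in>Fx. a x y * a y q)) = (\<Sum>y\<in>Fx. a y q * (\<Sum>x\<in>Fx. a y x * a x p))"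
    by (simp only: sum_distrib_left, subst sum.swap, intro sum.cong refl) (simp add: sym)
  then have "(\<Sum>x\<in>Fx. a x p * (1 + a x q)) = (\<Sum>y\<in>Fx. a y q * (3 - 2 * a y p - a y q))"
    by (simp add: e cong: sum.cong)
  moreover have "(\<Sum>x\<in>Fx. a x p * (1 + a x q)) = 5 + (\<Sum>x\<in>Fx. a x p * a x q)"
    using sp by (simp add: distrib_left sum.distrib)
  moreover have "(\<Sum>y\<in>Fx. a y q * (3 - 2 * a y p - a y q)) = (\<Sum>y\<in>Fx. 2 * a y q - 2 * (a y p * a y q))"
  proof (rule sum.cong[OF refl])
    fix y show "a y q * (3 - 2 * a y p - a y q) = 2 * a y q - 2 * (a y p * a y q)"
      using a01[of y q] by auto
  qed
  moreover have "\<dots> = 10 - 2 * (\<Sum>x\<in>Fx. a x p * a x q)"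
    using sp by (simp add: sum_subtractf sum_distrib_left[symmetric])
  ultimately have "3 * (\<Sum>x\<in>Fx. a x p * a x q) = 5" by simp
  moreover have "3 * k \<noteq> 5" for k :: int by presburger
  ultimately show False by blast
qed

end

text \<open>The first exchange complements the distinguished part of \<open>Fx\<close> and turns
  \<open>(dd, gg)\<close> into \<open>(3 - gg, 3 - dd)\<close>. The second exchanges two orbits with
  the same fixed out-neighbours.\<close>

lemma case10J_swap: "case10J A s p q r t \<Longrightarrow> case10J A s q p t r" "case10J A s p q r t \<Longrightarrow> case10J A s t q r p"
proof -
  assume "case10J A s p q r t"
  then interpret case10J A s p q r t .
  have "Om = {q, p, t, r}" "Om = {t, q, r, p}" using O by auto
  then show "case10J A s q p t r" "case10J A s t q r p"
    using d by (unfold_locales; simp add: J)+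
qed

context case10J
begin

lemma not_02: "\<not> (dd = 0 \<and> gg = 2)"
proof
  assume dg: "dd = 0 \<and> gg = 2"
  note rr = rows[unfolded conjunct1[OF dg] conjunct2[OF dg]]
  interpret W: case10J A s t q r p by (rule case10J_swap(2)[OF case10J_axioms])
  have Wdg: "W.dd = 0" "W.gg = 2" using rr by (simp_all add: W.dd_def W.gg_def)
  have q: "R q p = 0 \<and> R q t = 1 \<or> R q p = 1 \<and> R q t = 0" using rr(5) R_bd(1)[of q p] R_bd(1)[of q t] by auto
  have r: "R r p = 0 \<and> R r t = 1 \<or> R r p = 1 \<and> R r t = 0" using rr(7) R_bd(1)[of r p] R_bd(1)[of r t] by auto
  have not: "\<not> (R q i = 0 \<and> R r i = 0)" if i: "i \<in> Om" "q \<noteq> i" "r \<noteq> i" for i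
    using U_in(1)[OF i(1) U_empty m(2) i(2), of r] U_empty[of i r] m i d by blast
  show False using not_02_aux W.not_02_aux dg Wdg q r not[OF m(1)] not[OF m(4)] d by blast
qed

lemma case10J_False: False
proof -
  interpret W: case10J A s q p t r by (rule case10J_swap(1)[OF case10J_axioms])
  have "W.dd = 3 - gg" "W.gg = 3 - dd" using rows by (simp_all add: W.dd_def W.gg_def)
  then show False using dg_cases not_21 not_02 W.not_02 by auto
qed

end

context case10
begin

text \<open>Every pair of out-neighbour orbits meets every pair of in-neighbour orbits in exactly
  one orbit. If an in-pair besides \<open>{p, t}\<close> and \<open>{q, r}\<close> occurs, each
  out-pair is transversal to two different partitions of the four orbits. Only two complementary
  out-pairs remain, which is the situation of \<open>case10J\<close> in the reversed graph.\<close>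

lemma families:
  obtains p q r t where "case10J A s p q r t" | p q r t where "case10J (\<lambda>x y. A y x) s p q r t"
proof -
  obtain z0 where z0: "z0 \<in> Fx" using f by (metis card.empty all_not_in_conv zero_neq_numeral)
  have "\<exists>xs. distinct xs \<and> set xs = Om" using finite_distinct_list[of Om] by auto
  then obtain xs where xs: "distinct xs" "set xs = Om" by blast
  then have "length xs = 4" using card_Om distinct_card by fastforce
  then obtain i j k l where "xs = [i, j, k, l]" by (auto simp: length_Suc_conv numeral_eq_Suc)
  then have O: "Om = {i, j, k, l}" "distinct [i, j, k, l]" using xs by auto
  have "a i z0 + a j z0 + a k z0 + a l z0 = 2" using nIJ(2)[OF z0] O by simp
  then have "\<exists>p t q r. Om = {p, q, r, t} \<and> distinct [p, q, r, t] \<and> a p z0 = 1 \<and> a t z0 = 1 \<and> a q z0 = 0 \<and> a r z0 = 0"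
    using O a01[of i z0] a01[of j z0] a01[of k z0] a01[of l z0]
    by (elim disjE) (auto simp: insert_commute; metis insert_commute)+
  then obtain p t q r where O: "Om = {p, q, r, t}" and d: "distinct [p, q, r, t]"
    and z: "a p z0 = 1" "a t z0 = 1" "a q z0 = 0" "a r z0 = 0" by blast
  have S: "(\<Sum>i\<in>Om. g i) = g p + g q + g r + g t" for g :: "'a \<Rightarrow> int"
    using d by (simp add: O)
  have pt: "a x p + a x t = 1" "a x q + a x r = 1" if x: "x \<in> Fx" for x
    using IJ1[OF x z0] nIJ(1)[OF x] by (simp_all add: S z)
  have dJ: "p \<noteq> q" "p \<noteq> r" "p \<noteq> t" "q \<noteq> r" "q \<noteq> t" "r \<noteq> t" using d by auto
  have dual1: "\<exists>p q r t. case10J (\<lambda>x y. A y x) s p q r t"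
    if z1: "z1 \<in> Fx" "a p z1 = 1" "a q z1 = 1" and O: "Om = {p, q, r, t}" and d: "distinct [p, q, r, t]"
      and pt: "\<And>x. x \<in> Fx \<Longrightarrow> a x p + a x t = 1" for z1 p q r t
  proof -
    interpret D: case10 "\<lambda>x y. A y x" s by (rule case10_dual) unfold_locales
    have Da: "D.a x y = a y x" for x y by (simp add: D.a_def a_def)
    have S: "(\<Sum>i\<in>Om. g i) = g p + g q + g r + g t" for g :: "'a \<Rightarrow> int"
      using d by (simp add: O)
    have rt: "a r z1 = 0" "a t z1 = 0" using nIJ(2)[OF z1(1)] z1(2,3) a_bd(1)[of r z1] a_bd(1)[of t z1] by (simp_all add: S)
    have e: "a x r = a x p" "a x t = 1 - a x p" "a x q = 1 - a x p" if x: "x \<in> Fx" for x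
      using IJ1[OF x z1(1)] nIJ(1)[OF x] pt[OF x] rt z1 by (simp_all add: S)
    have "Om = {p, q, t, r}" using O by auto
    then have "case10J (\<lambda>x y. A y x) s p q t r"
      using d by unfold_locales (auto simp: Da e)
    then show ?thesis by blast
  qed
  show ?thesis
  proof (cases "\<exists>z1\<in>Fx. a p z1 \<noteq> a t z1")
    case False
    have "case10J A s p q r t"
    proof unfold_locales
      fix x assume x: "x \<in> Fx"
      have "IJ z0 x = 1" "nJ x = 2" using IJ1[OF z0 x] nIJ(2)[OF x] by simp_all
      then show "a t x = a p x" "a q x = 1 - a p x" "a r x = 1 - a p x"
        using False x pt[OF z0] a01[of z0 p] a01[of z0 q] a01[of p x] a01[of t x] by (auto simp: S)
    qed (use O dJ in simp_all)
    then show ?thesis using that by blast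
  next
    case True
    then obtain z1 where z1: "z1 \<in> Fx" "a p z1 \<noteq> a t z1" by blast
    have s1: "a p z1 + a q z1 + a r z1 + a t z1 = 2" using nIJ(2)[OF z1(1)] unfolding S .
    have c: "a p z1 = 1 \<and> a t z1 = 0 \<or> a p z1 = 0 \<and> a t z1 = 1" "a q z1 = 1 \<and> a r z1 = 0 \<or> a q z1 = 0 \<and> a r z1 = 1"
      using z1(2) s1 a01[of p z1] a01[of t z1] a01[of q z1] a01[of r z1] by auto
    have O': "Om = {p, r, q, t}" "Om = {t, q, r, p}" "Om = {t, r, q, p}" using O by auto
    have pt': "\<And>x. x \<in> Fx \<Longrightarrow> a x t + a x p = 1" using pt by (simp add: add.commute)
    have "\<exists>p q r t. case10J (\<lambda>x y. A y x) s p q r t"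
      using c
    proof (elim disjE conjE)
      assume "a p z1 = 1" "a q z1 = 1" then show ?thesis using dual1[OF z1(1) _ _ O d pt(1)] by blast
    next
      assume "a p z1 = 1" "a r z1 = 1" then show ?thesis using dual1[OF z1(1) _ _ O'(1) _ pt(1)] d by auto
    next
      assume "a t z1 = 1" "a q z1 = 1" then show ?thesis using dual1[OF z1(1) _ _ O'(2) _ pt'] d by auto
    next
      assume "a t z1 = 1" "a r z1 = 1" then show ?thesis using dual1[OF z1(1) _ _ O'(3) _ pt'] d by auto
    qed
    then show ?thesis using that by blast
  qed
qed

lemma case10_False: False
  using families case10J.case10J_False by metis

end

context aut3
begin

lemma card_not_10: "card Fx \<noteq> 10"
proof
  assume f: "card Fx = 10"
  show False
  proof (cases "\<exists>x\<in>Fx. outF x = 3")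
    case True
    then obtain x where x: "x \<in> Fx" "outF x = 3" by blast
    have o: "outF z = 3" if "z \<in> Fx" for z by (rule out_F10_3(2)[OF f x that])
    have le: "a x y \<le> a y x" if xy: "x \<in> Fx" "y \<in> Fx" for x y
    proof -
      have "(\<Sum>z\<in>Fx. a x z * (1 - a z x)) = 0"
        using out_F10_3(1)[OF f xy(1) o[OF xy(1)]] o[OF xy(1)] by (simp add: right_diff_distrib sum_subtractf)
      then have "a x y * (1 - a y x) = 0"
        using xy(2) a_bd by (subst (asm) sum_nonneg_eq_0_iff) auto
      then show ?thesis using a01[of x y] a01[of y x] by auto
    qed
    have "case10 A s" using f o le by unfold_locales (auto intro: antisym)
    then show False by (rule case10.case10_False)
  next
    case False
    then show False using out_F10[OF f] out_F10_all6[OF f] by blast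
  qed
qed

theorem card_Fx:
  assumes "Om \<noteq> {}"
  shows "card Fx = 1" "card Om = 7"
proof -
  show 1: "card Fx = 1" using f_cases[OF assms] card_not_10 card_not_13 by auto
  show "card Om = 7" using card_FO 1 by simp
qed

end

section \<open>Sums over orbits and labelled vertices\<close>

instantiation idx :: finite
begin
instance
proof
  have "(UNIV :: idx set) = {I0, I1, I2, I3, I4, I5, I6}" using idx.exhaust by blast
  then show "finite (UNIV :: idx set)" by (metis finite.emptyI finite.insertI)
qed
end

instantiation z3 :: finite
begin
instance
proof
  have "(UNIV :: z3 set) = {D0, D1, D2}" using z3.exhaust by blast
  then show "finite (UNIV :: z3 set)" by (metis finite.emptyI finite.insertI)
qed
end

lemma UNIV_idx: "(UNIV :: idx set) = {I0, I1, I2, I3, I4, I5, I6}"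
  using idx.exhaust by blast

lemma UNIV_z3: "(UNIV :: z3 set) = {D0, D1, D2}"
  using z3.exhaust by blast

lemma all_z3: "(\<forall>d. P d) \<longleftrightarrow> P D0 \<and> P D1 \<and> P D2"
  by (metis z3.exhaust)

lemma sum_idx: "(\<Sum>i\<in>UNIV. g i) = g I0 + g I1 + g I2 + g I3 + g I4 + g I5 + (g I6 :: int)"
  by (simp add: UNIV_idx)

lemma sum_z3: "(\<Sum>d\<in>UNIV. g d) = g D0 + g D1 + (g D2 :: int)"
  by (simp add: UNIV_z3)

lemma sum_vx:
  fixes g :: "vx \<Rightarrow> int"
  shows "(\<Sum>x\<in>UNIV. g x) = g None + (\<Sum>i\<in>UNIV. \<Sum>d\<in>UNIV. g (Some (i, d)))"
proof -
  have "(\<Sum>x\<in>UNIV. g x) = g None + (\<Sum>x\<in>range Some. g x)"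
    unfolding UNIV_option_conv by (subst sum.insert) auto
  also have "(\<Sum>x\<in>range Some. g x) = (\<Sum>p\<in>UNIV. g (Some p))"
    by (simp add: sum.reindex)
  also have "\<dots> = (\<Sum>i\<in>UNIV. \<Sum>d\<in>UNIV. g (Some (i, d)))"
    by (simp add: sum.cartesian_product UNIV_Times_UNIV[symmetric] del: UNIV_Times_UNIV)
  finally show ?thesis .
qed

lemma card_vx: "card (UNIV :: vx set) = 22"
proof -
  have "int (card (UNIV :: vx set)) = (\<Sum>x\<in>(UNIV :: vx set). 1)" by simp
  also have "\<dots> = 22" unfolding sum_vx sum_idx sum_z3 by simp
  finally show ?thesis by simp
qed

section \<open>Block matrices of the graphs\<close>

text \<open>The fixed vertex is \<open>None\<close>, and the automorphism adds 1 in the integers modulo 3.\<close>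

definition adjS :: "(idx \<Rightarrow> idx \<Rightarrow> z3 \<Rightarrow> bool) \<Rightarrow> vx \<Rightarrow> vx \<Rightarrow> bool" where
  "adjS S x y = (case x of None \<Rightarrow> (case y of None \<Rightarrow> False | Some (j, b) \<Rightarrow> iw j)
     | Some (i, a) \<Rightarrow> (case y of None \<Rightarrow> ou i | Some (j, b) \<Rightarrow> S i j (dif b a)))"

lemma adjS_simps [simp]:
  "adjS S None None = False" "adjS S None (Some (j, b)) = iw j" "adjS S (Some (i, a)) None = ou i"
  "adjS S (Some (i, a)) (Some (j, b)) = S i j (dif b a)"
  by (simp_all add: adjS_def)

definition isoA :: "('a \<Rightarrow> 'a \<Rightarrow> bool) \<Rightarrow> ('b \<Rightarrow> 'b \<Rightarrow> bool) \<Rightarrow> bool" where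
  "isoA A B \<longleftrightarrow> (\<exists>h. bij h \<and> (\<forall>x y. A x y = B (h x) (h y)))"

lemma isoA_refl: "isoA A A"
  unfolding isoA_def by (rule exI[of _ id]) simp

lemma isoA_sym: "isoA A B \<Longrightarrow> isoA B A"
proof -
  assume "isoA A B"
  then obtain h where h: "bij h" "\<And>x y. A x y = B (h x) (h y)" by (auto simp: isoA_def)
  have "B x y = A (inv_into UNIV h x) (inv_into UNIV h y)" for x y
    using h by (simp add: bij_is_surj surj_f_inv_f)
  then show "isoA B A" unfolding isoA_def using bij_imp_bij_inv[OF h(1)] by blast
qed

lemma isoA_trans: "isoA A B \<Longrightarrow> isoA B C \<Longrightarrow> isoA A C"
proof -
  assume "isoA A B" "isoA B C"
  then obtain h k where h: "bij h" "\<And>x y. A x y = B (h x) (h y)" and k: "bij k" "\<And>x y. B x y = C (k x) (k y)"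
    by (auto simp: isoA_def)
  then show "isoA A C" unfolding isoA_def by (intro exI[of _ "k \<circ> h"]) (simp add: bij_comp)
qed

definition srg :: "('v::finite \<Rightarrow> 'v \<Rightarrow> bool) \<Rightarrow> bool" where
  "srg A \<longleftrightarrow> (\<forall>x. \<not> A x x) \<and> (\<forall>x. (\<Sum>y\<in>UNIV. of_bool (A x y)) = (9::int)) \<and>
     (\<forall>x. (\<Sum>y\<in>UNIV. of_bool (A y x)) = (9::int)) \<and>
     (\<forall>x y. (\<Sum>z\<in>UNIV. of_bool (A x z) * of_bool (A z y)) = (if x = y then 6 else if A x y then 3 else 4 :: int))"

lemma srg_iso:
  assumes "isoA A B" "srg B"
  shows "srg A"
proof -
  obtain h where h: "bij h" "\<And>x y. A x y = B (h x) (h y)" using assms by (auto simp: isoA_def)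
  have re: "(\<Sum>y\<in>UNIV. g (h y)) = (\<Sum>y\<in>UNIV. (g y :: int))" for g
    using sum.reindex_bij_betw[OF h(1)] .
  have eq: "h x = h y \<longleftrightarrow> x = y" for x y using h(1) by (simp add: bij_is_inj inj_eq)
  have 1: "(\<Sum>y\<in>UNIV. of_bool (A x y)) = (\<Sum>y\<in>UNIV. of_bool (B (h x) y) :: int)" for x
    unfolding h(2) by (rule re[of "\<lambda>y. of_bool (B (h x) y)"])
  have 2: "(\<Sum>y\<in>UNIV. of_bool (A y x)) = (\<Sum>y\<in>UNIV. of_bool (B y (h x)) :: int)" for x
    unfolding h(2) by (rule re[of "\<lambda>y. of_bool (B y (h x))"])
  have 3: "(\<Sum>z\<in>UNIV. of_bool (A x z) * of_bool (A z y)) = (\<Sum>z\<in>UNIV. of_bool (B (h x) z) * of_bool (B z (h y)) :: int)" for x y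
    unfolding h(2) by (rule re[of "\<lambda>z. of_bool (B (h x) z) * of_bool (B z (h y))"])
  have B: "\<not> B x x" "(\<Sum>y\<in>UNIV. of_bool (B x y)) = (9::int)" "(\<Sum>y\<in>UNIV. of_bool (B y x)) = (9::int)"
    "(\<Sum>z\<in>UNIV. of_bool (B x z) * of_bool (B z y)) = (if x = y then 6 else if B x y then 3 else 4 :: int)" for x y
    using assms(2) unfolding srg_def by blast+
  show ?thesis unfolding srg_def
  proof (intro conjI allI)
    fix x y
    show "\<not> A x x" unfolding h(2) by (rule B)
    show "(\<Sum>y\<in>UNIV. of_bool (A x y)) = (9::int)" unfolding 1 by (rule B)
    show "(\<Sum>y\<in>UNIV. of_bool (A y x)) = (9::int)" unfolding 2 by (rule B)
    show "(\<Sum>z\<in>UNIV. of_bool (A x z) * of_bool (A z y)) = (if x = y then 6 else if A x y then 3 else 4 :: int)"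
      unfolding 3 B(4) eq h(2)[of x y] by (rule refl)
  qed
qed

lemma sum_of_bool_card: "finite X \<Longrightarrow> (\<Sum>x\<in>X. of_bool (P x)) = int (card {x \<in> X. P x})"
  by (simp add: of_bool_def sum.inter_filter[symmetric])

context aut3
begin

lemma Fx_card1:
  assumes O: "Om \<noteq> {}"
  obtains p where "Fx = {p}" "(\<Sum>q\<in>Om. a p q) = 3" "(\<Sum>q\<in>Om. a q p) = 3" "(\<Sum>q\<in>Om. a p q * a q p) = 2"
proof -
  obtain p where p: "Fx = {p}" using card_Fx(1)[OF O] by (auto simp: card_1_singleton_iff)
  then show ?thesis using that[of p] out_F[of p] in_F[of p] pFF[of p p] by simp
qed

text \<open>Chosen representatives \<open>r i\<close> provide coordinates:
  \<open>Some (i, k)\<close> labels the vertex obtained from \<open>r i\<close> by applying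
  \<open>s\<close> as often as \<open>k\<close> says, and rotating both ends of an arc leaves only
  the difference of the second coordinates.\<close>

lemma label:
  assumes O: "Om \<noteq> {}"
  shows "\<exists>S. isoA (adjS S) A"
proof -
  obtain p where p: "Fx = {p}" "(\<Sum>q\<in>Om. a p q) = 3" "(\<Sum>q\<in>Om. a q p) = 3" "(\<Sum>q\<in>Om. a p q * a q p) = 2"
    using Fx_card1[OF O] .
  have p1: "int (card {q \<in> Om. A p q}) = 3" "int (card {q \<in> Om. A q p}) = 3" "int (card {q \<in> Om. A p q \<and> A q p}) = 2"
    using p(2-4) unfolding a_def of_bool_conj[symmetric] sum_of_bool_card[OF finite] .
  let ?B = "{q \<in> Om. A p q \<and> A q p}" and ?C = "{q \<in> Om. A p q \<and> \<not> A q p}"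
    and ?D = "{q \<in> Om. \<not> A p q \<and> A q p}" and ?E = "{q \<in> Om. \<not> A p q \<and> \<not> A q p}"
  have B: "card ?B = 2" using p1(3) by simp
  have "?B \<union> ?C = {q \<in> Om. A p q}" "?B \<union> ?D = {q \<in> Om. A q p}" by blast+
  then have "card (?B \<union> ?C) = 3" "card (?B \<union> ?D) = 3" using p1(1,2) by simp_all
  moreover have "card (?B \<union> ?C) = card ?B + card ?C" "card (?B \<union> ?D) = card ?B + card ?D"
    by (intro card_Un_disjoint; auto)+
  ultimately have C: "card ?C = 1" and D: "card ?D = 1" using B by simp_all
  have "card (?B \<union> ?C \<union> ?D \<union> ?E) = card ?B + card ?C + card ?D + card ?E"
    by (subst card_Un_disjoint; (auto)[1])+
  moreover have "?B \<union> ?C \<union> ?D \<union> ?E = Om" by blast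
  ultimately have E: "card ?E = 3" using B C D card_Fx(2)[OF O] by simp
  obtain b0 b1 where b: "?B = {b0, b1}" "b0 \<noteq> b1" using B by (auto simp: card_2_iff)
  obtain c where c: "?C = {c}" using C by (auto simp: card_1_singleton_iff)
  obtain d where d: "?D = {d}" using D by (auto simp: card_1_singleton_iff)
  obtain e0 e1 e2 where e: "?E = {e0, e1, e2}" using E by (auto simp: card_3_iff)
  define r where "r i = (case i of I0 \<Rightarrow> b0 | I1 \<Rightarrow> b1 | I2 \<Rightarrow> c | I3 \<Rightarrow> d | I4 \<Rightarrow> e0 | I5 \<Rightarrow> e1 | I6 \<Rightarrow> e2)" for i
  define sp where "sp k x = (case k of D0 \<Rightarrow> x | D1 \<Rightarrow> s x | D2 \<Rightarrow> s (s x))" for k x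
  have rOm: "range r = Om"
  proof -
    have "range r = {b0, b1} \<union> {c} \<union> {d} \<union> {e0, e1, e2}"
      unfolding UNIV_idx by (auto simp: r_def)
    also have "\<dots> = Om" unfolding b(1)[symmetric] c[symmetric] d[symmetric] e[symmetric] by blast
    finally show ?thesis .
  qed
  have adj: "A p (r i) = iw i" "A (r i) p = ou i" for i
  proof -
    have "b0 \<in> ?B" "b1 \<in> ?B" "c \<in> ?C" "d \<in> ?D" "e0 \<in> ?E" "e1 \<in> ?E" "e2 \<in> ?E"
      unfolding b(1) c d e by simp_all
    then show "A p (r i) = iw i" "A (r i) p = ou i" by (cases i; simp add: r_def)+
  qed
  define h where "h x = (case x of None \<Rightarrow> p | Some (i, k) \<Rightarrow> sp k (r i))" for x :: vx
  define S where "S i j k = A (r i) (sp k (r j))" for i j k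
  have pF: "s p = p" using p(1) by (auto simp: Fx_def)
  have surj: "x \<in> range h" for x
  proof (cases "x \<in> Fx")
    case True then show ?thesis using p(1) by (auto simp: h_def intro: image_eqI[of _ _ None])
  next
    case False
    then have "rep x \<in> Om" by (simp add: Om_def)
    then obtain i where i: "rep x = r i" using rOm by auto
    have "x \<in> orb (rep x)" by (simp add: orb_rep) (simp add: orb_def)
    then have "x = sp D0 (r i) \<or> x = sp D1 (r i) \<or> x = sp D2 (r i)" unfolding i by (simp add: orb_def sp_def)
    then obtain k where "x = sp k (r i)" by blast
    then have "x = h (Some (i, k))" by (simp add: h_def)
    then show ?thesis by blast
  qed
  then have "surj h" by blast
  then have "card (range h) = card (UNIV :: vx set)" unfolding card_vx card22[symmetric] by simp
  then have "inj h" by (rule eq_card_imp_inj_on[OF finite])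
  then have "bij h" using \<open>surj h\<close> by (simp add: bij_def)
  moreover have "adjS S x y = A (h x) (h y)" for x y
  proof (cases x; cases y)
    fix xp yp assume x: "x = Some xp" "y = Some yp"
    obtain i k j l where xy: "xp = (i, k)" "yp = (j, l)" by (cases xp; cases yp) auto
    have A1: "A (s u) v = A u (s (s v))" "A (s (s u)) v = A u (s v)" for u v
      using aut[of u "s (s v)"] aut[of "s u" "s (s v)"] aut[of u "s v"] cube by simp_all
    show ?thesis unfolding x xy by (cases k; cases l) (simp_all add: h_def S_def sp_def A1 cube)
  next
    fix yp assume x: "x = None" "y = Some yp"
    obtain j l where y: "yp = (j, l)" by (cases yp)
    have "A p (s v) = A p v" for v using aut[of p v] pF by simp
    then show ?thesis unfolding x y by (cases l) (simp_all add: h_def sp_def adj)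
  next
    fix xp assume x: "x = Some xp" "y = None"
    obtain j l where y: "xp = (j, l)" by (cases xp)
    have "A (s v) p = A v p" for v using aut[of v p] pF by simp
    then show ?thesis unfolding x y by (cases l) (simp_all add: h_def sp_def adj)
  next
    assume "x = None" "y = None" then show ?thesis using loop by (simp add: h_def)
  qed
  ultimately show ?thesis unfolding isoA_def by blast
qed

end

section \<open>Equations for block sizes and residues\<close>

definition bt :: "bool \<Rightarrow> int" where "bt b = of_bool b"

lemma bt_simps [simp]: "bt True = 1" "bt False = 0"
  by (simp_all add: bt_def)

lemma bt_bd: "0 \<le> bt b" "bt b \<le> 1"
  by (simp_all add: bt_def)

definition nn :: "(idx \<Rightarrow> idx \<Rightarrow> z3 \<Rightarrow> bool) \<Rightarrow> idx \<Rightarrow> idx \<Rightarrow> int" where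
  "nn S i j = bt (S i j D0) + bt (S i j D1) + bt (S i j D2)"

definition ww :: "(idx \<Rightarrow> idx \<Rightarrow> z3 \<Rightarrow> bool) \<Rightarrow> idx \<Rightarrow> idx \<Rightarrow> int" where
  "ww S i j = bt (S i j D0) + 3 * bt (S i j D1) + 9 * bt (S i j D2)"

locale vsrg =
  fixes S :: "idx \<Rightarrow> idx \<Rightarrow> z3 \<Rightarrow> bool"
  assumes srg: "srg (adjS S)"
begin

lemma srg': "\<not> adjS S x x" "(\<Sum>y\<in>UNIV. bt (adjS S x y)) = 9" "(\<Sum>y\<in>UNIV. bt (adjS S y x)) = 9"
  "(\<Sum>z\<in>UNIV. bt (adjS S x z) * bt (adjS S z y)) = (if x = y then 6 else if adjS S x y then 3 else 4)"
  using srg unfolding srg_def bt_def by blast+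

lemma diag0: "\<not> S i i D0"
  using srg'(1)[of "Some (i, D0)"] by simp

text \<open>Arcs between orbits depend on differences only, so paths starting at
  \<open>Some (i, D0)\<close> represent all paths from orbit \<open>i\<close>.\<close>

lemma conv: "bt (ou i) * bt (iw j) + (\<Sum>z\<in>UNIV. bt (S i z D0) * bt (S z j d) + bt (S i z D1) * bt (S z j (dif d D1))
    + bt (S i z D2) * bt (S z j (dif d D2))) = (if i = j \<and> d = D0 then 6 else 4 - bt (S i j d))"
proof -
  have *: "dif e D0 = e" for e by (cases e) simp_all
  show ?thesis
    using srg'(4)[of "Some (i, D0)" "Some (j, d)"] unfolding sum_vx sum_z3
    by (auto simp: * bt_def)
qed

text \<open>Two-paths to the fixed vertex: their midpoints lie in the orbits \<open>I0\<close>,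
  \<open>I1\<close>, \<open>I3\<close>.\<close>

lemma out_u: "nn S i I0 + nn S i I1 + nn S i I3 = 4 - bt (ou i)"
  using srg'(4)[of "Some (i, D0)" None] unfolding sum_vx sum_z3 sum_idx nn_def by (cases "ou i") simp_all

lemma in_w: "nn S I0 j + nn S I1 j + nn S I2 j = 4 - bt (iw j)"
  using srg'(4)[of None "Some (j, D0)"] unfolding sum_vx sum_z3 sum_idx nn_def by (cases "iw j") simp_all

text \<open>What remains of the out-degree 9: the arc to the fixed vertex and the deficit in
  \<open>out_u\<close> compensate each other.\<close>

lemma out_e: "nn S i I2 + nn S i I4 + nn S i I5 + nn S i I6 = 5"
  using srg'(2)[of "Some (i, D0)"] out_u[of i] unfolding sum_vx sum_z3 sum_idx nn_def by simp

lemma in_e: "nn S I3 j + nn S I4 j + nn S I5 j + nn S I6 j = 5"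
  using srg'(3)[of "Some (j, D0)"] in_w[of j] unfolding sum_vx sum_z3 sum_idx nn_def by simp

lemma sizes: "(\<Sum>z\<in>UNIV. nn S i z * nn S z j) + nn S i j = 12 + (if i = j then 2 else 0) - 3 * bt (ou i) * bt (iw j)"
proof -
  let ?c = "\<lambda>d z. bt (S i z D0) * bt (S z j d) + bt (S i z D1) * bt (S z j (dif d D1)) + bt (S i z D2) * bt (S z j (dif d D2))"
  have "(\<Sum>z\<in>UNIV. nn S i z * nn S z j) = (\<Sum>z\<in>UNIV. ?c D0 z) + (\<Sum>z\<in>UNIV. ?c D1 z) + (\<Sum>z\<in>UNIV. ?c D2 z)"
    unfolding sum.distrib[symmetric] by (intro sum.cong refl) (simp add: nn_def algebra_simps)
  then show ?thesis using conv[of i j D0] conv[of i j D1] conv[of i j D2] diag0[of i]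
    by (auto simp: nn_def)
qed

lemma residues: "((\<Sum>z\<in>UNIV. ww S i z * ww S z j) + ww S i j - (if i = j then 2 else 0)) mod 13 = 0"
proof -
  let ?c = "\<lambda>d z. bt (S i z D0) * bt (S z j d) + bt (S i z D1) * bt (S z j (dif d D1)) + bt (S i z D2) * bt (S z j (dif d D2))"
  \<comment> \<open>The carries of the reduction to exponents 0, 1, 2:
    \<open>3 * 9 = 1 + 2 * 13\<close> and \<open>9 * 9 = 3 + 6 * 13\<close>.\<close>
  let ?r = "\<lambda>z. 2 * (bt (S i z D1) * bt (S z j D2) + bt (S i z D2) * bt (S z j D1)) + 6 * (bt (S i z D2) * bt (S z j D2))"
  have "(\<Sum>z\<in>UNIV. ww S i z * ww S z j) = (\<Sum>z\<in>UNIV. ?c D0 z) + 3 * (\<Sum>z\<in>UNIV. ?c D1 z) + 9 * (\<Sum>z\<in>UNIV. ?c D2 z)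
      + 13 * (\<Sum>z\<in>UNIV. ?r z)"
    unfolding sum_distrib_left sum.distrib[symmetric] by (intro sum.cong refl) (simp add: ww_def algebra_simps)
  then have "(\<Sum>z\<in>UNIV. ww S i z * ww S z j) + ww S i j - (if i = j then 2 else 0)
      = 13 * (4 - bt (ou i) * bt (iw j) + (\<Sum>z\<in>UNIV. ?r z))"
    using conv[of i j D0] conv[of i j D1] conv[of i j D2] diag0[of i] by (auto simp: ww_def)
  then show ?thesis by simp
qed

text \<open>A closed two-path matches an element of one block with its negative in the reverse
  block, so the smaller size bounds their number. Inside orbit \<open>i\<close> such a match needs
  both 1 and 2 in the diagonal block.\<close>

lemma recip_le: "6 \<le> bt (ou i) * bt (iw i) + (\<Sum>z\<in>UNIV. if z = i then (if nn S i i = 2 then 2 else 0) else min (nn S i z) (nn S z i))"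
proof -
  have "6 = bt (ou i) * bt (iw i) + (\<Sum>z\<in>UNIV. bt (S i z D0) * bt (S z i D0) + bt (S i z D1) * bt (S z i D2) + bt (S i z D2) * bt (S z i D1))"
    using conv[of i i D0] by simp
  also have "\<dots> \<le> bt (ou i) * bt (iw i) + (\<Sum>z\<in>UNIV. if z = i then (if nn S i i = 2 then 2 else 0) else min (nn S i z) (nn S z i))"
  proof (rule add_left_mono, rule sum_mono)
    fix z
    show "bt (S i z D0) * bt (S z i D0) + bt (S i z D1) * bt (S z i D2) + bt (S i z D2) * bt (S z i D1)
      \<le> (if z = i then (if nn S i i = 2 then 2 else 0) else min (nn S i z) (nn S z i))"
      using diag0[of i] unfolding nn_def
      by (cases "S i z D0"; cases "S i z D1"; cases "S i z D2"; cases "S z i D0"; cases "S z i D1"; cases "S z i D2") auto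
  qed
  finally show ?thesis .
qed

text \<open>The two-paths counted by \<open>(i, z)\<close> and \<open>(z, i)\<close> below agree, so that only the diagonal contributes modulo 2.\<close>

lemma trace_even: "even (\<Sum>i\<in>UNIV. nn S i i)"
proof -
  let ?t = "\<lambda>i z. bt (S i z D0) * bt (S z i D1) + bt (S i z D1) * bt (S z i D0) + bt (S i z D2) * bt (S z i D2)"
  have e: "(\<Sum>z\<in>UNIV. ?t i z) = 4 - bt (S i i D1) - bt (ou i) * bt (iw i)" for i
    using conv[of i i D1] by simp
  have sym: "?t i z = ?t z i" for i z by simp
  have "even ((\<Sum>i\<in>UNIV. \<Sum>z\<in>UNIV. ?t i z) - (\<Sum>i\<in>UNIV. ?t i i))"
    unfolding sum_idx
      sym[of I1 I0] sym[of I2 I0] sym[of I3 I0] sym[of I4 I0] sym[of I5 I0] sym[of I6 I0]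
      sym[of I2 I1] sym[of I3 I1] sym[of I4 I1] sym[of I5 I1] sym[of I6 I1]
      sym[of I3 I2] sym[of I4 I2] sym[of I5 I2] sym[of I6 I2]
      sym[of I4 I3] sym[of I5 I3] sym[of I6 I3] sym[of I5 I4] sym[of I6 I4] sym[of I6 I5]
    by (simp only: mult.commute) presburger
  moreover have "(\<Sum>i\<in>UNIV. ?t i i) = (\<Sum>i\<in>UNIV. bt (S i i D2))"
    by (intro sum.cong refl) (simp add: diag0 bt_def)
  \<comment> \<open>Each of the seven orbits contributes 4, less 1 for the two orbits joined with
    the fixed vertex in both directions.\<close>
  moreover have "(\<Sum>i\<in>UNIV. \<Sum>z\<in>UNIV. ?t i z) = 26 - (\<Sum>i\<in>UNIV. bt (S i i D1))"
    unfolding e by (simp add: sum_idx)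
  moreover have "(\<Sum>i\<in>UNIV. nn S i i) = (\<Sum>i\<in>UNIV. bt (S i i D1)) + (\<Sum>i\<in>UNIV. bt (S i i D2))"
    by (simp add: nn_def diag0 sum.distrib)
  ultimately show ?thesis by simp
qed

end

section \<open>Symmetries of block matrices\<close>

fun ad :: "z3 \<Rightarrow> z3 \<Rightarrow> z3" where "ad x y = dif x (dif D0 y)"

definition permS :: "(idx \<Rightarrow> idx) \<Rightarrow> (idx \<Rightarrow> idx \<Rightarrow> z3 \<Rightarrow> bool) \<Rightarrow> idx \<Rightarrow> idx \<Rightarrow> z3 \<Rightarrow> bool" where
  "permS f S i j d = S (f i) (f j) d"

text \<open>A new choice of representatives, the one of orbit \<open>i\<close> moved by
  \<open>c i\<close>.\<close>

definition shiftS :: "(idx \<Rightarrow> z3) \<Rightarrow> (idx \<Rightarrow> idx \<Rightarrow> z3 \<Rightarrow> bool) \<Rightarrow> idx \<Rightarrow> idx \<Rightarrow> z3 \<Rightarrow> bool" where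
  "shiftS c S i j d = S i j (dif (ad d (c j)) (c i))"

text \<open>Replaces the automorphism of order three by its inverse.\<close>

definition negS :: "(idx \<Rightarrow> idx \<Rightarrow> z3 \<Rightarrow> bool) \<Rightarrow> idx \<Rightarrow> idx \<Rightarrow> z3 \<Rightarrow> bool" where
  "negS S i j d = S i j (dif D0 d)"

lemma isoA_finite:
  fixes h :: "'a::finite \<Rightarrow> 'a"
  assumes "inj h" "\<And>x y. A x y = B (h x) (h y)"
  shows "isoA A B"
  unfolding isoA_def using assms finite_UNIV_inj_surj[of h] by (intro exI[of _ h]) (auto simp: bij_def)

lemma iso_perm:
  assumes "inj f" "\<And>i. ou (f i) = ou i" "\<And>i. iw (f i) = iw i"
  shows "isoA (adjS (permS f S)) (adjS S)"
proof (rule isoA_finite)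
  let ?h = "\<lambda>x. case x of None \<Rightarrow> None | Some (i, a) \<Rightarrow> Some (f i, a)"
  show "inj ?h" using assms(1) by (auto simp: inj_def split: option.splits)
  show "adjS (permS f S) x y = adjS S (?h x) (?h y)" for x y
    using assms(2,3) by (auto simp: adjS_def permS_def split: option.splits)
qed

lemma iso_shift: "isoA (adjS (shiftS c S)) (adjS S)"
proof (rule isoA_finite)
  let ?h = "\<lambda>x. case x of None \<Rightarrow> None | Some (i, a) \<Rightarrow> Some (i, ad a (c i))"
  have i: "ad a e = ad b e \<longleftrightarrow> a = b" for a b e by (cases a; cases b; cases e) simp_all
  show "inj ?h" by (auto simp: inj_def i simp del: ad.simps split: option.splits)
  have "dif (ad (dif b a) e) g = dif (ad b e) (ad a g)" for a b e g
    by (cases a; cases b; cases e; cases g) simp_all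
  then show "adjS (shiftS c S) x y = adjS S (?h x) (?h y)" for x y
    by (auto simp: adjS_def shiftS_def simp del: ad.simps split: option.splits)
qed

lemma iso_neg: "isoA (adjS (negS S)) (adjS S)"
proof (rule isoA_finite)
  let ?h = "\<lambda>x. case x of None \<Rightarrow> None | Some (i, a) \<Rightarrow> Some (i, dif D0 a)"
  have i: "dif D0 a = dif D0 b \<longleftrightarrow> a = b" for a b by (cases a; cases b) simp_all
  show "inj ?h" by (auto simp: inj_def i split: option.splits)
  have "dif D0 (dif b a) = dif (dif D0 b) (dif D0 a)" for a b
    by (cases a; cases b) simp_all
  then show "adjS (negS S) x y = adjS S (?h x) (?h y)" for x y
    by (auto simp: adjS_def negS_def split: option.splits)
qed

section \<open>Completeness of the search\<close>

fun rv :: "res \<Rightarrow> int" where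
  "rv E0 = 0" | "rv E1 = 1" | "rv E2 = 2" | "rv E3 = 3" | "rv E4 = 4" | "rv E5 = 5" | "rv E6 = 6"
| "rv E7 = 7" | "rv E8 = 8" | "rv E9 = 9" | "rv E10 = 10" | "rv E11 = 11" | "rv E12 = 12"

fun szv :: "sz \<Rightarrow> int" where
  "szv Z0 = 0" | "szv Z1 = 1" | "szv Z2 = 2" | "szv Z3 = 3" | "szv ZX = 0"

lemma rv_mod: "rv a mod 13 = rv a"
  by (cases a) simp_all

lemma rv_ad: "rv (ad1 a) = (rv a + 1) mod 13" "rv (ad2 a) = (rv a + 2) mod 13" "rv (ad3 a) = (rv a + 3) mod 13"
  "rv (ad4 a) = (rv a + 4) mod 13" "rv (ad6 a) = (rv a + 6) mod 13" "rv (ad9 a) = (rv a + 9) mod 13"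
  "rv (ad10 a) = (rv a + 10) mod 13" "rv (ad11 a) = (rv a + 11) mod 13" "rv (ad12 a) = (rv a + 12) mod 13"
  by (cases a; simp)+

lemma rv_mac: "rv (mac a x y) = (rv a + szv x * szv y) mod 13"
  by (cases x; cases y) (simp_all add: rv_ad rv_mod)

lemma is0_rv: "is0 a \<longleftrightarrow> rv a = 0"
  by (cases a) simp_all

lemma chk_iff: "chk p (Q a b c d) (Q x y z v) \<longleftrightarrow>
    (rv p + szv a * szv x + szv b * szv y + szv c * szv z + szv d * szv v) mod 13 = 0"
  by (simp add: is0_rv rv_mac mod_simps)

lemma dot_iff: "dot p (Row a0 a1 a2 a3 a4 a5 a6) (Row b0 b1 b2 b3 b4 b5 b6) x \<longleftrightarrow>
    (rv p + szv x + szv a0 * szv b0 + szv a1 * szv b1 + szv a2 * szv b2 + szv a3 * szv b3 + szv a4 * szv b4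
      + szv a5 * szv b5 + szv a6 * szv b6) mod 13 = 0"
  by (simp add: is0_rv rv_mac mod_simps)

lemma le3_iff: "le3 x \<longleftrightarrow> x \<noteq> ZX"
  by (cases x) simp_all

lemma le2_iff: "le2 x \<longleftrightarrow> x \<noteq> ZX \<and> x \<noteq> Z3"
  by (cases x) simp_all

lemma sub3: "szv a + szv b + szv c = 3 \<Longrightarrow> a \<noteq> ZX \<Longrightarrow> b \<noteq> ZX \<Longrightarrow> c \<noteq> ZX \<Longrightarrow> tosz (sb (sb E3 a) b) = c"
  by (cases a; cases b; cases c) simp_all

lemma sub4: "szv a + szv b + szv c = 4 \<Longrightarrow> a \<noteq> ZX \<Longrightarrow> b \<noteq> ZX \<Longrightarrow> c \<noteq> ZX \<Longrightarrow> tosz (sb (sb E4 a) b) = c"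
  by (cases a; cases b; cases c) simp_all

lemma sub5: "szv a + szv b + szv c + szv d = 5 \<Longrightarrow> a \<noteq> ZX \<Longrightarrow> b \<noteq> ZX \<Longrightarrow> c \<noteq> ZX \<Longrightarrow> d \<noteq> ZX \<Longrightarrow>
    tosz (sb (sb (sb E5 a) b) c) = d"
  by (cases a; cases b; cases c; cases d; simp)

lemma mn_eq: "int (mn x y n) = int n + min (szv x) (szv y)"
  by (cases x; cases y) simp_all

lemma dg_eq: "int (dg x n) = int n + (if szv x = 2 then 2 else 0)"
  by (cases x) simp_all

lemma ge6_iff: "ge6 n \<longleftrightarrow> 6 \<le> int n"
  by (cases n rule: ge6.cases) simp_all

lemma flip_eq: "flip x b \<longleftrightarrow> (even (szv x) = b)"
  by (cases x; cases b) simp_all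

lemma quads5: "szv a + szv b + szv c + szv d = 5 \<Longrightarrow> a \<noteq> ZX \<Longrightarrow> b \<noteq> ZX \<Longrightarrow> c \<noteq> ZX \<Longrightarrow> d \<noteq> ZX \<Longrightarrow>
    Q a b c d \<in> set quads5"
  unfolding quads5_def by (cases a; cases b; cases c; cases d; simp)

lemma qle2_set: "Q a b c d \<in> set qs \<Longrightarrow> le2 b \<Longrightarrow> Q a b c d \<in> set (qle2 qs)"
  by (induction qs rule: qle2.induct) auto

lemma qle3_set: "Q a b c d \<in> set qs \<Longrightarrow> le2 c \<Longrightarrow> Q a b c d \<in> set (qle3 qs)"
  by (induction qs rule: qle3.induct) auto

lemma qsort_set: "Q a b c d \<in> set qs \<Longrightarrow> lexle [b] [c] \<Longrightarrow> lexle [c] [d] \<Longrightarrow> Q a b c d \<in> set (qsort qs)"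
  by (induction qs rule: qsort.induct) auto

lemma mkrow_set: "Q c e f g \<in> set qs \<Longrightarrow> Row a b c d e f g \<in> set (mkrow a b d qs)"
  by (induction qs rule: mkrow.induct) auto

lemma copts_set: "t \<in> set ts \<Longrightarrow> chk p qa t \<Longrightarrow> chk q qb t \<Longrightarrow> hi4 n qs t \<Longrightarrow> t \<in> set (copts p qa q qb n qs ts)"
  by (induction ts) auto

lemma lpA_set: "a \<in> set as \<Longrightarrow> M \<in> set (lpB a bs) \<Longrightarrow> M \<in> set (lpA as bs)"
  by (induction as) auto

lemma lpB_set: "b \<in> set bs \<Longrightarrow> symB a b \<Longrightarrow> M \<in> set (ent0 a b (row2 a b)) \<Longrightarrow> M \<in> set (lpB a bs)"
  by (induction bs) (auto simp del: ent0.simps)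

lemma ent0_set: "okc c \<Longrightarrow> M \<in> set (lpC0 a b c (copts0 a b c) (copts1 a b c)) \<Longrightarrow> M \<in> set (ent0 a b c)"
  by (cases "copts0 a b c") auto

lemma lpC0_set: "x \<in> set xs \<Longrightarrow> M \<in> set (lpC1 a b c x ys) \<Longrightarrow> M \<in> set (lpC0 a b c xs ys)"
  by (induction xs) auto

lemma lpC1_set: "y \<in> set ys \<Longrightarrow> M \<in> set (ent2 a b c x y (col3 x y)) \<Longrightarrow> M \<in> set (lpC1 a b c x ys)"
  by (induction ys) (auto simp del: ent2.simps col3.simps)

lemma lpR3_nil: "lpR3 P ts [] ws = []"
  by (induction ts) auto

lemma ent2_set: "okz z \<Longrightarrow> P = Part a b c x y z \<Longrightarrow> M \<in> set (lpR3 P (ropts3 P) (ropts4 P) (ropts5 P)) \<Longrightarrow>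
    M \<in> set (ent2 a b c x y z)"
  by (cases "ropts3 P"; cases "ropts4 P") (auto simp: lpR3_nil)

lemma lpR3_set: "t \<in> set ts \<Longrightarrow> M \<in> set (lpR4 P t us ws) \<Longrightarrow> M \<in> set (lpR3 P ts us ws)"
  by (induction ts) auto

lemma lpR4_set: "u \<in> set us \<Longrightarrow> M \<in> set (lpR5 P t u ws) \<Longrightarrow> M \<in> set (lpR4 P t us ws)"
  by (induction us) auto

lemma lpR5_set: "w \<in> set ws \<Longrightarrow> v = row6 t u w \<Longrightarrow> okv v \<Longrightarrow> M = assemble P t u w v \<Longrightarrow> final M \<Longrightarrow>
    M \<in> set (lpR5 P t u ws)"
  by (induction ws) (auto simp del: final.simps okv.simps row6.simps assemble.simps)

definition mk :: "(idx \<Rightarrow> idx \<Rightarrow> 'b) \<Rightarrow> 'b row row" where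
  "mk n = Row (Row (n I0 I0) (n I0 I1) (n I0 I2) (n I0 I3) (n I0 I4) (n I0 I5) (n I0 I6))
    (Row (n I1 I0) (n I1 I1) (n I1 I2) (n I1 I3) (n I1 I4) (n I1 I5) (n I1 I6))
    (Row (n I2 I0) (n I2 I1) (n I2 I2) (n I2 I3) (n I2 I4) (n I2 I5) (n I2 I6))
    (Row (n I3 I0) (n I3 I1) (n I3 I2) (n I3 I3) (n I3 I4) (n I3 I5) (n I3 I6))
    (Row (n I4 I0) (n I4 I1) (n I4 I2) (n I4 I3) (n I4 I4) (n I4 I5) (n I4 I6))
    (Row (n I5 I0) (n I5 I1) (n I5 I2) (n I5 I3) (n I5 I4) (n I5 I5) (n I5 I6))
    (Row (n I6 I0) (n I6 I1) (n I6 I2) (n I6 I3) (n I6 I4) (n I6 I5) (n I6 I6))"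

lemma el_mk [simp]: "el j (el i (mk n)) = n i j"
  by (cases i; cases j) (simp_all add: mk_def)

lemma row_mk: "el i (mk n) = Row (n i I0) (n i I1) (n i I2) (n i I3) (n i I4) (n i I5) (n i I6)"
  by (cases i) (simp_all add: mk_def)

lemma col_mk: "col j (mk n) = Row (n I0 j) (n I1 j) (n I2 j) (n I3 j) (n I4 j) (n I5 j) (n I6 j)"
  by (cases j) (simp_all add: mk_def)

lemma row_eq: "r = Row (el I0 r) (el I1 r) (el I2 r) (el I3 r) (el I4 r) (el I5 r) (el I6 r)"
  by (cases r) simp

lemma mk_el: "mk (\<lambda>i j. el j (el i M)) = M"
  unfolding mk_def by (cases M) (simp add: row_eq[symmetric])

text \<open>Gathers exactly what the filters of the enumeration test. The assumptions
  \<open>sB\<close>, \<open>k45\<close> and \<open>k56\<close> are the normalisation under exchanges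
  of orbits, the others follow from the path equations.\<close>

locale size_matrix =
  fixes n :: "idx \<Rightarrow> idx \<Rightarrow> sz"
  assumes nX: "n i j \<noteq> ZX" and nd: "n i i \<noteq> Z3"
    and ru: "szv (n i I0) + szv (n i I1) + szv (n i I3) = 4 - bt (ou i)"
    and re: "szv (n i I2) + szv (n i I4) + szv (n i I5) + szv (n i I6) = 5"
    and cu: "szv (n I0 j) + szv (n I1 j) + szv (n I2 j) = 4 - bt (iw j)"
    and ce: "szv (n I3 j) + szv (n I4 j) + szv (n I5 j) + szv (n I6 j) = 5"
    and sq: "(\<Sum>z\<in>UNIV. szv (n i z) * szv (n z j)) + szv (n i j) = 12 + (if i = j then 2 else 0) - 3 * bt (ou i) * bt (iw j)"
    and hi: "6 \<le> bt (ou i) * bt (iw i) + (\<Sum>z\<in>UNIV. if z = i then (if szv (n i i) = 2 then 2 else 0)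
        else min (szv (n i z)) (szv (n z i)))"
    and tr: "even (\<Sum>i\<in>UNIV. szv (n i i))"
    and sB: "lexle [n I0 I0, n I0 I1] [n I1 I1, n I1 I0]"
    and k45: "lexle (key I4 (mk n)) (key I5 (mk n))" and k56: "lexle (key I5 (mk n)) (key I6 (mk n))"
begin

lemma le2d: "le2 (n i i)" and le3n: "le3 (n i j)"
  by (simp_all add: le2_iff le3_iff nX nd)

lemma rhs: "(rv (rhs i j) + szv (n i j) + (\<Sum>z\<in>UNIV. szv (n i z) * szv (n z j))) mod 13 = 0"
proof -
  have "(rv (rhs i j) + 12 + (if i = j then 2 else 0) - 3 * bt (ou i) * bt (iw j)) mod 13 = 0"
    by (cases i; cases j) simp_all
  moreover have "rv (rhs i j) + szv (n i j) + (\<Sum>z\<in>UNIV. szv (n i z) * szv (n z j))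
    = rv (rhs i j) + 12 + (if i = j then 2 else 0) - 3 * bt (ou i) * bt (iw j)" using sq[of i j] by linarith
  ultimately show ?thesis by (simp only:)
qed

lemma eqij: "eqij i j (mk n)"
  using rhs[of i j] unfolding eqij.simps el_mk unfolding row_mk col_mk dot_iff sum_idx by (simp add: add_ac)

lemma eqsj: "eqsj i js (mk n)"
  by (induction js) (simp_all add: eqij del: eqij.simps)

lemma eqsi: "eqsi is (mk n)"
  by (induction "is") (simp_all add: eqsj del: eqsj.simps)

lemma hid: "int (hid i) = bt (ou i) * bt (iw i)"
  by (cases i) simp_all

lemma szv0: "0 \<le> szv x"
  by (cases x) simp_all

lemma hiall: "hiall is (mk n)"
proof (induction "is")
  case (Cons i "is")
  have "hirow (dg (n i i) (hid i)) (put i Z0 (el i (mk n))) (col i (mk n))"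
    using hi[of i] unfolding sum_idx
    by (cases i) (simp_all add: row_mk col_mk ge6_iff mn_eq dg_eq hid szv0 add_ac)
  then show ?case using Cons by simp
qed simp

lemma trev: "trev (mk n)"
  using tr unfolding sum_idx by (simp add: flip_eq) blast

lemma final: "final (mk n)"
  using trev eqsi hiall k45 k56 by (simp del: trev.simps eqsi.simps hiall.simps key.simps)

lemma lex_prefix: "lexle (x # y # xs) (x' # y' # ys) \<Longrightarrow> lexle [x, y] [x', y']" "lexle (x # xs) (x' # ys) \<Longrightarrow> lexle [x] [x']"
  by (cases "cmp x x'"; cases "cmp y y'"; simp)+

lemma l45: "lexle [n I0 I4, n I1 I4] [n I0 I5, n I1 I5]" and l56: "lexle [n I0 I5, n I1 I5] [n I0 I6, n I1 I6]"
  by (rule lex_prefix(1)[OF k45[unfolded key.simps el_mk]] lex_prefix(1)[OF k56[unfolded key.simps el_mk]])+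

lemma rowA: "el I0 (mk n) \<in> set rowsA0 \<union> set rowsA1 \<union> set rowsA2 \<union> set rowsA3"
proof -
  have q: "Q (n I0 I2) (n I0 I4) (n I0 I5) (n I0 I6) \<in> set (qsort quads5)"
    by (intro qsort_set quads5 lex_prefix(2)[OF l45] lex_prefix(2)[OF l56]) (simp_all add: nX re)
  have t: "szv (n I0 I0) + szv (n I0 I1) + szv (n I0 I3) = 3" using ru[of I0] by simp
  have d: "n I0 I0 \<noteq> Z3" "n I0 I0 \<noteq> ZX" "n I0 I1 \<noteq> ZX" "n I0 I3 \<noteq> ZX" using nX nd by auto
  show ?thesis using t d mkrow_set[OF q]
    unfolding row_mk rowsA0_def rowsA1_def rowsA2_def rowsA3_def
    by (cases "n I0 I0"; cases "n I0 I1"; cases "n I0 I3"; simp)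
qed

lemma rowB: "el I1 (mk n) \<in> set rowsB"
proof -
  have q: "Q (n I1 I2) (n I1 I4) (n I1 I5) (n I1 I6) \<in> set quads5"
    by (intro quads5) (auto simp: nX re)
  have t: "szv (n I1 I0) + szv (n I1 I1) + szv (n I1 I3) = 3" using ru[of I1] by simp
  have d: "n I1 I1 \<noteq> Z3" "n I1 I0 \<noteq> ZX" "n I1 I1 \<noteq> ZX" "n I1 I3 \<noteq> ZX" using nX nd by auto
  show ?thesis using t d mkrow_set[OF q]
    unfolding row_mk rowsB_def
    by (cases "n I1 I0"; cases "n I1 I1"; cases "n I1 I3"; simp)
qed

lemma row2: "row2 (el I0 (mk n)) (el I1 (mk n)) = el I2 (mk n)"
  using cu[of I0] cu[of I1] cu[of I2] cu[of I3] cu[of I4] cu[of I5] cu[of I6]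
  by (simp add: row_mk sub3 sub4 nX)

abbreviation "cq j \<equiv> Q (n I3 j) (n I4 j) (n I5 j) (n I6 j)"
abbreviation "rq i \<equiv> Q (n i I2) (n i I4) (n i I5) (n i I6)"

lemma copts: "cq I0 \<in> set (copts0 (el I0 (mk n)) (el I1 (mk n)) (el I2 (mk n)))"
  "cq I1 \<in> set (copts1 (el I0 (mk n)) (el I1 (mk n)) (el I2 (mk n)))"
proof -
  have q: "cq j \<in> set quads5" for j by (intro quads5) (auto simp: nX ce)
  show "cq I0 \<in> set (copts0 (el I0 (mk n)) (el I1 (mk n)) (el I2 (mk n)))"
    unfolding row_mk copts0.simps using rhs[of I0 I0] rhs[of I1 I0] hi[of I0]
    by (intro copts_set q) (simp_all only: chk_iff rv_mac hi4.simps ge6_iff mn_eq dg_eq sum_idx,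
      simp_all only: add.assoc mod_add_left_eq, simp_all add: ac_simps)
  show "cq I1 \<in> set (copts1 (el I0 (mk n)) (el I1 (mk n)) (el I2 (mk n)))"
    unfolding row_mk copts1.simps using rhs[of I0 I1] rhs[of I1 I1] hi[of I1]
    by (intro copts_set q) (simp_all only: chk_iff rv_mac hi4.simps ge6_iff mn_eq dg_eq sum_idx,
      simp_all only: add.assoc mod_add_left_eq, simp_all add: ac_simps)
qed

lemma col3: "col3 (cq I0) (cq I1) = cq I3"
  using ru[of I3] ru[of I4] ru[of I5] ru[of I6] by (simp add: sub3 sub4 nX)

definition "P = Part (el I0 (mk n)) (el I1 (mk n)) (el I2 (mk n)) (cq I0) (cq I1) (cq I3)"

lemma ropts: "rq I3 \<in> set (ropts3 P)" "rq I4 \<in> set (ropts4 P)" "rq I5 \<in> set (ropts5 P)"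
proof -
  have q: "rq i \<in> set quads5" for i by (intro quads5) (auto simp: nX re)
  have q2: "rq I4 \<in> set (qle2 quads5)" "rq I5 \<in> set (qle3 quads5)"
    by (rule qle2_set[OF q le2d] qle3_set[OF q le2d])+
  have h: "hi4 (Suc (Suc (Suc (Suc (Suc (Suc 0)))))) x y" for x y
    by (cases x; cases y) (simp add: ge6_iff mn_eq szv0)
  show "rq I3 \<in> set (ropts3 P)"
    unfolding row_mk P_def ropts3.simps using rhs[of I3 I0] rhs[of I3 I1] hi[of I3]
    by (intro copts_set q) (simp_all only: chk_iff rv_mac hi4.simps ge6_iff mn_eq dg_eq sum_idx,
      simp_all only: add.assoc mod_add_left_eq, simp_all add: ac_simps)
  show "rq I4 \<in> set (ropts4 P)"
    unfolding row_mk P_def ropts4.simps using rhs[of I4 I0] rhs[of I4 I1]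
    by (intro copts_set q2 h) (simp_all only: chk_iff rv_mac sum_idx, simp_all only: add.assoc mod_add_left_eq, simp_all add: ac_simps)
  show "rq I5 \<in> set (ropts5 P)"
    unfolding row_mk P_def ropts5.simps using rhs[of I5 I0] rhs[of I5 I1]
    by (intro copts_set q2 h) (simp_all only: chk_iff rv_mac sum_idx, simp_all only: add.assoc mod_add_left_eq, simp_all add: ac_simps)
qed

lemma row6: "row6 (rq I3) (rq I4) (rq I5) = rq I6"
  using ce[of I2] ce[of I4] ce[of I5] ce[of I6] by (simp add: sub5 nX)

lemma assemble: "assemble P (rq I3) (rq I4) (rq I5) (rq I6) = mk n"
  unfolding P_def by (simp add: row_mk) (simp add: mk_def)

lemma mem_lpB: "mk n \<in> set (lpB (el I0 (mk n)) rowsB)"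
proof (rule lpB_set[OF rowB])
  show "symB (el I0 (mk n)) (el I1 (mk n))" using sB l45 l56 by (simp add: row_mk)
  show "mk n \<in> set (ent0 (el I0 (mk n)) (el I1 (mk n)) (row2 (el I0 (mk n)) (el I1 (mk n))))"
    unfolding row2
  proof (rule ent0_set[OF _ lpC0_set[OF copts(1) lpC1_set[OF copts(2)]]])
    show "okc (el I2 (mk n))" by (simp add: row_mk le2d le3n)
    show "mk n \<in> set (ent2 (el I0 (mk n)) (el I1 (mk n)) (el I2 (mk n)) (cq I0) (cq I1) (col3 (cq I0) (cq I1)))"
      unfolding col3
    proof (rule ent2_set[OF _ P_def lpR3_set[OF ropts(1) lpR4_set[OF ropts(2) lpR5_set[OF ropts(3) row6[symmetric] _ assemble[symmetric] final]]]])
      show "okz (cq I3)" "okv (rq I6)" by (simp_all add: le2d le3n)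
    qed
  qed
qed

lemma stage1: "mk n \<in> set (lpA rowsA0 rowsB) \<union> set (lpA rowsA1 rowsB) \<union> set (lpA rowsA2 rowsB) \<union> set (lpA rowsA3 rowsB)"
  using rowA lpA_set[OF _ mem_lpB] by blast

end

text \<open>Meaning of a cell as a set of possible residues modulo 13; with \<open>sts\<close> it
  makes \<open>mulc\<close>, \<open>addc\<close> and \<open>fin\<close> safe over-approximations of
  arithmetic modulo 13.\<close>

fun cs :: "cell \<Rightarrow> int set" where
  "cs CZ = {0}" | "cs UP = {1, 3, 9}" | "cs UM = {12, 10, 4}" | "cs P0 = {1}" | "cs P1 = {3}" | "cs P2 = {9}"
| "cs M0 = {12}" | "cs M1 = {10}" | "cs M2 = {4}"

fun sts :: "st \<Rightarrow> int set" where
  "sts (K a) = {rv a}" | "sts (HP a) = {(rv a + 1) mod 13, (rv a + 3) mod 13, (rv a + 9) mod 13}"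
| "sts (HM a) = {(rv a + 12) mod 13, (rv a + 10) mod 13, (rv a + 4) mod 13}" | "sts DD = UNIV"

lemma mulc_cs0: "\<forall>x\<in>cs c. \<forall>y\<in>cs d. (x * y) mod 13 \<in> cs (mulc c d)"
  by (cases c; cases d; simp)

lemma mulc_cs: "x mod 13 \<in> cs c \<Longrightarrow> y mod 13 \<in> cs d \<Longrightarrow> (x * y) mod 13 \<in> cs (mulc c d)"
  using mulc_cs0[of c d] by (metis mod_mult_eq)

lemma addc_sts0: "x \<in> sts t \<Longrightarrow> y \<in> cs c \<Longrightarrow> (x + y) mod 13 \<in> sts (addc t c)"
  by (cases t; cases c; auto simp: rv_ad rv_mod mod_simps add_ac)

lemma addc_sts: "x mod 13 \<in> sts t \<Longrightarrow> y mod 13 \<in> cs c \<Longrightarrow> (x + y) mod 13 \<in> sts (addc t c)"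
  using addc_sts0[of "x mod 13" t "y mod 13" c] by (simp add: mod_simps)

lemma fin_sts: "0 \<in> sts t \<Longrightarrow> fin t"
proof (cases t)
  case (K a) then show "0 \<in> sts t \<Longrightarrow> fin t" by (simp add: is0_rv)
next
  case (HP a) then show "0 \<in> sts t \<Longrightarrow> fin t" by (cases a) simp_all
next
  case (HM a) then show "0 \<in> sts t \<Longrightarrow> fin t" by (cases a) simp_all
qed simp

lemma ev_true:
  assumes "w mod 13 \<in> cs c" "x0 mod 13 \<in> cs a0" "x1 mod 13 \<in> cs a1" "x2 mod 13 \<in> cs a2" "x3 mod 13 \<in> cs a3"
    "x4 mod 13 \<in> cs a4" "x5 mod 13 \<in> cs a5" "x6 mod 13 \<in> cs a6"
    "y0 mod 13 \<in> cs b0" "y1 mod 13 \<in> cs b1" "y2 mod 13 \<in> cs b2" "y3 mod 13 \<in> cs b3"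
    "y4 mod 13 \<in> cs b4" "y5 mod 13 \<in> cs b5" "y6 mod 13 \<in> cs b6"
    and "(rv p + w + x0 * y0 + x1 * y1 + x2 * y2 + x3 * y3 + x4 * y4 + x5 * y5 + x6 * y6) mod 13 = 0"
  shows "ev p (Row a0 a1 a2 a3 a4 a5 a6) (Row b0 b1 b2 b3 b4 b5 b6) c"
proof -
  have "rv p mod 13 \<in> sts (K p)" by (simp add: rv_mod)
  then have "(rv p + w + x0 * y0 + x1 * y1 + x2 * y2 + x3 * y3 + x4 * y4 + x5 * y5 + x6 * y6) mod 13
    \<in> sts (addc (addc (addc (addc (addc (addc (addc (addc (K p) c) (mulc a0 b0)) (mulc a1 b1))
      (mulc a2 b2)) (mulc a3 b3)) (mulc a4 b4)) (mulc a5 b5)) (mulc a6 b6))"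
    using assms(1-15) by (intro addc_sts mulc_cs)
  then show ?thesis unfolding assms(16) ev.simps by (rule fin_sts)
qed

lemma el_put: "el k (put i x r) = (if k = i then x else el k r)"
  by (cases r; cases i; cases k) simp_all

lemma ev_sum:
  assumes "\<And>i. x i mod 13 \<in> cs (el i r)" "\<And>i. y i mod 13 \<in> cs (el i q)" "w mod 13 \<in> cs c"
    "(rv p + w + (\<Sum>i\<in>UNIV. x i * y i)) mod 13 = 0"
  shows "ev p r q c"
  by (subst row_eq[of r], subst row_eq[of q], rule ev_true[of w c "x I0" _ "x I1" _ "x I2" _ "x I3" _ "x I4" _ "x I5" _ "x I6" _
    "y I0" _ "y I1" _ "y I2" _ "y I3" _ "y I4" _ "y I5" _ "y I6"])
    (use assms(1-3) in \<open>simp_all only:\<close>, use assms(4) in \<open>simp add: sum_idx add_ac\<close>)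

lemma el_col: "el k (col j M) = el j (el k M)"
  by (cases M; cases k) simp_all

text \<open>An arbitrary solution of the matrix equation modulo 13, which the search must not lose.
  Loop-freeness enters as \<open>Wd\<close>: among the values of diagonal blocks, 1 would belong to
  the block {0}.\<close>

locale search =
  fixes W :: "idx \<Rightarrow> idx \<Rightarrow> int"
  assumes W: "((\<Sum>z\<in>UNIV. W i z * W z j) + W i j - (if i = j then 2 else 0)) mod 13 = 0"
    and Wd: "W i i mod 13 \<noteq> 1"
begin

definition ok :: "cell row row \<Rightarrow> bool" where
  "ok M \<longleftrightarrow> (\<forall>i j. W i j mod 13 \<in> cs (el j (el i M)))"

lemma ok_ev:
  assumes "ok M"
  shows "ev (if i = j then E11 else E0) (el i M) (col j M) (el j (el i M))"
proof -
  have c: "W i j mod 13 \<in> cs (el j (el i M))" for i j using assms by (simp add: ok_def)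
  have "((\<Sum>z\<in>UNIV. W i z * W z j) + W i j - (if i = j then 2 else 0) + 13 * (if i = j then 1 else 0)) mod 13 = 0"
    unfolding mod_mult_self2 by (rule W)
  moreover have "rv (if i = j then E11 else E0) + W i j + (\<Sum>z\<in>UNIV. W i z * W z j)
    = (\<Sum>z\<in>UNIV. W i z * W z j) + W i j - (if i = j then 2 else 0) + 13 * (if i = j then 1 else 0)" by simp
  ultimately have z: "(rv (if i = j then E11 else E0) + W i j + (\<Sum>z\<in>UNIV. W i z * W z j)) mod 13 = 0" by (simp only:)
  show ?thesis by (rule ev_sum[of "W i" _ "\<lambda>z. W z j" _ "W i j", OF c _ c z]) (simp only: el_col c)
qed

lemma ok_evs: "ok M \<Longrightarrow> evs ks M"
proof (induction ks)
  case (Cons k ks)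
  then show ?case using ok_ev[OF Cons.prems] by (cases k) auto
qed simp

lemma ok_setc: "ok M \<Longrightarrow> W i j mod 13 \<in> cs x \<Longrightarrow> ok (setc i j x M)"
  by (auto simp: ok_def el_put)

lemma ok_exs: "ok M \<Longrightarrow> x \<in> set xs \<Longrightarrow> W i j mod 13 \<in> cs x \<Longrightarrow> \<exists>N\<in>set (exs i j ks M xs). ok N"
proof (induction xs)
  case (Cons y ys)
  show ?case
  proof (cases "x = y")
    case True
    then show ?thesis using ok_setc[OF Cons.prems(1,3)] ok_evs by (auto simp del: setc.simps)
  next
    case False
    then show ?thesis using Cons by (auto simp del: setc.simps)
  qed
qed simp

lemma ok_ext: "M \<in> set Ms \<Longrightarrow> ok M \<Longrightarrow> \<exists>N\<in>set (ext i j ks Ms). ok N"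
proof (induction Ms)
  case (Cons M' Ms)
  show ?case
  proof (cases "M = M'")
    case True
    have "W i j mod 13 \<in> cs (el j (el i M))" using Cons by (simp add: ok_def)
    then have "\<exists>x\<in>set (opt (i = j) (el j (el i M))). W i j mod 13 \<in> cs x"
      using Wd[of i] by (cases "el j (el i M)"; cases "i = j") auto
    then show ?thesis using ok_exs[OF Cons.prems(2)] True by fastforce
  next
    case False then show ?thesis using Cons by auto
  qed
qed simp

lemma ok_runp: "M \<in> set Ms \<Longrightarrow> ok M \<Longrightarrow> \<exists>N\<in>set (runp ps Ms). ok N"
proof (induction ps Ms arbitrary: M rule: runp.induct)
  case (3 i j ks ps m ms)
  obtain N where "N \<in> set (ext i j ks (m # ms))" "ok N" using ok_ext[OF 3(2,3)] by blast
  then show ?case using 3(1) by (simp del: ext.simps)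
qed auto

text \<open>The residues 9 and 4 are those of the blocks {2} and {0, 1}, the options that
  \<open>opt1\<close> leaves out.\<close>

lemma ok_run1:
  assumes "ok M" and f: "\<And>i j ks qs. ps = (Pr i j # ks) # qs \<Longrightarrow> W i j mod 13 \<noteq> 9 \<and> W i j mod 13 \<noteq> 4"
  shows "\<exists>N\<in>set (run1 ps M). ok N"
proof (cases "(ps, M)" rule: run1.cases)
  case (2 i j ks qs m)
  then have p: "ps = (Pr i j # ks) # qs" by simp
  have "W i j mod 13 \<in> cs (el j (el i M))" using assms(1) by (simp add: ok_def)
  then have "\<exists>x\<in>set (opt1 (i = j) (el j (el i M))). W i j mod 13 \<in> cs x"
    using Wd[of i] f[OF p] by (cases "el j (el i M)"; cases "i = j") auto
  then obtain N where "N \<in> set (ext1 i j ks M)" "ok N" using ok_exs[OF assms(1)] by fastforce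
  then show ?thesis using p ok_runp by (simp del: ext1.simps)
qed (use assms in auto)

text \<open>The residue 0 belongs to the empty and the full block, 1 to {0} and 12 to {1, 2}, so
  writing \<open>P0\<close> or \<open>M0\<close> into an open cell is correct.\<close>

lemma ok_anchor:
  assumes "ok M" "\<And>i j. Pr i j \<in> set ks \<Longrightarrow> W i j mod 13 \<in> {0, 1, 12}"
  shows "ok (anchor ks M)"
  using assms(2)
proof (induction ks)
  case (Cons k ks)
  then have IH: "ok (anchor ks M)" by simp
  show ?case
  proof (cases k)
    case (Pr i j)
    have "W i j mod 13 \<in> cs (el j (el i M))" using assms(1) by (simp add: ok_def)
    moreover have "W i j mod 13 \<in> {0, 1, 12}" using Cons.prems Pr by simp
    ultimately show ?thesis using IH ok_setc[OF IH, of i j] Pr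
      by (cases "el j (el i M)") (auto simp del: setc.simps)
  qed (use IH in simp)
qed (simp add: assms(1))

end

fun szb :: "blk \<Rightarrow> sz" where
  "szb B0 = Z0" | "szb B1 = Z1" | "szb B2 = Z1" | "szb B3 = Z2" | "szb B4 = Z1" | "szb B5 = Z2" | "szb B6 = Z2" | "szb B7 = Z3"

fun mrow :: "('b \<Rightarrow> 'c) \<Rightarrow> 'b row \<Rightarrow> 'c row" where
  "mrow f (Row a b c d e g h) = Row (f a) (f b) (f c) (f d) (f e) (f g) (f h)"

fun szbm :: "blk row row \<Rightarrow> sz row row" where
  "szbm M = mrow (mrow szb) M"

fun sizedl :: "sz row row \<Rightarrow> blk row row list \<Rightarrow> bool" where
  "sizedl R [] = True" | "sizedl R (M # Ms) = (if szbm M = R then sizedl R Ms else False)"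

text \<open>Each anchored cell meets an orbit that occurs in no later cell, so that a rotation of this
  orbit can move an element of the block to 0 without disturbing the later cells.\<close>

fun inverts :: "idx \<Rightarrow> tok list \<Rightarrow> bool" where
  "inverts v [] = False" | "inverts v (Sp # ks) = inverts v ks"
| "inverts v (Pr i j # ks) = (if v = i then True else if v = j then True else inverts v ks)"

fun forest :: "tok list \<Rightarrow> bool" where
  "forest [] = True" | "forest (Sp # ks) = forest ks"
| "forest (Pr i j # ks) = (if i = j then False else if inverts i ks then if inverts j ks then False else forest ks
     else forest ks)"

fun wellf :: "task list \<Rightarrow> bool" where
  "wellf [] = True"
| "wellf (Task R as ps ls # ts) = (if sizedl (szmat R) (blkmats ls) then if forest (toks as) then wellf ts else False else False)"

fun taskR :: "task list \<Rightarrow> sz row row list" where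
  "taskR [] = []" | "taskR (Task R as ps ls # ts) = szmat R # taskR ts"

fun subl :: "'b list \<Rightarrow> 'b list \<Rightarrow> bool" where
  "subl [] ys = True" | "subl (x # xs) ys = (if memb x ys then subl xs ys else False)"

definition bitsb :: "bool \<Rightarrow> bool \<Rightarrow> bool \<Rightarrow> blk" where
  "bitsb x y z = (if x then if y then if z then B7 else B3 else if z then B5 else B1
     else if y then if z then B6 else B2 else if z then B4 else B0)"

definition blkS :: "(idx \<Rightarrow> idx \<Rightarrow> z3 \<Rightarrow> bool) \<Rightarrow> idx \<Rightarrow> idx \<Rightarrow> blk" where
  "blkS S i j = bitsb (S i j D0) (S i j D1) (S i j D2)"

lemma mem_blkS: "mem d (blkS S i j) = S i j d"
  unfolding blkS_def bitsb_def by (cases d) (simp_all split: if_split)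

lemma adjm_adjS: "adjm M = adjS (\<lambda>i j d. mem d (el j (el i M)))"
proof (intro ext)
  fix x y show "adjm M x y = adjS (\<lambda>i j d. mem d (el j (el i M))) x y"
    by (cases "(M, x, y)" rule: adjm.cases) auto
qed

lemma adjm_blkS: "adjm (mk (blkS S)) = adjS S"
  unfolding adjm_adjS by (simp add: mem_blkS)

lemma szv_blkS: "szv (szb (blkS S i j)) = nn S i j"
  unfolding blkS_def bitsb_def nn_def by simp

text \<open>Given the size, the residue modulo 13 determines a block. The second assumption rules
  out cells that are still open, as these would turn into the junk value.\<close>

lemma comb_blkS:
  assumes "ww S i j mod 13 \<in> cs c" "szb (comb (szb (blkS S i j)) c) = szb (blkS S i j)"
  shows "comb (szb (blkS S i j)) c = blkS S i j"
  using assms unfolding blkS_def bitsb_def ww_def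
  by (cases c; hypsubst; cases "S i j D0"; cases "S i j D1"; cases "S i j D2"; simp)

lemma el_mrow: "el i (mrow f r) = f (el i r)"
  by (cases r; cases i) simp_all

lemma el_combmat: "el j (el i (combmat R M)) = comb (el j (el i R)) (el j (el i M))"
proof -
  have 1: "el j (combrow r q) = comb (el j r) (el j q)" for r q
    by (cases r; cases q; cases j) simp_all
  have "el i (combmat R M) = combrow (el i R) (el i M)"
    by (cases R; cases M; cases i) simp_all
  then show ?thesis by (simp add: 1)
qed

lemma el_init: "el j (el i (init R)) = (if i = j then cld (el i (el i R)) else cl (el j (el i R)))"
proof -
  have 1: "el j (clrow r) = cl (el j r)" for r by (cases r; cases j) simp_all
  show ?thesis by (cases R; cases i) (simp_all add: el_put 1)
qed

lemma combs_set: "M \<in> set Ms \<Longrightarrow> combmat R M \<in> set (combs R Ms)"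
  by (induction Ms) auto

lemma sizedl_set: "sizedl R Ms \<Longrightarrow> M \<in> set Ms \<Longrightarrow> szbm M = R"
  by (induction Ms) (auto split: if_splits)

lemma mat_eqI: "(\<And>i j. el j (el i M) = el j (el i N)) \<Longrightarrow> M = N"
proof -
  assume "\<And>i j. el j (el i M) = el j (el i N)"
  then have "mk (\<lambda>i j. el j (el i M)) = mk (\<lambda>i j. el j (el i N))" by simp
  then show ?thesis unfolding mk_el .
qed

context vsrg
begin

lemma ww_cs: "ww S i j mod 13 \<in> cs (cl (szb (blkS S i j)))" "ww S i i mod 13 \<in> cs (cld (szb (blkS S i i)))"
proof -
  show "ww S i j mod 13 \<in> cs (cl (szb (blkS S i j)))" unfolding ww_def blkS_def bitsb_def
    by (cases "S i j D0"; cases "S i j D1"; cases "S i j D2"; simp)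
  show "ww S i i mod 13 \<in> cs (cld (szb (blkS S i i)))" using diag0[of i] unfolding ww_def blkS_def bitsb_def
    by (cases "S i i D1"; cases "S i i D2"; simp)
qed

lemma ww_diag: "ww S i i mod 13 \<noteq> 1"
  using diag0[of i] unfolding ww_def by (cases "S i i D1"; cases "S i i D2"; simp)

sublocale search "ww S"
  using residues ww_diag by unfold_locales

lemma leaf:
  assumes R: "szmat R = mk (\<lambda>i j. szb (blkS S i j))"
    and an: "\<And>i j. Pr i j \<in> set (toks as) \<Longrightarrow> ww S i j mod 13 \<in> {0, 1, 12}"
    and f: "\<And>i j ks qs. steps ps = (Pr i j # ks) # qs \<Longrightarrow> ww S i j mod 13 \<noteq> 9 \<and> ww S i j mod 13 \<noteq> 4"
    and sol: "solve (Task R as ps ls)" and sd: "sizedl (szmat R) (blkmats ls)"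
  shows "mk (blkS S) \<in> set (blkmats ls)"
proof -
  let ?n = "\<lambda>i j. szb (blkS S i j)"
  have "ok (init (mk ?n))" unfolding ok_def by (simp add: el_init ww_cs)
  then have "ok (anchor (toks as) (init (mk ?n)))" by (rule ok_anchor[OF _ an])
  then obtain N where N: "N \<in> set (run1 (steps ps) (anchor (toks as) (init (mk ?n))))" "ok N"
    using ok_run1 f by blast
  then have m: "combmat (mk ?n) N \<in> set (blkmats ls)"
    using combs_set[OF N(1), of "mk ?n"] sol by (simp add: R)
  \<comment> \<open>All listed results have the sizes prescribed by \<open>R\<close>, so no cell of
    \<open>N\<close> that matters is still open.\<close>
  have "szbm (combmat (mk ?n) N) = mk ?n" using sizedl_set[OF sd m] R by simp
  then have "el j (el i (szbm (combmat (mk ?n) N))) = ?n i j" for i j by simp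
  then have s: "szb (comb (?n i j) (el j (el i N))) = ?n i j" for i j
    by (simp add: el_mrow el_combmat)
  have "combmat (mk ?n) N = mk (blkS S)"
  proof (rule mat_eqI)
    fix i j
    have "ww S i j mod 13 \<in> cs (el j (el i N))" using N(2) by (simp add: ok_def)
    then show "el j (el i (combmat (mk ?n) N)) = el j (el i (mk (blkS S)))"
      using comb_blkS s by (simp add: el_combmat)
  qed
  then show ?thesis using m by simp
qed

end

section \<open>Normal forms under permutations, rotations and negation\<close>

lemma vsrg_iso: "vsrg S \<Longrightarrow> isoA (adjS T) (adjS S) \<Longrightarrow> vsrg T"
  unfolding vsrg_def using srg_iso by blast

lemma lexle_total: "length xs = length ys \<Longrightarrow> lexle xs ys \<or> lexle ys xs"
proof (induction xs ys rule: list_induct2)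
  case (Cons x xs y ys)
  have "cmp x y = EQ \<and> cmp y x = EQ \<or> cmp x y = LT \<and> cmp y x = GT \<or> cmp x y = GT \<and> cmp y x = LT"
    by (cases x; cases y) simp_all
  then show ?case using Cons by auto
qed simp

abbreviation szS :: "(idx \<Rightarrow> idx \<Rightarrow> z3 \<Rightarrow> bool) \<Rightarrow> idx \<Rightarrow> idx \<Rightarrow> sz" where
  "szS S \<equiv> (\<lambda>i j. szb (blkS S i j))"

fun pe :: "idx \<Rightarrow> idx \<Rightarrow> idx \<Rightarrow> idx \<Rightarrow> idx" where
  "pe x y z I4 = x" | "pe x y z I5 = y" | "pe x y z I6 = z" | "pe x y z I0 = I0" | "pe x y z I1 = I1"
| "pe x y z I2 = I2" | "pe x y z I3 = I3"

fun swb :: "idx \<Rightarrow> idx" where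
  "swb I0 = I1" | "swb I1 = I0" | "swb I2 = I2" | "swb I3 = I3" | "swb I4 = I4" | "swb I5 = I5" | "swb I6 = I6"

lemma iso_pe:
  assumes "(x, y, z) \<in> {(I4, I5, I6), (I4, I6, I5), (I5, I4, I6), (I5, I6, I4), (I6, I4, I5), (I6, I5, I4)}"
  shows "isoA (adjS (permS (pe x y z) S)) (adjS S)"
proof (rule iso_perm)
  have "pe x y z i = pe x y z j \<Longrightarrow> i = j" for i j using assms by (cases i; cases j) auto
  then show "inj (pe x y z)" by (auto simp: inj_def)
  show "ou (pe x y z i) = ou i" "iw (pe x y z i) = iw i" for i using assms by (cases i; auto)+
qed

lemma iso_swb: "isoA (adjS (permS swb S)) (adjS S)"
proof (rule iso_perm)
  have "swb i = swb j \<Longrightarrow> i = j" for i j by (cases i; cases j) auto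
  then show "inj swb" by (auto simp: inj_def)
  show "ou (swb i) = ou i" "iw (swb i) = iw i" for i by (cases i; simp)+
qed

lemma szS_perm: "szS (permS f S) i j = szS S (f i) (f j)"
  by (simp add: blkS_def permS_def)

lemma path3:
  assumes "\<And>x y. lq x y \<or> lq y x"
  obtains x y z where "(x, y, z) \<in> {(I4, I5, I6), (I4, I6, I5), (I5, I4, I6), (I5, I6, I4), (I6, I4, I5), (I6, I5, I4)}"
    "lq x y" "lq y z"
  using assms[of I4 I5] assms[of I4 I6] assms[of I5 I6] by blast

text \<open>Permuting \<open>I4\<close>, \<open>I5\<close>, \<open>I6\<close> does not touch the
  entries compared for the exchange of \<open>I0\<close> and \<open>I1\<close>, so the two
  normalisations can be made one after the other.\<close>

lemma normal_perm:
  assumes "vsrg S"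
  obtains T where "isoA (adjS T) (adjS S)" "lexle [szS T I0 I0, szS T I0 I1] [szS T I1 I1, szS T I1 I0]"
    "lexle (key I4 (mk (szS T))) (key I5 (mk (szS T)))" "lexle (key I5 (mk (szS T))) (key I6 (mk (szS T)))"
proof -
  obtain T0 where T0: "isoA (adjS T0) (adjS S)" "lexle [szS T0 I0 I0, szS T0 I0 I1] [szS T0 I1 I1, szS T0 I1 I0]"
  proof (cases "lexle [szS S I0 I0, szS S I0 I1] [szS S I1 I1, szS S I1 I0]")
    case True then show ?thesis using that[OF isoA_refl] by blast
  next
    case False
    then have "lexle [szS S I1 I1, szS S I1 I0] [szS S I0 I0, szS S I0 I1]"
      using lexle_total[of "[szS S I1 I1, szS S I1 I0]" "[szS S I0 I0, szS S I0 I1]"] by simp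
    then show ?thesis using that[OF iso_swb] by (simp add: szS_perm)
  qed
  have "lexle (key x (mk (szS T0))) (key y (mk (szS T0))) \<or> lexle (key y (mk (szS T0))) (key x (mk (szS T0)))" for x y
    by (rule lexle_total) simp
  then obtain x y z where p: "(x, y, z) \<in> {(I4, I5, I6), (I4, I6, I5), (I5, I4, I6), (I5, I6, I4), (I6, I4, I5), (I6, I5, I4)}"
    and l: "lexle (key x (mk (szS T0))) (key y (mk (szS T0)))" "lexle (key y (mk (szS T0))) (key z (mk (szS T0)))"
    by (rule path3)
  have k: "key j (mk (szS (permS (pe x y z) T0))) = key (pe x y z j) (mk (szS T0))" for j
    by (simp add: szS_perm)
  show ?thesis
  proof (rule that)
    show "isoA (adjS (permS (pe x y z) T0)) (adjS S)" using iso_pe[OF p] T0(1) by (rule isoA_trans)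
    show "lexle [szS (permS (pe x y z) T0) I0 I0, szS (permS (pe x y z) T0) I0 I1]
      [szS (permS (pe x y z) T0) I1 I1, szS (permS (pe x y z) T0) I1 I0]"
      unfolding szS_perm pe.simps by (rule T0(2))
    show "lexle (key I4 (mk (szS (permS (pe x y z) T0)))) (key I5 (mk (szS (permS (pe x y z) T0))))"
      "lexle (key I5 (mk (szS (permS (pe x y z) T0)))) (key I6 (mk (szS (permS (pe x y z) T0))))"
      unfolding k pe.simps by (rule l)+
  qed
qed

lemma (in vsrg) size_matrix:
  assumes "lexle [szS S I0 I0, szS S I0 I1] [szS S I1 I1, szS S I1 I0]"
    "lexle (key I4 (mk (szS S))) (key I5 (mk (szS S)))" "lexle (key I5 (mk (szS S))) (key I6 (mk (szS S)))"
  shows "size_matrix (szS S)"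
proof
  fix i j
  show "szS S i j \<noteq> ZX" by (cases "blkS S i j") simp_all
  have "nn S i i \<noteq> 3" using diag0[of i] bt_bd(2)[of "S i i D1"] bt_bd(2)[of "S i i D2"] by (simp add: nn_def)
  then show "szS S i i \<noteq> Z3" unfolding szv_blkS[symmetric] by (metis szv.simps(4))
  show "szv (szS S i I0) + szv (szS S i I1) + szv (szS S i I3) = 4 - bt (ou i)"
    "szv (szS S i I2) + szv (szS S i I4) + szv (szS S i I5) + szv (szS S i I6) = 5"
    "szv (szS S I0 j) + szv (szS S I1 j) + szv (szS S I2 j) = 4 - bt (iw j)"
    "szv (szS S I3 j) + szv (szS S I4 j) + szv (szS S I5 j) + szv (szS S I6 j) = 5"
    "(\<Sum>z\<in>UNIV. szv (szS S i z) * szv (szS S z j)) + szv (szS S i j) = 12 + (if i = j then 2 else 0) - 3 * bt (ou i) * bt (iw j)"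
    "6 \<le> bt (ou i) * bt (iw i) + (\<Sum>z\<in>UNIV. if z = i then (if szv (szS S i i) = 2 then 2 else 0)
        else min (szv (szS S i z)) (szv (szS S z i)))"
    "even (\<Sum>i\<in>UNIV. szv (szS S i i))"
    unfolding szv_blkS by (rule out_u out_e in_w in_e sizes recip_le trace_even)+
qed (rule assms)+

text \<open>One block from each class under rotation, chosen so that negation fixes it; hence the
  anchors survive the passage to \<open>negS\<close>.\<close>

definition anchored :: "blk \<Rightarrow> bool" where
  "anchored b \<longleftrightarrow> b \<in> {B0, B7, B1, B6}"

lemma ww_anchored: "anchored (blkS S i j) \<Longrightarrow> ww S i j mod 13 \<in> {0, 1, 12}"
  unfolding anchored_def blkS_def bitsb_def ww_def
  by (cases "S i j D0"; cases "S i j D1"; cases "S i j D2") simp_all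

lemma inverts_iff: "inverts v ks \<longleftrightarrow> (\<exists>i j. Pr i j \<in> set ks \<and> (v = i \<or> v = j))"
proof (induction ks)
  case (Cons k ks) then show ?case by (cases k) (auto split: if_splits)
qed simp

lemma anchor_ex: "i \<noteq> j \<Longrightarrow> \<exists>e. anchored (blkS (shiftS (c(j := e)) S) i j)" "i \<noteq> j \<Longrightarrow> \<exists>e. anchored (blkS (shiftS (c(i := e)) S) i j)"
proof -
  assume ij: "i \<noteq> j"
  have ex: "(\<exists>e::z3. P e) \<longleftrightarrow> P D0 \<or> P D1 \<or> P D2" for P by (metis z3.exhaust)
  show "\<exists>e. anchored (blkS (shiftS (c(j := e)) S) i j)" unfolding ex
    using ij by (cases "c i"; cases "S i j D0"; cases "S i j D1"; cases "S i j D2")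
      (simp_all add: anchored_def blkS_def bitsb_def shiftS_def)
  show "\<exists>e. anchored (blkS (shiftS (c(i := e)) S) i j)" unfolding ex
    using ij by (cases "c j"; cases "S i j D0"; cases "S i j D1"; cases "S i j D2")
      (simp_all add: anchored_def blkS_def bitsb_def shiftS_def)
qed

lemma forest_shift: "forest ks \<Longrightarrow> \<exists>c. \<forall>i j. Pr i j \<in> set ks \<longrightarrow> anchored (blkS (shiftS c S) i j)"
proof (induction ks)
  case (Cons k ks)
  show ?case
  proof (cases k)
    case Sp then show ?thesis using Cons by auto
  next
    case (Pr i j)
    have f: "forest ks" "i \<noteq> j" "\<not> inverts i ks \<or> \<not> inverts j ks" using Cons.prems Pr by (auto split: if_splits)
    obtain c where c: "\<And>i j. Pr i j \<in> set ks \<Longrightarrow> anchored (blkS (shiftS c S) i j)" using Cons.IH[OF f(1)] by blast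
    have keep: "anchored (blkS (shiftS (c(v := e)) S) i' j')" if "\<not> inverts v ks" "Pr i' j' \<in> set ks" for v e i' j'
    proof -
      have "v \<noteq> i'" "v \<noteq> j'" using that unfolding inverts_iff by blast+
      then have "blkS (shiftS (c(v := e)) S) i' j' = blkS (shiftS c S) i' j'" by (simp add: blkS_def shiftS_def)
      then show ?thesis using c[OF that(2)] by simp
    qed
    have fin: ?thesis if "anchored (blkS (shiftS c' S) i j)" "\<And>i' j'. Pr i' j' \<in> set ks \<Longrightarrow> anchored (blkS (shiftS c' S) i' j')" for c'
      using that Pr by (intro exI[of _ c']) auto
    from f(3) show ?thesis
    proof
      assume v: "\<not> inverts i ks"
      obtain e where e: "anchored (blkS (shiftS (c(i := e)) S) i j)" using anchor_ex(2)[OF f(2)] by blast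
      show ?thesis by (rule fin[OF e keep[OF v]])
    next
      assume v: "\<not> inverts j ks"
      obtain e where e: "anchored (blkS (shiftS (c(j := e)) S) i j)" using anchor_ex(1)[OF f(2)] by blast
      show ?thesis by (rule fin[OF e keep[OF v]])
    qed
  qed
qed simp

lemma szS_shift: "szS (shiftS c S) = szS S"
proof (intro ext)
  fix i j show "szS (shiftS c S) i j = szS S i j"
    unfolding blkS_def bitsb_def shiftS_def by (cases "c i"; cases "c j") (auto split: if_splits)
qed

lemma szS_neg: "szS (negS S) = szS S"
  unfolding blkS_def bitsb_def negS_def by (auto intro!: ext split: if_splits)

lemma anchored_neg: "anchored (blkS S i j) \<Longrightarrow> anchored (blkS (negS S) i j)"
  unfolding anchored_def blkS_def bitsb_def negS_def
  by (cases "S i j D0"; cases "S i j D1"; cases "S i j D2") simp_all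

text \<open>Negation exchanges the elements 1 and 2, hence the residues 3 and 9 of single arcs and
  10 and 4 of their complements.\<close>

lemma ww_neg: "ww S i j mod 13 \<noteq> 9 \<and> ww S i j mod 13 \<noteq> 4 \<or> ww (negS S) i j mod 13 \<noteq> 9 \<and> ww (negS S) i j mod 13 \<noteq> 4"
  unfolding ww_def negS_def by (cases "S i j D0"; cases "S i j D1"; cases "S i j D2") simp_all

lemma memb_iff: "memb x ys \<longleftrightarrow> x \<in> set ys"
  by (induction ys) auto

lemma subl_iff: "subl xs ys \<longleftrightarrow> set xs \<subseteq> set ys"
  by (induction xs) (auto simp: memb_iff)

lemma blkmats_leafs: "Task R as ps ls \<in> set ts \<Longrightarrow> set (blkmats ls) \<subseteq> set (leafs ts)"
  by (induction ts rule: leafs.induct) auto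

lemma taskR_set: "M \<in> set (taskR ts) \<Longrightarrow> \<exists>R as ps ls. Task R as ps ls \<in> set ts \<and> szmat R = M"
  by (induction ts rule: taskR.induct) auto

lemma solves_set: "solves ts \<Longrightarrow> t \<in> set ts \<Longrightarrow> solve t"
  by (induction ts) (auto split: if_splits simp del: solve.simps)

lemma wellf_set: "wellf ts \<Longrightarrow> Task R as ps ls \<in> set ts \<Longrightarrow> sizedl (szmat R) (blkmats ls) \<and> forest (toks as)"
  by (induction ts rule: wellf.induct) (auto split: if_splits)

text \<open>Combines the normalisations: a permutation of the orbits fixes the size matrix,
  rotations achieve the anchors, and negation is applied if the first branching cell demands it.
  Neither of the last two changes the sizes.\<close>

theorem leaf_exists:
  assumes S: "vsrg S" and sub: "set (lpA rowsA0 rowsB) \<union> set (lpA rowsA1 rowsB) \<union> set (lpA rowsA2 rowsB) \<union>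
      set (lpA rowsA3 rowsB) \<subseteq> set (taskR ts)" and sol: "solves ts" and wf: "wellf ts"
  shows "\<exists>M\<in>set (leafs ts). isoA (adjS S) (adjm M)"
proof -
  obtain T where T: "isoA (adjS T) (adjS S)" "lexle [szS T I0 I0, szS T I0 I1] [szS T I1 I1, szS T I1 I0]"
    "lexle (key I4 (mk (szS T))) (key I5 (mk (szS T)))" "lexle (key I5 (mk (szS T))) (key I6 (mk (szS T)))"
    using normal_perm[OF S] .
  interpret T: vsrg T using S T(1) by (rule vsrg_iso)
  interpret size_matrix "szS T" by (rule T.size_matrix[OF T(2-4)])
  obtain R as ps ls where t: "Task R as ps ls \<in> set ts" and R: "szmat R = mk (szS T)"
    using taskR_set stage1 sub by blast
  have w: "sizedl (szmat R) (blkmats ls)" "forest (toks as)" using wellf_set[OF wf t] by simp_all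
  obtain c where c: "\<And>i j. Pr i j \<in> set (toks as) \<Longrightarrow> anchored (blkS (shiftS c T) i j)"
    using forest_shift[OF w(2)] by blast
  obtain X where X: "isoA (adjS X) (adjS T)" "szS X = szS T" "\<And>i j. Pr i j \<in> set (toks as) \<Longrightarrow> anchored (blkS X i j)"
    "\<And>i j ks qs. steps ps = (Pr i j # ks) # qs \<Longrightarrow> ww X i j mod 13 \<noteq> 9 \<and> ww X i j mod 13 \<noteq> 4"
  proof (cases "\<forall>i j ks qs. steps ps = (Pr i j # ks) # qs \<longrightarrow> ww (shiftS c T) i j mod 13 \<noteq> 9 \<and> ww (shiftS c T) i j mod 13 \<noteq> 4")
    case True then show ?thesis using that[OF iso_shift szS_shift c] by blast
  next
    case False
    then obtain i j ks qs where s: "steps ps = (Pr i j # ks) # qs" "\<not> (ww (shiftS c T) i j mod 13 \<noteq> 9 \<and> ww (shiftS c T) i j mod 13 \<noteq> 4)"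
      by blast
    show ?thesis
    proof (rule that[of "negS (shiftS c T)"])
      show "isoA (adjS (negS (shiftS c T))) (adjS T)" by (rule isoA_trans[OF iso_neg iso_shift])
      show "szS (negS (shiftS c T)) = szS T" unfolding szS_neg szS_shift ..
      show "anchored (blkS (negS (shiftS c T)) i j)" if "Pr i j \<in> set (toks as)" for i j
        by (rule anchored_neg[OF c[OF that]])
      show "ww (negS (shiftS c T)) i' j' mod 13 \<noteq> 9 \<and> ww (negS (shiftS c T)) i' j' mod 13 \<noteq> 4"
        if "steps ps = (Pr i' j' # ks') # qs'" for i' j' ks' qs'
        using ww_neg[of "shiftS c T" i j] s that by auto
    qed
  qed
  interpret X: vsrg X using T.vsrg_axioms X(1) by (rule vsrg_iso)
  have "mk (blkS X) \<in> set (blkmats ls)"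
  proof (rule X.leaf[OF _ _ _ solves_set[OF sol t] w(1)])
    show "szmat R = mk (szS X)" unfolding X(2) by (rule R)
    show "ww X i j mod 13 \<in> {0, 1, 12}" if "Pr i j \<in> set (toks as)" for i j by (rule ww_anchored[OF X(3)[OF that]])
    show "ww X i j mod 13 \<noteq> 9 \<and> ww X i j mod 13 \<noteq> 4" if "steps ps = (Pr i j # ks) # qs" for i j ks qs
      by (rule X(4)[OF that])
  qed
  then have "mk (blkS X) \<in> set (leafs ts)" using blkmats_leafs[OF t] by blast
  moreover have "isoA (adjS S) (adjm (mk (blkS X)))"
    unfolding adjm_blkS by (rule isoA_sym[OF isoA_trans[OF X(1) T(1)]])
  ultimately show ?thesis by blast
qed

section \<open>Invariants of the results\<close>

lemma set_vs: "set vs = UNIV" and distinct_vs: "distinct vs"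
proof -
  have "x \<in> set vs" for x :: vx
  proof (cases x)
    case (Some p)
    obtain i d where "p = (i, d)" by (cases p)
    then show ?thesis unfolding Some vs_def by (cases i; cases d; simp)
  qed (simp add: vs_def)
  then show 1: "set vs = UNIV" by blast
  show "distinct vs" by (rule card_distinct) (simp add: 1 card_vx, simp add: vs_def)
qed

lemma sum_vs: "(\<Sum>x\<leftarrow>vs. g x) = (\<Sum>x\<in>UNIV. (g x :: int))"
  using sum.distinct_set_conv_list[OF distinct_vs, of g] by (simp add: set_vs)

text \<open>The invariant \<open>hh\<close> distinguishes the fixed vertex from all others in each result of the search,
  and \<open>WW\<close> separates the isomorphism classes.\<close>

definition cn :: "('v::finite \<Rightarrow> 'v \<Rightarrow> bool) \<Rightarrow> 'v \<Rightarrow> 'v \<Rightarrow> int" where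
  "cn A x y = (\<Sum>z\<in>UNIV. bt (A x z) * bt (A y z))"

definition hh :: "('v::finite \<Rightarrow> 'v \<Rightarrow> bool) \<Rightarrow> 'v \<Rightarrow> int" where
  "hh A x = (\<Sum>y\<in>UNIV. (cn A x y)\<^sup>2 * (2 * bt (A x y) + 3 * bt (A y x)))"

definition WW :: "('v::finite \<Rightarrow> 'v \<Rightarrow> bool) \<Rightarrow> int" where
  "WW A = (\<Sum>x\<in>UNIV. hh A x * (\<Sum>y\<in>UNIV. bt (A x y) * hh A y))"

lemma
  assumes h: "bij h" and e: "\<And>x y. A x y = B (h x) (h y)"
  shows hh_iso: "hh A x = hh B (h x)" and WW_iso: "WW A = WW B"
proof -
  have re: "(\<Sum>y\<in>UNIV. g (h y)) = (\<Sum>y\<in>UNIV. (g y :: int))" for g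
    using sum.reindex_bij_betw[OF h] .
  have 1: "cn A x y = cn B (h x) (h y)" for x y
    unfolding cn_def e using re[of "\<lambda>z. bt (B (h x) z) * bt (B (h y) z)"] .
  show 2: "hh A x = hh B (h x)" for x
    unfolding hh_def 1 e using re[of "\<lambda>y. (cn B (h x) y)\<^sup>2 * (2 * bt (B (h x) y) + 3 * bt (B y (h x)))"] .
  have "(\<Sum>y\<in>UNIV. bt (A x y) * hh A y) = (\<Sum>y\<in>UNIV. bt (B (h x) y) * hh B y)" for x
    unfolding 2 e using re[of "\<lambda>y. bt (B (h x) y) * hh B y"] .
  then show "WW A = WW B" unfolding WW_def 2
    using re[of "\<lambda>x. hh B x * (\<Sum>y\<in>UNIV. bt (B x y) * hh B y)"] by simp
qed

lemma rowl_map: "rowl M x ys = map (adjm M x) ys"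
  by (induction ys) auto

lemma coll_map: "coll M x ys = map (\<lambda>y. adjm M y x) ys"
  by (induction ys) auto

lemma rowls_map: "rowls M ys xs = map (\<lambda>x. map (adjm M x) ys) xs"
  by (induction xs) (auto simp: rowl_map)

lemma colls_map: "colls M ys xs = map (\<lambda>x. map (\<lambda>y. adjm M y x) ys) xs"
  by (induction xs) (auto simp: coll_map)

lemma cnt_map: "int (cnt (map f xs) (map g xs)) = (\<Sum>z\<leftarrow>xs. bt (f z) * bt (g z))"
proof (induction xs)
  case (Cons x xs) then show ?case by (cases "f x"; cases "g x") auto
qed simp

lemma sq_eq: "sq n = (int n)\<^sup>2"
  by (cases n rule: sq.cases) simp_all

lemma hs_map: "hs r (map q ys) (map f ys) (map g ys) = (\<Sum>y\<leftarrow>ys. (int (cnt r (q y)))\<^sup>2 * (2 * bt (f y) + 3 * bt (g y)))"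
proof (induction ys)
  case (Cons y ys) then show ?case by (cases "f y"; cases "g y") (auto simp: sq_eq)
qed simp

lemma hlist_map: "hlist rs (map q xs) (map c xs) = map (\<lambda>x. hs (q x) rs (q x) (c x)) xs"
  by (induction xs) auto

lemma dotb_map: "dotb (map f xs) (map k xs) = (\<Sum>x\<leftarrow>xs. bt (f x) * k x)"
proof (induction xs)
  case (Cons x xs) then show ?case by (cases "f x") auto
qed simp

lemma wsum_map: "wsum gs (map k xs) (map r xs) = (\<Sum>x\<leftarrow>xs. k x * dotb (r x) gs)"
  by (induction xs) auto

lemma cnt_rows: "int (cnt (map (adjm M x) vs) (map (adjm M y) vs)) = cn (adjm M) x y"
  by (simp add: cnt_map sum_vs cn_def)

lemma hlist_vs: "hlist (rowls M vs vs) (rowls M vs vs) (colls M vs vs) = map (hh (adjm M)) vs"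
  unfolding rowls_map colls_map hlist_map hs_map cnt_rows sum_vs hh_def by (rule refl)

lemma wsum_vs: "wsum (map (hh (adjm M)) vs) (map (hh (adjm M)) vs) (rowls M vs vs) = WW (adjm M)"
  unfolding rowls_map wsum_map dotb_map sum_vs WW_def by (rule refl)

lemma isn: "is3 n \<longleftrightarrow> n = 3" "is4 n \<longleftrightarrow> n = 4" "is6 n \<longleftrightarrow> n = 6" "is9 n \<longleftrightarrow> n = 9"
proof -
  show 3: "is3 n \<longleftrightarrow> n = 3" for n by (cases n rule: is3.cases) simp_all
  show 4: "is4 n \<longleftrightarrow> n = 4" for n by (cases n) (simp_all add: 3)
  show 6: "is6 n \<longleftrightarrow> n = 6" for n by (cases n rule: is6.cases) (simp_all add: 4)
  show "is9 n \<longleftrightarrow> n = 9" by (cases n rule: is9.cases) (simp_all add: 6)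
qed

lemma path_iff: "path e b n \<longleftrightarrow> \<not> (e \<and> b) \<and> int n = (if e then 6 else if b then 3 else 4)"
  by (cases e; cases b) (auto simp: isn)

lemma vrow_map: "vrow x r (map f ys) ys (map c ys) \<longleftrightarrow> (\<forall>y\<in>set ys. path (x = y) (f y) (cnt r (c y)))"
  by (induction ys) auto

lemma valids_map: "valids ys xs (map r xs) (map c xs) ds \<longleftrightarrow>
    (\<forall>x\<in>set xs. is9 (cnt (r x) (r x)) \<and> is9 (cnt (c x) (c x)) \<and> vrow x (r x) (r x) ys ds)"
  by (induction xs) auto

text \<open>A direct check of the definition, independent of how \<open>M\<close> was found;
  counting a 0-1 list against itself gives the degrees.\<close>

lemma valids_srg:
  assumes v: "valids vs vs (rowls M vs vs) (colls M vs vs) (colls M vs vs)"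
  shows "srg (adjm M)"
proof -
  have v': "is9 (cnt (map (adjm M x) vs) (map (adjm M x) vs))" "is9 (cnt (map (\<lambda>y. adjm M y x) vs) (map (\<lambda>y. adjm M y x) vs))"
    "path (x = y) (adjm M x y) (cnt (map (adjm M x) vs) (map (\<lambda>z. adjm M z y) vs))" for x y
    using v unfolding rowls_map colls_map valids_map vrow_map set_vs by blast+
  have sq: "bt b * bt b = bt b" for b by (cases b) simp_all
  have 1: "(\<Sum>y\<in>UNIV. bt (adjm M x y)) = 9" "(\<Sum>y\<in>UNIV. bt (adjm M y x)) = 9" for x
    using v'(1,2)[of x] unfolding isn by (simp_all add: cnt_map sum_vs sq flip: of_nat_eq_iff[where 'a = int])
  have 2: "(\<Sum>z\<in>UNIV. bt (adjm M x z) * bt (adjm M z y)) = (if x = y then 6 else if adjm M x y then 3 else 4)" for x y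
    using v'(3)[of x y] unfolding path_iff cnt_map sum_vs by blast
  have 3: "\<not> adjm M x x" for x using v'(3)[of x x] unfolding path_iff by blast
  show ?thesis unfolding srg_def bt_def[symmetric] by (intro conjI allI 1 2 3)
qed

section \<open>The search for isomorphisms\<close>

lemma cons_iff: "cons M N x y ps \<longleftrightarrow> (\<forall>(x', y')\<in>set ps. adjm M x x' = adjm N y y' \<and> adjm M x' x = adjm N y' y \<and> y \<noteq> y')"
  by (induction ps) (auto split: if_splits)

lemma exm_iff: "qs \<in> set (exm M N x ps ys) \<longleftrightarrow> (\<exists>y\<in>set ys. qs = (x, y) # ps \<and> cons M N x y ps)"
  by (induction ys) auto

lemma exl_iff: "qs \<in> set (exl M N x ys pss) \<longleftrightarrow> (\<exists>ps\<in>set pss. \<exists>y\<in>set ys. qs = (x, y) # ps \<and> cons M N x y ps)"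
  by (induction pss) (auto simp: exm_iff)

text \<open>An isomorphism \<open>h\<close> passes every consistency test, so the list of its pairs
  survives each level; later choices stand in front, hence the reversal.\<close>

lemma bfs_complete:
  assumes "bij h" "\<And>x y. adjm M x y = adjm N (h x) (h y)"
  shows "ps \<in> set pss \<Longrightarrow> \<forall>(x, y)\<in>set ps. y = h x \<Longrightarrow> distinct xs \<Longrightarrow> set xs \<inter> fst ` set ps = {} \<Longrightarrow>
    rev (map (\<lambda>x. (x, h x)) xs) @ ps \<in> set (bfs M N vs xs pss)"
proof (induction xs arbitrary: ps pss)
  case (Cons x xs)
  have "cons M N x (h x) ps"
    unfolding cons_iff
  proof (clarify)
    fix x' y' assume p: "(x', y') \<in> set ps"
    then have y: "y' = h x'" using Cons.prems(2) by blast
    have "x \<noteq> x'" using Cons.prems(4) p by force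
    then show "adjm M x x' = adjm N (h x) y' \<and> adjm M x' x = adjm N y' (h x) \<and> h x \<noteq> y'"
      unfolding y using assms bij_is_inj[OF assms(1)] by (auto simp: inj_eq)
  qed
  then have "(x, h x) # ps \<in> set (exl M N x vs pss)" unfolding exl_iff set_vs using Cons.prems(1) by blast
  from Cons.IH[OF this] show ?case using Cons.prems by auto
qed simp

definition pm :: "blk row row \<Rightarrow> blk row row \<Rightarrow> (vx \<times> vx) list \<Rightarrow> bool" where
  "pm M N ps \<longleftrightarrow> distinct (map fst ps) \<and> (\<forall>(x, y)\<in>set ps. \<forall>(x', y')\<in>set ps. adjm M x x' = adjm N y y' \<and> (x \<noteq> x' \<longrightarrow> y \<noteq> y'))"

lemma pm_cons:
  assumes l: "\<And>x. \<not> adjm M x x" "\<And>x. \<not> adjm N x x"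
  shows "pm M N ps \<Longrightarrow> cons M N x y ps \<Longrightarrow> x \<notin> fst ` set ps \<Longrightarrow> pm M N ((x, y) # ps)"
  unfolding pm_def cons_iff using l by (fastforce simp: image_iff)

lemma bfs_sound:
  assumes l: "\<And>x. \<not> adjm M x x" "\<And>x. \<not> adjm N x x"
  shows "qs \<in> set (bfs M N vs xs pss) \<Longrightarrow> \<forall>ps\<in>set pss. pm M N ps \<and> fst ` set ps = X \<Longrightarrow> distinct xs \<Longrightarrow> set xs \<inter> X = {} \<Longrightarrow>
    \<exists>ps\<in>set pss. pm M N qs \<and> fst ` set qs = X \<union> set xs \<and> set ps \<subseteq> set qs"
proof (induction xs arbitrary: pss X)
  case (Cons x xs)
  have "\<forall>ps\<in>set (exl M N x vs pss). pm M N ps \<and> fst ` set ps = insert x X"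
  proof
    fix qs assume "qs \<in> set (exl M N x vs pss)"
    then obtain ps y where q: "ps \<in> set pss" "qs = (x, y) # ps" "cons M N x y ps" unfolding exl_iff by blast
    then have "pm M N ps" "fst ` set ps = X" "x \<notin> X" using Cons.prems(2,4) by auto
    then show "pm M N qs \<and> fst ` set qs = insert x X" using pm_cons[OF l _ q(3)] q(2) by simp
  qed
  then have "\<exists>ps\<in>set (exl M N x vs pss). pm M N qs \<and> fst ` set qs = insert x X \<union> set xs \<and> set ps \<subseteq> set qs"
    using Cons.IH[of "exl M N x vs pss" "insert x X"] Cons.prems by auto
  then obtain ps' where ps': "ps' \<in> set (exl M N x vs pss)" "pm M N qs" "fst ` set qs = insert x X \<union> set xs" "set ps' \<subseteq> set qs"
    by blast
  then obtain ps y where "ps \<in> set pss" "ps' = (x, y) # ps" unfolding exl_iff by blast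
  then show ?case using ps' by (intro bexI[of _ ps]) auto
qed auto

lemma starts_iff: "ps \<in> set (starts M N pss) \<longleftrightarrow> ps \<in> set pss \<and> stok M N ps"
  by (induction pss) auto

lemma stok_pm:
  assumes l: "\<And>x. \<not> adjm M x x" "\<And>x. \<not> adjm N x x"
  shows "stok M N ps \<Longrightarrow> distinct (map fst ps) \<Longrightarrow> pm M N ps"
proof (induction ps)
  case (Cons p ps)
  obtain x y where p: "p = (x, y)" by (cases p)
  have "x \<notin> fst ` set ps" using Cons.prems(2) p by simp
  then show ?case using Cons pm_cons[OF l, of ps x y] by (auto simp: p split: if_splits)
qed (simp add: pm_def)

lemma stok_complete:
  assumes "bij h" "\<And>x y. adjm M x y = adjm N (h x) (h y)"
  shows "\<forall>(x, y)\<in>set ps. y = h x \<Longrightarrow> distinct (map fst ps) \<Longrightarrow> stok M N ps"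
proof (induction ps)
  case (Cons p ps)
  obtain x y where p: "p = (x, y)" by (cases p)
  have "cons M N x y ps" unfolding cons_iff
    using Cons.prems assms bij_is_inj[OF assms(1)] unfolding p by (force simp: inj_eq)
  then show ?case using Cons p by auto
qed simp

abbreviation pC :: "z3 \<Rightarrow> vx" where "pC d \<equiv> Some (I2, d)"

lemma start_simps: "fst ` set stid = {None, pC D0, pC D1, pC D2}" "fst ` set stsw = {None, pC D0, pC D1, pC D2}"
  "distinct (map fst stid)" "distinct (map fst stsw)" "distinct vs1" "set vs1 \<inter> {None, pC D0, pC D1, pC D2} = {}"
  by (auto simp: stid_def stsw_def vs1_def)

lemma vs1_union: "{None, pC D0, pC D1, pC D2} \<union> set vs1 = UNIV"
proof -
  have "x \<in> {None, pC D0, pC D1, pC D2} \<union> set vs1" for x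
  proof (cases x)
    case (Some p)
    obtain i d where "p = (i, d)" by (cases p)
    then show ?thesis unfolding Some vs1_def by (cases i; cases d; simp)
  qed simp
  then show ?thesis by blast
qed

lemma pm_iso:
  assumes "pm M N qs" "fst ` set qs = UNIV"
  obtains h where "bij h" "\<And>x y. adjm M x y = adjm N (h x) (h y)" "\<And>x y. (x, y) \<in> set qs \<Longrightarrow> h x = y"
proof -
  define h where "h x = the (map_of qs x)" for x
  have d: "distinct (map fst qs)" using assms(1) by (simp add: pm_def)
  have hv: "h x = y" if "(x, y) \<in> set qs" for x y using d that by (simp add: h_def)
  have mem: "(x, h x) \<in> set qs" for x
  proof -
    have "x \<in> fst ` set qs" using assms(2) by simp
    then obtain y where "(x, y) \<in> set qs" by force
    then show ?thesis using hv by blast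
  qed
  have p: "adjm M x y = adjm N (h x) (h y) \<and> (x \<noteq> y \<longrightarrow> h x \<noteq> h y)" for x y
    using assms(1) mem[of x] mem[of y] unfolding pm_def by blast
  then have "inj h" by (auto simp: inj_def)
  then have "bij h" using finite_UNIV_inj_surj[of h] by (simp add: bij_def)
  then show ?thesis using that p hv by blast
qed

lemma bfs_iso:
  assumes l: "srg (adjm M)" "srg (adjm N)" and ne: "\<not> isnil (bfs M N vs vs1 (starts M N pss))" and p: "set pss \<subseteq> {stid, stsw}"
  obtains h ps where "bij h" "\<And>x y. adjm M x y = adjm N (h x) (h y)" "ps \<in> set pss" "\<forall>(x, y)\<in>set ps. h x = y"
proof -
  have l': "\<not> adjm M x x" "\<not> adjm N x x" for x using l by (simp_all add: srg_def)
  obtain qs where qs: "qs \<in> set (bfs M N vs vs1 (starts M N pss))"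
    using ne by (cases "bfs M N vs vs1 (starts M N pss)") auto
  have "\<forall>ps\<in>set (starts M N pss). pm M N ps \<and> fst ` set ps = {None, pC D0, pC D1, pC D2}"
  proof
    fix ps assume "ps \<in> set (starts M N pss)"
    then have "ps = stid \<or> ps = stsw" "stok M N ps" using p by (auto simp: starts_iff)
    then show "pm M N ps \<and> fst ` set ps = {None, pC D0, pC D1, pC D2}"
      using stok_pm[OF l'] start_simps by auto
  qed
  from bfs_sound[OF l' qs this start_simps(5,6)]
  obtain ps where ps: "ps \<in> set (starts M N pss)" "pm M N qs" "fst ` set qs = UNIV" "set ps \<subseteq> set qs"
    unfolding vs1_union by blast
  from pm_iso[OF ps(2,3)] obtain h where "bij h" "\<And>x y. adjm M x y = adjm N (h x) (h y)" "\<And>x y. (x, y) \<in> set qs \<Longrightarrow> h x = y"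
    by blast
  moreover have "ps \<in> set pss" using ps(1) by (simp add: starts_iff)
  moreover have "\<forall>(x, y)\<in>set ps. h x = y" using calculation(3) ps(4) by auto
  ultimately show ?thesis using that by blast
qed

lemma isom_isoA: "srg (adjm M) \<Longrightarrow> srg (adjm N) \<Longrightarrow> isom M N \<Longrightarrow> isoA (adjm M) (adjm N)"
proof -
  assume "srg (adjm M)" "srg (adjm N)" "isom M N"
  then obtain h ps where "bij h" "\<And>x y. adjm M x y = adjm N (h x) (h y)" "ps \<in> set [stid, stsw]" "\<forall>(x, y)\<in>set ps. h x = y"
    unfolding isom.simps by (rule bfs_iso) auto
  then show ?thesis unfolding isoA_def by blast
qed

lemma diag_eq: "diag xs ps = rev (map (\<lambda>x. (x, x)) xs) @ ps"
  by (induction xs arbitrary: ps) auto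

text \<open>The pairs of \<open>h\<close> are among the results of the search by
  \<open>bfs_complete\<close>, and the only result is the identity.\<close>

lemma rigid_id:
  assumes "rigid M" "bij h" "\<And>x y. adjm M x y = adjm M (h x) (h y)" "h None = None" "\<And>d. h (pC d) = pC d"
  shows "h = id"
proof -
  have "rev (map (\<lambda>x. (x, h x)) vs1) @ stid \<in> set (bfs M M vs vs1 [stid])"
  proof (rule bfs_complete[OF assms(2,3) _ _ start_simps(5)])
    show "stid \<in> set [stid]" by (simp only: list.set insertI1)
    show "\<forall>(x, y)\<in>set stid. y = h x" using assms(4,5) by (simp add: stid_def)
    show "set vs1 \<inter> fst ` set stid = {}" unfolding start_simps(1) by (rule start_simps(6))
  qed
  then have "rev (map (\<lambda>x. (x, h x)) vs1) @ stid = rev (map (\<lambda>x. (x, x)) vs1) @ stid"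
    unfolding assms(1)[unfolded rigid.simps] diag_eq by (simp only: list.set singleton_iff)
  then have "map (\<lambda>x. (x, h x)) vs1 = map (\<lambda>x. (x, x)) vs1"
    by (simp only: append_same_eq rev_is_rev_conv)
  then have "\<forall>x\<in>set vs1. h x = x" by (simp add: map_eq_conv)
  then have v: "h x = x" if "x \<in> set vs1" for x using that by (rule bspec)
  have "h x = x" for x
  proof -
    have "x \<in> {None, pC D0, pC D1, pC D2} \<union> set vs1" by (simp only: vs1_union UNIV_I)
    then consider "x = None" | d where "x = pC d" | "x \<in> set vs1" unfolding Un_iff insert_iff empty_iff by blast
    then show ?thesis by cases (simp_all only: assms(4,5) v)
  qed
  then show ?thesis by (simp add: fun_eq_iff)
qed

lemma swaps_iff:
  assumes "srg (adjm M)"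
  shows "swaps M \<longleftrightarrow> (\<exists>h. bij h \<and> (\<forall>x y. adjm M x y = adjm M (h x) (h y)) \<and> h None = None \<and>
     h (pC D0) = pC D0 \<and> h (pC D1) = pC D2 \<and> h (pC D2) = pC D1)" (is "_ = ?R")
proof
  assume s: "swaps M"
  obtain h ps where h: "bij h" "\<And>x y. adjm M x y = adjm M (h x) (h y)" "ps \<in> set [stsw]" "\<forall>(x, y)\<in>set ps. h x = y"
    by (rule bfs_iso[OF assms assms s[unfolded swaps.simps]]) auto
  then have "h None = None \<and> h (pC D0) = pC D0 \<and> h (pC D1) = pC D2 \<and> h (pC D2) = pC D1" by (simp add: stsw_def)
  then show ?R using h(1,2) by blast
next
  assume ?R
  then obtain h where h: "bij h" "\<And>x y. adjm M x y = adjm M (h x) (h y)" "h None = None"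
    "h (pC D0) = pC D0" "h (pC D1) = pC D2" "h (pC D2) = pC D1" by blast
  have st: "\<forall>(x, y)\<in>set stsw. y = h x" using h by (auto simp: stsw_def)
  have "stok M M stsw" by (rule stok_complete[OF h(1,2) st start_simps(4)])
  then have "stsw \<in> set (starts M M [stsw])" unfolding starts_iff by (simp only: list.set insertI1 simp_thms)
  then have "rev (map (\<lambda>x. (x, h x)) vs1) @ stsw \<in> set (bfs M M vs vs1 (starts M M [stsw]))"
  proof (rule bfs_complete[OF h(1,2) _ st start_simps(5)])
    show "set vs1 \<inter> fst ` set stsw = {}" unfolding start_simps(2) by (rule start_simps(6))
  qed
  moreover have "\<not> isnil xs" if "x \<in> set xs" for x and xs :: "(vx \<times> vx) list list" using that by (cases xs) simp_all
  ultimately show "swaps M" unfolding swaps.simps by blast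
qed

lemma nmem_iff: "nmem k ls \<longleftrightarrow> k \<notin> set ls"
  by (induction ls) auto

lemma info_good:
  assumes "info0 M (rowls M vs vs) (colls M vs vs) = Inf w b"
  shows "srg (adjm M)" "WW (adjm M) = w" "\<And>x. x \<noteq> None \<Longrightarrow> hh (adjm M) x \<noteq> hh (adjm M) None" "rigid M" "swaps M = b"
proof -
  have i: "valids vs vs (rowls M vs vs) (colls M vs vs) (colls M vs vs)" "punq (map (hh (adjm M)) vs)" "rigid M"
    "WW (adjm M) = w" "swaps M = b"
    using assms by (simp_all only: info0.simps info1.simps hlist_vs wsum_vs split: if_splits) auto
  then show "srg (adjm M)" "WW (adjm M) = w" "rigid M" "swaps M = b" by (simp_all only: valids_srg)
  fix x :: vx assume "x \<noteq> None"
  \<comment> \<open>The list \<open>vs\<close> starts with the fixed vertex, so \<open>punq\<close>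
    says that its value of \<open>hh\<close> does not occur again.\<close>
  obtain us where us: "vs = None # us" unfolding vs_def by blast
  have "x \<in> set us" using \<open>x \<noteq> None\<close> set_vs unfolding us by auto
  then show "hh (adjm M) x \<noteq> hh (adjm M) None" using i(2) unfolding us by (simp add: nmem_iff) (metis imageI)
qed

section \<open>Automorphism groups\<close>

definition AU :: "('v \<Rightarrow> 'v \<Rightarrow> bool) \<Rightarrow> ('v \<Rightarrow> 'v) set" where
  "AU A = {h. bij h \<and> (\<forall>x y. A x y = A (h x) (h y))}"

text \<open>Automorphisms as total functions on the vertex type, which are easier to compose;
  \<open>isoG_AG\<close> transfers results to the extensional functions of
  \<open>digraph_AutoGroup\<close>.\<close>

definition AG :: "('v \<Rightarrow> 'v \<Rightarrow> bool) \<Rightarrow> ('v \<Rightarrow> 'v) monoid" where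
  "AG A = \<lparr>carrier = AU A, mult = (\<circ>), one = id\<rparr>"

lemma AU_comp: "h \<in> AU A \<Longrightarrow> k \<in> AU A \<Longrightarrow> h \<circ> k \<in> AU A"
  by (auto simp: AU_def bij_comp)

lemma AU_inv: "h \<in> AU A \<Longrightarrow> inv_into UNIV h \<in> AU A"
proof -
  assume h: "h \<in> AU A"
  then have b: "bij h" and e: "\<And>x y. A x y = A (h x) (h y)" by (auto simp: AU_def)
  have "A x y = A (inv_into UNIV h x) (inv_into UNIV h y)" for x y
    using e[of "inv_into UNIV h x" "inv_into UNIV h y"] b by (simp add: bij_is_surj surj_f_inv_f)
  then show ?thesis using bij_imp_bij_inv[OF b] by (simp add: AU_def)
qed

lemma AG_group: "group (AG A)"
proof (rule groupI)
  fix h assume h: "h \<in> carrier (AG A)"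
  then have "inv_into UNIV h \<in> carrier (AG A)" using AU_inv by (simp add: AG_def)
  moreover have "inv_into UNIV h \<circ> h = id" using h by (simp add: AG_def AU_def bij_is_inj)
  ultimately show "\<exists>k\<in>carrier (AG A). k \<otimes>\<^bsub>AG A\<^esub> h = \<one>\<^bsub>AG A\<^esub>" by (auto simp: AG_def)
qed (auto simp: AG_def AU_comp comp_assoc, simp add: AU_def)

text \<open>Labels the vertices of a digraph by the elements of a type, so that sums over
  \<open>UNIV\<close> can replace sums over the vertex set.\<close>

definition isoG :: "'a pair_pre_digraph \<Rightarrow> ('v \<Rightarrow> 'v \<Rightarrow> bool) \<Rightarrow> bool" where
  "isoG G A \<longleftrightarrow> (\<exists>f. bij_betw f UNIV (pverts G) \<and> (\<forall>x y. A x y \<longleftrightarrow> (f x, f y) \<in> parcs G))"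

lemma isoG_isoA: "isoG G A \<Longrightarrow> isoA B A \<Longrightarrow> isoG G B"
proof -
  assume "isoG G A" "isoA B A"
  then obtain f h where f: "bij_betw f UNIV (pverts G)" "\<And>x y. A x y \<longleftrightarrow> (f x, f y) \<in> parcs G"
    and h: "bij h" "\<And>x y. B x y = A (h x) (h y)" by (auto simp: isoG_def isoA_def)
  have "bij_betw (f \<circ> h) UNIV (pverts G)" using h(1) f(1) by (rule bij_betw_trans)
  then show ?thesis unfolding isoG_def using f(2) h(2) by (intro exI[of _ "f \<circ> h"]) simp
qed

lemma isoG_unique: "isoG G A \<Longrightarrow> isoG G B \<Longrightarrow> isoA A B"
proof -
  assume "isoG G A" "isoG G B"
  then obtain f g where f: "bij_betw f UNIV (pverts G)" "\<And>x y. A x y \<longleftrightarrow> (f x, f y) \<in> parcs G"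
    and g: "bij_betw g UNIV (pverts G)" "\<And>x y. B x y \<longleftrightarrow> (g x, g y) \<in> parcs G" by (auto simp: isoG_def)
  let ?k = "inv_into UNIV g"
  have gk: "g (?k v) = v" if "v \<in> pverts G" for v using that g(1) by (simp add: bij_betw_def f_inv_into_f)
  have fv: "f x \<in> pverts G" for x using f(1) by (auto simp: bij_betw_def)
  have "bij (?k \<circ> f)" using bij_betw_trans[OF f(1) bij_betw_inv_into[OF g(1)]] .
  moreover have "A x y = B ((?k \<circ> f) x) ((?k \<circ> f) y)" for x y
    unfolding f(2) g(2) by (simp add: gk fv)
  ultimately show ?thesis unfolding isoA_def by blast
qed

lemma isoG_digraph_iso:
  assumes "pair_wf_digraph G" "pair_wf_digraph H" "isoG G A"
  shows "digraph_iso (with_proj G) (with_proj H) \<longleftrightarrow> isoG H A"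
  unfolding digraph_iso_pair_iff[OF assms(1,2)]
proof
  obtain f where f: "bij_betw f UNIV (pverts G)" "\<And>x y. A x y \<longleftrightarrow> (f x, f y) \<in> parcs G"
    using assms(3) by (auto simp: isoG_def)
  have fv: "f x \<in> pverts G" for x using f(1) by (auto simp: bij_betw_def)
  {
    assume "\<exists>g. bij_betw g (pverts G) (pverts H) \<and> (\<forall>x\<in>pverts G. \<forall>y\<in>pverts G. (x, y) \<in> parcs G \<longleftrightarrow> (g x, g y) \<in> parcs H)"
    then obtain g where g: "bij_betw g (pverts G) (pverts H)"
      "\<And>x y. x \<in> pverts G \<Longrightarrow> y \<in> pverts G \<Longrightarrow> (x, y) \<in> parcs G \<longleftrightarrow> (g x, g y) \<in> parcs H" by blast
    show "isoG H A" unfolding isoG_def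
      using bij_betw_trans[OF f(1) g(1)] f(2) g(2) fv by (intro exI[of _ "g \<circ> f"]) simp
  }
  assume "isoG H A"
  then obtain k where k: "bij_betw k UNIV (pverts H)" "\<And>x y. A x y \<longleftrightarrow> (k x, k y) \<in> parcs H" by (auto simp: isoG_def)
  let ?i = "inv_into UNIV f"
  have fi: "f (?i v) = v" if "v \<in> pverts G" for v using that f(1) by (simp add: bij_betw_def f_inv_into_f)
  show "\<exists>g. bij_betw g (pverts G) (pverts H) \<and> (\<forall>x\<in>pverts G. \<forall>y\<in>pverts G. (x, y) \<in> parcs G \<longleftrightarrow> (g x, g y) \<in> parcs H)"
    using bij_betw_trans[OF bij_betw_inv_into[OF f(1)] k(1)] fi f(2) k(2)
    by (intro exI[of _ "k \<circ> ?i"]) (simp flip: k(2) add: f(2))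
qed

lemma isoG_AG:
  assumes "isoG G A"
  shows "digraph_AutoGroup G \<cong> AG A"
proof -
  obtain f where f: "bij_betw f UNIV (pverts G)" "\<And>x y. A x y \<longleftrightarrow> (f x, f y) \<in> parcs G"
    using assms by (auto simp: isoG_def)
  let ?i = "inv_into UNIV f"
  have fv: "f x \<in> pverts G" for x using f(1) by (auto simp: bij_betw_def)
  have fi: "f (?i v) = v" if "v \<in> pverts G" for v using that f(1) by (simp add: bij_betw_def f_inv_into_f)
  have if': "?i (f x) = x" for x using f(1) by (simp add: bij_betw_def)
  let ?F = "\<lambda>h. restrict (f \<circ> h \<circ> ?i) (pverts G)"
  have car: "?F h \<in> carrier (digraph_AutoGroup G)" if h: "h \<in> AU A" for h
  proof -
    have hb: "bij h" "\<And>x y. A x y = A (h x) (h y)" using h by (auto simp: AU_def)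
    have "bij_betw (f \<circ> h \<circ> ?i) (pverts G) (pverts G)"
      using bij_betw_trans[OF bij_betw_inv_into[OF f(1)] bij_betw_trans[OF hb(1) f(1)]] by (simp add: comp_assoc)
    then have "?F h \<in> Bij (pverts G)" by (simp add: Bij_def cong: bij_betw_cong)
    moreover have "(x, y) \<in> parcs G \<longleftrightarrow> (?F h x, ?F h y) \<in> parcs G" if "x \<in> pverts G" "y \<in> pverts G" for x y
      using that f(2)[of "?i x" "?i y"] f(2)[of "h (?i x)" "h (?i y)"] hb(2)[of "?i x" "?i y"] by (simp add: fi)
    ultimately show ?thesis by (simp add: digraph_AutoGroup_def digraph_auto_def)
  qed
  have mul: "?F (h \<circ> k) = ?F h \<otimes>\<^bsub>digraph_AutoGroup G\<^esub> ?F k" if "h \<in> AU A" "k \<in> AU A" for h k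
  proof -
    have B: "?F h \<in> Bij (pverts G)" "?F k \<in> Bij (pverts G)"
      using car that by (auto simp: digraph_AutoGroup_def digraph_auto_def)
    then have "?F h \<otimes>\<^bsub>digraph_AutoGroup G\<^esub> ?F k = compose (pverts G) (?F h) (?F k)"
      by (simp add: digraph_AutoGroup_def BijGroup_def)
    also have "\<dots> = ?F (h \<circ> k)"
      by (rule ext) (auto simp: compose_def restrict_def fv if')
    finally show ?thesis ..
  qed
  have inj: "inj_on ?F (AU A)"
  proof (rule inj_onI)
    fix h k assume "?F h = ?F k"
    then have "?F h (f x) = ?F k (f x)" for x by simp
    then have "f (h x) = f (k x)" for x by (simp add: fv if')
    then show "h = k" using f(1) by (auto simp: bij_betw_def inj_eq)
  qed
  have surj: "\<exists>h\<in>AU A. ?F h = g" if g: "g \<in> carrier (digraph_AutoGroup G)" for g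
  proof -
    have gB: "g \<in> Bij (pverts G)" "\<And>x y. x \<in> pverts G \<Longrightarrow> y \<in> pverts G \<Longrightarrow> (x, y) \<in> parcs G \<longleftrightarrow> (g x, g y) \<in> parcs G"
      using g by (auto simp: digraph_AutoGroup_def digraph_auto_def)
    have gb: "bij_betw g (pverts G) (pverts G)" "g \<in> extensional (pverts G)" using gB(1) by (auto simp: Bij_def)
    have gv: "g v \<in> pverts G" if "v \<in> pverts G" for v using gb(1) that by (auto simp: bij_betw_def)
    let ?h = "?i \<circ> g \<circ> f"
    have "bij ?h" using bij_betw_trans[OF bij_betw_trans[OF f(1) gb(1)] bij_betw_inv_into[OF f(1)]] by (simp add: comp_assoc)
    moreover have "A x y = A (?h x) (?h y)" for x y using gB(2)[OF fv fv, of x y] by (simp add: f(2) fi gv fv)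
    ultimately have "?h \<in> AU A" by (simp add: AU_def)
    moreover have "?F ?h = g"
    proof (rule ext)
      fix v show "?F ?h v = g v" using extensional_arb[OF gb(2), of v] by (cases "v \<in> pverts G") (simp_all add: fi gv)
    qed
    ultimately show ?thesis by blast
  qed
  have "carrier (digraph_AutoGroup G) \<subseteq> ?F ` AU A"
  proof
    fix g assume "g \<in> carrier (digraph_AutoGroup G)"
    from surj[OF this] show "g \<in> ?F ` AU A" by blast
  qed
  then have "?F \<in> iso (AG A) (digraph_AutoGroup G)"
    unfolding iso_def hom_def bij_betw_def AG_def using car mul inj by auto
  then have "AG A \<cong> digraph_AutoGroup G" unfolding is_iso_def by blast
  then show ?thesis by (rule group.iso_sym[OF AG_group])
qed

text \<open>In \<open>srg\<close> the parameter 6 for reciprocated arcs appears as the number of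
  closed two-paths, which merges it with the path condition.\<close>

lemma dsrg_srg:
  fixes A :: "vx \<Rightarrow> vx \<Rightarrow> bool"
  assumes f: "bij_betw f UNIV (pverts G)" "\<And>x y. A x y \<longleftrightarrow> (f x, f y) \<in> parcs G"
    and wf: "pair_wf_digraph G"
  shows "directed_srg G 22 9 6 3 4 \<longleftrightarrow> srg A"
proof -
  interpret pair_wf_digraph G by (rule wf)
  have V: "pverts G = range f" using f(1) by (simp add: bij_betw_def)
  have fin: "finite (pverts G)" unfolding V by simp
  have all: "(\<forall>v\<in>pverts G. P v) \<longleftrightarrow> (\<forall>x. P (f x))" for P unfolding V by blast
  have inj: "f x = f y \<longleftrightarrow> x = y" for x y using f(1) by (auto simp: bij_betw_def inj_eq)
  have arcV: "x \<in> pverts G \<and> y \<in> pverts G" if "(x, y) \<in> parcs G" for x y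
    using that arc_fst_in_verts[of "(x, y)"] arc_snd_in_verts[of "(x, y)"] by simp
  have arcE: "\<exists>u w. x = f u \<and> y = f w" if "(x, y) \<in> parcs G" for x y
    using arcV[OF that] unfolding V by blast
  have card: "card (pverts G) = 22" using bij_betw_same_card[OF f(1)] card_vx by simp
  have s: "(\<Sum>y\<in>UNIV. of_bool (Q y)) = int (card {y::vx. Q y})" for Q using sum_of_bool_card[of UNIV Q] by simp
  have ind: "in_degree (with_proj G) (f x) = card {y. A y x}" for x
  proof -
    have "bij_betw (\<lambda>y. (f y, f x)) {y. A y x} {e \<in> parcs G. snd e = f x}"
      unfolding bij_betw_def by (auto simp: inj_on_def inj f(2) image_iff) (metis arcE)
    then show ?thesis unfolding in_degree_def in_arcs_def by (simp add: bij_betw_same_card with_proj_def)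
  qed
  have outd: "out_degree (with_proj G) (f x) = card {y. A x y}" for x
  proof -
    have "bij_betw (\<lambda>y. (f x, f y)) {y. A x y} {e \<in> parcs G. fst e = f x}"
      unfolding bij_betw_def by (auto simp: inj_on_def inj f(2) image_iff) (metis arcE)
    then show ?thesis unfolding out_degree_def out_arcs_def by (simp add: bij_betw_same_card with_proj_def)
  qed
  have rec: "card {y. (f x, y) \<in> parcs G \<and> (y, f z) \<in> parcs G} = card {y. A x y \<and> A y z}" for x z
  proof -
    have "bij_betw f {y. A x y \<and> A y z} {y. (f x, y) \<in> parcs G \<and> (y, f z) \<in> parcs G}"
      unfolding bij_betw_def by (auto simp: inj_on_def inj f(2) image_iff) (metis arcE)
    then show ?thesis by (simp add: bij_betw_same_card)
  qed
  have lf: "(\<forall>e\<in>parcs G. fst e \<noteq> snd e) \<longleftrightarrow> (\<forall>x. \<not> A x x)"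
  proof
    assume "\<forall>e\<in>parcs G. fst e \<noteq> snd e" then show "\<forall>x. \<not> A x x" by (auto simp: f(2))
  next
    assume n: "\<forall>x. \<not> A x x"
    show "\<forall>e\<in>parcs G. fst e \<noteq> snd e"
    proof
      fix e assume e: "e \<in> parcs G"
      then have "fst e \<in> pverts G" by (rule arc_fst_in_verts)
      then obtain x where "fst e = f x" unfolding V by blast
      then show "fst e \<noteq> snd e" using n e by (auto simp: f(2) prod_eq_iff) (metis prod.collapse)
    qed
  qed
  have pd: "pair_digraph G \<longleftrightarrow> (\<forall>x. \<not> A x x)"
  proof
    assume "pair_digraph G"
    then interpret P: pair_digraph G .
    show "\<forall>x. \<not> A x x" using P.pair_no_loops by (auto simp: lf[symmetric])
  next
    assume "\<forall>x. \<not> A x x"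
    moreover have "finite (parcs G)"
      by (rule finite_subset[of _ "pverts G \<times> pverts G"]) (use arcV fin in auto)
    ultimately show "pair_digraph G" using fin by unfold_locales (auto simp: lf[symmetric])
  qed
  have n: "int k = 9 \<longleftrightarrow> k = 9" "int k = 6 \<longleftrightarrow> k = 6" "int k = 3 \<longleftrightarrow> k = 3" "int k = 4 \<longleftrightarrow> k = 4" for k by auto
  have "directed_srg G 22 9 6 3 4 \<longleftrightarrow> (\<forall>x. \<not> A x x) \<and> (\<forall>x. card {y. A y x} = 9 \<and> card {y. A x y} = 9) \<and>
      (\<forall>x. card {y. A x y \<and> A y x} = 6) \<and> (\<forall>x y. x \<noteq> y \<longrightarrow> card {z. A x z \<and> A z y} = (if A x y then 3 else 4))"
    unfolding directed_srg_def pd all ind outd rec inj f(2)[symmetric] by (simp add: card)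
  also have "\<dots> \<longleftrightarrow> srg A"
    unfolding srg_def of_bool_conj[symmetric] s by (auto simp: n split: if_splits)
  finally show ?thesis .
qed

section \<open>The symmetric group on 1, 2, 3 and the permutations of the integers modulo 3\<close>

fun ze :: "z3 \<Rightarrow> nat" where "ze D0 = 1" | "ze D1 = 2" | "ze D2 = 3"

definition zd :: "nat \<Rightarrow> z3" where "zd n = (if n = 1 then D0 else if n = 2 then D1 else D2)"

lemma zd_ze [simp]: "zd (ze a) = a"
  by (cases a) (simp_all add: zd_def)

lemma ze_zd: "n \<in> {1..3} \<Longrightarrow> ze (zd n) = n"
  by (auto simp: zd_def)

lemma ze_in: "ze a \<in> {1..3}"
  by (cases a) simp_all

lemma bij_ze: "bij_betw ze UNIV {1..3}" and bij_zd: "bij_betw zd {1..3} UNIV"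
  by (rule bij_betw_byWitness[of _ zd], auto simp: ze_zd ze_in[simplified] zd_ze image_iff)
    (rule bij_betw_byWitness[of _ ze], auto simp: ze_zd ze_in[simplified] zd_ze image_iff)

definition psi :: "(z3 \<Rightarrow> z3) \<Rightarrow> nat \<Rightarrow> nat" where
  "psi p n = (if n \<in> {1..3} then ze (p (zd n)) else n)"

lemma psi_comp: "psi (p \<circ> q) = psi p \<circ> psi q"
  using ze_in by (auto simp: psi_def)

lemma psi_bij: "bij_betw psi {p. bij p} (carrier (sym_group 3))"
proof (rule bij_betw_imageI)
  show "inj_on psi {p. bij p}"
  proof (rule inj_onI, rule ext)
    fix p q a assume "psi p = psi q"
    then have "psi p (ze a) = psi q (ze a)" by simp
    then have "zd (ze (p a)) = zd (ze (q a))" using ze_in[of a] by (simp add: psi_def)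
    then show "p a = q a" by simp
  qed
  show "psi ` {p. bij p} = carrier (sym_group 3)"
  proof (rule Set.equalityI; rule subsetI)
    fix g assume "g \<in> psi ` {p. bij p}"
    then obtain p where p: "bij p" "g = psi p" by blast
    have "bij_betw (ze \<circ> (p \<circ> zd)) {1..3} {1..3}"
      by (rule bij_betw_trans[OF bij_betw_trans[OF bij_zd p(1)] bij_ze])
    then have "bij_betw (psi p) {1..3} {1..3}" by (rule bij_betw_cong[THEN iffD1, rotated]) (simp add: psi_def)
    then have "psi p permutes {1..3}" by (rule bij_imp_permutes) (simp add: psi_def del: atLeastAtMost_iff)
    then show "g \<in> carrier (sym_group 3)" by (simp add: sym_group_carrier p(2))
  next
    fix g assume "g \<in> carrier (sym_group 3)"
    then have g: "g permutes {1..3}" by (simp add: sym_group_carrier)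
    have gin: "g n \<in> {1..3}" if "n \<in> {1..3}" for n using permutes_in_image[OF g] that by blast
    have "bij (zd \<circ> (g \<circ> ze))"
      by (rule bij_betw_trans[OF bij_betw_trans[OF bij_ze permutes_imp_bij[OF g]] bij_zd])
    moreover have "psi (zd \<circ> (g \<circ> ze)) = g"
    proof (rule ext)
      fix n show "psi (zd \<circ> (g \<circ> ze)) n = g n"
      proof (cases "n \<in> {1..3}")
        case True then show ?thesis using gin[OF True] by (simp add: psi_def ze_zd del: atLeastAtMost_iff)
      next
        case False then show ?thesis using permutes_not_in[OF g False] by (simp add: psi_def del: atLeastAtMost_iff)
      qed
    qed
    ultimately show "g \<in> psi ` {p. bij p}" by (metis image_eqI mem_Collect_eq)
  qed
qed

lemma card_bij_z3: "card {p :: z3 \<Rightarrow> z3. bij p} = 6"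
  using bij_betw_same_card[OF psi_bij] sym_group_card_carrier[of 3] by (simp add: eval_nat_numeral)

lemma ad_cancel: "ad a k = ad b k \<longleftrightarrow> a = b" "ad D0 k = k" "ad a D0 = a"
  subgoal by (cases a; cases b; cases k) simp_all
  subgoal by (cases k) simp_all
  subgoal by (cases a) simp_all
  done

text \<open>Every permutation of the integers modulo 3 is affine: a rotation, or the negation
  followed by a rotation.\<close>

lemma bij_z3_cases:
  assumes "bij p"
  shows "p = (\<lambda>a. ad a (p D0)) \<or> p = (\<lambda>a. ad (dif D0 a) (p D0))"
proof -
  have d: "p D0 \<noteq> p D1" "p D0 \<noteq> p D2" "p D1 \<noteq> p D2" using assms by (auto simp: bij_def inj_def)
  have "(\<forall>a. p a = ad a (p D0)) \<or> (\<forall>a. p a = ad (dif D0 a) (p D0))"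
    unfolding all_z3 using d by (cases "p D0"; cases "p D1"; cases "p D2") simp_all
  then show ?thesis by auto
qed

definition rt :: "z3 \<Rightarrow> vx \<Rightarrow> vx" where
  "rt k x = (case x of None \<Rightarrow> None | Some (i, a) \<Rightarrow> Some (i, ad a k))"

lemma rt_AU: "rt k \<in> AU (adjm M)"
proof -
  have "inj (rt k)" by (auto simp: inj_def rt_def ad_cancel simp del: ad.simps split: option.splits)
  then have "bij (rt k)" using finite_UNIV_inj_surj[of "rt k"] by (simp add: bij_def)
  moreover have "dif (ad b k) (ad a k) = dif b a" for a b by (cases a; cases b; cases k) simp_all
  then have "adjm M x y = adjm M (rt k x) (rt k y)" for x y
    unfolding adjm_adjS by (auto simp: adjS_def rt_def simp del: ad.simps split: option.splits)
  ultimately show ?thesis by (simp add: AU_def)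
qed

text \<open>Automorphisms fix \<open>None\<close>, hence permute the orbit \<open>I2\<close> of its out-neighbours without an arc back,
  and by rigidity they are determined by this permutation.\<close>

locale rigid_rep =
  fixes M :: "blk row row"
  assumes srg: "srg (adjm M)" and uq: "x \<noteq> None \<Longrightarrow> hh (adjm M) x \<noteq> hh (adjm M) None" and rig: "rigid M"
begin

abbreviation "Aut \<equiv> AU (adjm M)"

text \<open>Automorphisms preserve \<open>hh\<close>, and \<open>None\<close> is the only vertex
  with its value.\<close>

lemma fixN: "h \<in> Aut \<Longrightarrow> h None = None"
  using hh_iso[of h "adjm M" "adjm M" None] uq[of "h None"] unfolding AU_def by (cases "h None = None") auto

definition pr :: "(vx \<Rightarrow> vx) \<Rightarrow> z3 \<Rightarrow> z3" where
  "pr h d = (case h (pC d) of None \<Rightarrow> D0 | Some (i, e) \<Rightarrow> e)"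

lemma pr: "h \<in> Aut \<Longrightarrow> h (pC d) = pC (pr h d)"
proof -
  assume h: "h \<in> Aut"
  have "adjm M None (h (pC d))" "\<not> adjm M (h (pC d)) None"
    using h fixN[OF h] unfolding AU_def by (metis (mono_tags, lifting) mem_Collect_eq adjm.simps(2,3) iw.simps(3) ou.simps(3))+
  then obtain i e where i: "h (pC d) = Some (i, e)" "iw i" "\<not> ou i" by (cases "h (pC d)") auto
  have "i = I2" using i(2,3) by (cases i) simp_all
  then show ?thesis using i(1) by (simp add: pr_def)
qed

lemma pr_comp: "h \<in> Aut \<Longrightarrow> k \<in> Aut \<Longrightarrow> pr (h \<circ> k) = pr h \<circ> pr k"
proof (rule ext)
  fix d assume h: "h \<in> Aut" and k: "k \<in> Aut"
  have "pC (pr (h \<circ> k) d) = pC (pr h (pr k d))" using pr[OF AU_comp[OF h k], of d] pr[OF h] pr[OF k] by simp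
  then show "pr (h \<circ> k) d = (pr h \<circ> pr k) d" by simp
qed

lemma pr_bij: "h \<in> Aut \<Longrightarrow> bij (pr h)"
proof -
  assume h: "h \<in> Aut"
  have "inj (pr h)"
  proof (rule injI)
    fix a b assume "pr h a = pr h b"
    then have "h (pC a) = h (pC b)" by (simp add: pr[OF h])
    then show "a = b" using h by (auto simp: AU_def bij_def inj_def)
  qed
  then show ?thesis using finite_UNIV_inj_surj[of "pr h"] by (simp add: bij_def)
qed

lemma pr_inj: "inj_on pr Aut"
proof (rule inj_onI)
  fix h k assume hk: "h \<in> Aut" "k \<in> Aut" "pr h = pr k"
  let ?i = "inv_into UNIV h"
  have hb: "bij h" using hk by (simp add: AU_def)
  have i: "?i \<in> Aut" by (rule AU_inv[OF hk(1)])
  have g: "?i \<circ> k \<in> Aut" by (rule AU_comp[OF i hk(2)])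
  have "(?i \<circ> k) (pC d) = pC d" for d
    using pr[OF hk(1), of d] pr[OF hk(2), of d] hk(3) hb by (metis bij_is_inj comp_apply inv_f_f)
  then have "?i \<circ> k = id"
    using rigid_id[OF rig, of "?i \<circ> k"] g fixN[OF g] by (auto simp: AU_def)
  then have "h \<circ> (?i \<circ> k) = h" by simp
  then show "h = k" using hb by (simp add: comp_assoc[symmetric] bij_is_surj surj_iff[THEN iffD1])
qed

lemma pr_rt: "pr (rt k) = (\<lambda>a. ad a k)"
  by (rule ext) (simp add: pr_def rt_def del: ad.simps)

lemma neg_swaps: "(\<lambda>a. dif D0 a) \<in> pr ` Aut \<longleftrightarrow> swaps M"
proof
  assume "(\<lambda>a. dif D0 a) \<in> pr ` Aut"
  then obtain h where h: "h \<in> Aut" "\<And>a. pr h a = dif D0 a" by (metis image_iff)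
  then show "swaps M" unfolding swaps_iff[OF srg]
    using pr[OF h(1)] fixN[OF h(1)] by (intro exI[of _ h]) (auto simp: AU_def)
next
  assume "swaps M"
  then obtain h where h: "h \<in> Aut" "h (pC D0) = pC D0" "h (pC D1) = pC D2" "h (pC D2) = pC D1"
    unfolding swaps_iff[OF srg] by (auto simp: AU_def)
  have "\<forall>a. pr h a = dif D0 a" unfolding all_z3 by (simp add: pr_def h)
  then have "pr h = (\<lambda>a. dif D0 a)" by auto
  then show "(\<lambda>a. dif D0 a) \<in> pr ` Aut" using imageI[OF h(1), of pr] by simp
qed

lemma comp_rt: "p \<in> pr ` Aut \<Longrightarrow> (\<lambda>a. ad (p a) k) \<in> pr ` Aut"
proof -
  assume "p \<in> pr ` Aut"
  then obtain h where h: "h \<in> Aut" "p = pr h" by blast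
  have "pr (rt k \<circ> h) = (\<lambda>a. ad (p a) k)" unfolding pr_comp[OF rt_AU h(1)] pr_rt h(2) by auto
  then show ?thesis using AU_comp[OF rt_AU h(1)] by (metis image_eqI)
qed

text \<open>The image always contains the rotations, and together with the negation they give all
  six affine maps.\<close>

lemma image_swaps: "swaps M \<Longrightarrow> pr ` Aut = {p. bij p}"
proof (rule Set.equalityI; rule subsetI)
  fix p :: "z3 \<Rightarrow> z3" assume "p \<in> pr ` Aut" then show "p \<in> {p. bij p}" using pr_bij by blast
next
  fix p :: "z3 \<Rightarrow> z3" assume s: "swaps M" and "p \<in> {p. bij p}"
  then have "p = (\<lambda>a. ad a (p D0)) \<or> p = (\<lambda>a. ad (dif D0 a) (p D0))" using bij_z3_cases by blast
  moreover have "(\<lambda>a. ad a (p D0)) \<in> pr ` Aut" using pr_rt rt_AU by (metis image_eqI)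
  moreover have "(\<lambda>a. ad (dif D0 a) (p D0)) \<in> pr ` Aut" using comp_rt s neg_swaps by blast
  ultimately show "p \<in> pr ` Aut" by metis
qed

text \<open>If the image contained any reflection, composing it with a suitable rotation would give
  the negation, hence an automorphism that swaps.\<close>

lemma image_no_swaps: "\<not> swaps M \<Longrightarrow> pr ` Aut = range (\<lambda>k a. ad a k)"
proof (rule Set.equalityI; rule subsetI)
  fix p :: "z3 \<Rightarrow> z3" assume s: "\<not> swaps M" and p: "p \<in> pr ` Aut"
  then have "bij p" using pr_bij by blast
  then have "p = (\<lambda>a. ad a (p D0)) \<or> p = (\<lambda>a. ad (dif D0 a) (p D0))" by (rule bij_z3_cases)
  then show "p \<in> range (\<lambda>k a. ad a k)"
  proof
    assume "p = (\<lambda>a. ad a (p D0))" then show ?thesis by (rule range_eqI)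
  next
    assume e: "p = (\<lambda>a. ad (dif D0 a) (p D0))"
    have "(\<lambda>a. ad (p a) (dif D0 (p D0))) \<in> pr ` Aut" by (rule comp_rt[OF p])
    moreover have "ad (ad b c) (dif D0 c) = b" for b c by (cases b; cases c) simp_all
    then have "(\<lambda>a. ad (p a) (dif D0 (p D0))) = (\<lambda>a. dif D0 a)" by (subst e) (simp del: ad.simps)
    ultimately show ?thesis using neg_swaps s by metis
  qed
next
  fix p :: "z3 \<Rightarrow> z3" assume "p \<in> range (\<lambda>k a. ad a k)"
  then obtain k where "p = pr (rt k)" unfolding pr_rt by blast
  then show "p \<in> pr ` Aut" using imageI[OF rt_AU, of pr] by simp
qed

lemma card_Aut: "card Aut = (if swaps M then 6 else 3)"
proof -
  have c: "card Aut = card (pr ` Aut)" by (rule card_image[OF pr_inj, symmetric])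
  have "inj (\<lambda>k a. ad a k)"
  proof (rule injI)
    fix k l assume "(\<lambda>a. ad a k) = (\<lambda>a. ad a l)"
    then have "ad D0 k = ad D0 l" by metis
    then show "k = l" by (simp only: ad_cancel)
  qed
  then have "card (range (\<lambda>k a. ad a k)) = card (UNIV :: z3 set)" by (rule card_image)
  also have "\<dots> = 3" by (simp add: UNIV_z3)
  finally show ?thesis using c image_swaps image_no_swaps card_bij_z3 by auto
qed

lemma AG_sym: "swaps M \<Longrightarrow> AG (adjm M) \<cong> sym_group 3"
proof -
  assume s: "swaps M"
  have b: "bij_betw pr Aut {p. bij p}" using pr_inj image_swaps[OF s] by (rule bij_betw_imageI)
  have B: "bij_betw (psi \<circ> pr) Aut (carrier (sym_group 3))" by (rule bij_betw_trans[OF b psi_bij])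
  then have "psi \<circ> pr \<in> iso (AG (adjm M)) (sym_group 3)"
    unfolding iso_def hom_def by (auto simp: AG_def sym_group_mult pr_comp psi_comp bij_betw_def)
  then show ?thesis unfolding is_iso_def by blast
qed

end

lemma order_3_iff:
  fixes G (structure)
  assumes "group G" "x \<in> carrier G"
  shows "group.ord G x = 3 \<longleftrightarrow> x \<noteq> \<one>\<^bsub>G\<^esub> \<and> x \<otimes>\<^bsub>G\<^esub> x \<otimes>\<^bsub>G\<^esub> x = \<one>\<^bsub>G\<^esub>"
proof -
  interpret group G by fact
  have e: "x [^] (3::nat) = x \<otimes> x \<otimes> x" using assms(2) by (simp add: eval_nat_numeral)
  have o: "ord x = 1 \<longleftrightarrow> x = \<one>" using pow_eq_id[OF assms(2), of 1] assms(2) by auto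
  show ?thesis
  proof
    assume 3: "ord x = 3"
    then show "x \<noteq> \<one> \<and> x \<otimes> x \<otimes> x = \<one>" using o pow_eq_id[OF assms(2), of 3] e by simp
  next
    assume r: "x \<noteq> \<one> \<and> x \<otimes> x \<otimes> x = \<one>"
    then have "ord x dvd 3" using pow_eq_id[OF assms(2), of 3] e by simp
    moreover have "n = 1 \<or> n = 3" if n: "n dvd 3" for n :: nat
    proof -
      have "n \<le> 3" using n by (simp add: dvd_imp_le)
      moreover have "n \<noteq> 0" using n by (intro notI) simp
      moreover have "n \<noteq> 2" using n by auto
      ultimately show ?thesis by arith
    qed
    ultimately show "ord x = 3" using r o by blast
  qed
qed

lemma iso_order_3_imp:
  assumes G: "group G" "group H" "G \<cong> H" "x \<in> carrier G" "group.ord G x = 3"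
  shows "\<exists>y\<in>carrier H. group.ord H y = 3"
proof -
  obtain f where f: "f \<in> iso G H" using G(3) by (auto simp: is_iso_def)
  then have h: "f \<in> hom G H" "inj_on f (carrier G)" by (auto simp: iso_def bij_betw_def)
  have one: "f \<one>\<^bsub>G\<^esub> = \<one>\<^bsub>H\<^esub>" by (rule hom_one[OF h(1) G(1,2)])
  have m: "\<one>\<^bsub>G\<^esub> \<in> carrier G" "x \<otimes>\<^bsub>G\<^esub> x \<in> carrier G"
    using G(1,4) by (simp_all add: group.is_monoid monoid.one_closed monoid.m_closed)
  have o: "x \<noteq> \<one>\<^bsub>G\<^esub>" "x \<otimes>\<^bsub>G\<^esub> x \<otimes>\<^bsub>G\<^esub> x = \<one>\<^bsub>G\<^esub>" using order_3_iff[OF G(1,4)] G(5) by blast+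
  have fx: "f x \<in> carrier H" using hom_in_carrier[OF h(1) G(4)] .
  have "f x \<noteq> f \<one>\<^bsub>G\<^esub>" using inj_onD[OF h(2) _ G(4) m(1)] o(1) by blast
  moreover have "f x \<otimes>\<^bsub>H\<^esub> f x \<otimes>\<^bsub>H\<^esub> f x = f (x \<otimes>\<^bsub>G\<^esub> x \<otimes>\<^bsub>G\<^esub> x)"
    using hom_mult[OF h(1)] G(4) m(2) by simp
  ultimately have "group.ord H (f x) = 3" unfolding order_3_iff[OF G(2) fx] o(2) one by blast
  then show ?thesis using fx by blast
qed

lemma iso_order_3:
  assumes "group G" "group H" "G \<cong> H"
  shows "(\<exists>x\<in>carrier G. group.ord G x = 3) \<longleftrightarrow> (\<exists>y\<in>carrier H. group.ord H y = 3)"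
  using iso_order_3_imp[OF assms] iso_order_3_imp[OF assms(2,1) group.iso_sym[OF assms(1,3)]] by blast

lemma AG_order_3: "(\<exists>h\<in>carrier (AG A). group.ord (AG A) h = 3) \<longleftrightarrow> (\<exists>h\<in>AU A. h \<noteq> id \<and> (\<forall>x. h (h (h x)) = x))"
proof -
  have "group.ord (AG A) h = 3 \<longleftrightarrow> h \<noteq> id \<and> (\<forall>x. h (h (h x)) = x)" if "h \<in> AU A" for h
    using order_3_iff[OF AG_group, of h A] that by (simp add: AG_def fun_eq_iff)
  then show ?thesis by (auto simp: AG_def)
qed

section \<open>Isomorphism classes\<close>

abbreviation "D22 \<equiv> dsrgs_auto3 22 9 6 3 4"

lemma D22_wf: "G \<in> D22 \<Longrightarrow> pair_wf_digraph G"
  unfolding dsrgs_auto3_def directed_srg_def pair_digraph_def pair_fin_digraph_def by blast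

lemma D22_iff:
  fixes A :: "vx \<Rightarrow> vx \<Rightarrow> bool"
  assumes "pair_wf_digraph G" "isoG G A"
  shows "G \<in> D22 \<longleftrightarrow> srg A \<and> (\<exists>h\<in>AU A. h \<noteq> id \<and> (\<forall>x. h (h (h x)) = x))"
proof -
  obtain f where "bij_betw f UNIV (pverts G)" "\<And>x y. A x y \<longleftrightarrow> (f x, f y) \<in> parcs G"
    using assms(2) by (auto simp: isoG_def)
  from dsrg_srg[OF this assms(1)] show ?thesis
    unfolding dsrgs_auto3_def mem_Collect_eq iso_order_3[OF group_digraph_AutoGroup AG_group isoG_AG[OF assms(2)]] AG_order_3
    by simp
qed

lemma D22_isoG:
  assumes "G \<in> D22"
  shows "\<exists>A :: vx \<Rightarrow> vx \<Rightarrow> bool. isoG G A"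
proof -
  have "finite (pverts G)" "card (pverts G) = card (UNIV :: vx set)" unfolding card_vx
    using assms by (auto simp: dsrgs_auto3_def directed_srg_def intro: card_ge_0_finite)
  then obtain f where "bij_betw f (UNIV :: vx set) (pverts G)" using finite_same_card_bij[OF finite] by metis
  then show ?thesis unfolding isoG_def by (intro exI[of _ "\<lambda>x y. (f x, f y) \<in> parcs G"]) auto
qed

lemma AU_label:
  fixes A :: "vx \<Rightarrow> vx \<Rightarrow> bool"
  assumes "srg A" "h \<in> AU A" "h \<noteq> id" "\<And>x. h (h (h x)) = x"
  obtains S where "vsrg S" "isoA (adjS S) A"
proof -
  interpret aut3 A h
    using assms card_vx unfolding srg_def AU_def by unfold_locales blast+
  obtain x where "h x \<noteq> x" using assms(3) by (auto simp: fun_eq_iff)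
  then have "rep x \<in> Om" by (simp add: Om_def Fx_def)
  then obtain S where S: "isoA (adjS S) A" using label by blast
  then have "vsrg S" using srg_iso assms(1) by (simp add: vsrg_def)
  then show ?thesis using S that by blast
qed

text \<open>Isomorphism classes are counted on vertex sets of natural numbers, so each matrix needs
  a copy there to make its class non-empty.\<close>

definition gr :: "(vx \<Rightarrow> vx \<Rightarrow> bool) \<Rightarrow> nat pair_pre_digraph" where
  "gr A = (let e = (SOME e. inj e) in \<lparr>pverts = range e, parcs = {(e x, e y) |x y. A x y}\<rparr>)"

lemma gr: "pair_wf_digraph (gr A)" "isoG (gr A) A"
proof -
  obtain e0 :: "vx \<Rightarrow> nat" where "inj e0" using finite_imp_inj_to_nat_seg[of "UNIV :: vx set"] by auto
  then have "inj (SOME e :: vx \<Rightarrow> nat. inj e)" by (rule someI[where P = inj])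
  then obtain e :: "vx \<Rightarrow> nat" where e: "inj e" "gr A = \<lparr>pverts = range e, parcs = {(e x, e y) |x y. A x y}\<rparr>"
    by (auto simp: gr_def Let_def)
  show "pair_wf_digraph (gr A)" by unfold_locales (auto simp: e(2))
  show "isoG (gr A) A" unfolding isoG_def e(2) using e(1)
    by (intro exI[of _ e]) (auto simp: bij_betw_def inj_eq)
qed

definition cls :: "blk row row \<Rightarrow> nat pair_pre_digraph set" where
  "cls M = {G \<in> D22. isoG G (adjm M)}"

text \<open>The distinct values of \<open>WW\<close> in \<open>dW\<close> stand in for pairwise
  non-isomorphism.\<close>

locale classification =
  fixes Ms :: "blk row row list"
  assumes rr: "M \<in> set Ms \<Longrightarrow> rigid_rep M"
    and ex: "vsrg S \<Longrightarrow> \<exists>M\<in>set Ms. isoA (adjS S) (adjm M)"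
    and dW: "distinct (map (\<lambda>M. WW (adjm M)) Ms)"
begin

text \<open>The rotation \<open>rt D1\<close> of all orbits is the required automorphism of order
  three.\<close>

lemma gr_in: "M \<in> set Ms \<Longrightarrow> gr (adjm M) \<in> cls M"
proof -
  assume "M \<in> set Ms"
  then interpret rigid_rep M by (rule rr)
  have "rt D1 (Some (I0, D0)) \<noteq> Some (I0, D0)" by (simp add: rt_def)
  then have "rt D1 \<noteq> id" by (metis id_apply)
  moreover have "ad (ad (ad a D1) D1) D1 = a" for a by (cases a) simp_all
  then have "rt D1 (rt D1 (rt D1 x)) = x" for x by (simp add: rt_def del: ad.simps split: option.split)
  ultimately have "gr (adjm M) \<in> D22" unfolding D22_iff[OF gr] using srg rt_AU by blast
  then show ?thesis using gr(2) by (simp add: cls_def)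
qed

lemma cls_ex: "G \<in> D22 \<Longrightarrow> \<exists>M\<in>set Ms. G \<in> cls M"
proof -
  assume G: "G \<in> D22"
  obtain A :: "vx \<Rightarrow> vx \<Rightarrow> bool" where A: "isoG G A" using D22_isoG[OF G] by blast
  obtain h where h: "srg A" "h \<in> AU A" "h \<noteq> id" "\<And>x. h (h (h x)) = x"
    using G D22_iff[OF D22_wf[OF G] A] by blast
  obtain S where S: "vsrg S" "isoA (adjS S) A" using AU_label[OF h] by blast
  obtain M where M: "M \<in> set Ms" "isoA (adjS S) (adjm M)" using ex[OF S(1)] by blast
  have "isoG G (adjm M)" using isoG_isoA[OF A isoA_trans[OF isoA_sym[OF M(2)] S(2)]] .
  then show ?thesis using M(1) G by (auto simp: cls_def)
qed

lemma cls_unique: "M \<in> set Ms \<Longrightarrow> N \<in> set Ms \<Longrightarrow> G \<in> cls M \<Longrightarrow> G \<in> cls N \<Longrightarrow> M = N"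
proof -
  assume m: "M \<in> set Ms" "N \<in> set Ms" and G: "G \<in> cls M" "G \<in> cls N"
  have "isoA (adjm M) (adjm N)" using G isoG_unique by (auto simp: cls_def)
  then have "WW (adjm M) = WW (adjm N)" unfolding isoA_def using WW_iso by blast
  then show ?thesis using dW m by (auto simp: distinct_map inj_on_def)
qed

lemma classes: "iso_classes D22 = cls ` set Ms"
proof -
  let ?r = "{(G, H). G \<in> D22 \<and> H \<in> D22 \<and> digraph_iso (with_proj G) (with_proj H)}"
  have im: "?r `` {G} = cls M" if "G \<in> cls M" for G M
  proof -
    have G: "G \<in> D22" "isoG G (adjm M)" using that by (auto simp: cls_def)
    show ?thesis using isoG_digraph_iso[OF D22_wf[OF G(1)] D22_wf G(2)] G(1) by (auto simp: cls_def)
  qed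
  show ?thesis unfolding iso_classes_def
  proof (rule Set.equalityI; rule subsetI)
    fix K assume "K \<in> D22 // ?r"
    then obtain G where G: "G \<in> D22" "K = ?r `` {G}" by (auto simp: quotient_def)
    then show "K \<in> cls ` set Ms" using cls_ex[OF G(1)] im by blast
  next
    fix K assume "K \<in> cls ` set Ms"
    then obtain M where M: "M \<in> set Ms" "K = cls M" by blast
    have g: "gr (adjm M) \<in> cls M" by (rule gr_in[OF M(1)])
    then have "gr (adjm M) \<in> D22" by (simp add: cls_def)
    then show "K \<in> D22 // ?r" unfolding M(2) im[OF g, symmetric] by (rule quotientI)
  qed
qed

lemma inj_cls: "inj_on cls (set Ms)"
proof (rule inj_onI)
  fix M N assume m: "M \<in> set Ms" "N \<in> set Ms" "cls M = cls N"
  then show "M = N" using cls_unique[OF m(1,2) gr_in[OF m(1)]] gr_in[OF m(1)] by simp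
qed

lemma order_cls: "M \<in> set Ms \<Longrightarrow> G \<in> cls M \<Longrightarrow> order (digraph_AutoGroup G) = (if swaps M then 6 else 3)"
proof -
  assume "M \<in> set Ms" and G: "G \<in> cls M"
  then interpret rigid_rep M by (auto intro: rr)
  have "digraph_AutoGroup G \<cong> AG (adjm M)" using G by (auto simp: cls_def intro: isoG_AG)
  then have "card (carrier (digraph_AutoGroup G)) = card Aut"
    unfolding is_iso_def iso_def by (auto simp: AG_def dest: bij_betw_same_card)
  then show ?thesis by (simp add: order_def card_Aut)
qed

lemma sym_cls: "M \<in> set Ms \<Longrightarrow> G \<in> cls M \<Longrightarrow> swaps M \<Longrightarrow> digraph_AutoGroup G \<cong> sym_group 3"
proof -
  assume "M \<in> set Ms" and G: "G \<in> cls M" and s: "swaps M"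
  then interpret rigid_rep M by (auto intro: rr)
  have "digraph_AutoGroup G \<cong> AG (adjm M)" using G by (auto simp: cls_def intro: isoG_AG)
  then show ?thesis using AG_sym[OF s] by (rule iso_trans)
qed

lemma counts:
  defines "C \<equiv> iso_classes D22"
  defines "T \<equiv> {K \<in> C. \<forall>G\<in>K. order (digraph_AutoGroup G) = 6 \<and> digraph_AutoGroup G \<cong> sym_group 3}"
  shows "card C = length Ms" "card T = length (filter swaps Ms)" "card (C - T) = length Ms - length (filter swaps Ms)"
    "\<forall>K\<in>C - T. \<forall>G\<in>K. order (digraph_AutoGroup G) = 3"
proof -
  have dM: "distinct Ms" using dW by (simp add: distinct_map)
  have C: "C = cls ` set Ms" unfolding C_def by (rule classes)
  have T: "T = cls ` set (filter swaps Ms)"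
  proof (rule Set.equalityI; rule subsetI)
    fix K assume K: "K \<in> T"
    then obtain M where M: "M \<in> set Ms" "K = cls M" by (auto simp: T_def C)
    have "order (digraph_AutoGroup (gr (adjm M))) = 6" using K gr_in[OF M(1)] M(2) by (auto simp: T_def)
    then have "swaps M" using order_cls[OF M(1) gr_in[OF M(1)]] by (simp split: if_splits)
    then show "K \<in> cls ` set (filter swaps Ms)" using M by simp
  next
    fix K assume "K \<in> cls ` set (filter swaps Ms)"
    then obtain M where M: "M \<in> set Ms" "swaps M" "K = cls M" by auto
    then show "K \<in> T" using order_cls[OF M(1)] sym_cls[OF M(1)] by (auto simp: T_def C)
  qed
  show 1: "card C = length Ms" unfolding C by (simp add: card_image[OF inj_cls] distinct_card[OF dM])
  have "inj_on cls (set (filter swaps Ms))" by (rule inj_on_subset[OF inj_cls]) auto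
  then show 2: "card T = length (filter swaps Ms)" unfolding T
    using distinct_card[of "filter swaps Ms"] dM by (simp add: card_image)
  have "T \<subseteq> C" "finite T" unfolding T C by auto
  then show "card (C - T) = length Ms - length (filter swaps Ms)" using 1 2 by (simp add: card_Diff_subset)
  show "\<forall>K\<in>C - T. \<forall>G\<in>K. order (digraph_AutoGroup G) = 3"
  proof (intro ballI)
    fix K G assume K: "K \<in> C - T" and G: "G \<in> K"
    then obtain M where M: "M \<in> set Ms" "K = cls M" by (auto simp: C)
    then have "\<not> swaps M" using K unfolding T by auto
    then show "order (digraph_AutoGroup G) = 3" using order_cls[OF M(1)] G M(2) by simp
  qed
qed

end

section \<open>Joining the batches\<close>

lemma solves_append: "solves (ts @ us) \<longleftrightarrow> solves ts \<and> solves us"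
  by (induction ts) (auto simp del: solve.simps)

lemma wellf_append: "wellf (ts @ us) \<longleftrightarrow> wellf ts \<and> wellf us"
  by (induction ts rule: wellf.induct) auto

lemma leafs_append: "leafs (ts @ us) = leafs ts @ leafs us"
  by (induction ts rule: leafs.induct) auto

lemma without_append: "without (xs @ ys) zs = without xs zs @ without ys zs"
  by (induction xs) auto

lemma set_without: "set (without xs ys) = set xs - set ys"
  by (induction xs) (auto simp: memb_iff)

lemma reps_append: "reps (ts @ us) = reps ts @ reps us"
  by (simp add: reps_def leafs_append without_append)

lemma dupok_isom: "dupok Ms ds \<Longrightarrow> M \<in> set (firsts ds) \<Longrightarrow> \<exists>N\<in>set Ms. isom M N"
  by (induction ds rule: firsts.induct) (auto simp: memb_iff simp del: isom.simps split: if_splits)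

text \<open>The range contains no \<open>Bad\<close>, so an equation
  \<open>infos Ms = infl ps\<close> says that all checks have succeeded.\<close>

fun infl :: "(int \<times> bool) list \<Rightarrow> info list" where
  "infl [] = []" | "infl ((w, b) # ps) = Inf w b # infl ps"

lemma infos_append: "infos (Ms @ Ns) = infos Ms @ infos Ns"
  by (induction Ms) (auto simp del: info0.simps)

lemma infl_append: "infl (ps @ qs) = infl ps @ infl qs"
  by (induction ps rule: infl.induct) auto

lemma infos_infl:
  "infos Ms = infl ps \<Longrightarrow> (\<forall>M\<in>set Ms. rigid_rep M) \<and> map (\<lambda>M. WW (adjm M)) Ms = map fst ps \<and> map swaps Ms = map snd ps"
proof (induction Ms arbitrary: ps)
  case Nil then show ?case by (cases ps rule: infl.cases) auto
next
  case (Cons M Ms)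
  then obtain w b qs where ps: "ps = (w, b) # qs" by (cases ps rule: infl.cases) auto
  have i: "info0 M (rowls M vs vs) (colls M vs vs) = Inf w b" and r: "infos Ms = infl qs"
    using Cons.prems by (auto simp: ps simp del: info0.simps)
  have "rigid_rep M" using info_good[OF i] by unfold_locales auto
  then show ?case using Cons.IH[OF r] info_good(2,5)[OF i] by (simp only: ps list.simps insert_iff) auto
qed

text \<open>Values of \<open>WW\<close> and \<open>swaps\<close> for the representatives of this
  batch; the first components are pairwise different over all batches.\<close>

definition "il0 = ([
    (56453046, True), (55561686, False), (45997926, True), (47602926, False), (54655350, True), (53216598,
    False), (53482050, False), (56875950, False), (52922130, False), (52916838, False), (52332990, False),
    (51565416, False), (52117656, False), (52922694, False), (53208762, False), (52334430, False), (53482164,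
    False), (53291346, False), (54435714, False), (53192886, False), (54869688, False), (53970570, True),
    (52710978, False), (54787044, False), (54166470, False), (53711892, False), (53675778, False), (53843166,
    False), (54500994, False), (53428734, False), (53595486, False), (53657760, False), (52305813, False),
    (57750624, False), (56114958, False), (50855166, True), (49022040, False), (43430574, False), (44444298,
    False), (53016528, False), (52175874, False), (52386522, False), (52971186, False), (52156824, False),
    (51217770, True), (52939704, False), (52111500, False), (51504666, False), (51232116, False), (52128384,
    False), (51231426, False), (52087422, False), (51749418, False), (50995200, False), (54736656, False),
    (52116249, False), (54143610, False), (53609970, False), (50475492, False), (51099258, False), (47492478,
    True), (48753264, False), (49008342, False), (46898802, False), (48388026, False), (46347858, False),
    (59272938, True), (58721394, False), (48246294, False), (50204046, False), (51601986, True), (52572486,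
    False), (52528350, False), (50545698, False), (54274926, False), (46075380, False), (44438088, False),
    (44086392, False), (42974328, False)] :: (int \<times> bool) list)"
definition "il1 = ([
    (45564882, False), (56170332, False), (50578860, False), (51104850, True), (48998010, False)] :: (int \<times> bool) list)"
definition "il2 = ([
    (47088012, False), (50264886, False)] :: (int \<times> bool) list)"
definition "il3 = ([
    (47498910, True), (46562814, False), (46697418, False), (45722334, True), (47404950, False), (47402070,
    False), (42734622, False), (46931118, False), (47673816, False), (53201586, True), (53341404, False),
    (52515594, False), (56622654, False), (51685218, False), (52524762, False), (52213308, False), (53031222,
    False), (53062278, False), (52522350, False), (52271622, False), (53037270, False)] :: (int \<times> bool) list)"
definition "il4 = ([
    (49587174, True), (48530214, False), (41247432, False), (44079576, False), (46715148, False), (47546118,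
    False), (44312850, False)] :: (int \<times> bool) list)"
definition "il5 = ([
    (47668452, False), (49054566, False), (46890588, False), (47405676, False), (49581486, False), (47265618,
    False), (44647500, False), (45739392, False), (47318664, False), (47023092, False), (45830046, False),
    (45253278, False), (44735760, False)] :: (int \<times> bool) list)"
definition "il6 = ([] :: (int \<times> bool) list)"
definition "il7 = ([
    (48081366, False), (46606461, False), (46697457, False), (50402673, False), (50422605, False), (51775230,
    False), (49028046, False)] :: (int \<times> bool) list)"

section \<open>Evaluation of the search\<close>

lemma solves0: "solves tasks0"
  by code_simp

lemma wellf0: "wellf tasks0"
  by code_simp

lemma infos0: "infos (reps tasks0) = infl il0"
  by code_simp

lemma solves1: "solves tasks1"
  by code_simp

lemma wellf1: "wellf tasks1"
  by code_simp

lemma infos1: "infos (reps tasks1) = infl il1"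
  by code_simp

lemma solves2: "solves tasks2"
  by code_simp

lemma wellf2: "wellf tasks2"
  by code_simp

lemma infos2: "infos (reps tasks2) = infl il2"
  by code_simp

lemma solves3: "solves tasks3"
  by code_simp

lemma wellf3: "wellf tasks3"
  by code_simp

lemma infos3: "infos (reps tasks3) = infl il3"
  by code_simp

lemma solves4: "solves tasks4"
  by code_simp

lemma wellf4: "wellf tasks4"
  by code_simp

lemma infos4: "infos (reps tasks4) = infl il4"
  by code_simp

lemma solves5: "solves tasks5"
  by code_simp

lemma wellf5: "wellf tasks5"
  by code_simp

lemma infos5: "infos (reps tasks5) = infl il5"
  by code_simp

lemma solves6: "solves tasks6"
  by code_simp

lemma wellf6: "wellf tasks6"
  by code_simp

lemma infos6: "infos (reps tasks6) = infl il6"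
  by code_simp

lemma solves7: "solves tasks7"
  by code_simp

lemma wellf7: "wellf tasks7"
  by code_simp

lemma infos7: "infos (reps tasks7) = infl il7"
  by code_simp

definition "all_tasks = tasks0 @ tasks1 @ tasks2 @ tasks3 @ tasks4 @ tasks5 @ tasks6 @ tasks7"

lemma subl0: "subl (lpA rowsA0 rowsB) (taskR all_tasks)"
  by code_simp

lemma subl1: "subl (lpA rowsA1 rowsB) (taskR all_tasks)"
  by code_simp

lemma subl2: "subl (lpA rowsA2 rowsB) (taskR all_tasks)"
  by code_simp

lemma subl3: "subl (lpA rowsA3 rowsB) (taskR all_tasks)"
  by code_simp

lemma dupok_all: "dupok (reps all_tasks) dups"
  by code_simp

definition "il = il0 @ il1 @ il2 @ il3 @ il4 @ il5 @ il6 @ il7"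

lemma distinct_il: "distinct (map fst il)"
  by code_simp

lemma counts_il: "length il = 134" "length (filter snd il) = 14"
  by code_simp+

lemma infos_all: "infos (reps all_tasks) = infl il"
  unfolding all_tasks_def il_def reps_append infos_append infl_append infos0 infos1 infos2 infos3 infos4 infos5 infos6 infos7 by (rule refl)

lemma leaf_all: "vsrg S \<Longrightarrow> \<exists>M\<in>set (leafs all_tasks). isoA (adjS S) (adjm M)"
proof (rule leaf_exists)
  show "set (lpA rowsA0 rowsB) \<union> set (lpA rowsA1 rowsB) \<union> set (lpA rowsA2 rowsB) \<union> set (lpA rowsA3 rowsB)
      \<subseteq> set (taskR all_tasks)"
    using subl0 subl1 subl2 subl3 unfolding subl_iff by (simp only: Un_subset_iff)
  show "solves all_tasks" unfolding all_tasks_def solves_append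
    by (intro conjI solves0 solves1 solves2 solves3 solves4 solves5 solves6 solves7)
  show "wellf all_tasks" unfolding all_tasks_def wellf_append
    by (intro conjI wellf0 wellf1 wellf2 wellf3 wellf4 wellf5 wellf6 wellf7)
qed

interpretation srg22: classification "reps all_tasks"
proof (rule classification.intro)
  note il = infos_infl[OF infos_all]
  show rr: "rigid_rep M" if "M \<in> set (reps all_tasks)" for M using il that by blast
  show "distinct (map (\<lambda>M. WW (adjm M)) (reps all_tasks))" using il distinct_il by (simp only:)
  show "\<exists>M\<in>set (reps all_tasks). isoA (adjS S) (adjm M)" if S: "vsrg S" for S
  proof -
    obtain M where M: "M \<in> set (leafs all_tasks)" "isoA (adjS S) (adjm M)" using leaf_all[OF S] by blast
    show ?thesis
    proof (cases "M \<in> set (firsts dups)")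
      case False
      then show ?thesis using M unfolding reps_def set_without by blast
    next
      case True
      obtain N where N: "N \<in> set (reps all_tasks)" "isom M N" using dupok_isom[OF dupok_all True] by blast
      \<comment> \<open>A discarded matrix is not covered by \<open>infos_all\<close>; it inherits
        the parameters from \<open>S\<close>, and \<open>isom_isoA\<close> needs them.\<close>
      have "srg (adjm M)" using srg_iso[OF isoA_sym[OF M(2)]] S by (simp only: vsrg_def)
      then have "isoA (adjm M) (adjm N)" using isom_isoA rigid_rep.srg[OF rr[OF N(1)]] N(2) by blast
      then show ?thesis using isoA_trans[OF M(2)] N(1) by blast
    qed
  qed
qed

theorem theorem4p7:
  shows "let C = iso_classes (dsrgs_auto3 22 9 6 3 4);
             S = {K \<in> C. \<forall>G\<in>K. order (digraph_AutoGroup G) = 6 \<and>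
                                 digraph_AutoGroup G \<cong> sym_group 3}
         in card C = 134 \<and>
            card S = 14 \<and>
            card (C - S) = 120 \<and>
            (\<forall>K \<in> C - S. \<forall>G\<in>K. order (digraph_AutoGroup G) = 3)"
proof -
  note il = infos_infl[OF infos_all]
  \<comment> \<open>The lengths are read off the recorded list \<open>il\<close> through
    \<open>infos_all\<close>, so that the representatives need not be evaluated again.\<close>
  have "length (reps all_tasks) = length (map swaps (reps all_tasks))" by (simp only: length_map)
  also have "\<dots> = 134" using il counts_il(1) by (simp only: length_map)
  finally have 1: "length (reps all_tasks) = 134" .
  have "length (filter swaps (reps all_tasks)) = length (filter id (map swaps (reps all_tasks)))"
    by (simp only: filter_map length_map id_comp)
  also have "\<dots> = length (filter id (map snd il))" using il by (simp only:)
  also have "\<dots> = 14" using counts_il(2) by (simp only: filter_map length_map id_comp)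
  finally have 2: "length (filter swaps (reps all_tasks)) = 14" .
  have 3: "134 - 14 = (120 :: nat)" by simp
  show ?thesis unfolding Let_def
    by (intro conjI) (rule srg22.counts[unfolded 1 2 3])+
qed

end
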